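(* Let the nonnegative constant $\varrho$ satisfy $\varrho\ne0$. Suppose that: (i) there exist quantities $\eta_{\mathbf y,K},\eta_{p,K},\eta_{\mathbf w,K},\eta_{q,K}$ ($K\in\mathscr T$) such that $\|\hat{\mathbf y}-\bar{\mathbf y}_{\mathscr T}\|_{\mathbf V,\Omega}^2\le \sum_{K\in\mathscr T}\eta_{\mathbf y,K}^2$, $\|\hat p-\bar p_{\mathscr T}\|_{Q,\Omega}^2\le\sum_{K\in\mathscr T}\eta_{p,K}^2$, $\|\hat{\mathbf w}-\bar{\mathbf w}_{\mathscr T}\|_{\mathbf V,\Omega}^2\le \sum_{K\in\mathscr T}\eta_{\mathbf w,K}^2$, $\|\hat q-\bar q_{\mathscr T}\|_{Q,\Omega}^2\le\sum_{K\in\mathscr T}\eta_{q,K}^2$; (ii) there exist computable quantities $\tilde\eta_{\mathbf y,K},\tilde\eta_{p,K},\tilde\eta_{\mathbf w,K},\tilde\eta_{q,K}$ such that $\eta_{\mathbf y,K}\lesssim\tilde\eta_{\mathbf y,K}$, $\eta_{p,K}\lesssim\tilde\eta_{p,K}$, $\eta_{\mathbf w,K}\lesssim\tilde\eta_{\mathbf w,K}$, $\eta_{q,K}\lesssim\tilde\eta_{q,K}$ for all $K\in\mathscr T$; (iii) $\mathbf V(\mathscr T)=\{\mathbf v\in\mathbf V:\mathbf v|_K\in\mathbb P_{l_{\mathbf V}}(K)^d\ \forall K\in\mathscr T\}$ for some positive integer $l_{\mathbf V}$; $Q(\mathscr T)$ is either $\{\phi\in Q:\phi|_K\in\mathbb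 P_{l_Q}(K)\ \forall K\in\mathscr T\}$ for some nonnegative integer $l_Q$, or $\{\phi\in Q\cap H^1(\Omega):\phi|_K\in\mathbb P_{l_Q}(K)\ \forall K\in\mathscr T\}$ for some positive integer $l_Q$; $\mathbf U_{ad}(\mathscr T)$ is either $\{\mathbf v\in\mathbf U_{ad}:\mathbf v|_K\in\mathbb P_{l_{\mathbf U}}(K)^d\ \forall K\in\mathscr T\}$ for some nonnegative integer $l_{\mathbf U}$, or $\{\mathbf v\in\mathbf U_{ad}\cap H^1(\Omega)^d:\mathbf v|_K\in\mathbb P_{l_{\mathbf U}}(K)^d\ \forall K\in\mathscr T\}$ for some positive integer $l_{\mathbf U}$; (iv) for all $K\in\mathscr T$, the quantity $\tilde\Upsilon_K^2:=\tilde\eta_{\mathbf y,K}^2+\tilde\eta_{p,K}^2+\tilde\eta_{\mathbf w,K}^2+\tilde\eta_{q,K}^2+\eta_{\mathbf u,K}^2$ satisfies $$\begin{aligned}\tilde\Upsilon_K^2\lesssim{}&\|\nabla\cdot\bar{\mathbf y}_{\mathscr T}\|_{L^2(K)}^2+\|\nabla\cdot\bar{\mathbf w}_{\mathscr T}\|_{L^2(K)}^2+\sum_{K'\in\hat{\mathscr T}_K}h_K^2\big(\|\mathcal R^{st}_{K'}\|_{L^2(K')}^2+\|\mathcal R^{ad}_{K'}\|_{L^2(K')}^2\big)\\&+\sum_{\gamma\in\hat{\mathcal F}_K}h_K\big(\|[\![\mathcal R^{st}_\gamma]\!]\|_{L^2(\gamma)}^2+\|[\![\mathcal R^{ad}_\gamma]\!]\|_{L^2(\gamma)}^2\big)+\sum_{K'\in\hat{\mathscr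 T}_K}h_K^2\big(\|\mathrm{osc}^{st}_{K'}\|_{L^2(K')}^2+\|\mathrm{osc}^{ad}_{K'}\|_{L^2(K')}^2\big)+\eta_{\mathbf u,K}^2,\end{aligned}$$ where $\hat{\mathscr T}_K\subset\mathscr T$ and $\hat{\mathcal F}_K\subset\mathcal F_I$. Let $\Upsilon_K^2:=\mathfrak C_{\mathbf y}\eta_{\mathbf y,K}^2+2\varrho\,\eta_{p,K}^2+\mathfrak C_{\mathbf w}\eta_{\mathbf w,K}^2+2\varrho\,\eta_{q,K}^2+\mathfrak C_{\mathbf u}\eta_{\mathbf u,K}^2$. Then, for $K\in\mathscr T$, $$\Upsilon_K^2\lesssim\tilde\Upsilon_K^2\lesssim\|\mathbf e_{\mathbf w}\|_{L^2(K)}^2+\sum_{K'\in\tilde\Omega_K}\Big(E_{K'}^2+h_{K'}^2\big(\|\mathbf e_{\mathbf u}\|_{L^2(K')}^2+\|\mathbf e_{\mathbf y}\|_{L^2(K')}^2+\|\mathrm{osc}^{st}_{K'}\|_{L^2(K')}^2+\|\mathrm{osc}^{ad}_{K'}\|_{L^2(K')}^2\big)\Big),$$ with $\tilde\Omega_K=\hat{\mathscr T}_K\cup\bigcup_{\gamma\in\hat{\mathcal F}_K}\Omega_\gamma$.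
   Context: Convention: $A\lesssim B$ means that there exists a constant $C$ such that $A\le C\,B$; the constant $C$ may be different at each occurrence but is independent of $A$, $B$ and the size of the elements in the mesh. Setting. $d\in\{2,3\}$; $\Omega\subset\mathbb R^d$ is an open bounded polytopal domain with Lipschitz boundary; $\mathbf f,\mathbf y_\Omega\in L^2(\Omega)^d$; $\varepsilon>0$, $\kappa\ge0$, $\vartheta>0$ are real; $\mathbf c\in W^{1,\infty}(\Omega)^d$ with $\nabla\cdot\mathbf c=0$; $\mathbf a,\mathbf b\in\mathbb R^d$ with $\mathbf a<\mathbf b$ (vector inequalities are componentwise). $\mathbf V=H^1_0(\Omega)^d$, $Q=L^2_0(\Omega)$ (zero-mean $L^2$ functions), $\mathbf U_{ad}=\{\mathbf v\in L^2(\Omega)^d:\mathbf a\le\mathbf v\le\mathbf b\text{ a.e. in }\Omega\}$. $\mathscr T$ is a conforming partition of $\bar\Omega$ into simplices $K$, a member of a shape-regular family; $h_K$ is the diameter of $K$; $\mathcal F_I$ is the set of interior edges ($d=2$)/faces ($d=3$); $\mathcal F_K$ the set of edges/faces of $K$; $\Omega_\gamma=\{K\in\mathscr T:\gamma\in\mathcal F_K\}$; $\boldsymbol n^K_\gamma$ is the unit exterior normal to $K$ on $\gamma\in\mathcal F_K$; $\mathbb P_n(K)$ denotes polynomials on $K$ of total degree at most $n$; $\Pi_{K,l}$ is the $L^2(K)^d$-orthogonal projection onto $\mathbb P_l(K)^d$. Norms: $\|\boldsymbol\xi\|_{\mathbf V,K}^2=\varepsilon\|\nabla\boldsymbol\xi\|_{L^2(K)}^2+\kappa\|\boldsymbol\xi\|_{L^2(K)}^2$,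 $\|\phi\|_{Q,K}=\|\phi\|_{L^2(K)}$, and $\|\cdot\|^2_{\mathbf V,\Omega}=\sum_{K\in\mathscr T}\|\cdot\|^2_{\mathbf V,K}$, $\|\cdot\|^2_{Q,\Omega}=\sum_{K\in\mathscr T}\|\cdot\|_{Q,K}^2$. Forms: $\mathcal A(\boldsymbol\xi,\boldsymbol\zeta)=\varepsilon(\nabla\boldsymbol\xi,\nabla\boldsymbol\zeta)_\Omega+(\kappa\boldsymbol\xi+(\mathbf c\cdot\nabla)\boldsymbol\xi,\boldsymbol\zeta)_\Omega$, $\mathcal B(\boldsymbol\zeta,\phi)=(\phi,\nabla\cdot\boldsymbol\zeta)_\Omega$, $\mathcal C(\boldsymbol\xi,\boldsymbol\zeta)=\varepsilon(\nabla\boldsymbol\xi,\nabla\boldsymbol\zeta)_\Omega+(\kappa\boldsymbol\xi-(\mathbf c\cdot\nabla)\boldsymbol\xi,\boldsymbol\zeta)_\Omega$, with $(\cdot,\cdot)_\Omega$ the $L^2(\Omega)$ inner product. Constants: $C_{P,\Omega}=\frac1\pi\big(\sum_{i=1}^d |l_i|^{-2}\big)^{-1/2}$, where $|l_1|,\dots,|l_d|$ are the side lengths of a $d$-dimensional box containing $\Omega$; $C_\Omega=C_{P,\Omega}/\sqrt\varepsilon$ if $\kappa=0$ and $C_\Omega=\min\{C_{P,\Omega}/\sqrt\varepsilon,1/\sqrt\kappa\}$ if $\kappa\ne0$; $C_{ct}=1+\frac{C_\Omega}{\sqrt\varepsilon}\||\mathbf c|\|_{L^\infty(\Omega)}$;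 $\beta>0$ is a constant with $\beta\|\phi\|_{L^2(\Omega)}\le\sup_{\boldsymbol\xi\in\mathbf V\setminus\{0\}}\mathcal B(\boldsymbol\xi,\phi)/\|\nabla\boldsymbol\xi\|_{L^2(\Omega)}$ for all $\phi\in Q$; $C_{is}=\sqrt{\varepsilon+\kappa C_{P,\Omega}^2}/\beta$. With $\mu=4\vartheta^{-2}$, $\omega=C_{is}^2(1+C_{ct})^2$: $\mathfrak C_{\mathbf y}=2+2\mu C_\Omega^6+4(1+\varrho\omega)(C_\Omega^4+\mu C_\Omega^8+2\mu C_\Omega^{12})$, $\mathfrak C_{\mathbf w}=2+\mu C_\Omega^2+2\mu(1+\varrho\omega)(C_\Omega^4+2C_\Omega^8)$, $\mathfrak C_{\mathbf u}=2+2\mu C_\Omega^8+4(1+\varrho\omega)(C_\Omega^2+2C_\Omega^6+\mu C_\Omega^{10}+2\mu C_\Omega^{14})$. Continuous optimality system: $(\bar{\mathbf y},\bar p,\bar{\mathbf w},\bar q,\bar{\mathbf u})\in\mathbf V\times Q\times\mathbf V\times Q\times\mathbf U_{ad}$ is the solution of: $\mathcal A(\bar{\mathbf y},\boldsymbol\xi)-\mathcal B(\boldsymbol\xi,\bar p)=(\mathbf f+\bar{\mathbf u},\boldsymbol\xi)_\Omega$, $\mathcal B(\bar{\mathbf y},\phi)=0$, $\mathcal C(\bar{\mathbf w},\boldsymbol\zeta)+\mathcal B(\boldsymbol\zeta,\bar q)=(\bar{\mathbf y}-\mathbf y_\Omega,\boldsymbol\zeta)_\Omega$, $\mathcal B(\bar{\mathbf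 w},\psi)=0$, $(\bar{\mathbf w}+\vartheta\bar{\mathbf u},\mathbf u-\bar{\mathbf u})_\Omega\ge0$ for all $\boldsymbol\xi,\boldsymbol\zeta\in\mathbf V$, $\phi,\psi\in Q$, $\mathbf u\in\mathbf U_{ad}$. Discrete system: with $\mathbf V(\mathscr T)\subset\mathbf V$, $Q(\mathscr T)\subset Q$, $\mathbf U_{ad}(\mathscr T)\subset\mathbf U_{ad}$ and stabilization terms $\mathcal S,\mathcal H,\mathcal Q,\mathcal K$ (no relation between them assumed), $(\bar{\mathbf y}_{\mathscr T},\bar p_{\mathscr T},\bar{\mathbf w}_{\mathscr T},\bar q_{\mathscr T},\bar{\mathbf u}_{\mathscr T})\in\mathbf V(\mathscr T)\times Q(\mathscr T)\times\mathbf V(\mathscr T)\times Q(\mathscr T)\times\mathbf U_{ad}(\mathscr T)$ is a solution (at least one is assumed to exist) of: $\mathcal A(\bar{\mathbf y}_{\mathscr T},\boldsymbol\xi)-\mathcal B(\boldsymbol\xi,\bar p_{\mathscr T})+\mathcal S(\bar{\mathbf y}_{\mathscr T},\bar p_{\mathscr T},\mathbf f+\bar{\mathbf u}_{\mathscr T};\boldsymbol\xi)=(\mathbf f+\bar{\mathbf u}_{\mathscr T},\boldsymbol\xi)_\Omega$, $\mathcal B(\bar{\mathbf y}_{\mathscr T},\phi)+\mathcal H(\bar{\mathbf y}_{\mathscr T},\bar p_{\mathscr T},\mathbf f+\bar{\mathbf u}_{\mathscr T};\phi)=0$, $\mathcal C(\bar{\mathbf w}_{\mathscr T},\boldsymbol\zeta)+\mathcal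 B(\boldsymbol\zeta,\bar q_{\mathscr T})+\mathcal Q(\bar{\mathbf w}_{\mathscr T},\bar q_{\mathscr T},\bar{\mathbf y}_{\mathscr T}-\mathbf y_\Omega;\boldsymbol\zeta)=(\bar{\mathbf y}_{\mathscr T}-\mathbf y_\Omega,\boldsymbol\zeta)_\Omega$, $\mathcal B(\bar{\mathbf w}_{\mathscr T},\psi)+\mathcal K(\bar{\mathbf w}_{\mathscr T},\bar q_{\mathscr T},\bar{\mathbf y}_{\mathscr T}-\mathbf y_\Omega;\psi)=0$, $(\bar{\mathbf w}_{\mathscr T}+\vartheta\bar{\mathbf u}_{\mathscr T},\mathbf u-\bar{\mathbf u}_{\mathscr T})_\Omega\ge0$ for all $\boldsymbol\xi,\boldsymbol\zeta\in\mathbf V(\mathscr T)$, $\phi,\psi\in Q(\mathscr T)$, $\mathbf u\in\mathbf U_{ad}(\mathscr T)$. Auxiliary solutions: $(\hat{\mathbf y},\hat p)\in\mathbf V\times Q$ solves $\mathcal A(\hat{\mathbf y},\boldsymbol\xi)-\mathcal B(\boldsymbol\xi,\hat p)=(\mathbf f+\bar{\mathbf u}_{\mathscr T},\boldsymbol\xi)_\Omega$, $\mathcal B(\hat{\mathbf y},\phi)=0$ for all $(\boldsymbol\xi,\phi)\in\mathbf V\times Q$; $(\hat{\mathbf w},\hat q)\in\mathbf V\times Q$ solves $\mathcal C(\hat{\mathbf w},\boldsymbol\zeta)+\mathcal B(\boldsymbol\zeta,\hat q)=(\bar{\mathbf y}_{\mathscr T}-\mathbf y_\Omega,\boldsymbol\zeta)_\Omega$,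 $\mathcal B(\hat{\mathbf w},\psi)=0$ for all $(\boldsymbol\zeta,\psi)\in\mathbf V\times Q$. Control indicator: $\tilde{\mathbf u}=\Pi_{[\mathbf a,\mathbf b]}(-\frac1\vartheta\bar{\mathbf w}_{\mathscr T})$ with $\Pi_{[\mathbf a,\mathbf b]}(\boldsymbol\zeta)(x)=\min\{\mathbf b,\max\{\mathbf a,\boldsymbol\zeta(x)\}\}$ componentwise; $\eta_{\mathbf u,K}=\|\tilde{\mathbf u}-\bar{\mathbf u}_{\mathscr T}\|_{L^2(K)}$. Residuals and oscillations, with $m=\max\{l_{\mathbf V},l_Q-1,l_{\mathbf U}\}$ and all discrete functions restricted to $K$: $\mathcal R^{st}_K=\Pi_{K,m}(\mathbf f)+\bar{\mathbf u}_{\mathscr T}+\varepsilon\Delta\bar{\mathbf y}_{\mathscr T}-\Pi_{K,m}((\mathbf c\cdot\nabla)\bar{\mathbf y}_{\mathscr T})-\kappa\bar{\mathbf y}_{\mathscr T}-\nabla\bar p_{\mathscr T}$; $\mathcal R^{ad}_K=\bar{\mathbf y}_{\mathscr T}-\Pi_{K,m}(\mathbf y_\Omega)+\varepsilon\Delta\bar{\mathbf w}_{\mathscr T}+\Pi_{K,m}((\mathbf c\cdot\nabla)\bar{\mathbf w}_{\mathscr T})-\kappa\bar{\mathbf w}_{\mathscr T}+\nabla\bar q_{\mathscr T}$; $\mathrm{osc}^{st}_K=\mathbf f-\Pi_{K,m}(\mathbf f)-\big((\mathbf c\cdot\nabla)\bar{\mathbf y}_{\mathscr T}-\Pi_{K,m}((\mathbf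 c\cdot\nabla)\bar{\mathbf y}_{\mathscr T})\big)$; $\mathrm{osc}^{ad}_K=-(\mathbf y_\Omega-\Pi_{K,m}(\mathbf y_\Omega))+\big((\mathbf c\cdot\nabla)\bar{\mathbf w}_{\mathscr T}-\Pi_{K,m}((\mathbf c\cdot\nabla)\bar{\mathbf w}_{\mathscr T})\big)$; for $\gamma\in\mathcal F_I$, $[\![\mathcal R^{st}_\gamma]\!]=\sum_{K\in\Omega_\gamma}\mathcal R^{st}_{\gamma,K}$ with $\mathcal R^{st}_{\gamma,K}=-\varepsilon(\boldsymbol n^K_\gamma\cdot\nabla)\bar{\mathbf y}_{\mathscr T}|_K+\bar p_{\mathscr T}|_K\boldsymbol n^K_\gamma$, and $[\![\mathcal R^{ad}_\gamma]\!]=\sum_{K\in\Omega_\gamma}\mathcal R^{ad}_{\gamma,K}$ with $\mathcal R^{ad}_{\gamma,K}=-\varepsilon(\boldsymbol n^K_\gamma\cdot\nabla)\bar{\mathbf w}_{\mathscr T}|_K-\bar q_{\mathscr T}|_K\boldsymbol n^K_\gamma$. Errors: $\mathbf e_{\mathbf y}=\bar{\mathbf y}-\bar{\mathbf y}_{\mathscr T}$, $e_p=\bar p-\bar p_{\mathscr T}$, $\mathbf e_{\mathbf w}=\bar{\mathbf w}-\bar{\mathbf w}_{\mathscr T}$, $e_q=\bar q-\bar q_{\mathscr T}$, $\mathbf e_{\mathbf u}=\bar{\mathbf u}-\bar{\mathbf u}_{\mathscr T}$; $E_K^2=\|\mathbf e_{\mathbf y}\|_{\mathbf V,K}^2+\varrho\|e_p\|_{Q,K}^2+\|\mathbf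 e_{\mathbf w}\|_{\mathbf V,K}^2+\varrho\|e_q\|_{Q,K}^2+\|\mathbf e_{\mathbf u}\|_{L^2(K)}^2$.
   Formalization: The formal statement also assumes that the η's are nonnegative, that K belongs to Ω̃_K, and that h_K ≲ h_{K'} for all K' in Ω̃_K; for arbitrary subsets T̂_K, F̂_K (for example both empty) or negative η's the claim as written fails. *)

theory Defs
  imports "HOL-Analysis.Analysis" "HOL-Probability.Essential_Supremum"
begin

section \<open>Lebesgue and Sobolev spaces\<close>

text \<open>Functions are represented by pointwise representatives; all notions below depend only on the
  values almost everywhere in the set under consideration. Integrals are Lebesgue integrals.\<close>

type_synonym 'n sfield = "real^'n \<Rightarrow> real"
type_synonym 'n vfield = "real^'n \<Rightarrow> real^'n"

definition L2 :: "'a::euclidean_space set \<Rightarrow> ('a \<Rightarrow> 'b::euclidean_space) set" where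
  "L2 S = {f \<in> borel_measurable (lebesgue_on S). integrable (lebesgue_on S) (\<lambda>x. (norm (f x))\<^sup>2)}"

definition L2inner :: "'a::euclidean_space set \<Rightarrow> ('a \<Rightarrow> 'b::euclidean_space) \<Rightarrow> ('a \<Rightarrow> 'b) \<Rightarrow> real" where
  "L2inner S f g = (LINT x|lebesgue_on S. f x \<bullet> g x)"

definition L2norm :: "'a::euclidean_space set \<Rightarrow> ('a \<Rightarrow> 'b::euclidean_space) \<Rightarrow> real" where
  "L2norm S f = sqrt (LINT x|lebesgue_on S. (norm (f x))\<^sup>2)"

definition Linf :: "'a::euclidean_space set \<Rightarrow> ('a \<Rightarrow> 'b::euclidean_space) set" where
  "Linf S = {f \<in> borel_measurable (lebesgue_on S). \<exists>B. AE x in lebesgue_on S. norm (f x) \<le> B}"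

definition Linf_norm :: "'a::euclidean_space set \<Rightarrow> ('a \<Rightarrow> 'b::euclidean_space) \<Rightarrow> real" where
  "Linf_norm S f = real_of_ereal (esssup (lebesgue_on S) (\<lambda>x. ereal (norm (f x))))"

primrec Ck :: "nat \<Rightarrow> (real^'n \<Rightarrow> real) \<Rightarrow> bool" where
  "Ck 0 \<phi> = continuous_on UNIV \<phi>"
| "Ck (Suc k) \<phi> = ((\<forall>x. \<phi> differentiable (at x)) \<and>
     (\<forall>v. Ck k (\<lambda>x. frechet_derivative \<phi> (at x) v)))"

text \<open>The space of compactly supported smooth functions on \<open>\<Omega>\<close>, extended by zero.\<close>

definition test_functions :: "(real^'n) set \<Rightarrow> (real^'n \<Rightarrow> real) set" where
  "test_functions \<Omega> = {\<phi>. (\<forall>k. Ck k \<phi>) \<and> (\<exists>S. compact S \<and> S \<subseteq> \<Omega> \<and> (\<forall>x. x \<notin> S \<longrightarrow> \<phi> x = 0))}"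

text \<open>The classical gradient.\<close>

definition cgrad :: "(real^'n \<Rightarrow> real) \<Rightarrow> real^'n \<Rightarrow> real^'n" where
  "cgrad \<phi> x = (\<chi> j. frechet_derivative \<phi> (at x) (axis j 1))"

definition is_weak_grad :: "(real^'n) set \<Rightarrow> (real^'n \<Rightarrow> real) \<Rightarrow> (real^'n \<Rightarrow> real^'n) \<Rightarrow> bool" where
  "is_weak_grad \<Omega> u g \<longleftrightarrow>
     (\<forall>S. compact S \<and> S \<subseteq> \<Omega> \<longrightarrow> u absolutely_integrable_on S \<and> g absolutely_integrable_on S) \<and>
     (\<forall>\<phi>\<in>test_functions \<Omega>. \<forall>j.
        (LINT x|lebesgue_on \<Omega>. u x * cgrad \<phi> x $ j) = - (LINT x|lebesgue_on \<Omega>. g x $ j * \<phi> x))"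

text \<open>Weak gradients are unique up to null sets of \<open>\<Omega>\<close>, so the choice below is immaterial.\<close>

definition wgrad :: "(real^'n) set \<Rightarrow> (real^'n \<Rightarrow> real) \<Rightarrow> real^'n \<Rightarrow> real^'n" where
  "wgrad \<Omega> u = (SOME g. is_weak_grad \<Omega> u g)"

definition H1 :: "(real^'n) set \<Rightarrow> (real^'n \<Rightarrow> real) set" where
  "H1 \<Omega> = {u \<in> L2 \<Omega>. \<exists>g\<in>L2 \<Omega>. is_weak_grad \<Omega> u g}"

definition H10 :: "(real^'n) set \<Rightarrow> (real^'n \<Rightarrow> real) set" where
  "H10 \<Omega> = {u \<in> H1 \<Omega>. \<exists>\<phi> :: nat \<Rightarrow> _. (\<forall>n. \<phi> n \<in> test_functions \<Omega>) \<and>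
      (\<lambda>n. L2norm \<Omega> (\<lambda>x. u x - \<phi> n x)) \<longlonglongrightarrow> 0 \<and>
      (\<lambda>n. L2norm \<Omega> (\<lambda>x. wgrad \<Omega> u x - cgrad (\<phi> n) x)) \<longlonglongrightarrow> 0}"

definition W1inf :: "(real^'n) set \<Rightarrow> (real^'n \<Rightarrow> real) set" where
  "W1inf \<Omega> = {u \<in> Linf \<Omega>. \<exists>g\<in>Linf \<Omega>. is_weak_grad \<Omega> u g}"

definition vec_space :: "(real^'n \<Rightarrow> real) set \<Rightarrow> (real^'n \<Rightarrow> real^'n) set" where
  "vec_space X = {v. \<forall>i. (\<lambda>x. v x $ i) \<in> X}"

text \<open>Weak Jacobian: row \<open>i\<close> is the gradient of the \<open>i\<close>-th component. The norm and inner product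
  of \<open>real^'n^'n\<close> are the Frobenius ones.\<close>

definition wGrad :: "(real^'n) set \<Rightarrow> (real^'n \<Rightarrow> real^'n) \<Rightarrow> real^'n \<Rightarrow> real^'n^'n" where
  "wGrad \<Omega> v x = (\<chi> i. wgrad \<Omega> (\<lambda>z. v z $ i) x)"

definition wdiv :: "(real^'n) set \<Rightarrow> (real^'n \<Rightarrow> real^'n) \<Rightarrow> real^'n \<Rightarrow> real" where
  "wdiv \<Omega> v x = trace (wGrad \<Omega> v x)"


section \<open>The domain\<close>

definition lipschitz_boundary :: "'a::euclidean_space set \<Rightarrow> bool" where
  "lipschitz_boundary \<Omega> \<longleftrightarrow> (\<forall>x\<in>frontier \<Omega>. \<exists>U e L \<phi>. open U \<and> x \<in> U \<and> norm e = 1 \<and>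
     L-lipschitz_on UNIV \<phi> \<and> \<Omega> \<inter> U = {z \<in> U. \<phi> (z - (z \<bullet> e) *\<^sub>R e) < z \<bullet> e})"

definition polytopal_domain :: "'a::euclidean_space set \<Rightarrow> bool" where
  "polytopal_domain \<Omega> \<longleftrightarrow> open \<Omega> \<and> connected \<Omega> \<and> \<Omega> \<noteq> {} \<and> bounded \<Omega> \<and> lipschitz_boundary \<Omega> \<and>
     (\<exists>\<P>. finite \<P> \<and> (\<forall>P\<in>\<P>. polytope P) \<and> closure \<Omega> = \<Union>\<P>)"

text \<open>\<open>\<Omega>\<close> lies in a box (in arbitrary position) with side lengths \<open>l $ i\<close>.\<close>

definition in_box :: "(real^'n) set \<Rightarrow> real^'n \<Rightarrow> bool" where
  "in_box \<Omega> l \<longleftrightarrow> (\<forall>i. 0 < l $ i) \<and>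
     (\<exists>p R. orthogonal_transformation R \<and> \<Omega> \<subseteq> (\<lambda>x. p + R x) ` cbox 0 l)"


section \<open>The continuous problem\<close>

abbreviation Vsp :: "(real^'n) set \<Rightarrow> (real^'n \<Rightarrow> real^'n) set" where
  "Vsp \<Omega> \<equiv> vec_space (H10 \<Omega>)"

definition Qsp :: "(real^'n) set \<Rightarrow> (real^'n \<Rightarrow> real) set" where
  "Qsp \<Omega> = {\<phi> \<in> L2 \<Omega>. (LINT x|lebesgue_on \<Omega>. \<phi> x) = 0}"

definition Uad :: "(real^'n) set \<Rightarrow> real^'n \<Rightarrow> real^'n \<Rightarrow> (real^'n \<Rightarrow> real^'n) set" where
  "Uad \<Omega> a b = {v \<in> L2 \<Omega>. AE x in lebesgue_on \<Omega>. \<forall>i. a $ i \<le> v x $ i \<and> v x $ i \<le> b $ i}"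

definition formA ::
    "(real^'n) set \<Rightarrow> real \<Rightarrow> real \<Rightarrow>
     'n vfield \<Rightarrow> 'n vfield \<Rightarrow> 'n vfield \<Rightarrow> real" where
  "formA \<Omega> \<epsilon> \<kappa> c \<xi> \<zeta> = \<epsilon> * L2inner \<Omega> (wGrad \<Omega> \<xi>) (wGrad \<Omega> \<zeta>)
     + L2inner \<Omega> (\<lambda>x. \<kappa> *\<^sub>R \<xi> x + wGrad \<Omega> \<xi> x *v c x) \<zeta>"

definition formB :: "(real^'n) set \<Rightarrow> 'n vfield \<Rightarrow> 'n sfield \<Rightarrow> real" where
  "formB \<Omega> \<zeta> \<phi> = L2inner \<Omega> \<phi> (wdiv \<Omega> \<zeta>)"

definition formC ::
    "(real^'n) set \<Rightarrow> real \<Rightarrow> real \<Rightarrow>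
     'n vfield \<Rightarrow> 'n vfield \<Rightarrow> 'n vfield \<Rightarrow> real" where
  "formC \<Omega> \<epsilon> \<kappa> c \<xi> \<zeta> = \<epsilon> * L2inner \<Omega> (wGrad \<Omega> \<xi>) (wGrad \<Omega> \<zeta>)
     + L2inner \<Omega> (\<lambda>x. \<kappa> *\<^sub>R \<xi> x - wGrad \<Omega> \<xi> x *v c x) \<zeta>"

text \<open>\<open>(y, p)\<close> solves the state equations with source \<open>g\<close>; \<open>(w, q)\<close> solves the adjoint
  equations with source \<open>g\<close>.\<close>

definition state_eqs ::
    "(real^'n) set \<Rightarrow> real \<Rightarrow> real \<Rightarrow> 'n vfield \<Rightarrow>
     'n vfield \<Rightarrow> 'n vfield \<Rightarrow> 'n sfield \<Rightarrow> bool" where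
  "state_eqs \<Omega> \<epsilon> \<kappa> c g y p \<longleftrightarrow> y \<in> Vsp \<Omega> \<and> p \<in> Qsp \<Omega> \<and>
     (\<forall>\<xi>\<in>Vsp \<Omega>. formA \<Omega> \<epsilon> \<kappa> c y \<xi> - formB \<Omega> \<xi> p = L2inner \<Omega> g \<xi>) \<and>
     (\<forall>\<phi>\<in>Qsp \<Omega>. formB \<Omega> y \<phi> = 0)"

definition adjoint_eqs ::
    "(real^'n) set \<Rightarrow> real \<Rightarrow> real \<Rightarrow> 'n vfield \<Rightarrow>
     'n vfield \<Rightarrow> 'n vfield \<Rightarrow> 'n sfield \<Rightarrow> bool" where
  "adjoint_eqs \<Omega> \<epsilon> \<kappa> c g w q \<longleftrightarrow> w \<in> Vsp \<Omega> \<and> q \<in> Qsp \<Omega> \<and>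
     (\<forall>\<zeta>\<in>Vsp \<Omega>. formC \<Omega> \<epsilon> \<kappa> c w \<zeta> + formB \<Omega> \<zeta> q = L2inner \<Omega> g \<zeta>) \<and>
     (\<forall>\<psi>\<in>Qsp \<Omega>. formB \<Omega> w \<psi> = 0)"

definition variational_ineq ::
    "(real^'n) set \<Rightarrow> real \<Rightarrow> 'n vfield set \<Rightarrow>
     'n vfield \<Rightarrow> 'n vfield \<Rightarrow> bool" where
  "variational_ineq \<Omega> \<theta> U w u \<longleftrightarrow> u \<in> U \<and>
     (\<forall>v\<in>U. L2inner \<Omega> (\<lambda>x. w x + \<theta> *\<^sub>R u x) (\<lambda>x. v x - u x) \<ge> 0)"

text \<open>\<open>\<beta>\<close> is an inf-sup constant; \<open>\<xi> \<noteq> 0\<close> is meant almost everywhere.\<close>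

definition inf_sup_const :: "(real^'n) set \<Rightarrow> real \<Rightarrow> bool" where
  "inf_sup_const \<Omega> \<beta> \<longleftrightarrow> 0 < \<beta> \<and> (\<forall>\<phi>\<in>Qsp \<Omega>. \<beta> * L2norm \<Omega> \<phi> \<le>
     (SUP \<xi>\<in>{\<xi> \<in> Vsp \<Omega>. \<not> (AE x in lebesgue_on \<Omega>. \<xi> x = 0)}. formB \<Omega> \<xi> \<phi> / L2norm \<Omega> (wGrad \<Omega> \<xi>)))"


section \<open>Constants\<close>

definition C_P :: "real^'n \<Rightarrow> real" where
  "C_P l = (1 / pi) * (\<Sum>i\<in>UNIV. (l $ i) powi (-2)) powr (- 1 / 2)"

definition C_Om :: "real \<Rightarrow> real \<Rightarrow> real^'n \<Rightarrow> real" where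
  "C_Om \<epsilon> \<kappa> l = (if \<kappa> = 0 then C_P l / sqrt \<epsilon> else min (C_P l / sqrt \<epsilon>) (1 / sqrt \<kappa>))"

definition C_ct ::
    "(real^'n) set \<Rightarrow> real \<Rightarrow> real \<Rightarrow>
     'n vfield \<Rightarrow> real^'n \<Rightarrow> real" where
  "C_ct \<Omega> \<epsilon> \<kappa> c l = 1 + C_Om \<epsilon> \<kappa> l / sqrt \<epsilon> * Linf_norm \<Omega> c"

definition C_is :: "real \<Rightarrow> real \<Rightarrow> real^'n \<Rightarrow> real \<Rightarrow> real" where
  "C_is \<epsilon> \<kappa> l \<beta> = sqrt (\<epsilon> + \<kappa> * (C_P l)\<^sup>2) / \<beta>"

definition mu :: "real \<Rightarrow> real" where
  "mu \<theta> = 4 * \<theta> powi (-2)"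

definition omega ::
    "(real^'n) set \<Rightarrow> real \<Rightarrow> real \<Rightarrow>
     'n vfield \<Rightarrow> real^'n \<Rightarrow> real \<Rightarrow> real" where
  "omega \<Omega> \<epsilon> \<kappa> c l \<beta> = (C_is \<epsilon> \<kappa> l \<beta>)\<^sup>2 * (1 + C_ct \<Omega> \<epsilon> \<kappa> c l)\<^sup>2"

text \<open>The arguments stand for \<open>\<mu>\<close>, \<open>\<rho> * \<omega>\<close> and the constant \<open>C_Om\<close>.\<close>

definition const_y :: "real \<Rightarrow> real \<Rightarrow> real \<Rightarrow> real" where
  "const_y m r C = 2 + 2 * m * C^6 + 4 * (1 + r) * (C^4 + m * C^8 + 2 * m * C^12)"

definition const_w :: "real \<Rightarrow> real \<Rightarrow> real \<Rightarrow> real" where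
  "const_w m r C = 2 + m * C^2 + 2 * m * (1 + r) * (C^4 + 2 * C^8)"

definition const_u :: "real \<Rightarrow> real \<Rightarrow> real \<Rightarrow> real" where
  "const_u m r C = 2 + 2 * m * C^8 + 4 * (1 + r) * (C^2 + 2 * C^6 + m * C^10 + 2 * m * C^14)"


section \<open>Meshes\<close>

definition conforming_mesh :: "(real^'n) set \<Rightarrow> (real^'n) set set \<Rightarrow> bool" where
  "conforming_mesh \<Omega> T \<longleftrightarrow> triangulation T \<and> (\<forall>K\<in>T. int CARD('n) simplex K) \<and> \<Union>T = closure \<Omega>"

definition inball_diameter :: "'a::euclidean_space set \<Rightarrow> real" where
  "inball_diameter K = Sup {2 * r | r. 0 \<le> r \<and> (\<exists>x. cball x r \<subseteq> K)}"

definition shape_regular :: "'a::euclidean_space set set set \<Rightarrow> bool" where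
  "shape_regular \<TT> \<longleftrightarrow> (\<exists>\<sigma>>0. \<forall>T\<in>\<TT>. \<forall>K\<in>T. diameter K \<le> \<sigma> * inball_diameter K)"

text \<open>Edges (\<open>d = 2\<close>) or faces (\<open>d = 3\<close>) interior to \<open>\<Omega>\<close>, and the elements sharing one.\<close>

definition int_faces :: "'a::euclidean_space set \<Rightarrow> 'a set set \<Rightarrow> 'a set set" where
  "int_faces \<Omega> T = {\<gamma>. (\<exists>K\<in>T. \<gamma> facet_of K) \<and> rel_interior \<gamma> \<subseteq> \<Omega>}"

definition face_patch :: "'a::euclidean_space set set \<Rightarrow> 'a set \<Rightarrow> 'a set set" where
  "face_patch T \<gamma> = {K \<in> T. \<gamma> facet_of K}"

definition outer_normal :: "'a::euclidean_space set \<Rightarrow> 'a set \<Rightarrow> 'a" where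
  "outer_normal K \<gamma> = (THE n. norm n = 1 \<and>
     (\<exists>t. (\<forall>x\<in>\<gamma>. n \<bullet> x = t) \<and> (\<forall>x\<in>K. n \<bullet> x \<le> t)))"

text \<open>For a subset \<open>\<gamma>\<close> of a hyperplane with unit normal \<open>n\<close>, the surface integral of \<open>g\<close> over
  \<open>\<gamma>\<close> equals, by Fubini, the volume integral over the prism \<open>\<gamma> + [0,1] n\<close> of the extension of
  \<open>g\<close> that is constant in direction \<open>n\<close>. This serves as its definition.\<close>

definition face_L2norm :: "'a::euclidean_space set \<Rightarrow> ('a \<Rightarrow> 'b::euclidean_space) \<Rightarrow> real" where
  "face_L2norm \<gamma> g = (let n = (SOME n. norm n = 1 \<and> (\<exists>t. \<forall>x\<in>\<gamma>. n \<bullet> x = t))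
     in L2norm {x + s *\<^sub>R n | x s. x \<in> \<gamma> \<and> 0 \<le> s \<and> s \<le> 1}
          (\<lambda>z. g (closest_point (affine hull \<gamma>) z)))"


section \<open>Polynomials and discrete spaces\<close>

text \<open>Polynomials of total degree at most \<open>m\<close>; \<open>\<alpha>\<close> ranges over multi-indices.\<close>

definition poly_deg :: "nat \<Rightarrow> (real^'n \<Rightarrow> real) set" where
  "poly_deg m = {p. \<exists>a :: ('n \<Rightarrow> nat) \<Rightarrow> real.
     p = (\<lambda>x. \<Sum>\<alpha>\<in>{\<alpha>. sum \<alpha> UNIV \<le> m}. a \<alpha> * (\<Prod>i\<in>UNIV. x $ i ^ \<alpha> i))}"

definition piecewise :: "'a::euclidean_space set set \<Rightarrow> ('a \<Rightarrow> 'b) set \<Rightarrow> ('a \<Rightarrow> 'b) set" where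
  "piecewise T P = {v. \<forall>K\<in>T. \<exists>p\<in>P. AE x in lebesgue_on K. v x = p x}"

definition V_fe :: "(real^'n) set \<Rightarrow> (real^'n) set set \<Rightarrow> nat \<Rightarrow> (real^'n \<Rightarrow> real^'n) set" where
  "V_fe \<Omega> T m = Vsp \<Omega> \<inter> piecewise T (vec_space (poly_deg m))"

definition Q_fe_disc :: "(real^'n) set \<Rightarrow> (real^'n) set set \<Rightarrow> nat \<Rightarrow> (real^'n \<Rightarrow> real) set" where
  "Q_fe_disc \<Omega> T m = Qsp \<Omega> \<inter> piecewise T (poly_deg m)"

definition Q_fe_cont :: "(real^'n) set \<Rightarrow> (real^'n) set set \<Rightarrow> nat \<Rightarrow> (real^'n \<Rightarrow> real) set" where
  "Q_fe_cont \<Omega> T m = Qsp \<Omega> \<inter> H1 \<Omega> \<inter> piecewise T (poly_deg m)"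

definition U_fe_disc ::
    "(real^'n) set \<Rightarrow> real^'n \<Rightarrow> real^'n \<Rightarrow>
     (real^'n) set set \<Rightarrow> nat \<Rightarrow> 'n vfield set" where
  "U_fe_disc \<Omega> a b T m = Uad \<Omega> a b \<inter> piecewise T (vec_space (poly_deg m))"

definition U_fe_cont ::
    "(real^'n) set \<Rightarrow> real^'n \<Rightarrow> real^'n \<Rightarrow>
     (real^'n) set set \<Rightarrow> nat \<Rightarrow> 'n vfield set" where
  "U_fe_cont \<Omega> a b T m = Uad \<Omega> a b \<inter> vec_space (H1 \<Omega>) \<inter> piecewise T (vec_space (poly_deg m))"

text \<open>The polynomial that represents the restriction to \<open>K\<close> of a piecewise polynomial; elementwise
  derivatives and one-sided traces on faces are those of this polynomial.\<close>

definition loc :: "'a::euclidean_space set \<Rightarrow> ('a \<Rightarrow> 'b::euclidean_space) \<Rightarrow> 'a \<Rightarrow> 'b" where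
  "loc K v = (THE p. polynomial_function p \<and> (AE x in lebesgue_on K. v x = p x))"

text \<open>The orthogonal projection of \<open>L2 K\<close> onto vector-valued polynomials of degree at most \<open>m\<close>.\<close>

definition proj :: "(real^'n) set \<Rightarrow> nat \<Rightarrow> (real^'n \<Rightarrow> real^'n) \<Rightarrow> real^'n \<Rightarrow> real^'n" where
  "proj K m f = (THE p. p \<in> vec_space (poly_deg m) \<and>
     (\<forall>q\<in>vec_space (poly_deg m). L2inner K (\<lambda>x. f x - p x) q = 0))"

definition laplacian :: "('a::euclidean_space \<Rightarrow> 'b::euclidean_space) \<Rightarrow> 'a \<Rightarrow> 'b" where
  "laplacian f x =
     (\<Sum>e\<in>Basis. frechet_derivative (\<lambda>z. frechet_derivative f (at z) e) (at x) e)"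


section \<open>The discrete problem\<close>

definition discrete_state_eqs ::
    "(real^'n) set \<Rightarrow> real \<Rightarrow> real \<Rightarrow> 'n vfield \<Rightarrow> 'n vfield set \<Rightarrow> 'n sfield set \<Rightarrow>
     ('n vfield \<Rightarrow> 'n sfield \<Rightarrow> 'n vfield \<Rightarrow> 'n vfield \<Rightarrow> real) \<Rightarrow> ('n vfield \<Rightarrow> 'n sfield \<Rightarrow> 'n vfield \<Rightarrow> 'n sfield \<Rightarrow> real) \<Rightarrow> 'n vfield \<Rightarrow> 'n vfield \<Rightarrow> 'n sfield \<Rightarrow> bool" where
  "discrete_state_eqs \<Omega> \<epsilon> \<kappa> c VT QT S H g y p \<longleftrightarrow> y \<in> VT \<and> p \<in> QT \<and>
     (\<forall>\<xi>\<in>VT. formA \<Omega> \<epsilon> \<kappa> c y \<xi> - formB \<Omega> \<xi> p + S y p g \<xi> = L2inner \<Omega> g \<xi>) \<and>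
     (\<forall>\<phi>\<in>QT. formB \<Omega> y \<phi> + H y p g \<phi> = 0)"

definition discrete_adjoint_eqs ::
    "(real^'n) set \<Rightarrow> real \<Rightarrow> real \<Rightarrow> 'n vfield \<Rightarrow> 'n vfield set \<Rightarrow> 'n sfield set \<Rightarrow>
     ('n vfield \<Rightarrow> 'n sfield \<Rightarrow> 'n vfield \<Rightarrow> 'n vfield \<Rightarrow> real) \<Rightarrow> ('n vfield \<Rightarrow> 'n sfield \<Rightarrow> 'n vfield \<Rightarrow> 'n sfield \<Rightarrow> real) \<Rightarrow> 'n vfield \<Rightarrow> 'n vfield \<Rightarrow> 'n sfield \<Rightarrow> bool" where
  "discrete_adjoint_eqs \<Omega> \<epsilon> \<kappa> c VT QT Qs Ks g w q \<longleftrightarrow> w \<in> VT \<and> q \<in> QT \<and>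
     (\<forall>\<zeta>\<in>VT. formC \<Omega> \<epsilon> \<kappa> c w \<zeta> + formB \<Omega> \<zeta> q + Qs w q g \<zeta> = L2inner \<Omega> g \<zeta>) \<and>
     (\<forall>\<psi>\<in>QT. formB \<Omega> w \<psi> + Ks w q g \<psi> = 0)"


section \<open>Norms, indicators, residuals and oscillations\<close>

definition normV ::
    "(real^'n) set \<Rightarrow> real \<Rightarrow> real \<Rightarrow>
     (real^'n) set \<Rightarrow> 'n vfield \<Rightarrow> real" where
  "normV \<Omega> \<epsilon> \<kappa> K \<xi> = sqrt (\<epsilon> * (L2norm K (wGrad \<Omega> \<xi>))\<^sup>2 + \<kappa> * (L2norm K \<xi>)\<^sup>2)"

definition normV_mesh ::
    "(real^'n) set \<Rightarrow> real \<Rightarrow> real \<Rightarrow>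
     (real^'n) set set \<Rightarrow> 'n vfield \<Rightarrow> real" where
  "normV_mesh \<Omega> \<epsilon> \<kappa> T \<xi> = sqrt (\<Sum>K\<in>T. (normV \<Omega> \<epsilon> \<kappa> K \<xi>)\<^sup>2)"

definition normQ_mesh :: "'a::euclidean_space set set \<Rightarrow> ('a \<Rightarrow> real) \<Rightarrow> real" where
  "normQ_mesh T \<phi> = sqrt (\<Sum>K\<in>T. (L2norm K \<phi>)\<^sup>2)"

definition box_proj :: "real^'n \<Rightarrow> real^'n \<Rightarrow> real^'n \<Rightarrow> real^'n" where
  "box_proj a b z = (\<chi> i. min (b $ i) (max (a $ i) (z $ i)))"

definition eta_u ::
    "real^'n \<Rightarrow> real^'n \<Rightarrow> real \<Rightarrow>
     'n vfield \<Rightarrow> 'n vfield \<Rightarrow> (real^'n) set \<Rightarrow> real" where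
  "eta_u a b \<theta> w u K = L2norm K (\<lambda>x. box_proj a b (- (1 / \<theta>) *\<^sub>R w x) - u x)"

text \<open>The convective term on \<open>K\<close> for a piecewise polynomial \<open>v\<close>.\<close>

definition conv :: "'n vfield \<Rightarrow> (real^'n) set \<Rightarrow> 'n vfield \<Rightarrow> 'n vfield" where
  "conv c K v x = frechet_derivative (loc K v) (at x) (c x)"

definition R_st ::
    "real \<Rightarrow> real \<Rightarrow> 'n vfield \<Rightarrow> 'n vfield \<Rightarrow> nat \<Rightarrow>
     'n vfield \<Rightarrow> 'n sfield \<Rightarrow> 'n vfield \<Rightarrow> (real^'n) set \<Rightarrow> 'n vfield" where
  "R_st \<epsilon> \<kappa> c f m y p u K x =
     proj K m f x + u x + \<epsilon> *\<^sub>R laplacian (loc K y) x - proj K m (conv c K y) x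
     - \<kappa> *\<^sub>R y x - cgrad (loc K p) x"

definition R_ad ::
    "real \<Rightarrow> real \<Rightarrow> 'n vfield \<Rightarrow> 'n vfield \<Rightarrow> nat \<Rightarrow>
     'n vfield \<Rightarrow> 'n vfield \<Rightarrow> 'n sfield \<Rightarrow> (real^'n) set \<Rightarrow> 'n vfield" where
  "R_ad \<epsilon> \<kappa> c y\<Omega> m y w q K x =
     y x - proj K m y\<Omega> x + \<epsilon> *\<^sub>R laplacian (loc K w) x + proj K m (conv c K w) x
     - \<kappa> *\<^sub>R w x + cgrad (loc K q) x"

definition osc_st ::
    "'n vfield \<Rightarrow> 'n vfield \<Rightarrow> nat \<Rightarrow>
     'n vfield \<Rightarrow> (real^'n) set \<Rightarrow> 'n vfield" where
  "osc_st c f m y K x = f x - proj K m f x - (conv c K y x - proj K m (conv c K y) x)"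

definition osc_ad ::
    "'n vfield \<Rightarrow> 'n vfield \<Rightarrow> nat \<Rightarrow>
     'n vfield \<Rightarrow> (real^'n) set \<Rightarrow> 'n vfield" where
  "osc_ad c y\<Omega> m w K x = - (y\<Omega> x - proj K m y\<Omega> x) + (conv c K w x - proj K m (conv c K w) x)"

definition jump_st ::
    "real \<Rightarrow> (real^'n) set set \<Rightarrow> 'n vfield \<Rightarrow>
     'n sfield \<Rightarrow> (real^'n) set \<Rightarrow> 'n vfield" where
  "jump_st \<epsilon> T y p \<gamma> x = (\<Sum>K\<in>face_patch T \<gamma>.
     - \<epsilon> *\<^sub>R frechet_derivative (loc K y) (at x) (outer_normal K \<gamma>) + loc K p x *\<^sub>R outer_normal K \<gamma>)"

definition jump_ad ::
    "real \<Rightarrow> (real^'n) set set \<Rightarrow> 'n vfield \<Rightarrow>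
     'n sfield \<Rightarrow> (real^'n) set \<Rightarrow> 'n vfield" where
  "jump_ad \<epsilon> T w q \<gamma> x = (\<Sum>K\<in>face_patch T \<gamma>.
     - \<epsilon> *\<^sub>R frechet_derivative (loc K w) (at x) (outer_normal K \<gamma>) - loc K q x *\<^sub>R outer_normal K \<gamma>)"

definition local_error_sq ::
    "(real^'n) set \<Rightarrow> real \<Rightarrow> real \<Rightarrow> real \<Rightarrow> 'n vfield \<Rightarrow>
     'n sfield \<Rightarrow> 'n vfield \<Rightarrow> 'n sfield \<Rightarrow> 'n vfield \<Rightarrow> (real^'n) set \<Rightarrow> real" where
  "local_error_sq \<Omega> \<epsilon> \<kappa> \<rho> ey ep ew eq eu K =
     (normV \<Omega> \<epsilon> \<kappa> K ey)\<^sup>2 + \<rho> * (L2norm K ep)\<^sup>2 + (normV \<Omega> \<epsilon> \<kappa> K ew)\<^sup>2 + \<rho> * (L2norm K eq)\<^sup>2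
     + (L2norm K eu)\<^sup>2"

text \<open>For a family of meshes \<open>\<T> i\<close> and quantities \<open>A i K\<close>, \<open>B i K\<close> attached to their elements:
  the relation \<open>A \<lesssim> B\<close>, the constant being the same for all meshes and all elements.\<close>

definition lesssim :: "('i \<Rightarrow> 'k set) \<Rightarrow> ('i \<Rightarrow> 'k \<Rightarrow> real) \<Rightarrow> ('i \<Rightarrow> 'k \<Rightarrow> real) \<Rightarrow> bool" where
  "lesssim \<T> A B \<longleftrightarrow> (\<exists>C>0. \<forall>i. \<forall>K\<in>\<T> i. A i K \<le> C * B i K)"

end

theory Submission
  imports Defs
begin

text \<open>The first relation only compares coefficients. For the second, each residual is bounded by local
  errors through a bubble-function argument. The smooth bump \<open>b\<close> of a ball inscribed in an element
  \<open>K\<close> gives an admissible test function \<open>b R\<close> with \<open>R\<close> the (polynomial) residual, and the weak form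
  of the equation turns \<open>\<integral> b R\<^sup>2\<close> into errors and oscillations; equivalence of norms on polynomials
  of bounded degree over balls of comparable size compares this integral with the norm of \<open>R\<close> on \<open>K\<close>.
  Jumps are treated alike with the bump of a ball about the centre of the face that stays inside the two
  adjacent elements. Divergences vanish for the exact solution, so they are errors of the gradient, and
  the exact control is the projection of \<open>- w / \<theta>\<close>, which bounds the control indicator. Since an
  element has at most \<open>d + 1\<close> faces, summing over the patch costs only a constant.\<close>

section \<open>Integrals over Lebesgue measurable sets\<close>

text \<open>The constant of the relation has to be fixed before the mesh, the element and the
  discrete solution are known. Balls make this possible: translation and dilation reduce every
  inverse estimate to one comparison of quadratic forms on a fixed finite-dimensional space of
  polynomials, so its constant depends only on a degree bound, the dimension and a ratio of radii.
  Shape regularity enters through that ratio alone. A test field supported in a ball that meets at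
  most one face also reduces integration by parts to half-spaces, where a surface integral can be
  written as a volume integral over a slab of arbitrary thickness; the thickness is chosen to suit
  each estimate. Elements are closed and cover the closure of the domain. That the supports stay
  inside the domain rests on a Lipschitz domain being the interior of its closure. A bump field on a
  ball of radius r has a gradient of order 1/r, so each estimate is multiplied by the squared
  radius; this yields the weights of residuals and oscillations. The pressure errors arise with
  weight 1 and must be absorbed by terms of weight \<open>\<rho>\<close>, hence
  \<open>\<rho>\<close> must be positive.\<close>

lemma integrable_lebesgue_on_cong_AE:
  fixes f g :: "'a::euclidean_space \<Rightarrow> 'b::euclidean_space"
  assumes S: "S \<in> sets lebesgue" and T: "T \<in> sets lebesgue"
    and eq: "AE x in lebesgue. (if x \<in> S then f x else 0) = (if x \<in> T then g x else 0)"
  shows "integrable (lebesgue_on S) f \<longleftrightarrow> integrable (lebesgue_on T) g"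
    and "f \<in> borel_measurable (lebesgue_on S) \<longleftrightarrow> g \<in> borel_measurable (lebesgue_on T)"
    and "integral\<^sup>L (lebesgue_on S) f = integral\<^sup>L (lebesgue_on T) g"
proof -
  let ?f = "\<lambda>x. if x \<in> S then f x else 0" and ?g = "\<lambda>x. if x \<in> T then g x else 0"
  \<comment> \<open>Lebesgue measure is complete, so measurability passes between functions that
    agree almost everywhere and need not be assumed.\<close>
  have meas: "?f \<in> borel_measurable lebesgue \<longleftrightarrow> ?g \<in> borel_measurable lebesgue"
  proof -
    have "AE x in lebesgue. ?g x = ?f x" using eq by eventually_elim (rule sym)
    then show ?thesis
      using borel_measurable_AE[of ?f ?g] borel_measurable_AE[of ?g ?f] eq by blast
  qed
  then show "f \<in> borel_measurable (lebesgue_on S) \<longleftrightarrow> g \<in> borel_measurable (lebesgue_on T)"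
    by (simp add: borel_measurable_if S T)
  have int: "integrable lebesgue ?f \<longleftrightarrow> integrable lebesgue ?g"
  proof (cases "?f \<in> borel_measurable lebesgue")
    case True
    with meas eq show ?thesis by (intro integrable_cong_AE) auto
  next
    case False
    with meas show ?thesis using borel_measurable_integrable by blast
  qed
  then show "integrable (lebesgue_on S) f \<longleftrightarrow> integrable (lebesgue_on T) g"
    by (simp add: Lebesgue_Measure.integrable_restrict_UNIV S T)
  have "integral\<^sup>L lebesgue ?f = integral\<^sup>L lebesgue ?g"
  proof (cases "?f \<in> borel_measurable lebesgue")
    case True
    with meas eq show ?thesis by (intro integral_cong_AE) auto
  next
    \<comment> \<open>Without measurability both integrals take the default value 0.\<close>
    case False
    with meas have "\<not> integrable lebesgue ?f" "\<not> integrable lebesgue ?g"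
      using borel_measurable_integrable by blast+
    then show ?thesis by (simp add: not_integrable_integral_eq)
  qed
  then show "integral\<^sup>L (lebesgue_on S) f = integral\<^sup>L (lebesgue_on T) g"
    by (simp add: Lebesgue_Measure.integral_restrict_UNIV S T)
qed

lemma AE_lebesgue_on_iff:
  assumes "S \<in> sets lebesgue"
  shows "(AE x in lebesgue_on S. P x) \<longleftrightarrow> (AE x in lebesgue. x \<in> S \<longrightarrow> P x)"
  using assms by (simp add: AE_restrict_space_iff)

text \<open>Inclusion is only required up to a null set because an element lies in the closure of
  the domain: it may share boundary points with it that are not in the open domain itself.\<close>

lemma AE_lebesgue_on_subset:
  assumes "AE x in lebesgue_on T. P x" "S \<in> sets lebesgue" "T \<in> sets lebesgue" "negligible (S - T)"
  shows "AE x in lebesgue_on S. P x"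
proof -
  have "AE x in lebesgue. x \<notin> S - T"
    using assms(4) negligible_iff_null_sets by (metis AE_not_in)
  with assms show ?thesis by (auto simp: AE_lebesgue_on_iff)
qed

lemma borel_measurable_lebesgue_on_subset:
  fixes f :: "'a::euclidean_space \<Rightarrow> 'b::euclidean_space"
  assumes f: "f \<in> borel_measurable (lebesgue_on T)"
    and S: "S \<in> sets lebesgue" and T: "T \<in> sets lebesgue" and neg: "negligible (S - T)"
  shows "f \<in> borel_measurable (lebesgue_on S)"
proof -
  have "f \<in> borel_measurable (lebesgue_on (S \<inter> T))"
    by (rule measurable_restrict_mono[OF f]) auto
  moreover have "AE x in lebesgue. x \<notin> S - T"
    using neg negligible_iff_null_sets by (metis AE_not_in)
  then have "AE x in lebesgue. (if x \<in> S then f x else 0) = (if x \<in> S \<inter> T then f x else 0)"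
    by auto
  ultimately show ?thesis
    using integrable_lebesgue_on_cong_AE(2)[of S "S \<inter> T" f f] S T by auto
qed

lemma integrable_lebesgue_on_subset:
  fixes f :: "'a::euclidean_space \<Rightarrow> 'b::euclidean_space"
  assumes f: "integrable (lebesgue_on T) f"
    and S: "S \<in> sets lebesgue" and T: "T \<in> sets lebesgue" and neg: "negligible (S - T)"
  shows "integrable (lebesgue_on S) f"
proof -
  have "set_integrable lebesgue T f"
    using f T by (simp add: set_integrable_def integrable_restrict_space)
  then have "set_integrable lebesgue (S \<inter> T) f"
    by (rule set_integrable_subset) (use S T in auto)
  then have "integrable (lebesgue_on (S \<inter> T)) f"
    using absolutely_integrable_imp_integrable S T by blast
  moreover have "AE x in lebesgue. x \<notin> S - T"
    using neg negligible_iff_null_sets by (metis AE_not_in)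
  then have "AE x in lebesgue. (if x \<in> S then f x else 0) = (if x \<in> S \<inter> T then f x else 0)"
    by auto
  ultimately show ?thesis
    using integrable_lebesgue_on_cong_AE(1)[of S "S \<inter> T" f f] S T by auto
qed

lemma integral_lebesgue_on_mono_set:
  fixes f :: "'a::euclidean_space \<Rightarrow> real"
  assumes f: "integrable (lebesgue_on T) f" "\<And>x. x \<in> T \<Longrightarrow> 0 \<le> f x"
    and S: "S \<in> sets lebesgue" and T: "T \<in> sets lebesgue" and neg: "negligible (S - T)"
  shows "(LINT x|lebesgue_on S. f x) \<le> (LINT x|lebesgue_on T. f x)"
proof -
  have "AE x in lebesgue. x \<notin> S - T"
    using neg negligible_iff_null_sets by (metis AE_not_in)
  then have "AE x in lebesgue. (if x \<in> S then f x else 0) = (if x \<in> S \<inter> T then f x else 0)"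
    by auto
  then have "(LINT x|lebesgue_on S. f x) = (LINT x|lebesgue_on (S \<inter> T). f x)"
    using integrable_lebesgue_on_cong_AE(3)[of S "S \<inter> T" f f] S T by auto
  also have "\<dots> \<le> (LINT x|lebesgue_on T. f x)"
    by (rule integral_mono_lebesgue_on_AE[OF f(1)])
       (use S T f in \<open>auto simp: AE_lebesgue_on_iff\<close>)
  finally show ?thesis .
qed

lemma integrable_bounded_lebesgue_on:
  fixes f :: "'a::euclidean_space \<Rightarrow> 'b::euclidean_space"
  assumes "S \<in> lmeasurable" "f \<in> borel_measurable (lebesgue_on S)" "AE x in lebesgue_on S. norm (f x) \<le> B"
  shows "integrable (lebesgue_on S) f"
proof -
  interpret finite_measure "lebesgue_on S" using assms(1) by (rule finite_measure_lebesgue_on)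
  show ?thesis using assms(2,3) by (rule integrable_const_bound[rotated])
qed

lemma integrable_mult_of_square:
  fixes f g :: "'a \<Rightarrow> real"
  assumes "f \<in> borel_measurable M" "g \<in> borel_measurable M"
    "integrable M (\<lambda>x. (f x)\<^sup>2)" "integrable M (\<lambda>x. (g x)\<^sup>2)"
  shows "integrable M (\<lambda>x. f x * g x)"
proof (rule Bochner_Integration.integrable_bound)
  show "integrable M (\<lambda>x. (f x)\<^sup>2 + (g x)\<^sup>2)" using assms by simp
  have "\<bar>f x * g x\<bar> \<le> (f x)\<^sup>2 + (g x)\<^sup>2" for x
  proof -
    have "2 * (\<bar>f x\<bar> * \<bar>g x\<bar>) \<le> (f x)\<^sup>2 + (g x)\<^sup>2"
      using sum_squares_bound[of "\<bar>f x\<bar>" "\<bar>g x\<bar>"] by simp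
    moreover have "0 \<le> \<bar>f x\<bar> * \<bar>g x\<bar>" by simp
    ultimately show ?thesis unfolding abs_mult by linarith
  qed
  then show "AE x in M. norm (f x * g x) \<le> norm ((f x)\<^sup>2 + (g x)\<^sup>2)" by auto
qed (use assms in auto)

lemma Cauchy_Schwarz_integral:
  fixes f g :: "'a \<Rightarrow> real"
  assumes "f \<in> borel_measurable M" "g \<in> borel_measurable M"
    "integrable M (\<lambda>x. (f x)\<^sup>2)" "integrable M (\<lambda>x. (g x)\<^sup>2)"
  shows "\<bar>LINT x|M. f x * g x\<bar> \<le> sqrt (LINT x|M. (f x)\<^sup>2) * sqrt (LINT x|M. (g x)\<^sup>2)"
proof -
  let ?F = "LINT x|M. (f x)\<^sup>2" and ?G = "LINT x|M. (g x)\<^sup>2" and ?I = "LINT x|M. f x * g x"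
  have fg: "integrable M (\<lambda>x. f x * g x)" using assms by (rule integrable_mult_of_square)
  have quad: "0 \<le> ?F * s\<^sup>2 + 2 * ?I * s + ?G" for s :: real
  proof -
    have "0 \<le> (LINT x|M. (s * f x + g x)\<^sup>2)" by simp
    also have "\<dots> = (LINT x|M. s\<^sup>2 * (f x)\<^sup>2 + 2 * s * (f x * g x) + (g x)\<^sup>2)"
      by (intro Bochner_Integration.integral_cong) (auto simp: power2_eq_square algebra_simps)
    also have "\<dots> = ?F * s\<^sup>2 + 2 * ?I * s + ?G"
      using fg assms by simp
    finally show ?thesis .
  qed
  have F0: "0 \<le> ?F" and G0: "0 \<le> ?G" by simp_all
  have "?I\<^sup>2 \<le> ?F * ?G"
  proof (cases "?F = 0")
    case True
    \<comment> \<open>With leading coefficient 0 the quadratic is affine in \<open>s\<close>; a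
      nonzero slope would make it negative at the point chosen below.\<close>
    have "?I = 0"
    proof (rule ccontr)
      assume "?I \<noteq> 0"
      have "0 \<le> 2 * ?I * (- (?G + 1) / (2 * ?I)) + ?G"
        using quad[of "- (?G + 1) / (2 * ?I)"] True by simp
      then show False using \<open>?I \<noteq> 0\<close> by (simp add: field_simps)
    qed
    then show ?thesis by (simp add: True)
  next
    case False
    then have F: "?F > 0" using F0 by linarith
    \<comment> \<open>The quadratic is evaluated at its minimum.\<close>
    have "0 \<le> ?F * (- ?I / ?F)\<^sup>2 + 2 * ?I * (- ?I / ?F) + ?G" by (rule quad)
    also have "\<dots> = ?G - ?I\<^sup>2 / ?F" using F by (simp add: power2_eq_square field_simps)
    finally show ?thesis using F by (simp add: field_simps)
  qed
  then have "sqrt (?I\<^sup>2) \<le> sqrt (?F * ?G)" by (rule real_sqrt_le_mono)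
  then show ?thesis by (simp add: real_sqrt_mult)
qed

section \<open>Square-integrable functions and their norms\<close>

lemma L2norm_nonneg [simp]: "0 \<le> L2norm S f"
  by (simp add: L2norm_def)

lemma L2norm_squared: "(L2norm S f)\<^sup>2 = (LINT x|lebesgue_on S. (norm (f x))\<^sup>2)"
  by (simp add: L2norm_def)

lemma L2norm_sq_cong_AE:
  fixes f g :: "'a::euclidean_space \<Rightarrow> 'b::euclidean_space"
  assumes "S \<in> sets lebesgue" "T \<in> sets lebesgue"
    "AE x in lebesgue. (if x \<in> S then f x else 0) = (if x \<in> T then g x else 0)"
  shows "L2norm S f = L2norm T g"
proof -
  have "AE x in lebesgue. (if x \<in> S then (norm (f x))\<^sup>2 else 0) = (if x \<in> T then (norm (g x))\<^sup>2 else 0)"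
    using assms(3) by eventually_elim (auto split: if_splits)
  from integrable_lebesgue_on_cong_AE(3)[OF assms(1,2) this] show ?thesis
    by (simp add: L2norm_def)
qed

lemma L2norm_cong_AE:
  fixes f g :: "'a::euclidean_space \<Rightarrow> 'b::euclidean_space"
  assumes "S \<in> sets lebesgue" "AE x in lebesgue_on S. f x = g x"
  shows "L2norm S f = L2norm S g"
  by (rule L2norm_sq_cong_AE) (use assms in \<open>auto simp: AE_lebesgue_on_iff\<close>)

lemma L2_meas: "f \<in> L2 S \<Longrightarrow> f \<in> borel_measurable (lebesgue_on S)"
  and L2_integrable: "f \<in> L2 S \<Longrightarrow> integrable (lebesgue_on S) (\<lambda>x. (norm (f x))\<^sup>2)"
  by (auto simp: L2_def)

lemma L2_cong_AE:
  fixes f g :: "'a::euclidean_space \<Rightarrow> 'b::euclidean_space"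
  assumes S: "S \<in> sets lebesgue" and eq: "AE x in lebesgue_on S. f x = g x" and f: "f \<in> L2 S"
  shows "g \<in> L2 S"
proof -
  have 1: "AE x in lebesgue. (if x \<in> S then f x else 0) = (if x \<in> S then g x else 0)"
    using eq S by (auto simp: AE_lebesgue_on_iff)
  then have "AE x in lebesgue. (if x \<in> S then (norm (f x))\<^sup>2 else 0) = (if x \<in> S then (norm (g x))\<^sup>2 else 0)"
    by eventually_elim (auto split: if_splits)
  from integrable_lebesgue_on_cong_AE(1)[OF S S this] integrable_lebesgue_on_cong_AE(2)[OF S S 1] f
  show ?thesis by (simp add: L2_def)
qed

lemma L2_subset:
  fixes f :: "'a::euclidean_space \<Rightarrow> 'b::euclidean_space"
  assumes "f \<in> L2 T" "S \<in> sets lebesgue" "T \<in> sets lebesgue" "negligible (S - T)"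
  shows "f \<in> L2 S"
  using assms borel_measurable_lebesgue_on_subset[of f T S]
    integrable_lebesgue_on_subset[of T "\<lambda>x. (norm (f x))\<^sup>2" S]
  unfolding L2_def by blast

lemma L2norm_subset:
  fixes f :: "'a::euclidean_space \<Rightarrow> 'b::euclidean_space"
  assumes "f \<in> L2 T" "S \<in> sets lebesgue" "T \<in> sets lebesgue" "negligible (S - T)"
  shows "L2norm S f \<le> L2norm T f"
  unfolding L2norm_def
  by (intro real_sqrt_le_mono integral_lebesgue_on_mono_set) (use assms in \<open>auto simp: L2_def\<close>)

lemma L2_norm: "f \<in> L2 S \<Longrightarrow> (\<lambda>x. norm (f x)) \<in> L2 S"
  by (auto simp: L2_def)

lemma L2_bound:
  fixes f :: "'a::euclidean_space \<Rightarrow> 'b::euclidean_space" and g :: "'a \<Rightarrow> real"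
  assumes "f \<in> borel_measurable (lebesgue_on S)" "g \<in> L2 S" "AE x in lebesgue_on S. norm (f x) \<le> g x"
  shows "f \<in> L2 S"
proof -
  have "integrable (lebesgue_on S) (\<lambda>x. (norm (f x))\<^sup>2)"
  proof (rule Bochner_Integration.integrable_bound)
    show "integrable (lebesgue_on S) (\<lambda>x. (norm (g x))\<^sup>2)" using assms(2) by (simp add: L2_def)
    show "(\<lambda>x. (norm (f x))\<^sup>2) \<in> borel_measurable (lebesgue_on S)" using assms(1) by measurable
    show "AE x in lebesgue_on S. norm ((norm (f x))\<^sup>2) \<le> norm ((norm (g x))\<^sup>2)"
      using assms(3) by eventually_elim (auto intro!: power_mono simp: power2_le_iff_abs_le abs_le_square_iff[symmetric])
  qed
  with assms(1) show ?thesis by (simp add: L2_def)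
qed

lemma L2norm_mono:
  fixes f :: "'a::euclidean_space \<Rightarrow> 'b::euclidean_space" and g :: "'a \<Rightarrow> real"
  assumes "f \<in> borel_measurable (lebesgue_on S)" "g \<in> L2 S" "AE x in lebesgue_on S. norm (f x) \<le> g x"
  shows "L2norm S f \<le> L2norm S g"
  unfolding L2norm_def
proof (intro real_sqrt_le_mono integral_mono_AE)
  show "integrable (lebesgue_on S) (\<lambda>x. (norm (f x))\<^sup>2)"
    using L2_bound[OF assms] by (simp add: L2_def)
  show "AE x in lebesgue_on S. (norm (f x))\<^sup>2 \<le> (norm (g x))\<^sup>2"
    using assms(3) by eventually_elim (auto intro!: power_mono)
qed (use assms in \<open>auto simp: L2_def\<close>)

lemma norm_add_sq_le: "(norm (a + b :: 'a::real_normed_vector))\<^sup>2 \<le> 2 * (norm a)\<^sup>2 + 2 * (norm b)\<^sup>2"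
proof -
  have "(norm (a + b))\<^sup>2 \<le> (norm a + norm b)\<^sup>2" by (intro power_mono norm_triangle_ineq) auto
  also have "\<dots> \<le> 2 * (norm a)\<^sup>2 + 2 * (norm b)\<^sup>2"
    using sum_squares_bound[of "norm a" "norm b"] by (simp add: power2_sum)
  finally show ?thesis .
qed

lemma L2_add:
  assumes "f \<in> L2 S" "g \<in> L2 S"
  shows "(\<lambda>x. f x + g x) \<in> L2 S"
proof -
  have "integrable (lebesgue_on S) (\<lambda>x. (norm (f x + g x))\<^sup>2)"
  proof (rule Bochner_Integration.integrable_bound)
    show "integrable (lebesgue_on S) (\<lambda>x. 2 * (norm (f x))\<^sup>2 + 2 * (norm (g x))\<^sup>2)"
      using assms by (simp add: L2_def)
    show "AE x in lebesgue_on S. norm ((norm (f x + g x))\<^sup>2) \<le> norm (2 * (norm (f x))\<^sup>2 + 2 * (norm (g x))\<^sup>2)"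
      using norm_add_sq_le by auto
  qed (use assms in \<open>auto simp: L2_def\<close>)
  with assms show ?thesis by (auto simp: L2_def)
qed

lemma L2_scaleR: "f \<in> L2 S \<Longrightarrow> (\<lambda>x. r *\<^sub>R f x) \<in> L2 S"
  by (auto simp: L2_def power_mult_distrib)

lemma L2_uminus: "f \<in> L2 S \<Longrightarrow> (\<lambda>x. - f x) \<in> L2 S"
  using L2_scaleR[of f S "-1"] by simp

lemma L2_diff: "f \<in> L2 S \<Longrightarrow> g \<in> L2 S \<Longrightarrow> (\<lambda>x. f x - g x) \<in> L2 S"
  using L2_add[of f S "\<lambda>x. - g x"] L2_uminus[of g S] by simp

lemma L2_sum: "finite I \<Longrightarrow> (\<And>i. i \<in> I \<Longrightarrow> f i \<in> L2 S) \<Longrightarrow> (\<lambda>x. \<Sum>i\<in>I. f i x) \<in> L2 S"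
proof (induction I rule: finite_induct)
  case empty
  show ?case by (simp add: L2_def)
next
  case (insert i I)
  then show ?case using L2_add[of "f i" S "\<lambda>x. \<Sum>i\<in>I. f i x"] by simp
qed

lemma L2_mult_integrable:
  fixes f g :: "'a::euclidean_space \<Rightarrow> real"
  assumes "f \<in> L2 S" "g \<in> L2 S"
  shows "integrable (lebesgue_on S) (\<lambda>x. f x * g x)"
  by (rule integrable_mult_of_square) (use assms in \<open>auto simp: L2_def\<close>)

lemma L2_inner_integrable:
  assumes "f \<in> L2 S" "g \<in> L2 S"
  shows "integrable (lebesgue_on S) (\<lambda>x. f x \<bullet> g x)"
proof (rule Bochner_Integration.integrable_bound)
  show "integrable (lebesgue_on S) (\<lambda>x. norm (f x) * norm (g x))"
    using assms by (intro L2_mult_integrable L2_norm)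
  show "AE x in lebesgue_on S. norm (f x \<bullet> g x) \<le> norm (norm (f x) * norm (g x))"
    using Cauchy_Schwarz_ineq2 by auto
qed (use assms in \<open>auto simp: L2_def\<close>)

lemma L2_Cauchy_Schwarz:
  fixes f g :: "'a::euclidean_space \<Rightarrow> real"
  assumes "f \<in> L2 S" "g \<in> L2 S"
  shows "\<bar>LINT x|lebesgue_on S. f x * g x\<bar> \<le> L2norm S f * L2norm S g"
  using Cauchy_Schwarz_integral[of f "lebesgue_on S" g] assms by (simp add: L2_def L2norm_def)

lemma L2norm_add_sq:
  assumes "f \<in> L2 S" "g \<in> L2 S"
  shows "(L2norm S (\<lambda>x. f x + g x))\<^sup>2 \<le> 2 * (L2norm S f)\<^sup>2 + 2 * (L2norm S g)\<^sup>2"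
proof -
  have "(LINT x|lebesgue_on S. (norm (f x + g x))\<^sup>2)
      \<le> (LINT x|lebesgue_on S. 2 * (norm (f x))\<^sup>2 + 2 * (norm (g x))\<^sup>2)"
    by (rule integral_mono) (use assms L2_add[OF assms] norm_add_sq_le in \<open>auto simp: L2_def\<close>)
  also have "\<dots> = 2 * (L2norm S f)\<^sup>2 + 2 * (L2norm S g)\<^sup>2"
    using assms by (simp add: L2norm_squared L2_def)
  finally show ?thesis by (simp add: L2norm_squared)
qed

lemma L2_bounded:
  fixes f :: "'a::euclidean_space \<Rightarrow> 'b::euclidean_space"
  assumes "S \<in> lmeasurable" "f \<in> borel_measurable (lebesgue_on S)" "AE x in lebesgue_on S. norm (f x) \<le> B"
  shows "f \<in> L2 S"
proof -
  have "integrable (lebesgue_on S) (\<lambda>x. (norm (f x))\<^sup>2)"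
  proof (rule integrable_bounded_lebesgue_on[OF assms(1)])
    show "AE x in lebesgue_on S. norm ((norm (f x))\<^sup>2) \<le> B\<^sup>2"
      using assms(3) by eventually_elim (auto intro!: power_mono)
  qed (use assms in measurable)
  with assms(2) show ?thesis by (simp add: L2_def)
qed

lemma L2_integrable_self:
  fixes f :: "'a::euclidean_space \<Rightarrow> 'b::euclidean_space"
  assumes "S \<in> lmeasurable" "f \<in> L2 S"
  shows "integrable (lebesgue_on S) f"
proof (rule Bochner_Integration.integrable_bound)
  have "(\<lambda>x. 1::real) \<in> L2 S" using assms(1) by (intro L2_bounded[where B=1]) auto
  with assms show "integrable (lebesgue_on S) (\<lambda>x. 1 * norm (f x))"
    by (intro L2_mult_integrable L2_norm)
qed (use assms in \<open>auto simp: L2_def\<close>)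

lemma borel_measurable_vec_nth_compose:
  fixes f :: "'a \<Rightarrow> 'b::euclidean_space^'n"
  assumes "f \<in> borel_measurable M"
  shows "(\<lambda>x. f x $ i) \<in> borel_measurable M"
proof -
  have "continuous_on UNIV (\<lambda>v :: 'b^'n. v $ i)" by (intro continuous_intros)
  then show ?thesis
    using measurable_compose[OF assms borel_measurable_continuous_onI] by blast
qed

lemma L2_component:
  fixes f :: "'a::euclidean_space \<Rightarrow> 'b::euclidean_space^'n"
  assumes f: "f \<in> L2 S"
  shows "(\<lambda>x. f x $ i) \<in> L2 S"
proof (rule L2_bound[where g="\<lambda>x. norm (f x)"])
  show "(\<lambda>x. f x $ i) \<in> borel_measurable (lebesgue_on S)"
    using f by (intro borel_measurable_vec_nth_compose) (simp add: L2_def)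
  show "(\<lambda>x. norm (f x)) \<in> L2 S" using f by (rule L2_norm)
qed (auto simp: Finite_Cartesian_Product.norm_nth_le)

lemma borel_measurable_componentwise:
  fixes f :: "'a \<Rightarrow> 'b::euclidean_space^'n"
  assumes "\<And>i. (\<lambda>x. f x $ i) \<in> borel_measurable M"
  shows "f \<in> borel_measurable M"
proof -
  have "(\<lambda>x. f x \<bullet> b) \<in> borel_measurable M" if b: "b \<in> Basis" for b :: "'b^'n"
  proof -
    from b obtain i u where "b = axis i u" by (auto simp: Basis_vec_def)
    then have "(\<lambda>x. f x \<bullet> b) = (\<lambda>x. f x $ i \<bullet> u)" by (auto simp: inner_axis)
    with assms[of i] show ?thesis by simp
  qed
  then show ?thesis using borel_measurable_euclidean_space by blast
qed

lemma L2_componentwise: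
  fixes f :: "'a::euclidean_space \<Rightarrow> 'b::euclidean_space^'n"
  assumes "\<And>i. (\<lambda>x. f x $ i) \<in> L2 S"
  shows "f \<in> L2 S"
proof (rule L2_bound)
  show "f \<in> borel_measurable (lebesgue_on S)"
    using assms by (intro borel_measurable_componentwise) (simp add: L2_def)
  show "(\<lambda>x. \<Sum>i\<in>UNIV. norm (f x $ i)) \<in> L2 S"
    using assms by (intro L2_sum L2_norm) auto
  show "AE x in lebesgue_on S. norm (f x) \<le> (\<Sum>i\<in>UNIV. norm (f x $ i))"
    by (auto simp: norm_vec_def L2_set_le_sum)
qed

section \<open>Smooth functions with compact support\<close>

text \<open>The exponent \<open>k\<close> is there because differentiation leaves exp(-a/t) for
  combinations of exp(-a/t)/t^j; with it the family is closed under derivatives. The classical flat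
  function is the case k = 0.\<close>

definition flat :: "real \<Rightarrow> nat \<Rightarrow> real \<Rightarrow> real" where
  "flat a k t = (if t > 0 then exp (- a / t) / t ^ k else 0)"

lemma flat_nonneg: "0 \<le> flat a k t"
  by (simp add: flat_def)

text \<open>Quadratic decay at 0 makes the function differentiable there with derivative 0.\<close>

lemma flat_le_quadratic:
  assumes "0 < a"
  obtains C where "0 \<le> C" "\<And>t. flat a k t \<le> C * t\<^sup>2"
proof
  let ?m = "k + 2"
  show "0 \<le> (real ?m / a) ^ ?m" using assms by simp
  fix t
  show "flat a k t \<le> (real ?m / a) ^ ?m * t\<^sup>2"
  proof (cases "t > 0")
    case True
    \<comment> \<open>From x <= exp x with x = a/(t m), raised to the power m. The choice m = k + 2
      absorbs the denominator t^k and leaves t^2.\<close>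
    have "(a / (t * ?m)) ^ ?m \<le> exp (a / (t * ?m)) ^ ?m"
    proof (rule power_mono)
      show "a / (t * ?m) \<le> exp (a / (t * ?m))"
        using exp_ge_add_one_self[of "a / (t * ?m)"] by linarith
    qed (use assms True in auto)
    also have "\<dots> = exp (a / t)"
      using True by (simp only: exp_of_nat_mult[symmetric]) (simp del: of_nat_add)
    finally have "inverse (exp (a / t)) \<le> inverse ((a / (t * ?m)) ^ ?m)"
      using assms True by (intro le_imp_inverse_le zero_less_power divide_pos_pos mult_pos_pos) auto
    then have "exp (- a / t) \<le> (t * ?m / a) ^ ?m"
      unfolding power_inverse[symmetric] inverse_divide by (simp add: exp_minus)
    also have "t * ?m / a = real ?m / a * t" by simp
    also have "(real ?m / a * t) ^ ?m = (real ?m / a) ^ ?m * t\<^sup>2 * t ^ k"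
      by (simp only: power_mult_distrib power_add[of t k 2] ac_simps)
    finally show ?thesis
      using True by (simp add: flat_def divide_le_eq)
  next
    case False
    have "0 \<le> (real ?m / a) ^ ?m * t\<^sup>2" using assms by simp
    with False show ?thesis by (simp add: flat_def)
  qed
qed

text \<open>One formula covers the whole line: to the left of 0 and at 0 both terms on the right are
  0 by definition, and the quadratic bound settles the point 0 itself.\<close>

lemma flat_has_real_derivative:
  assumes a: "0 < a"
  shows "(flat a k has_real_derivative a * flat a (k + 2) t - k * flat a (k + 1) t) (at t)"
proof -
  consider "t > 0" | "t < 0" | "t = 0" by linarith
  then show ?thesis
  proof cases
    case 1
    have "((\<lambda>t. exp (- a / t) * inverse t ^ k) has_real_derivative
        a * flat a (k + 2) t - k * flat a (k + 1) t) (at t)"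
    proof -
      have D1: "((\<lambda>t. exp (- a / t)) has_real_derivative exp (- a / t) * (a * (inverse t)\<^sup>2)) (at t)"
        using 1 by (auto intro!: derivative_eq_intros simp: power2_eq_square field_simps)
      have D2: "((\<lambda>t. inverse t ^ k) has_real_derivative - real k * inverse t ^ (k + 1)) (at t)"
      proof (cases k)
        case (Suc j)
        have "(inverse has_real_derivative - (inverse t * inverse t)) (at t)"
          using 1 DERIV_inverse[of t UNIV] by (simp add: power2_eq_square)
        from DERIV_power[OF this, of k] show ?thesis
          by (rule DERIV_cong) (simp add: Suc algebra_simps)
      qed simp
      show ?thesis
        by (rule DERIV_cong[OF DERIV_mult[OF D1 D2]])
           (use 1 in \<open>simp add: flat_def divide_inverse power_inverse power2_eq_square algebra_simps\<close>)
    qed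
    then show ?thesis
      by (rule has_field_derivative_transform_within_open[where S="{0<..}"])
         (use 1 in \<open>auto simp: flat_def power_inverse divide_inverse\<close>)
  next
    case 2
    have "((\<lambda>t. 0) has_real_derivative 0) (at t)" by simp
    then have "(flat a k has_real_derivative 0) (at t)"
      by (rule has_field_derivative_transform_within_open[where S="{..<0}"])
         (use 2 in \<open>auto simp: flat_def\<close>)
    with 2 show ?thesis by (simp add: flat_def)
  next
    case 3
    obtain C where C: "0 \<le> C" "\<And>t. flat a k t \<le> C * t\<^sup>2"
      using flat_le_quadratic[OF a] by blast
    have "(\<lambda>h. (flat a k (0 + h) - flat a k 0) / h) \<midarrow>0\<rightarrow> 0"
    proof (rule Lim_null_comparison)
      have "norm ((flat a k (0 + h) - flat a k 0) / h) \<le> C * \<bar>h\<bar>" if "h \<noteq> 0" for h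
      proof -
        have "norm ((flat a k (0 + h) - flat a k 0) / h) = flat a k h / \<bar>h\<bar>"
          using flat_nonneg[of a k h] by (simp add: flat_def)
        also have "\<dots> \<le> C * h\<^sup>2 / \<bar>h\<bar>" by (intro divide_right_mono C) auto
        also have "\<dots> = C * \<bar>h\<bar>" using that by (simp add: power2_eq_square abs_if)
        finally show ?thesis .
      qed
      then show "\<forall>\<^sub>F h in at 0. norm ((flat a k (0 + h) - flat a k 0) / h) \<le> C * \<bar>h\<bar>"
        by (simp add: eventually_at_filter)
      have "((\<lambda>h. C * \<bar>h\<bar>) \<longlongrightarrow> C * \<bar>0\<bar>) (at (0::real))" by (intro tendsto_intros)
      then show "((\<lambda>h. C * \<bar>h\<bar>) \<longlongrightarrow> 0) (at (0::real))" by simp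
    qed
    then have "(flat a k has_real_derivative 0) (at 0)" by (simp add: DERIV_def)
    with 3 show ?thesis by (simp add: flat_def)
  qed
qed

text \<open>An inductively generated class in place of all smooth functions. Once it is closed under
  directional derivatives, derivatives of every order follow without further estimates; polynomials
  and bumps belong to it by construction.\<close>

inductive_set smooth_fns :: "('a::euclidean_space \<Rightarrow> real) set" where
  const: "(\<lambda>x. r) \<in> smooth_fns"
| linear: "bounded_linear f \<Longrightarrow> f \<in> smooth_fns"
| add: "f \<in> smooth_fns \<Longrightarrow> g \<in> smooth_fns \<Longrightarrow> (\<lambda>x. f x + g x) \<in> smooth_fns"
| mult: "f \<in> smooth_fns \<Longrightarrow> g \<in> smooth_fns \<Longrightarrow> (\<lambda>x. f x * g x) \<in> smooth_fns"
| flat: "f \<in> smooth_fns \<Longrightarrow> 0 < a \<Longrightarrow> (\<lambda>x. flat a k (f x)) \<in> smooth_fns"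

lemma smooth_fns_uminus: "f \<in> smooth_fns \<Longrightarrow> (\<lambda>x. - f x) \<in> smooth_fns"
  using smooth_fns.mult[OF smooth_fns.const[of "-1"], of f] by simp

lemma smooth_fns_diff: "f \<in> smooth_fns \<Longrightarrow> g \<in> smooth_fns \<Longrightarrow> (\<lambda>x. f x - g x) \<in> smooth_fns"
  using smooth_fns.add[of f "\<lambda>x. - g x"] smooth_fns_uminus[of g] by simp

lemma smooth_fns_sum: "finite I \<Longrightarrow> (\<And>i. i \<in> I \<Longrightarrow> f i \<in> smooth_fns) \<Longrightarrow> (\<lambda>x. \<Sum>i\<in>I. f i x) \<in> smooth_fns"
  by (induction I rule: finite_induct) (auto intro: smooth_fns.intros)

lemma smooth_fns_prod: "finite I \<Longrightarrow> (\<And>i. i \<in> I \<Longrightarrow> f i \<in> smooth_fns) \<Longrightarrow> (\<lambda>x. \<Prod>i\<in>I. f i x) \<in> smooth_fns"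
  by (induction I rule: finite_induct) (auto intro: smooth_fns.intros)

lemma smooth_fns_polynomial: "real_polynomial_function f \<Longrightarrow> f \<in> smooth_fns"
  by (induction rule: real_polynomial_function.induct) (auto intro: smooth_fns.intros)

text \<open>Differentiability and closure are proved together, since the product rule needs the
  first for the second. The rule for \<open>flat\<close> stays in the class because its exponent is
  free.\<close>

lemma smooth_fns_derivative:
  "f \<in> smooth_fns \<Longrightarrow> (\<forall>x. f differentiable (at x)) \<and> (\<forall>v. (\<lambda>x. frechet_derivative f (at x) v) \<in> smooth_fns)"
proof (induction rule: smooth_fns.induct)
  case (const r)
  have "frechet_derivative (\<lambda>x. r) (at x) = (\<lambda>h. 0)" for x :: 'a
    by (rule frechet_derivative_at[symmetric]) auto
  then show ?case by (auto intro: smooth_fns.const)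
next
  case (linear f)
  then have "frechet_derivative f (at x) = f" for x
    by (intro frechet_derivative_at[symmetric] bounded_linear_imp_has_derivative)
  then show ?case using linear by (auto intro: smooth_fns.const bounded_linear_imp_differentiable)
next
  case (add f g)
  have "((\<lambda>x. f x + g x) has_derivative (\<lambda>v. frechet_derivative f (at x) v + frechet_derivative g (at x) v)) (at x)" for x
    using add.IH by (intro has_derivative_add) (auto simp: frechet_derivative_works)
  note D = this
  have "frechet_derivative (\<lambda>x. f x + g x) (at x) = (\<lambda>v. frechet_derivative f (at x) v + frechet_derivative g (at x) v)"
    and "(\<lambda>x. f x + g x) differentiable (at x)" for x
    by (rule frechet_derivative_at[OF D, symmetric], rule differentiableI[OF D])
  then show ?case using add.IH by (auto intro: smooth_fns.intros)
next
  case (mult f g)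
  have "((\<lambda>x. f x * g x) has_derivative (\<lambda>v. f x * frechet_derivative g (at x) v + frechet_derivative f (at x) v * g x)) (at x)" for x
    using mult.IH by (intro has_derivative_mult) (auto simp: frechet_derivative_works)
  note D = this
  have "frechet_derivative (\<lambda>x. f x * g x) (at x) = (\<lambda>v. f x * frechet_derivative g (at x) v + frechet_derivative f (at x) v * g x)"
    and "(\<lambda>x. f x * g x) differentiable (at x)" for x
    by (rule frechet_derivative_at[OF D, symmetric], rule differentiableI[OF D])
  moreover have "(\<lambda>x. f x * frechet_derivative g (at x) v + frechet_derivative f (at x) v * g x) \<in> smooth_fns" for v
    using mult.IH mult.hyps by (intro smooth_fns.add smooth_fns.mult) auto
  ultimately show ?case by auto
next
  case (flat f a k)
  let ?d = "\<lambda>x. a * flat a (k + 2) (f x) - k * flat a (k + 1) (f x)"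
  have "((\<lambda>x. flat a k (f x)) has_derivative (\<lambda>v. frechet_derivative f (at x) v * ?d x)) (at x)" for x
    using flat.IH by (intro DERIV_compose_FDERIV[where f="flat a k"] flat_has_real_derivative flat.hyps(2))
      (auto simp: frechet_derivative_works)
  note D = this
  have "frechet_derivative (\<lambda>x. flat a k (f x)) (at x) = (\<lambda>v. frechet_derivative f (at x) v * ?d x)"
    and "(\<lambda>x. flat a k (f x)) differentiable (at x)" for x
    by (rule frechet_derivative_at[OF D, symmetric], rule differentiableI[OF D])
  moreover have "(\<lambda>x. frechet_derivative f (at x) v * ?d x) \<in> smooth_fns" for v
    using flat.IH flat.hyps by (intro smooth_fns.mult smooth_fns_diff smooth_fns.const smooth_fns.flat) auto
  ultimately show ?case by auto
qed

lemma smooth_fns_Ck: "f \<in> smooth_fns \<Longrightarrow> Ck k f"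
proof (induction k arbitrary: f)
  case 0
  then have "\<forall>x. f differentiable (at x)" using smooth_fns_derivative by blast
  then show ?case
    using differentiable_imp_continuous_within by (auto simp: continuous_on_eq_continuous_within)
next
  case (Suc k)
  then show ?case using smooth_fns_derivative[of f] by auto
qed

lemma smooth_fns_continuous: "f \<in> smooth_fns \<Longrightarrow> continuous_on S f" for f :: "real^'n \<Rightarrow> real"
  using smooth_fns_Ck[of f 0] continuous_on_subset by auto

lemma test_functionsI:
  assumes "\<phi> \<in> smooth_fns" "compact S" "S \<subseteq> \<Omega>" "\<And>x. x \<notin> S \<Longrightarrow> \<phi> x = 0"
  shows "\<phi> \<in> test_functions \<Omega>"
  using assms smooth_fns_Ck by (auto simp: test_functions_def)

lemma bounded_linear_vec_nth': "bounded_linear (\<lambda>x::real^'n. x $ i)"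
  by (rule bounded_linear_vec_nth)

lemma smooth_fns_inner: "(\<lambda>x. n \<bullet> x) \<in> smooth_fns"
  by (intro smooth_fns.linear bounded_linear_inner_right)

lemma smooth_fns_norm_sq: "(\<lambda>x. (norm (x - z))\<^sup>2) \<in> smooth_fns" for z :: "'a::euclidean_space"
proof -
  have "(\<lambda>x. (norm (x - z))\<^sup>2) = (\<lambda>x. \<Sum>b\<in>Basis. (b \<bullet> x - b \<bullet> z) * (b \<bullet> x - b \<bullet> z))"
  proof
    fix x
    show "(norm (x - z))\<^sup>2 = (\<Sum>b\<in>Basis. (b \<bullet> x - b \<bullet> z) * (b \<bullet> x - b \<bullet> z))"
      unfolding power2_norm_eq_inner euclidean_inner[of "x - z" "x - z"]
      by (intro sum.cong refl) (simp add: inner_diff_left inner_diff_right inner_commute)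
  qed
  also have "\<dots> \<in> smooth_fns"
    by (intro smooth_fns_sum smooth_fns.mult smooth_fns_diff smooth_fns_inner smooth_fns.const) auto
  finally show ?thesis .
qed

section \<open>Radial bumps\<close>

definition bump :: "'a::euclidean_space \<Rightarrow> real \<Rightarrow> 'a \<Rightarrow> real" where
  "bump z r x = flat 1 0 (1 - (norm (x - z))\<^sup>2 / r\<^sup>2)"

lemma bump_smooth: "bump z r \<in> smooth_fns"
proof -
  have "(\<lambda>x. flat 1 0 (1 + - ((1 / r\<^sup>2) * (norm (x - z))\<^sup>2))) \<in> smooth_fns"
    by (intro smooth_fns.flat smooth_fns.add smooth_fns_uminus smooth_fns.mult smooth_fns.const smooth_fns_norm_sq) simp
  then show ?thesis by (simp add: bump_def[abs_def])
qed

lemma bump_nonneg: "0 \<le> bump z r x"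
  by (simp add: bump_def flat_nonneg)

lemma bump_le_1: "bump z r x \<le> 1"
  by (simp add: bump_def flat_def)

lemma bump_zero: "0 < r \<Longrightarrow> r \<le> norm (x - z) \<Longrightarrow> bump z r x = 0"
  using power_mono[of r "norm (x - z)" 2] by (auto simp: bump_def flat_def field_simps simp del: power_mono_iff)

lemma bump_pos: "norm (x - z) < r \<Longrightarrow> 0 < bump z r x"
proof -
  assume *: "norm (x - z) < r"
  then have "(norm (x - z))\<^sup>2 < r\<^sup>2" by (intro power_strict_mono) auto
  moreover have "r > 0" using * norm_ge_zero le_less_trans by blast
  ultimately show ?thesis by (simp add: bump_def flat_def field_simps)
qed

text \<open>On the half ball the argument of \<open>flat\<close> is at least 3/4; this is the origin
  of the number exp(-4/3) in the face estimates.\<close>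

lemma bump_lower:
  assumes "0 < r" "norm (x - z) \<le> r / 2"
  shows "exp (- 4 / 3) \<le> bump z r x"
proof -
  have "(norm (x - z))\<^sup>2 \<le> (r / 2)\<^sup>2" using assms by (intro power_mono) auto
  then have q: "(norm (x - z))\<^sup>2 / r\<^sup>2 \<le> 1 / 4" using assms by (simp add: field_simps power2_eq_square)
  then have "1 / (1 - (norm (x - z))\<^sup>2 / r\<^sup>2) \<le> 1 / (3 / 4)" by (intro divide_left_mono) auto
  moreover have "(norm (x - z))\<^sup>2 / r\<^sup>2 < 1" using q by linarith
  ultimately show ?thesis by (simp add: bump_def flat_def)
qed

lemma bump_scale: "0 < r \<Longrightarrow> bump z r (z + r *\<^sub>R x) = bump 0 1 x"
  by (simp add: bump_def power_mult_distrib)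

section \<open>Integrals of directional derivatives\<close>

lemma integral_lborel_translate:
  fixes f :: "'a::euclidean_space \<Rightarrow> real"
  assumes "f \<in> borel_measurable borel"
  shows "(LINT x|lborel. f (x + v)) = (LINT x|lborel. f x)"
proof -
  have "(LINT x|lborel. f x) = (LINT x|distr lborel borel ((+) v). f x)"
    by (simp add: lborel_distr_plus)
  also have "\<dots> = (LINT x|lborel. f (v + x))"
    using assms by (intro integral_distr) auto
  finally show ?thesis by (simp add: add.commute)
qed

lemma integrable_lborel_bounded_support:
  fixes f :: "'a::euclidean_space \<Rightarrow> real"
  assumes "f \<in> borel_measurable borel" "\<And>x. x \<notin> cball z R \<Longrightarrow> f x = 0" "\<And>x. \<bar>f x\<bar> \<le> B"
  shows "integrable lborel f"
proof (rule Bochner_Integration.integrable_bound)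
  show "integrable lborel (\<lambda>x. B * indicator (cball z R) x)"
    using emeasure_bounded_finite[OF bounded_cball] by (intro integrable_mult_right integrable_real_indicator) (auto simp: less_top)
  show "AE x in lborel. norm (f x) \<le> norm (B * indicator (cball z R) x)"
  proof (rule AE_I2)
    fix x
    show "norm (f x) \<le> norm (B * indicator (cball z R) x)"
      using assms(2)[of x] assms(3)[of x] by (cases "x \<in> cball z R") auto
  qed
qed (use assms in auto)

text \<open>The difference quotients have integral zero by translation invariance and converge
  boundedly.\<close>

lemma integral_line_derivative_zero:
  fixes \<Phi> \<psi> :: "'a::euclidean_space \<Rightarrow> real"
  assumes meas: "\<Phi> \<in> borel_measurable borel" "\<psi> \<in> borel_measurable borel"
    and supp: "\<And>x. x \<notin> cball 0 R \<Longrightarrow> \<Phi> x = 0" and bound: "\<And>x. \<bar>\<Phi> x\<bar> \<le> B"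
    and lip: "\<And>x h. 0 \<le> h \<Longrightarrow> h \<le> 1 \<Longrightarrow> \<bar>\<Phi> (x + h *\<^sub>R v) - \<Phi> x\<bar> \<le> L * h"
    and deriv: "AE x in lborel. ((\<lambda>h. \<Phi> (x + h *\<^sub>R v)) has_real_derivative \<psi> x) (at 0)"
  shows "(LINT x|lborel. \<psi> x) = 0" and "integrable lborel \<psi>"
proof -
  let ?h = "\<lambda>m. 1 / real (Suc m)"
  let ?q = "\<lambda>m x. (\<Phi> (x + ?h m *\<^sub>R v) - \<Phi> x) / ?h m"
  let ?w = "\<lambda>x. \<bar>L\<bar> * indicator (cball 0 (R + norm v)) x"
  have int: "integrable lborel \<Phi>"
    using meas(1) supp bound by (rule integrable_lborel_bounded_support)
  have int': "integrable lborel (\<lambda>x. \<Phi> (x + c))" for c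
  proof (rule integrable_lborel_bounded_support)
    show "\<Phi> (x + c) = 0" if "x \<notin> cball (- c) R" for x
      using that by (intro supp) (auto simp: dist_norm norm_minus_commute add.commute)
  qed (use meas bound in measurable)
  have q0: "integral\<^sup>L lborel (?q m) = 0" for m
    using int int' integral_lborel_translate[OF meas(1)] by (simp del: of_nat_Suc)
  have h0: "?h \<longlonglongrightarrow> 0" by (rule lim_1_over_n[THEN LIMSEQ_Suc])
  have lim: "AE x in lborel. (\<lambda>m. ?q m x) \<longlonglongrightarrow> \<psi> x"
    using deriv
  proof eventually_elim
    case (elim x)
    then have "((\<lambda>h. (\<Phi> (x + h *\<^sub>R v) - \<Phi> x) / h) \<longlongrightarrow> \<psi> x) (at 0)"
      by (simp add: DERIV_def)
    moreover have "filterlim ?h (at 0) sequentially"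
      using h0 by (auto simp: filterlim_at)
    ultimately show ?case by (rule filterlim_compose)
  qed
  \<comment> \<open>The step is at most 1, so the quotient vanishes outside the ball enlarged by the
    length of \<open>v\<close>; inside it the Lipschitz bound along \<open>v\<close>
    applies.\<close>
  have dom: "AE x in lborel. norm (?q m x) \<le> ?w x" for m
  proof (rule AE_I2)
    fix x
    show "norm (?q m x) \<le> ?w x"
    proof (cases "x \<in> cball 0 (R + norm v)")
      case True
      have "\<bar>\<Phi> (x + ?h m *\<^sub>R v) - \<Phi> x\<bar> \<le> L * ?h m" by (rule lip) auto
      also have "\<dots> \<le> \<bar>L\<bar> * ?h m" by (intro mult_right_mono) auto
      finally show ?thesis using True by (simp add: abs_mult divide_simps del: of_nat_Suc)
    next
      case False
      then have x: "R + norm v < norm x" by simp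
      have "norm (?h m *\<^sub>R v) \<le> norm v"
        using mult_right_mono[of "?h m" 1 "norm v"] by (simp del: of_nat_Suc)
      moreover have "norm x \<le> norm (x + ?h m *\<^sub>R v) + norm (?h m *\<^sub>R v)"
        using norm_triangle_sub[of x "- (?h m *\<^sub>R v)"] by simp
      ultimately have "R < norm (x + ?h m *\<^sub>R v)" using x by linarith
      moreover have "R < norm x" using x norm_ge_zero[of v] by linarith
      ultimately have "\<Phi> (x + ?h m *\<^sub>R v) = 0" "\<Phi> x = 0" by (auto intro!: supp)
      then show ?thesis by simp
    qed
  qed
  have w: "integrable lborel ?w"
    using emeasure_bounded_finite[OF bounded_cball] by (intro integrable_mult_right integrable_real_indicator) (auto simp: less_top)
  have qm: "?q m \<in> borel_measurable lborel" for m using meas(1) by measurable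
  have \<psi>m: "\<psi> \<in> borel_measurable lborel" using meas(2) by simp
  show "integrable lborel \<psi>"
    by (rule integrable_dominated_convergence[OF \<psi>m qm w lim dom])
  have "(\<lambda>m. integral\<^sup>L lborel (?q m)) \<longlonglongrightarrow> integral\<^sup>L lborel \<psi>"
    by (rule integral_dominated_convergence[OF \<psi>m qm w lim dom])
  then have "0 = integral\<^sup>L lborel \<psi>" by (simp only: q0 LIMSEQ_const_iff)
  then show "(LINT x|lborel. \<psi> x) = 0" by simp
qed

section \<open>The divergence theorem on half-spaces for compactly supported functions\<close>

definition C1_compact :: "(real^'n \<Rightarrow> real) \<Rightarrow> bool" where
  "C1_compact \<phi> \<longleftrightarrow> Ck 1 \<phi> \<and> (\<exists>R. \<forall>x. x \<notin> cball 0 R \<longrightarrow> \<phi> x = 0)"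

lemma test_functions_C1_compact: "\<phi> \<in> test_functions \<Omega> \<Longrightarrow> C1_compact \<phi>"
proof -
  assume "\<phi> \<in> test_functions \<Omega>"
  then obtain S where "compact S" "\<forall>x. x \<notin> S \<longrightarrow> \<phi> x = 0" "\<forall>k. Ck k \<phi>"
    by (auto simp: test_functions_def)
  moreover then obtain R where "S \<subseteq> cball 0 R"
    by (metis bounded_any_center compact_imp_bounded mem_cball subsetI)
  ultimately show ?thesis unfolding C1_compact_def by blast
qed

lemma C1_compact_differentiable: "C1_compact \<phi> \<Longrightarrow> \<phi> differentiable (at x)"
  by (simp add: C1_compact_def)

lemma C1_compact_continuous_derivative:
  "C1_compact \<phi> \<Longrightarrow> continuous_on UNIV (\<lambda>x. frechet_derivative \<phi> (at x) v)"
  by (simp add: C1_compact_def)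

lemma C1_compact_continuous: "C1_compact \<phi> \<Longrightarrow> continuous_on S \<phi>"
  using C1_compact_differentiable differentiable_imp_continuous_within
  by (metis continuous_at_imp_continuous_on)

lemma frechet_derivative_zero_outside:
  fixes \<phi> :: "'a::euclidean_space \<Rightarrow> real"
  assumes "\<And>x. x \<notin> cball z R \<Longrightarrow> \<phi> x = 0" "x \<notin> cball z R"
  shows "frechet_derivative \<phi> (at x) = (\<lambda>v. 0)"
proof -
  have "((\<lambda>x. 0) has_derivative (\<lambda>v. 0)) (at x)" by simp
  then have "(\<phi> has_derivative (\<lambda>v. 0)) (at x)"
    by (rule has_derivative_transform_within_open[where s="- cball z R"]) (use assms in \<open>auto simp: open_Compl\<close>)
  then show ?thesis by (rule frechet_derivative_at[symmetric])
qed

lemma frechet_derivative_cgrad: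
  fixes \<phi> :: "real^'n \<Rightarrow> real"
  assumes "\<phi> differentiable (at x)"
  shows "frechet_derivative \<phi> (at x) v = cgrad \<phi> x \<bullet> v"
proof -
  have "linear (frechet_derivative \<phi> (at x))"
    using assms by (simp add: linear_frechet_derivative)
  then have "frechet_derivative \<phi> (at x) v = (\<Sum>i\<in>UNIV. v $ i *\<^sub>R frechet_derivative \<phi> (at x) (axis i 1))"
    by (subst basis_expansion[of v, symmetric]) (simp add: linear_sum linear_cmul scalar_mult_eq_scaleR)
  then show ?thesis by (simp add: inner_vec_def cgrad_def mult.commute)
qed

lemma C1_compact_bounds:
  fixes \<phi> :: "real^'n \<Rightarrow> real"
  assumes "C1_compact \<phi>"
  obtains B L where "0 \<le> B" "0 \<le> L" "\<And>x. \<bar>\<phi> x\<bar> \<le> B" "\<And>x. norm (cgrad \<phi> x) \<le> L"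
    "\<And>x y. \<bar>\<phi> x - \<phi> y\<bar> \<le> L * norm (x - y)"
proof -
  obtain R where R: "\<And>x. x \<notin> cball 0 R \<Longrightarrow> \<phi> x = 0" using assms by (auto simp: C1_compact_def)
  have bd: "\<exists>B\<ge>0. \<forall>x. norm (g x) \<le> B"
    if "continuous_on UNIV g" "\<And>x. x \<notin> cball 0 R \<Longrightarrow> g x = 0" for g :: "real^'n \<Rightarrow> 'b::real_normed_vector"
  proof -
    have "bounded (g ` cball 0 R)"
      by (intro compact_imp_bounded compact_continuous_image continuous_on_subset[OF that(1)]) auto
    then obtain B where B: "\<forall>x\<in>cball 0 R. norm (g x) \<le> B" by (auto simp: bounded_iff)
    then have "norm (g x) \<le> max 0 B" for x
      using that(2)[of x] by (cases "x \<in> cball 0 R") (fastforce simp: le_max_iff_disj)+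
    then show ?thesis by (intro exI[of _ "max 0 B"]) auto
  qed
  obtain B where B: "0 \<le> B" "\<And>x. norm (\<phi> x) \<le> B"
    using bd[OF C1_compact_continuous[OF assms] R] by auto
  have "continuous_on UNIV (cgrad \<phi>)"
    unfolding cgrad_def using C1_compact_continuous_derivative[OF assms]
    by (intro continuous_intros) auto
  moreover have "cgrad \<phi> x = 0" if "x \<notin> cball 0 R" for x
    using frechet_derivative_zero_outside[OF R that] by (auto simp: cgrad_def vec_eq_iff)
  ultimately obtain L where L: "0 \<le> L" "\<And>x. norm (cgrad \<phi> x) \<le> L"
    using bd[of "cgrad \<phi>"] by auto
  have "\<bar>\<phi> x - \<phi> y\<bar> \<le> L * norm (x - y)" for x y
  proof -
    have "norm (\<phi> x - \<phi> y) \<le> L * norm (x - y)"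
    proof (rule differentiable_bound[of UNIV \<phi> "\<lambda>x. frechet_derivative \<phi> (at x)"])
      show "(\<phi> has_derivative frechet_derivative \<phi> (at x)) (at x within UNIV)" for x
        using C1_compact_differentiable[OF assms] by (simp add: frechet_derivative_works)
      show "onorm (frechet_derivative \<phi> (at x)) \<le> L" for x
      proof (rule onorm_le)
        fix v
        have "norm (frechet_derivative \<phi> (at x) v) \<le> norm (cgrad \<phi> x) * norm v"
          using frechet_derivative_cgrad[OF C1_compact_differentiable[OF assms]] Cauchy_Schwarz_ineq2 by simp
        also have "\<dots> \<le> L * norm v" by (intro mult_right_mono L) auto
        finally show "norm (frechet_derivative \<phi> (at x) v) \<le> L * norm v" .
      qed
    qed auto
    then show ?thesis by simp
  qed
  with B L that show ?thesis by auto
qed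

lemma C1_compact_line_derivative:
  assumes "C1_compact \<phi>"
  shows "((\<lambda>h. \<phi> (x + h *\<^sub>R v)) has_real_derivative frechet_derivative \<phi> (at x) v) (at 0)"
proof -
  have "(\<phi> has_derivative frechet_derivative \<phi> (at x)) (at (x + 0 *\<^sub>R v))"
    using C1_compact_differentiable[OF assms] by (simp add: frechet_derivative_works)
  moreover have "((\<lambda>h. x + h *\<^sub>R v) has_derivative (\<lambda>h. h *\<^sub>R v)) (at 0)"
    by (auto intro!: derivative_eq_intros)
  ultimately have "((\<lambda>h. \<phi> (x + h *\<^sub>R v)) has_derivative (\<lambda>h. frechet_derivative \<phi> (at x) (h *\<^sub>R v))) (at 0)"
    using has_derivative_compose by blast
  moreover have "(\<lambda>h. frechet_derivative \<phi> (at x) (h *\<^sub>R v)) = (*) (frechet_derivative \<phi> (at x) v)"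
    using linear_cmul[OF linear_frechet_derivative[OF C1_compact_differentiable[OF assms]]]
    by (auto simp: fun_eq_iff)
  ultimately show ?thesis by (simp add: has_field_derivative_def)
qed

lemma integral_C1_compact_derivative:
  fixes \<phi> :: "real^'n \<Rightarrow> real"
  assumes "C1_compact \<phi>"
  shows "(LINT x|lborel. frechet_derivative \<phi> (at x) v) = 0"
    and "integrable lborel (\<lambda>x. frechet_derivative \<phi> (at x) v)"
proof -
  obtain B L where BL: "0 \<le> L" "\<And>x. \<bar>\<phi> x\<bar> \<le> B" "\<And>x y. \<bar>\<phi> x - \<phi> y\<bar> \<le> L * norm (x - y)"
    using C1_compact_bounds[OF assms] by metis
  obtain R where R: "\<And>x. x \<notin> cball 0 R \<Longrightarrow> \<phi> x = 0" using assms by (auto simp: C1_compact_def)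
  have lip: "\<bar>\<phi> (x + h *\<^sub>R v) - \<phi> x\<bar> \<le> (L * norm v) * h" if "0 \<le> h" for x h
    using BL(3)[of "x + h *\<^sub>R v" x] that by (simp add: ac_simps)
  have m: "\<phi> \<in> borel_measurable borel" "(\<lambda>x. frechet_derivative \<phi> (at x) v) \<in> borel_measurable borel"
    using C1_compact_continuous[OF assms] C1_compact_continuous_derivative[OF assms]
    by (auto intro: borel_measurable_continuous_onI)
  show "(LINT x|lborel. frechet_derivative \<phi> (at x) v) = 0"
    "integrable lborel (\<lambda>x. frechet_derivative \<phi> (at x) v)"
    by (rule integral_line_derivative_zero[OF m R BL(2) lip AE_I2]; (use C1_compact_line_derivative[OF assms] in auto))+
qed

lemma AE_lborel_hyperplane:
  fixes n :: "'a::euclidean_space"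
  assumes "n \<noteq> 0"
  shows "AE x in lborel. n \<bullet> x \<noteq> t"
proof -
  have "negligible {x. n \<bullet> x = t}" using assms by (intro negligible_hyperplane) auto
  then have "AE x in lebesgue. x \<notin> {x. n \<bullet> x = t}"
    using negligible_iff_null_sets by (metis AE_not_in)
  then show ?thesis by (simp add: AE_completion_iff)
qed

definition hyper_proj :: "'a::euclidean_space \<Rightarrow> real \<Rightarrow> 'a \<Rightarrow> 'a" where
  "hyper_proj n t x = x - (n \<bullet> x - t) *\<^sub>R n"

text \<open>The surface integral over the hyperplane \<open>n \<bullet> x = t\<close>, computed from a slab of
  width \<open>\<delta>\<close>; by the next theorem it does not depend on \<open>\<delta>\<close>.\<close>

definition hyper_int :: "'a::euclidean_space \<Rightarrow> real \<Rightarrow> real \<Rightarrow> ('a \<Rightarrow> real) \<Rightarrow> real" where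
  "hyper_int n t \<delta> \<phi> = (1 / \<delta>) *
     (LINT x|lborel. indicator {x. t \<le> n \<bullet> x \<and> n \<bullet> x \<le> t + \<delta>} x * \<phi> (hyper_proj n t x))"

text \<open>Continue \<open>\<phi>\<close> beyond the hyperplane by its boundary values times a linear ramp of width
  \<open>\<delta>\<close>: the result is Lipschitz with compact support, so its derivative along \<open>n\<close> has
  integral zero.\<close>

lemma integral_halfspace_normal_derivative:
  fixes \<phi> :: "real^'n \<Rightarrow> real"
  assumes \<phi>: "C1_compact \<phi>" and n: "norm n = 1" and \<delta>: "0 < \<delta>"
  shows "(LINT x|lborel. indicator {x. n \<bullet> x < t} x * frechet_derivative \<phi> (at x) n) = hyper_int n t \<delta> \<phi>"
    and "integrable lborel (\<lambda>x. indicator {x. t \<le> n \<bullet> x \<and> n \<bullet> x \<le> t + \<delta>} x * \<phi> (hyper_proj n t x))"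
proof -
  obtain B L where BL: "0 \<le> B" "0 \<le> L" "\<And>x. \<bar>\<phi> x\<bar> \<le> B" "\<And>x y. \<bar>\<phi> x - \<phi> y\<bar> \<le> L * norm (x - y)"
    using C1_compact_bounds[OF \<phi>] by metis
  obtain R where R: "\<And>x. x \<notin> cball 0 R \<Longrightarrow> \<phi> x = 0" using \<phi> by (auto simp: C1_compact_def)
  \<comment> \<open>\<open>s\<close> is the distance beyond the hyperplane and \<open>k\<close>
    falls linearly from 1 to 0 over the width \<open>\<delta>\<close>, so \<open>\<Phi>\<close>
    equals \<open>\<phi>\<close> below the hyperplane and vanishes above the slab.\<close>
  define s where "s x = max 0 (n \<bullet> x - t)" for x
  define k where "k x = max 0 (1 - s x / \<delta>)" for x
  define \<Phi> where "\<Phi> x = \<phi> (x - s x *\<^sub>R n) * k x" for x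
  let ?S = "{x. t \<le> n \<bullet> x \<and> n \<bullet> x \<le> t + \<delta>}"
  define g where "g x = indicator {x. n \<bullet> x < t} x * frechet_derivative \<phi> (at x) n" for x
  define \<sigma> where "\<sigma> x = indicator ?S x * \<phi> (hyper_proj n t x)" for x
  have nn: "n \<bullet> n = 1" using n by (simp add: norm_eq_1)
  have n0: "n \<noteq> 0" using n by auto
  have s_lip: "\<bar>s x - s y\<bar> \<le> norm (x - y)" for x y
  proof -
    have "\<bar>s x - s y\<bar> \<le> \<bar>n \<bullet> (x - y)\<bar>" by (auto simp: s_def inner_diff_right)
    also have "\<dots> \<le> norm (x - y)" using Cauchy_Schwarz_ineq2[of n "x - y"] n by simp
    finally show ?thesis .
  qed
  have k_lip: "\<bar>k x - k y\<bar> \<le> norm (x - y) / \<delta>" for x y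
  proof -
    have "\<bar>k x - k y\<bar> \<le> \<bar>s x / \<delta> - s y / \<delta>\<bar>" by (auto simp: k_def)
    also have "\<dots> = \<bar>s x - s y\<bar> / \<delta>" using \<delta> by (simp add: diff_divide_distrib[symmetric])
    also have "\<dots> \<le> norm (x - y) / \<delta>" using \<delta> by (intro divide_right_mono s_lip) auto
    finally show ?thesis .
  qed
  have k01: "0 \<le> k x" "k x \<le> 1" for x using \<delta> by (auto simp: k_def s_def)
  have \<phi>s_lip: "\<bar>\<phi> (x - s x *\<^sub>R n) - \<phi> (y - s y *\<^sub>R n)\<bar> \<le> L * (2 * norm (x - y))" for x y
  proof -
    have "norm ((x - s x *\<^sub>R n) - (y - s y *\<^sub>R n)) = norm ((x - y) - (s x - s y) *\<^sub>R n)"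
      by (simp add: algebra_simps)
    also have "\<dots> \<le> norm (x - y) + \<bar>s x - s y\<bar>"
      using norm_triangle_ineq4[of "x - y" "(s x - s y) *\<^sub>R n"] n by simp
    also have "\<dots> \<le> 2 * norm (x - y)" using s_lip[of x y] by simp
    finally have "L * norm ((x - s x *\<^sub>R n) - (y - s y *\<^sub>R n)) \<le> L * (2 * norm (x - y))"
      using BL by (intro mult_left_mono) auto
    then show ?thesis using BL(4) order_trans by blast
  qed
  have \<Phi>_lip: "\<bar>\<Phi> x - \<Phi> y\<bar> \<le> (2 * L + B / \<delta>) * norm (x - y)" for x y
  proof -
    have "\<Phi> x - \<Phi> y = (\<phi> (x - s x *\<^sub>R n) - \<phi> (y - s y *\<^sub>R n)) * k x + \<phi> (y - s y *\<^sub>R n) * (k x - k y)"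
      by (simp add: \<Phi>_def algebra_simps)
    also have "\<bar>\<dots>\<bar> \<le> \<bar>\<phi> (x - s x *\<^sub>R n) - \<phi> (y - s y *\<^sub>R n)\<bar> * \<bar>k x\<bar> + \<bar>\<phi> (y - s y *\<^sub>R n)\<bar> * \<bar>k x - k y\<bar>"
      by (simp add: abs_mult[symmetric])
    also have "\<dots> \<le> (L * (2 * norm (x - y))) * 1 + B * (norm (x - y) / \<delta>)"
      using k01 BL by (intro add_mono mult_mono \<phi>s_lip k_lip) auto
    finally show ?thesis by (simp add: algebra_simps)
  qed
  have "continuous_on UNIV \<Phi>"
    unfolding \<Phi>_def k_def s_def using \<delta>
    by (intro continuous_intros continuous_on_compose2[OF C1_compact_continuous[OF \<phi>, of UNIV]]) auto
  then have \<Phi>m: "\<Phi> \<in> borel_measurable borel" by (rule borel_measurable_continuous_onI)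
  have m\<phi>: "(\<lambda>x. frechet_derivative \<phi> (at x) n) \<in> borel_measurable borel"
    using C1_compact_continuous_derivative[OF \<phi>] by (rule borel_measurable_continuous_onI)
  have gm: "g \<in> borel_measurable borel"
    unfolding g_def using m\<phi> by measurable
  have "continuous_on UNIV (\<lambda>x. \<phi> (hyper_proj n t x))"
    unfolding hyper_proj_def
    by (intro continuous_on_compose2[OF C1_compact_continuous[OF \<phi>, of UNIV]] continuous_intros) auto
  then have [measurable]: "(\<lambda>x. \<phi> (hyper_proj n t x)) \<in> borel_measurable borel"
    by (rule borel_measurable_continuous_onI)
  have \<sigma>m: "\<sigma> \<in> borel_measurable borel"
    unfolding \<sigma>_def by measurable
  have supp: "\<Phi> x = 0" if "x \<notin> cball 0 (R + \<delta>)" for x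
  proof (cases "s x \<le> \<delta>")
    case True
    have s0: "0 \<le> s x" by (simp add: s_def)
    have "norm x \<le> norm (x - s x *\<^sub>R n) + norm (s x *\<^sub>R n)"
      using norm_triangle_sub[of x "s x *\<^sub>R n"] by simp
    also have "\<dots> \<le> norm (x - s x *\<^sub>R n) + \<delta>" using True n s0 by simp
    finally have "R < norm (x - s x *\<^sub>R n)" using that by simp
    then have "\<phi> (x - s x *\<^sub>R n) = 0" by (intro R) auto
    then show ?thesis by (simp add: \<Phi>_def)
  next
    case False
    then have "k x = 0" using \<delta> by (simp add: k_def)
    then show ?thesis by (simp add: \<Phi>_def)
  qed
  have bound: "\<bar>\<Phi> x\<bar> \<le> B" for x
  proof -
    have "\<bar>\<Phi> x\<bar> \<le> B * 1" unfolding \<Phi>_def abs_mult using BL k01 by (intro mult_mono) auto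
    then show ?thesis by simp
  qed
  have lip: "\<bar>\<Phi> (x + h *\<^sub>R n) - \<Phi> x\<bar> \<le> (2 * L + B / \<delta>) * h" if "0 \<le> h" for x h
    using \<Phi>_lip[of "x + h *\<^sub>R n" x] that n by simp
  have ne: "AE x in lborel. n \<bullet> x \<noteq> t \<and> n \<bullet> x \<noteq> t + \<delta>"
    using AE_lborel_hyperplane[OF n0, of t] AE_lborel_hyperplane[OF n0, of "t + \<delta>"] by eventually_elim auto
  \<comment> \<open>Along \<open>n\<close> the projected value is constant, so in the slab only the
    ramp contributes, with slope -1/\<open>\<delta>\<close>. The derivative may fail to exist only
    on the two bounding hyperplanes, which form a null set.\<close>
  have deriv: "AE x in lborel. ((\<lambda>h. \<Phi> (x + h *\<^sub>R n)) has_real_derivative g x - \<sigma> x / \<delta>) (at 0)"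
    using ne
  proof eventually_elim
    case (elim x)
    then consider "n \<bullet> x < t" | "t < n \<bullet> x" "n \<bullet> x < t + \<delta>" | "t + \<delta> < n \<bullet> x" by linarith
    then show ?case
    proof cases
      case 1
      have "((\<lambda>h. \<phi> (x + h *\<^sub>R n)) has_real_derivative g x - \<sigma> x / \<delta>) (at 0)"
        using C1_compact_line_derivative[OF \<phi>, of x n] 1 by (simp add: g_def \<sigma>_def)
      then show ?thesis
        by (rule has_field_derivative_transform_within_open[where S="{..< t - n \<bullet> x}"])
           (use 1 nn in \<open>auto simp: \<Phi>_def k_def s_def inner_add_right\<close>)
    next
      case 2
      have "((\<lambda>h. \<phi> (hyper_proj n t x) * (1 - (n \<bullet> x + h - t) / \<delta>)) has_real_derivative g x - \<sigma> x / \<delta>) (at 0)"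
        using 2 \<delta> by (auto intro!: derivative_eq_intros simp: g_def \<sigma>_def)
      then show ?thesis
      proof (rule has_field_derivative_transform_within_open[where S="{t - n \<bullet> x<..<t + \<delta> - n \<bullet> x}"])
        fix h assume h: "h \<in> {t - n \<bullet> x<..<t + \<delta> - n \<bullet> x}"
        then have sx: "s (x + h *\<^sub>R n) = n \<bullet> x + h - t" using nn by (simp add: s_def inner_add_right)
        moreover have "k (x + h *\<^sub>R n) = 1 - (n \<bullet> x + h - t) / \<delta>"
          using sx h \<delta> by (auto simp: k_def field_simps)
        moreover have "x + h *\<^sub>R n - (n \<bullet> x + h - t) *\<^sub>R n = hyper_proj n t x"
          by (simp add: hyper_proj_def algebra_simps)
        ultimately show "\<phi> (hyper_proj n t x) * (1 - (n \<bullet> x + h - t) / \<delta>) = \<Phi> (x + h *\<^sub>R n)"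
          by (simp add: \<Phi>_def)
      qed (use 2 in auto)
    next
      case 3
      have "((\<lambda>h. 0) has_real_derivative g x - \<sigma> x / \<delta>) (at 0)"
        using 3 \<delta> by (auto simp: g_def \<sigma>_def)
      then show ?thesis
      proof (rule has_field_derivative_transform_within_open[where S="{t + \<delta> - n \<bullet> x<..}"])
        fix h assume h: "h \<in> {t + \<delta> - n \<bullet> x<..}"
        then have "s (x + h *\<^sub>R n) \<ge> \<delta>" using nn by (simp add: s_def inner_add_right)
        then show "0 = \<Phi> (x + h *\<^sub>R n)" using \<delta> by (simp add: \<Phi>_def k_def)
      qed (use 3 in auto)
    qed
  qed
  have zero: "(LINT x|lborel. g x - \<sigma> x / \<delta>) = 0"
    by (rule integral_line_derivative_zero(1)[OF \<Phi>m _ supp bound lip deriv]) (use gm \<sigma>m in auto)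
  have intg: "integrable lborel g"
  proof (rule Bochner_Integration.integrable_bound[OF integral_C1_compact_derivative(2)[OF \<phi>, of n]])
    show "AE x in lborel. norm (g x) \<le> norm (frechet_derivative \<phi> (at x) n)"
      by (auto simp: g_def indicator_def)
  qed (use gm in auto)
  show int\<sigma>: "integrable lborel (\<lambda>x. indicator ?S x * \<phi> (hyper_proj n t x))"
  proof -
    have "integrable lborel \<sigma>"
    proof (rule integrable_lborel_bounded_support[OF \<sigma>m])
      fix x :: "real^'n" assume x: "x \<notin> cball 0 (R + \<delta>)"
      show "\<sigma> x = 0"
      proof (cases "x \<in> ?S")
        case True
        have "norm x \<le> norm (hyper_proj n t x) + norm ((n \<bullet> x - t) *\<^sub>R n)"
          using norm_triangle_sub[of x "(n \<bullet> x - t) *\<^sub>R n"] by (simp add: hyper_proj_def)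
        also have "\<dots> \<le> norm (hyper_proj n t x) + \<delta>" using True n by simp
        finally have "R < norm (hyper_proj n t x)" using x by simp
        then show ?thesis using R by (simp add: \<sigma>_def)
      qed (simp add: \<sigma>_def)
    next
      show "\<bar>\<sigma> x\<bar> \<le> B" for x using BL by (auto simp: \<sigma>_def indicator_def)
    qed
    then show ?thesis by (simp add: \<sigma>_def[abs_def])
  qed
  have "(LINT x|lborel. g x) = (LINT x|lborel. \<sigma> x) / \<delta>"
    using zero intg int\<sigma> by (simp add: \<sigma>_def)
  then show "(LINT x|lborel. indicator {x. n \<bullet> x < t} x * frechet_derivative \<phi> (at x) n) = hyper_int n t \<delta> \<phi>"
    by (simp add: hyper_int_def g_def \<sigma>_def)
qed

text \<open>The indicator of the half-space is constant along \<open>v\<close>. Although its product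
  with \<open>\<phi>\<close> jumps across the hyperplane, it is Lipschitz in the direction
  \<open>v\<close>, and no other regularity enters the difference quotients.\<close>

lemma integral_halfspace_tangential_derivative:
  fixes \<phi> :: "real^'n \<Rightarrow> real"
  assumes \<phi>: "C1_compact \<phi>" and n: "norm n = 1" and v: "n \<bullet> v = 0"
  shows "(LINT x|lborel. indicator {x. n \<bullet> x < t} x * frechet_derivative \<phi> (at x) v) = 0"
proof -
  obtain B L where BL: "0 \<le> B" "0 \<le> L" "\<And>x. \<bar>\<phi> x\<bar> \<le> B" "\<And>x y. \<bar>\<phi> x - \<phi> y\<bar> \<le> L * norm (x - y)"
    using C1_compact_bounds[OF \<phi>] by metis
  obtain R where R: "\<And>x. x \<notin> cball 0 R \<Longrightarrow> \<phi> x = 0" using \<phi> by (auto simp: C1_compact_def)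
  have m: "\<phi> \<in> borel_measurable borel" "(\<lambda>x. frechet_derivative \<phi> (at x) v) \<in> borel_measurable borel"
    using C1_compact_continuous[OF \<phi>] C1_compact_continuous_derivative[OF \<phi>]
    by (auto intro: borel_measurable_continuous_onI)
  show ?thesis
  proof (rule integral_line_derivative_zero(1)[where \<Phi>="\<lambda>x. indicator {x. n \<bullet> x < t} x * \<phi> x" and v=v and R=R and B=B and L="L * norm v"])
    show "(\<lambda>x. indicat_real {x. n \<bullet> x < t} x * \<phi> x) \<in> borel_measurable borel"
      "(\<lambda>x. indicat_real {x. n \<bullet> x < t} x * frechet_derivative \<phi> (at x) v) \<in> borel_measurable borel"
      using m by measurable
    show "\<bar>indicat_real {x. n \<bullet> x < t} x * \<phi> x\<bar> \<le> B" for x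
      using BL by (auto simp: indicator_def)
    show "\<bar>indicat_real {x. n \<bullet> x < t} (x + h *\<^sub>R v) * \<phi> (x + h *\<^sub>R v) - indicat_real {x. n \<bullet> x < t} x * \<phi> x\<bar>
        \<le> L * norm v * h" if "0 \<le> h" for x h
      using BL(4)[of "x + h *\<^sub>R v" x] BL(2) v that
      by (auto simp: indicator_def inner_add_right ac_simps)
    have "((\<lambda>h. indicat_real {x. n \<bullet> x < t} x * \<phi> (x + h *\<^sub>R v)) has_real_derivative
        indicat_real {x. n \<bullet> x < t} x * frechet_derivative \<phi> (at x) v) (at 0)" for x
      by (rule DERIV_cmult[OF C1_compact_line_derivative[OF \<phi>]])
    moreover have "indicat_real {x. n \<bullet> x < t} (x + h *\<^sub>R v) = indicat_real {x. n \<bullet> x < t} x" for x h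
      using v by (simp add: indicator_def inner_add_right)
    ultimately show "AE x in lborel. ((\<lambda>h. indicat_real {x. n \<bullet> x < t} (x + h *\<^sub>R v) * \<phi> (x + h *\<^sub>R v)) has_real_derivative
        indicat_real {x. n \<bullet> x < t} x * frechet_derivative \<phi> (at x) v) (at 0)"
      by simp
  qed (use R in auto)
qed

lemma integrable_indicator_derivative:
  fixes \<phi> :: "real^'n \<Rightarrow> real"
  assumes "C1_compact \<phi>" "S \<in> sets borel"
  shows "integrable lborel (\<lambda>x. indicator S x * frechet_derivative \<phi> (at x) v)"
  using integrable_mult_indicator[OF _ integral_C1_compact_derivative(2)[OF assms(1), of v], of S] assms(2)
  by simp

text \<open>Splitting \<open>v\<close> into its normal and tangential parts combines the two
  previous results; \<open>hyper_int\<close> plays the part of the surface integral.\<close>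

theorem integral_halfspace_derivative:
  fixes \<phi> :: "real^'n \<Rightarrow> real"
  assumes \<phi>: "C1_compact \<phi>" and n: "norm n = 1" and \<delta>: "0 < \<delta>"
  shows "(LINT x|lborel. indicator {x. n \<bullet> x < t} x * frechet_derivative \<phi> (at x) v) = (n \<bullet> v) * hyper_int n t \<delta> \<phi>"
proof -
  let ?I = "indicator {x. n \<bullet> x < t} :: _ \<Rightarrow> real" and ?v = "v - (n \<bullet> v) *\<^sub>R n"
  have "n \<bullet> ?v = 0" using n by (simp add: inner_diff_right norm_eq_1)
  then have 0: "(LINT x|lborel. ?I x * frechet_derivative \<phi> (at x) ?v) = 0"
    by (rule integral_halfspace_tangential_derivative[OF \<phi> n])
  have lin: "frechet_derivative \<phi> (at x) v = frechet_derivative \<phi> (at x) ?v + (n \<bullet> v) * frechet_derivative \<phi> (at x) n" for x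
    using frechet_derivative_cgrad[OF C1_compact_differentiable[OF \<phi>], of x]
    by (simp add: inner_diff_right)
  have "(LINT x|lborel. ?I x * frechet_derivative \<phi> (at x) v)
      = (LINT x|lborel. ?I x * frechet_derivative \<phi> (at x) ?v + (n \<bullet> v) * (?I x * frechet_derivative \<phi> (at x) n))"
    by (intro Bochner_Integration.integral_cong) (auto simp: lin[of _] distrib_left ac_simps)
  also have "\<dots> = (n \<bullet> v) * (LINT x|lborel. ?I x * frechet_derivative \<phi> (at x) n)"
    using integrable_indicator_derivative[OF \<phi>, of "{x. n \<bullet> x < t}"] 0 by simp
  finally show ?thesis
    using integral_halfspace_normal_derivative(1)[OF \<phi> n \<delta>] by simp
qed

section \<open>Weak gradients\<close>

lemma integral_lebesgue_on_eq_lborel: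
  fixes f :: "'a::euclidean_space \<Rightarrow> real"
  assumes "\<Omega> \<in> sets lebesgue" "f \<in> borel_measurable borel" "\<And>x. x \<notin> \<Omega> \<Longrightarrow> f x = 0"
  shows "(LINT x|lebesgue_on \<Omega>. f x) = (LINT x|lborel. f x)"
    and "integrable (lebesgue_on \<Omega>) f \<longleftrightarrow> integrable lborel f"
proof -
  have eq: "(\<lambda>x. if x \<in> \<Omega> then f x else 0) = f" using assms(3) by auto
  show "(LINT x|lebesgue_on \<Omega>. f x) = (LINT x|lborel. f x)"
    using Lebesgue_Measure.integral_restrict_UNIV[OF assms(1), of f] assms(2) by (simp add: eq integral_completion)
  show "integrable (lebesgue_on \<Omega>) f \<longleftrightarrow> integrable lborel f"
    using Lebesgue_Measure.integrable_restrict_UNIV[OF assms(1), of f] assms(2) by (simp add: eq integrable_completion)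
qed

text \<open>Products of smooth one-dimensional cut-offs increase to the indicator of a box.\<close>

lemma integral_box_zero_of_test_functions:
  fixes g :: "real^'n \<Rightarrow> real"
  assumes U: "open U" and sub: "cbox \<alpha> \<beta> \<subseteq> U"
    and int: "g absolutely_integrable_on (cbox \<alpha> \<beta>)"
    and zero: "\<And>\<phi>. \<phi> \<in> test_functions U \<Longrightarrow> (LINT x|lebesgue_on U. g x * \<phi> x) = 0"
  shows "integral (cbox \<alpha> \<beta>) g = 0"
proof (cases "box \<alpha> \<beta> = {}")
  case True
  then show ?thesis by (simp add: content_eq_0_interior integral_null interior_cbox)
next
  case False
  then have ab: "\<alpha> $ i < \<beta> $ i" for i using interval_ne_empty_cart(2)[of \<alpha> \<beta>] by blast
  \<comment> \<open>The first argument of \<open>flat\<close> tends to 0, so each factor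
    exp(-(1/(m+1))/s) tends to 1 where s > 0, while the product is 0 outside the open box for every
    m.\<close>
  define \<phi> where "\<phi> m x = (\<Prod>i\<in>UNIV. flat (1 / real (Suc m)) 0 ((x $ i - \<alpha> $ i) * (\<beta> $ i - x $ i)))" for m and x :: "real^'n"
  let ?f = "\<lambda>x. if x \<in> cbox \<alpha> \<beta> then g x else 0"
  have f: "integrable lebesgue ?f"
    using int unfolding set_integrable_def indicator_scaleR_eq_if .
  have \<phi>0: "\<phi> m x = 0" if x: "x \<notin> box \<alpha> \<beta>" for m x
  proof -
    from x obtain i where "x $ i \<le> \<alpha> $ i \<or> \<beta> $ i \<le> x $ i" by (force simp: mem_box_cart not_less)
    then have "(x $ i - \<alpha> $ i) * (\<beta> $ i - x $ i) \<le> 0"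
      using ab[of i] by (auto simp: mult_le_0_iff)
    then have "flat (1 / real (Suc m)) 0 ((x $ i - \<alpha> $ i) * (\<beta> $ i - x $ i)) = 0" by (simp add: flat_def)
    then show ?thesis unfolding \<phi>_def by (intro prod_zero) auto
  qed
  have \<phi>_smooth: "\<phi> m \<in> smooth_fns" for m
    unfolding \<phi>_def
    by (intro smooth_fns_prod smooth_fns.flat smooth_fns.mult smooth_fns_diff smooth_fns.linear
        bounded_linear_vec_nth smooth_fns.const) auto
  have \<phi>_test: "\<phi> m \<in> test_functions U" for m
    using \<phi>_smooth compact_cbox sub
    by (rule test_functionsI) (use \<phi>0 box_subset_cbox in blast)
  have \<phi>1: "0 \<le> \<phi> m x \<and> \<phi> m x \<le> 1" for m x
    unfolding \<phi>_def by (intro conjI prod_nonneg prod_le_1) (auto simp: flat_def)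
  have \<phi>m: "\<phi> m \<in> borel_measurable lebesgue" for m
    using borel_measurable_continuous_onI[OF smooth_fns_continuous[OF \<phi>_smooth]]
    by (intro measurable_completion) simp
  have int0: "(LINT x|lebesgue. ?f x * \<phi> m x) = 0" for m
  proof -
    have "(LINT x|lebesgue. ?f x * \<phi> m x) = (LINT x|lebesgue. (if x \<in> U then g x * \<phi> m x else 0))"
    proof (rule Bochner_Integration.integral_cong[OF refl])
      fix x
      show "?f x * \<phi> m x = (if x \<in> U then g x * \<phi> m x else 0)"
        using \<phi>0[of x m] sub box_subset_cbox[of \<alpha> \<beta>] by (cases "x \<in> box \<alpha> \<beta>") auto
    qed
    also have "\<dots> = (LINT x|lebesgue_on U. g x * \<phi> m x)"
      using U by (intro Lebesgue_Measure.integral_restrict_UNIV) auto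
    finally show ?thesis using zero[OF \<phi>_test] by simp
  qed
  have lim: "(\<lambda>m. \<phi> m x) \<longlonglongrightarrow> indicator (box \<alpha> \<beta>) x" for x
  proof (cases "x \<in> box \<alpha> \<beta>")
    case True
    then have p: "0 < (x $ i - \<alpha> $ i) * (\<beta> $ i - x $ i)" for i by (simp add: mem_box_cart)
    have "(\<lambda>m. \<Prod>i\<in>UNIV. exp (- (1 / real (Suc m)) / ((x $ i - \<alpha> $ i) * (\<beta> $ i - x $ i)))) \<longlonglongrightarrow>
        (\<Prod>i\<in>(UNIV::'n set). exp (- 0 / ((x $ i - \<alpha> $ i) * (\<beta> $ i - x $ i))))"
      using p[THEN less_imp_neq, THEN not_sym] by (intro tendsto_intros lim_1_over_n[THEN LIMSEQ_Suc])
    with p True show ?thesis by (simp add: \<phi>_def flat_def)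
  qed (simp add: \<phi>0)
  have "(\<lambda>m. (LINT x|lebesgue. ?f x * \<phi> m x)) \<longlonglongrightarrow> (LINT x|lebesgue. ?f x * indicator (box \<alpha> \<beta>) x)"
  proof (rule integral_dominated_convergence)
    show "integrable lebesgue (\<lambda>x. norm (?f x))" using f by simp
    show "AE x in lebesgue. (\<lambda>m. ?f x * \<phi> m x) \<longlonglongrightarrow> ?f x * indicator (box \<alpha> \<beta>) x"
      by (intro AE_I2 tendsto_mult tendsto_const lim)
    show "AE x in lebesgue. norm (?f x * \<phi> m x) \<le> norm (?f x)" for m
      using \<phi>1[of m] by (intro AE_I2) (auto simp: abs_mult intro: mult_left_le)
    show "(\<lambda>x. ?f x * \<phi> m x) \<in> borel_measurable lebesgue" for m
      using borel_measurable_integrable[OF f] \<phi>m by (rule borel_measurable_times)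
    show "(\<lambda>x. ?f x * indicator (box \<alpha> \<beta>) x) \<in> borel_measurable lebesgue"
      using borel_measurable_integrable[OF f] by (intro borel_measurable_times borel_measurable_indicator) auto
  qed
  then have "0 = (LINT x|lebesgue. ?f x * indicator (box \<alpha> \<beta>) x)"
    by (simp only: int0 LIMSEQ_const_iff)
  also have "\<dots> = (LINT x|lebesgue. (if x \<in> box \<alpha> \<beta> then g x else 0))"
    using box_subset_cbox[of \<alpha> \<beta>] by (intro Bochner_Integration.integral_cong) (auto simp: indicator_def)
  also have "\<dots> = integral\<^sup>L (lebesgue_on (box \<alpha> \<beta>)) g"
    by (intro Lebesgue_Measure.integral_restrict_UNIV) auto
  also have "\<dots> = integral (box \<alpha> \<beta>) g"
  proof (rule lebesgue_integral_eq_integral)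
    show "integrable (lebesgue_on (box \<alpha> \<beta>)) g"
      using int by (intro absolutely_integrable_imp_integrable) (auto simp: absolutely_integrable_on_open_interval)
  qed auto
  also have "\<dots> = integral (cbox \<alpha> \<beta>) g" by (rule integral_open_interval)
  finally show ?thesis by simp
qed

text \<open>Smooth cut-offs give vanishing integrals over all boxes in the open set, and Lebesgue
  differentiation then gives vanishing values. As \<open>g\<close> is integrable only on compact
  subsets, the argument runs in one closed box at a time and countably many of them cover the
  set.\<close>

theorem fundamental_lemma_AE:
  fixes g :: "real^'n \<Rightarrow> real"
  assumes U: "open U"
    and int: "\<And>S. compact S \<Longrightarrow> S \<subseteq> U \<Longrightarrow> g absolutely_integrable_on S"
    and zero: "\<And>\<phi>. \<phi> \<in> test_functions U \<Longrightarrow> (LINT x|lebesgue_on U. g x * \<phi> x) = 0"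
  shows "AE x in lebesgue_on U. g x = 0"
proof -
  have box: "AE x in lebesgue. x \<in> cbox \<alpha> \<beta> \<longrightarrow> g x = 0" if sub: "cbox \<alpha> \<beta> \<subseteq> U" for \<alpha> \<beta>
  proof -
    let ?f = "\<lambda>x. if x \<in> cbox \<alpha> \<beta> then g x else 0"
    have f0: "integral (cbox a b) ?f = 0" "?f integrable_on cbox a b" for a b
    proof -
      obtain c d where cd: "cbox \<alpha> \<beta> \<inter> cbox a b = cbox c d"
        using Int_interval by blast
      have "integral (cbox a b) ?f = integral (cbox \<alpha> \<beta> \<inter> cbox a b) g"
        by (rule integral_restrict_Int)
      also have "\<dots> = 0"
        unfolding cd using U _ int[OF compact_cbox] zero
        by (rule integral_box_zero_of_test_functions) (use sub cd in blast)+
      finally show "integral (cbox a b) ?f = 0" .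
      have "g absolutely_integrable_on cbox c d" using sub cd by (intro int) auto
      then have "g integrable_on (cbox \<alpha> \<beta> \<inter> cbox a b)"
        unfolding cd by (rule set_lebesgue_integral_eq_integral)
      then show "?f integrable_on cbox a b"
        by (simp only: integrable_restrict_Int)
    qed
    \<comment> \<open>Lebesgue differentiation: off a null set the value is the limit of averages
      over small cubes. All these averages are 0.\<close>
    obtain N where N: "negligible N" "\<And>x e. \<lbrakk>x \<notin> N; 0 < e\<rbrakk> \<Longrightarrow>
               \<exists>d>0. \<forall>h. 0 < h \<and> h < d \<longrightarrow>
                         norm(integral (cbox x (x + h *\<^sub>R One)) ?f /\<^sub>R h ^ DIM(real^'n) - ?f x) < e"
      by (rule integrable_ccontinuous_explicit[of ?f, OF f0(2)]) (rule that)
    have "?f x = 0" if xN: "x \<notin> N" for x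
    proof (rule ccontr)
      assume "?f x \<noteq> 0"
      then obtain d where d: "d > 0"
        "\<And>h. 0 < h \<and> h < d \<Longrightarrow> norm(integral (cbox x (x + h *\<^sub>R One)) ?f /\<^sub>R h ^ DIM(real^'n) - ?f x) < norm (?f x)"
        using N(2)[OF xN, of "norm (?f x)"] by auto
      from d(2)[of "d / 2"] d(1) f0(1) show False by simp
    qed
    moreover have "AE x in lebesgue. x \<notin> N"
      using N(1) negligible_iff_null_sets by (metis AE_not_in)
    ultimately show ?thesis by (auto elim!: eventually_mono) (metis (full_types))
  qed
  obtain \<D> where \<D>: "countable \<D>" "\<D> \<subseteq> Pow U" "\<And>X. X \<in> \<D> \<Longrightarrow> \<exists>a b. X = cbox a b" "\<Union>\<D> = U"
    using open_countable_Union_open_cbox[OF U] by blast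
  have "AE x in lebesgue. \<forall>X\<in>\<D>. x \<in> X \<longrightarrow> g x = 0"
    unfolding AE_ball_countable[OF \<D>(1)]
  proof
    fix X assume X: "X \<in> \<D>"
    then obtain a b where "X = cbox a b" using \<D>(3) by blast
    moreover have "X \<subseteq> U" using X \<D>(2) by blast
    ultimately show "AE x in lebesgue. x \<in> X \<longrightarrow> g x = 0" using box by simp
  qed
  then have "AE x in lebesgue. x \<in> U \<longrightarrow> g x = 0"
    by eventually_elim (use \<D>(4) in blast)
  then show ?thesis using U by (simp add: AE_lebesgue_on_iff)
qed

section \<open>Integration by parts with test functions, and uniqueness of weak gradients\<close>

lemma Ck_1_mult:
  assumes "Ck 1 f" "Ck 1 g"
  shows "Ck 1 (\<lambda>x. f x * g x)"
    and "frechet_derivative (\<lambda>x. f x * g x) (at x) v = f x * frechet_derivative g (at x) v + frechet_derivative f (at x) v * g x"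
proof -
  have d: "f differentiable (at x)" "g differentiable (at x)" for x
    using assms by auto
  have D: "((\<lambda>x. f x * g x) has_derivative (\<lambda>v. f x * frechet_derivative g (at x) v + frechet_derivative f (at x) v * g x)) (at x)" for x
    using d by (intro has_derivative_mult) (auto simp: frechet_derivative_works)
  then have fd: "frechet_derivative (\<lambda>x. f x * g x) (at x) = (\<lambda>v. f x * frechet_derivative g (at x) v + frechet_derivative f (at x) v * g x)" for x
    by (rule frechet_derivative_at[symmetric])
  then show "frechet_derivative (\<lambda>x. f x * g x) (at x) v = f x * frechet_derivative g (at x) v + frechet_derivative f (at x) v * g x"
    by simp
  have c: "continuous_on UNIV f" "continuous_on UNIV g"
    using d differentiable_imp_continuous_within by (metis continuous_at_imp_continuous_on)+
  have "continuous_on UNIV (\<lambda>x. frechet_derivative (\<lambda>x. f x * g x) (at x) v)" for v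
    unfolding fd using c assms by (intro continuous_intros) auto
  moreover have "(\<lambda>x. f x * g x) differentiable (at x)" for x
    using D differentiableI by blast
  ultimately show "Ck 1 (\<lambda>x. f x * g x)" by simp
qed

lemma Ck_1_continuous: "Ck 1 f \<Longrightarrow> continuous_on S f"
  using differentiable_imp_continuous_within continuous_at_imp_continuous_on by (metis Ck.simps(2) One_nat_def)

lemma Ck_1_continuous_cgrad: "Ck 1 f \<Longrightarrow> continuous_on S (cgrad f)"
proof -
  assume "Ck 1 f"
  then have "continuous_on UNIV (cgrad f)"
    unfolding cgrad_def by (intro continuous_intros) auto
  then show ?thesis using continuous_on_subset by blast
qed

lemma C1_compact_mult: "Ck 1 f \<Longrightarrow> C1_compact \<phi> \<Longrightarrow> C1_compact (\<lambda>x. f x * \<phi> x)"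
  unfolding C1_compact_def using Ck_1_mult(1)[of f \<phi>] by auto

lemma test_functionsD:
  assumes "\<phi> \<in> test_functions \<Omega>"
  obtains S where "compact S" "S \<subseteq> \<Omega>" "\<And>x. x \<notin> S \<Longrightarrow> \<phi> x = 0" "\<And>x. x \<notin> S \<Longrightarrow> cgrad \<phi> x = 0"
proof -
  obtain S where S: "compact S" "S \<subseteq> \<Omega>" "\<And>x. x \<notin> S \<Longrightarrow> \<phi> x = 0"
    using assms by (auto simp: test_functions_def)
  have "cgrad \<phi> x = 0" if "x \<notin> S" for x
  proof -
    have "((\<lambda>x. 0) has_derivative (\<lambda>v. 0)) (at x)" by simp
    then have "(\<phi> has_derivative (\<lambda>v. 0)) (at x)"
      by (rule has_derivative_transform_within_open[where s="- S"])
         (use S that compact_imp_closed in \<open>auto simp: open_Compl\<close>)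
    then have "frechet_derivative \<phi> (at x) = (\<lambda>v. 0)" by (rule frechet_derivative_at[symmetric])
    then show ?thesis by (simp add: cgrad_def vec_eq_iff)
  qed
  with S that show ?thesis by blast
qed

lemma test_functions_Ck: "\<phi> \<in> test_functions \<Omega> \<Longrightarrow> Ck k \<phi>"
  by (simp add: test_functions_def)

lemma test_functions_mono: "E \<subseteq> \<Omega> \<Longrightarrow> test_functions E \<subseteq> test_functions \<Omega>"
  by (auto simp: test_functions_def)

lemma integral_test_gradient_zero:
  fixes \<Omega> :: "(real^'n) set"
  assumes "open \<Omega>" "\<phi> \<in> test_functions \<Omega>"
  shows "(LINT x|lebesgue_on \<Omega>. cgrad \<phi> x $ j) = 0"
proof -
  obtain S where S: "compact S" "S \<subseteq> \<Omega>" "\<And>x. x \<notin> S \<Longrightarrow> cgrad \<phi> x = 0"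
    using assms(2) test_functionsD by metis
  note C1 = test_functions_C1_compact[OF assms(2)]
  have "(LINT x|lebesgue_on \<Omega>. cgrad \<phi> x $ j) = (LINT x|lborel. cgrad \<phi> x $ j)"
  proof (rule integral_lebesgue_on_eq_lborel)
    show "(\<lambda>x. cgrad \<phi> x $ j) \<in> borel_measurable borel"
      using C1_compact_continuous_derivative[OF C1]
      by (intro borel_measurable_continuous_onI) (simp add: cgrad_def)
    show "cgrad \<phi> x $ j = 0" if "x \<notin> \<Omega>" for x
    proof -
      have "cgrad \<phi> x = 0" using that S by blast
      then show ?thesis by simp
    qed
  qed (use assms(1) in auto)
  then show ?thesis
    using integral_C1_compact_derivative(1)[OF C1] by (simp add: cgrad_def)
qed

lemma integral_by_parts_test:
  fixes \<Omega> :: "(real^'n) set"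
  assumes "open \<Omega>" "\<phi> \<in> test_functions \<Omega>" "Ck 1 u"
  shows "(LINT x|lebesgue_on \<Omega>. u x * cgrad \<phi> x $ j) = - (LINT x|lebesgue_on \<Omega>. cgrad u x $ j * \<phi> x)"
proof -
  obtain S where S: "compact S" "S \<subseteq> \<Omega>" "\<And>x. x \<notin> S \<Longrightarrow> \<phi> x = 0" "\<And>x. x \<notin> S \<Longrightarrow> cgrad \<phi> x = 0"
    using assms(2) test_functionsD by metis
  obtain R where R: "S \<subseteq> cball 0 R"
    using S(1) by (metis bounded_any_center compact_imp_bounded mem_cball subsetI)
  note C1 = test_functions_C1_compact[OF assms(2)]
  have supp: "f x = 0" if "x \<notin> \<Omega>" "\<And>x. x \<notin> S \<Longrightarrow> f x = 0" for f :: "real^'n \<Rightarrow> real" and x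
    using that S(2) by blast
  have m1: "continuous_on UNIV (\<lambda>x. u x * cgrad \<phi> x $ j)" and m2: "continuous_on UNIV (\<lambda>x. cgrad u x $ j * \<phi> x)"
    by (intro continuous_intros Ck_1_continuous Ck_1_continuous_cgrad assms(3) test_functions_Ck[OF assms(2)])+
  have int: "integrable lborel f" if "continuous_on UNIV f" "\<And>x. x \<notin> S \<Longrightarrow> f x = 0" for f :: "real^'n \<Rightarrow> real"
  proof -
    have "integrable lborel (\<lambda>x. indicator S x *\<^sub>R f x)"
      using S(1) that(1) by (intro borel_integrable_compact) (auto intro: continuous_on_subset)
    moreover have "(\<lambda>x. indicator S x *\<^sub>R f x) = f"
    proof
      show "indicator S x *\<^sub>R f x = f x" for x using that(2)[of x] by (cases "x \<in> S") auto
    qed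
    ultimately show ?thesis by simp
  qed
  have "(LINT x|lborel. u x * cgrad \<phi> x $ j + cgrad u x $ j * \<phi> x) = 0"
    using integral_C1_compact_derivative(1)[OF C1_compact_mult[OF assms(3) C1], of "axis j 1"]
      Ck_1_mult(2)[OF assms(3) test_functions_Ck[OF assms(2)]]
    by (simp add: cgrad_def)
  moreover have "integrable lborel (\<lambda>x. u x * cgrad \<phi> x $ j)" "integrable lborel (\<lambda>x. cgrad u x $ j * \<phi> x)"
    using S by (auto intro!: int m1 m2)
  ultimately have "(LINT x|lborel. u x * cgrad \<phi> x $ j) = - (LINT x|lborel. cgrad u x $ j * \<phi> x)"
    by simp
  moreover have "(LINT x|lebesgue_on \<Omega>. u x * cgrad \<phi> x $ j) = (LINT x|lborel. u x * cgrad \<phi> x $ j)"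
    by (rule integral_lebesgue_on_eq_lborel(1)[OF _ borel_measurable_continuous_onI[OF m1]], use assms(1) in simp,
        rule supp) (use S(4) in auto)
  moreover have "(LINT x|lebesgue_on \<Omega>. cgrad u x $ j * \<phi> x) = (LINT x|lborel. cgrad u x $ j * \<phi> x)"
    by (rule integral_lebesgue_on_eq_lborel(1)[OF _ borel_measurable_continuous_onI[OF m2]], use assms(1) in simp,
        rule supp) (use S(3) in auto)
  ultimately show ?thesis by simp
qed

lemma absolutely_integrable_continuous_compact:
  fixes f :: "'a::euclidean_space \<Rightarrow> 'b::euclidean_space"
  assumes "continuous_on UNIV f" "compact S"
  shows "f absolutely_integrable_on S"
proof -
  have "integrable lborel (\<lambda>x. indicator S x *\<^sub>R f x)"
    using assms by (intro borel_integrable_compact) (auto intro: continuous_on_subset)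
  then show ?thesis
    unfolding set_integrable_def by (subst integrable_completion) auto
qed

lemma is_weak_grad_C1:
  assumes "open \<Omega>" "Ck 1 u"
  shows "is_weak_grad \<Omega> u (cgrad u)"
  unfolding is_weak_grad_def
  using assms by (auto intro!: absolutely_integrable_continuous_compact integral_by_parts_test
      Ck_1_continuous Ck_1_continuous_cgrad)

text \<open>Only the values on the compact support of the test function matter.\<close>

lemma integrable_times_test:
  fixes u :: "real^'n \<Rightarrow> real"
  assumes \<Omega>: "open \<Omega>" and S: "compact S" "S \<subseteq> \<Omega>" and int: "u absolutely_integrable_on S"
    and f: "continuous_on UNIV f" "\<And>x. x \<notin> S \<Longrightarrow> f x = 0"
  shows "integrable (lebesgue_on \<Omega>) (\<lambda>x. u x * f x)"
proof -
  have "bounded (f ` S)" using S f by (intro compact_imp_bounded compact_continuous_image continuous_on_subset[OF f(1)]) auto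
  then obtain B where B: "\<And>x. x \<in> S \<Longrightarrow> \<bar>f x\<bar> \<le> B" by (auto simp: bounded_iff)
  have fm: "f \<in> borel_measurable lebesgue"
    using borel_measurable_continuous_onI[OF f(1)] by (intro measurable_completion) simp
  have uS: "integrable lebesgue (\<lambda>x. if x \<in> S then u x else 0)"
    using int unfolding set_integrable_def indicator_scaleR_eq_if .
  have "integrable lebesgue (\<lambda>x. (if x \<in> S then u x else 0) * f x)"
  proof (rule Bochner_Integration.integrable_bound)
    show "integrable lebesgue (\<lambda>x. B * (if x \<in> S then u x else 0))" using uS by simp
    show "AE x in lebesgue. norm ((if x \<in> S then u x else 0) * f x) \<le> norm (B * (if x \<in> S then u x else 0))"
    proof (rule AE_I2)
      fix x
      show "norm ((if x \<in> S then u x else 0) * f x) \<le> norm (B * (if x \<in> S then u x else 0))"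
        using B[of x] by (auto simp: abs_mult mult.commute intro!: mult_right_mono)
    qed
    show "(\<lambda>x. (if x \<in> S then u x else 0) * f x) \<in> borel_measurable lebesgue"
      using borel_measurable_integrable[OF uS] fm by (rule borel_measurable_times)
  qed
  moreover have "(\<lambda>x. (if x \<in> S then u x else 0) * f x) = (\<lambda>x. if x \<in> \<Omega> then u x * f x else 0)"
  proof
    show "(if x \<in> S then u x else 0) * f x = (if x \<in> \<Omega> then u x * f x else 0)" for x
      using f(2)[of x] S(2) by (cases "x \<in> S") auto
  qed
  ultimately show ?thesis
    using Lebesgue_Measure.integrable_restrict_UNIV[of \<Omega> "\<lambda>x. u x * f x"] \<Omega> by simp
qed

lemma is_weak_grad_integrable:
  assumes \<Omega>: "open \<Omega>" and wg: "is_weak_grad \<Omega> u g" and \<phi>: "\<phi> \<in> test_functions \<Omega>"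
  shows "integrable (lebesgue_on \<Omega>) (\<lambda>x. u x * cgrad \<phi> x $ j)"
    and "integrable (lebesgue_on \<Omega>) (\<lambda>x. g x $ j * \<phi> x)"
proof -
  obtain S where S: "compact S" "S \<subseteq> \<Omega>" "\<And>x. x \<notin> S \<Longrightarrow> \<phi> x = 0" "\<And>x. x \<notin> S \<Longrightarrow> cgrad \<phi> x = 0"
    using \<phi> test_functionsD by metis
  have u: "u absolutely_integrable_on S" and g: "g absolutely_integrable_on S"
    using wg S by (auto simp: is_weak_grad_def)
  have gj: "(\<lambda>x. g x $ j) absolutely_integrable_on S"
    using absolutely_integrable_component[OF g, of "axis j 1"] by (simp add: inner_axis)
  show "integrable (lebesgue_on \<Omega>) (\<lambda>x. u x * cgrad \<phi> x $ j)"
    by (rule integrable_times_test[OF \<Omega> S(1,2) u]) (use S(4) \<phi> in \<open>auto intro!: continuous_intros Ck_1_continuous_cgrad test_functions_Ck\<close>)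
  show "integrable (lebesgue_on \<Omega>) (\<lambda>x. g x $ j * \<phi> x)"
    by (rule integrable_times_test[OF \<Omega> S(1,2) gj]) (use S(3) \<phi> in \<open>auto intro!: Ck_1_continuous test_functions_Ck\<close>)
qed

lemma is_weak_grad_diff:
  assumes "open \<Omega>" "is_weak_grad \<Omega> u g" "is_weak_grad \<Omega> v h"
  shows "is_weak_grad \<Omega> (\<lambda>x. u x - v x) (\<lambda>x. g x - h x)"
  unfolding is_weak_grad_def
proof (intro conjI allI impI ballI)
  fix S assume "compact S \<and> S \<subseteq> \<Omega>"
  then show "(\<lambda>x. u x - v x) absolutely_integrable_on S" "(\<lambda>x. g x - h x) absolutely_integrable_on S"
    using assms by (auto simp: is_weak_grad_def intro: set_integral_diff)
next
  fix \<phi> j assume \<phi>: "\<phi> \<in> test_functions \<Omega>"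
  show "(LINT x|lebesgue_on \<Omega>. (u x - v x) * cgrad \<phi> x $ j) = - (LINT x|lebesgue_on \<Omega>. (g x - h x) $ j * \<phi> x)"
    using is_weak_grad_integrable[OF assms(1,2) \<phi>, of j] is_weak_grad_integrable[OF assms(1,3) \<phi>, of j] assms(2,3) \<phi>
    by (simp add: left_diff_distrib is_weak_grad_def)
qed

text \<open>Two open sets occur because a discrete function coincides with a polynomial only inside
  one element. A test function supported in the smaller set is admissible for both gradients, so
  their difference is orthogonal to all of them.\<close>

lemma is_weak_grad_unique:
  fixes \<Omega> E :: "(real^'n) set"
  assumes \<Omega>: "open \<Omega>" "is_weak_grad \<Omega> u g" and E: "open E" "E \<subseteq> \<Omega>"
    and v: "is_weak_grad E v h" and eq: "AE x in lebesgue_on E. u x = v x"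
  shows "AE x in lebesgue_on E. g x = h x"
proof -
  have "AE x in lebesgue_on E. g x $ j - h x $ j = 0" for j
  proof (rule fundamental_lemma_AE[OF E(1)])
    fix S :: "(real^'n) set" assume S: "compact S" "S \<subseteq> E"
    then have "(\<lambda>x. g x - h x) absolutely_integrable_on S"
      using \<Omega> E v by (intro set_integral_diff) (auto simp: is_weak_grad_def)
    from absolutely_integrable_component[OF this, of "axis j 1"]
    show "(\<lambda>x. g x $ j - h x $ j) absolutely_integrable_on S" by (simp add: inner_axis)
  next
    fix \<phi> assume \<phi>: "\<phi> \<in> test_functions E"
    then have \<phi>': "\<phi> \<in> test_functions \<Omega>" using test_functions_mono[OF E(2)] by blast
    obtain S where S: "compact S" "S \<subseteq> E" "\<And>x. x \<notin> S \<Longrightarrow> \<phi> x = 0" "\<And>x. x \<notin> S \<Longrightarrow> cgrad \<phi> x = 0"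
      using \<phi> test_functionsD by metis
    have sets: "E \<in> sets lebesgue" "\<Omega> \<in> sets lebesgue" using \<Omega>(1) E(1) by auto
    have g_eq: "AE x in lebesgue. (if x \<in> \<Omega> then g x $ j * \<phi> x else 0) = (if x \<in> E then g x $ j * \<phi> x else 0)"
      using S E by (intro AE_I2) auto
    have u_eq: "AE x in lebesgue. (if x \<in> \<Omega> then u x * cgrad \<phi> x $ j else 0) = (if x \<in> E then v x * cgrad \<phi> x $ j else 0)"
      using eq unfolding AE_lebesgue_on_iff[OF sets(1)] 
    proof eventually_elim
      case (elim x)
      then show ?case using S(2) S(4)[of x] E(2) by (cases "x \<in> S") auto
    qed
    have "(LINT x|lebesgue_on E. (g x $ j - h x $ j) * \<phi> x) = (LINT x|lebesgue_on E. g x $ j * \<phi> x - h x $ j * \<phi> x)"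
      by (simp add: left_diff_distrib)
    also have "\<dots> = (LINT x|lebesgue_on E. g x $ j * \<phi> x) - (LINT x|lebesgue_on E. h x $ j * \<phi> x)"
    proof (rule Bochner_Integration.integral_diff)
      show "integrable (lebesgue_on E) (\<lambda>x. g x $ j * \<phi> x)"
        using is_weak_grad_integrable(2)[OF \<Omega> \<phi>'] integrable_lebesgue_on_cong_AE(1)[OF sets(2,1) g_eq] by simp
      show "integrable (lebesgue_on E) (\<lambda>x. h x $ j * \<phi> x)"
        by (rule is_weak_grad_integrable(2)[OF E(1) v \<phi>])
    qed
    also have "(LINT x|lebesgue_on E. g x $ j * \<phi> x) = (LINT x|lebesgue_on \<Omega>. g x $ j * \<phi> x)"
      using integrable_lebesgue_on_cong_AE(3)[OF sets(2,1) g_eq] by simp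
    also have "\<dots> = - (LINT x|lebesgue_on \<Omega>. u x * cgrad \<phi> x $ j)"
      using \<Omega>(2) \<phi>' by (simp add: is_weak_grad_def)
    also have "(LINT x|lebesgue_on \<Omega>. u x * cgrad \<phi> x $ j) = (LINT x|lebesgue_on E. v x * cgrad \<phi> x $ j)"
      by (rule integrable_lebesgue_on_cong_AE(3)[OF sets(2,1) u_eq])
    also have "(LINT x|lebesgue_on E. h x $ j * \<phi> x) = - (LINT x|lebesgue_on E. v x * cgrad \<phi> x $ j)"
      using v \<phi> by (simp add: is_weak_grad_def)
    finally show "(LINT x|lebesgue_on E. (g x $ j - h x $ j) * \<phi> x) = 0" by simp
  qed
  then have "AE x in lebesgue_on E. \<forall>j\<in>UNIV. g x $ j - h x $ j = 0"
    by (intro AE_finite_allI) auto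
  then show ?thesis by eventually_elim (simp add: vec_eq_iff)
qed

lemma wgrad_weak:
  assumes "open \<Omega>" "u \<in> H1 \<Omega>"
  shows "is_weak_grad \<Omega> u (wgrad \<Omega> u)" and "wgrad \<Omega> u \<in> L2 \<Omega>"
proof -
  obtain g where g: "g \<in> L2 \<Omega>" "is_weak_grad \<Omega> u g" using assms(2) by (auto simp: H1_def)
  then show w: "is_weak_grad \<Omega> u (wgrad \<Omega> u)" unfolding wgrad_def by (metis someI_ex)
  have "AE x in lebesgue_on \<Omega>. g x = wgrad \<Omega> u x"
    by (rule is_weak_grad_unique[OF assms(1) g(2) assms(1) _ w]) auto
  then show "wgrad \<Omega> u \<in> L2 \<Omega>"
    by (rule L2_cong_AE[rotated]) (use assms(1) g in auto)
qed

lemma wgrad_diff: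
  assumes "open \<Omega>" "u \<in> H1 \<Omega>" "v \<in> H1 \<Omega>"
  shows "AE x in lebesgue_on \<Omega>. wgrad \<Omega> (\<lambda>x. u x - v x) x = wgrad \<Omega> u x - wgrad \<Omega> v x"
proof -
  have w: "is_weak_grad \<Omega> (\<lambda>x. u x - v x) (\<lambda>x. wgrad \<Omega> u x - wgrad \<Omega> v x)"
    using assms wgrad_weak by (intro is_weak_grad_diff) auto
  then have "is_weak_grad \<Omega> (\<lambda>x. u x - v x) (wgrad \<Omega> (\<lambda>x. u x - v x))"
    using someI[of "is_weak_grad \<Omega> (\<lambda>x. u x - v x)", OF w] by (simp only: wgrad_def)
  from is_weak_grad_unique[OF assms(1) this assms(1) _ w] show ?thesis by simp
qed

lemma wgrad_eq_cgrad:
  assumes "open \<Omega>" "u \<in> H1 \<Omega>" "open E" "E \<subseteq> \<Omega>" "Ck 1 v" "AE x in lebesgue_on E. u x = v x"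
  shows "AE x in lebesgue_on E. wgrad \<Omega> u x = cgrad v x"
  using is_weak_grad_unique[OF assms(1) wgrad_weak(1)[OF assms(1,2)] assms(3,4) is_weak_grad_C1[OF assms(3,5)] assms(6)] .

lemma L2_continuous_compact_support:
  fixes f :: "'a::euclidean_space \<Rightarrow> 'b::euclidean_space"
  assumes "\<Omega> \<in> sets lebesgue" "continuous_on UNIV f" "compact S" "\<And>x. x \<notin> S \<Longrightarrow> f x = 0"
  shows "f \<in> L2 \<Omega>"
proof -
  have m: "f \<in> borel_measurable lebesgue"
    using borel_measurable_continuous_onI[OF assms(2)] by (intro measurable_completion) simp
  have "integrable lborel (\<lambda>x. indicator S x *\<^sub>R (norm (f x))\<^sup>2)"
    using assms by (intro borel_integrable_compact continuous_intros) (auto intro: continuous_on_subset)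
  moreover have "(\<lambda>x. indicator S x *\<^sub>R (norm (f x))\<^sup>2) = (\<lambda>x. (norm (f x))\<^sup>2)"
  proof
    show "indicator S x *\<^sub>R (norm (f x))\<^sup>2 = (norm (f x))\<^sup>2" for x
      using assms(4)[of x] by (cases "x \<in> S") auto
  qed
  ultimately have "integrable lborel (\<lambda>x. (norm (f x))\<^sup>2)" by simp
  then have "integrable lebesgue (\<lambda>x. (norm (f x))\<^sup>2)"
    using borel_measurable_continuous_onI[OF assms(2)] by (subst integrable_completion) auto
  then have "f \<in> L2 UNIV" using m by (simp add: L2_def lebesgue_on_UNIV_eq)
  then show ?thesis by (rule L2_subset) (use assms in auto)
qed

lemma test_functions_subset_H10:
  fixes \<Omega> :: "(real^'n) set"
  assumes "open \<Omega>" "\<phi> \<in> test_functions \<Omega>"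
  shows "\<phi> \<in> H10 \<Omega>"
proof -
  obtain S where S: "compact S" "S \<subseteq> \<Omega>" "\<And>x. x \<notin> S \<Longrightarrow> \<phi> x = 0" "\<And>x. x \<notin> S \<Longrightarrow> cgrad \<phi> x = 0"
    using assms(2) test_functionsD by metis
  note Ck = test_functions_Ck[OF assms(2), of 1]
  have "\<phi> \<in> L2 \<Omega>" "cgrad \<phi> \<in> L2 \<Omega>"
    using assms(1) S Ck by (auto intro!: L2_continuous_compact_support[where S=S] Ck_1_continuous Ck_1_continuous_cgrad)
  with is_weak_grad_C1[OF assms(1) Ck] have H1: "\<phi> \<in> H1 \<Omega>" by (auto simp: H1_def)
  have "AE x in lebesgue_on \<Omega>. wgrad \<Omega> \<phi> x - cgrad \<phi> x = 0"
    using wgrad_eq_cgrad[OF assms(1) H1 assms(1) order_refl Ck] by simp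
  then have "L2norm \<Omega> (\<lambda>x. wgrad \<Omega> \<phi> x - cgrad \<phi> x) = L2norm \<Omega> (\<lambda>x. 0 :: real^'n)"
    by (rule L2norm_cong_AE[of \<Omega> "\<lambda>x. wgrad \<Omega> \<phi> x - cgrad \<phi> x", rotated]) (use assms(1) in auto)
  then have "L2norm \<Omega> (\<lambda>x. wgrad \<Omega> \<phi> x - cgrad \<phi> x) = 0" by (simp add: L2norm_def)
  moreover have "L2norm \<Omega> (\<lambda>x. \<phi> x - \<phi> x) = 0" by (simp add: L2norm_def)
  ultimately show ?thesis
    unfolding H10_def using H1 assms(2) by (intro CollectI conjI exI[of _ "\<lambda>n. \<phi>"]) auto
qed

lemma H10_subset_H1: "H10 \<Omega> \<subseteq> H1 \<Omega>"
  by (auto simp: H10_def)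

lemma H1_subset_L2: "H1 \<Omega> \<subseteq> L2 \<Omega>"
  by (auto simp: H1_def)

text \<open>Gradients of test functions integrate to 0, and on a bounded set this survives the limit
  because the constant 1 is square integrable. It makes the divergence of a field in
  \<open>Vsp\<close> an admissible pressure.\<close>

lemma H10_integral_wgrad:
  assumes "open \<Omega>" "bounded \<Omega>" "u \<in> H10 \<Omega>"
  shows "(LINT x|lebesgue_on \<Omega>. wgrad \<Omega> u x $ j) = 0"
proof -
  obtain \<phi> where \<phi>: "\<And>n. \<phi> n \<in> test_functions \<Omega>"
    "(\<lambda>n. L2norm \<Omega> (\<lambda>x. wgrad \<Omega> u x - cgrad (\<phi> n) x)) \<longlonglongrightarrow> 0"
    using assms(3) by (auto simp: H10_def)
  have \<Omega>: "\<Omega> \<in> lmeasurable" using assms by (simp add: lmeasurable_open)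
  have u: "u \<in> H1 \<Omega>" using assms(3) H10_subset_H1 by blast
  note g = wgrad_weak(2)[OF assms(1) u]
  have one: "(\<lambda>x. 1::real) \<in> L2 \<Omega>" using \<Omega> by (intro L2_bounded[where B=1]) auto
  have bound: "\<bar>LINT x|lebesgue_on \<Omega>. wgrad \<Omega> u x $ j\<bar> \<le> L2norm \<Omega> (\<lambda>x. wgrad \<Omega> u x - cgrad (\<phi> n) x) * L2norm \<Omega> (\<lambda>x. 1::real)" for n
  proof -
    obtain S where S: "compact S" "S \<subseteq> \<Omega>" "\<And>x. x \<notin> S \<Longrightarrow> cgrad (\<phi> n) x = 0"
      using \<phi>(1)[of n] test_functionsD by metis
    have c: "cgrad (\<phi> n) \<in> L2 \<Omega>"
      using assms(1) S test_functions_Ck[OF \<phi>(1)]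
      by (auto intro!: L2_continuous_compact_support[where S=S] Ck_1_continuous_cgrad)
    let ?d = "\<lambda>x. wgrad \<Omega> u x - cgrad (\<phi> n) x"
    have d: "?d \<in> L2 \<Omega>" using g c by (rule L2_diff)
    have "(LINT x|lebesgue_on \<Omega>. wgrad \<Omega> u x $ j)
        = (LINT x|lebesgue_on \<Omega>. wgrad \<Omega> u x $ j - cgrad (\<phi> n) x $ j) + (LINT x|lebesgue_on \<Omega>. cgrad (\<phi> n) x $ j)"
      using L2_integrable_self[OF \<Omega> L2_component[OF g]] L2_integrable_self[OF \<Omega> L2_component[OF c]] by simp
    also have "\<dots> = (LINT x|lebesgue_on \<Omega>. ?d x $ j * 1)"
      using integral_test_gradient_zero[OF assms(1) \<phi>(1)] by simp
    also have "\<bar>\<dots>\<bar> \<le> L2norm \<Omega> (\<lambda>x. ?d x $ j) * L2norm \<Omega> (\<lambda>x. 1::real)"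
      using L2_component[OF d] one by (rule L2_Cauchy_Schwarz)
    also have "\<dots> \<le> L2norm \<Omega> ?d * L2norm \<Omega> (\<lambda>x. 1::real)"
    proof (rule mult_right_mono)
      have "L2norm \<Omega> (\<lambda>x. ?d x $ j) \<le> L2norm \<Omega> (\<lambda>x. norm (?d x))"
        using L2_component[OF d] L2_norm[OF d]
        by (intro L2norm_mono) (auto simp: L2_def intro: component_le_norm_cart[of "?d _" j, simplified])
      then show "L2norm \<Omega> (\<lambda>x. ?d x $ j) \<le> L2norm \<Omega> ?d" by (simp add: L2norm_def)
    qed simp
    finally show ?thesis .
  qed
  have "(\<lambda>n. L2norm \<Omega> (\<lambda>x. wgrad \<Omega> u x - cgrad (\<phi> n) x) * L2norm \<Omega> (\<lambda>x. 1::real)) \<longlonglongrightarrow> 0 * L2norm \<Omega> (\<lambda>x. 1::real)"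
    by (intro tendsto_intros \<phi>(2))
  then have "\<bar>LINT x|lebesgue_on \<Omega>. wgrad \<Omega> u x $ j\<bar> \<le> 0 * L2norm \<Omega> (\<lambda>x. 1::real)"
    by (rule LIMSEQ_le_const) (use bound in blast)
  then show ?thesis by simp
qed

section \<open>Finite-dimensional spaces of functions\<close>

text \<open>The span, generated by adding one multiple of a generator at a time; this fits
  inductions over a finite spanning set and needs no vector space structure on a function
  type.\<close>

inductive_set lin_comb :: "('a \<Rightarrow> real) set \<Rightarrow> ('a \<Rightarrow> real) set" for B where
  zero: "(\<lambda>x. 0) \<in> lin_comb B"
| step: "f \<in> lin_comb B \<Longrightarrow> b \<in> B \<Longrightarrow> (\<lambda>x. f x + c * b x) \<in> lin_comb B"

lemma lin_comb_lin:
  assumes "g \<in> lin_comb B" "f \<in> lin_comb B"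
  shows "(\<lambda>x. f x + c * g x) \<in> lin_comb B"
  using assms(1)
proof (induction rule: lin_comb.induct)
  case zero
  then show ?case using assms(2) by simp
next
  case (step g b d)
  have "(\<lambda>x. (f x + c * g x) + (c * d) * b x) \<in> lin_comb B"
    by (rule lin_comb.step[OF step.IH step.hyps(2)])
  then show ?case by (simp add: algebra_simps)
qed

lemma lin_comb_base: "b \<in> B \<Longrightarrow> b \<in> lin_comb B"
  using lin_comb.step[OF lin_comb.zero, of b B 1] by simp

lemma lin_comb_cmult: "f \<in> lin_comb B \<Longrightarrow> (\<lambda>x. c * f x) \<in> lin_comb B"
  using lin_comb_lin[OF _ lin_comb.zero] by fastforce

lemma lin_comb_add: "f \<in> lin_comb B \<Longrightarrow> g \<in> lin_comb B \<Longrightarrow> (\<lambda>x. f x + g x) \<in> lin_comb B"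
  using lin_comb_lin[of g B f 1] by simp

lemma lin_comb_sum:
  "finite I \<Longrightarrow> (\<And>i. i \<in> I \<Longrightarrow> f i \<in> lin_comb B) \<Longrightarrow> (\<lambda>x. \<Sum>i\<in>I. f i x) \<in> lin_comb B"
  by (induction I rule: finite_induct) (auto intro: lin_comb.zero lin_comb_add)

lemma lin_comb_mono: "f \<in> lin_comb B \<Longrightarrow> B \<subseteq> C \<Longrightarrow> f \<in> lin_comb C"
  by (induction rule: lin_comb.induct) (auto intro: lin_comb.intros)

lemma lin_comb_insertE:
  assumes "f \<in> lin_comb (insert b B)"
  obtains c g where "g \<in> lin_comb B" "f = (\<lambda>x. g x + c * b x)"
proof -
  from assms have "\<exists>c g. g \<in> lin_comb B \<and> f = (\<lambda>x. g x + c * b x)"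
  proof (induction rule: lin_comb.induct)
    case zero
    show ?case by (intro exI[of _ 0] exI[of _ "\<lambda>x. 0"]) (auto intro: lin_comb.zero)
  next
    case (step f b' d)
    then obtain c g where g: "g \<in> lin_comb B" "f = (\<lambda>x. g x + c * b x)" by blast
    show ?case
    proof (cases "b' = b")
      case True
      with g show ?thesis by (intro exI[of _ "c + d"] exI[of _ g]) (auto simp: algebra_simps)
    next
      case False
      with step.hyps have "b' \<in> B" by simp
      then have "(\<lambda>x. g x + d * b' x) \<in> lin_comb B" using g by (intro lin_comb.step)
      with g show ?thesis by (intro exI[of _ c] exI[of _ "\<lambda>x. g x + d * b' x"]) (auto simp: algebra_simps)
    qed
  qed
  with that show ?thesis by blast
qed

text \<open>The form may be degenerate: functions are pointwise representatives, so a nonzero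
  function that vanishes almost everywhere, or on the support of a weight, is a null vector.\<close>

locale semi_inner =
  fixes X :: "('a \<Rightarrow> real) set" and s :: "('a \<Rightarrow> real) \<Rightarrow> ('a \<Rightarrow> real) \<Rightarrow> real"
  assumes zero_in: "(\<lambda>x. 0) \<in> X"
    and lin_in: "f \<in> X \<Longrightarrow> g \<in> X \<Longrightarrow> (\<lambda>x. f x + c * g x) \<in> X"
    and sym: "f \<in> X \<Longrightarrow> g \<in> X \<Longrightarrow> s f g = s g f"
    and lin: "f \<in> X \<Longrightarrow> g \<in> X \<Longrightarrow> h \<in> X \<Longrightarrow> s (\<lambda>x. f x + c * g x) h = s f h + c * s g h"
    and nonneg: "f \<in> X \<Longrightarrow> 0 \<le> s f f"
begin

lemma lin_comb_in:
  assumes "B \<subseteq> X" "f \<in> lin_comb B"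
  shows "f \<in> X"
  using assms(2) by (induction rule: lin_comb.induct) (use assms(1) in \<open>auto intro: zero_in lin_in\<close>)

lemma lin_right: "f \<in> X \<Longrightarrow> g \<in> X \<Longrightarrow> h \<in> X \<Longrightarrow> s h (\<lambda>x. f x + c * g x) = s h f + c * s h g"
  using lin[of f g h c] sym[of h] lin_in[of f g c] by simp

lemma zero_left: "f \<in> X \<Longrightarrow> s (\<lambda>x. 0) f = 0"
  using lin[OF zero_in zero_in, of f 1] by simp

text \<open>On the line through \<open>f\<close> in a null direction the nonnegative quadratic form
  is affine, hence its slope vanishes.\<close>

lemma null_orth:
  assumes "f \<in> X" "g \<in> X" "s g g = 0"
  shows "s f g = 0"
proof (rule ccontr)
  assume ne: "s f g \<noteq> 0"
  let ?t = "- (s f f + 1) / (2 * s f g)"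
  have "0 \<le> s f f + 2 * t * s f g" for t
  proof -
    let ?h = "\<lambda>x. f x + t * g x"
    have h: "?h \<in> X" using assms by (intro lin_in)
    then have "0 \<le> s ?h ?h" by (rule nonneg)
    also have "\<dots> = s ?h f + t * s ?h g" using assms h by (intro lin_right)
    also have "\<dots> = s f f + t * s g f + t * (s f g + t * s g g)" using assms by (simp only: lin)
    also have "\<dots> = s f f + 2 * t * s f g" using assms sym[of g f] by simp
    finally show ?thesis .
  qed
  then have "0 \<le> s f f + 2 * ?t * s f g" .
  also have "\<dots> = - 1" using ne by (simp add: field_simps)
  finally show False by simp
qed

text \<open>Gram-Schmidt with one new generator per step: \<open>b\<close> is made orthogonal to the
  old span, then the old projection is corrected in that direction.\<close>

lemma projection_exists:
  assumes "finite B" "B \<subseteq> X" "f \<in> X"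
  shows "\<exists>p\<in>lin_comb B. \<forall>q\<in>lin_comb B. s (\<lambda>x. f x - p x) q = 0"
  using assms
proof (induction B arbitrary: f rule: finite_induct)
  case empty
  have "q = (\<lambda>x. 0)" if "q \<in> lin_comb {}" for q :: "'a \<Rightarrow> real"
    using that by (induction rule: lin_comb.induct) auto
  moreover have "s f (\<lambda>x. 0) = 0" using zero_left[of f] sym[of f "\<lambda>x. 0"] empty zero_in by simp
  ultimately have "\<forall>q\<in>lin_comb {}. s (\<lambda>x. f x - (\<lambda>x. 0) x) q = 0" by auto
  then show ?case by (intro bexI[of _ "\<lambda>x. 0"] lin_comb.zero)
next
  case (insert b B)
  have B: "B \<subseteq> X" and b: "b \<in> X" and f: "f \<in> X" using insert.prems by auto
  obtain p0 where p0: "p0 \<in> lin_comb B" "\<And>q. q \<in> lin_comb B \<Longrightarrow> s (\<lambda>x. f x - p0 x) q = 0"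
    using insert.IH[OF B f] by blast
  obtain q0 where q0: "q0 \<in> lin_comb B" "\<And>q. q \<in> lin_comb B \<Longrightarrow> s (\<lambda>x. b x - q0 x) q = 0"
    using insert.IH[OF B b] by blast
  define b' where "b' x = b x - q0 x" for x
  define f' where "f' x = f x - p0 x" for x
  have p0X: "p0 \<in> X" and q0X: "q0 \<in> X" using lin_comb_in[OF B] p0 q0 by auto
  have b'X: "b' \<in> X" using lin_in[OF b q0X, of "-1"] by (simp add: b'_def[abs_def])
  have f'X: "f' \<in> X" using lin_in[OF f p0X, of "-1"] by (simp add: f'_def[abs_def])
  have f'0: "s f' q = 0" if "q \<in> lin_comb B" for q using p0(2)[OF that] by (simp add: f'_def[abs_def])
  have b'0: "s b' q = 0" if "q \<in> lin_comb B" for q using q0(2)[OF that] by (simp add: b'_def[abs_def])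
  \<comment> \<open>If \<open>b'\<close> is a null vector, the quotient is 0 by convention and
    \<open>null_orth\<close> supplies the orthogonality.\<close>
  define \<beta> where "\<beta> = s f' b' / s b' b'"
  have orth: "s f' b' - \<beta> * s b' b' = 0"
    using null_orth[OF f'X b'X] by (cases "s b' b' = 0") (auto simp: \<beta>_def)
  let ?p = "\<lambda>x. p0 x + \<beta> * b' x"
  have mono: "lin_comb B \<subseteq> lin_comb (insert b B)" using lin_comb_mono by blast
  have "b' \<in> lin_comb (insert b B)"
    using lin_comb_lin[of q0 "insert b B" b "-1"] lin_comb_base[of b "insert b B"] q0(1) mono
    by (auto simp: b'_def[abs_def])
  then have p_in: "?p \<in> lin_comb (insert b B)" using p0(1) mono by (intro lin_comb_lin) auto
  have "s (\<lambda>x. f x - ?p x) q = 0" if q: "q \<in> lin_comb (insert b B)" for q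
  proof -
    obtain c g where g: "g \<in> lin_comb B" "q = (\<lambda>x. g x + c * b x)" using lin_comb_insertE[OF q] .
    let ?g = "\<lambda>x. g x + c * q0 x"
    have g': "?g \<in> lin_comb B" using g q0 by (intro lin_comb_lin)
    then have g'X: "?g \<in> X" using lin_comb_in[OF B] by blast
    have q': "q = (\<lambda>x. ?g x + c * b' x)" using g by (auto simp: b'_def algebra_simps)
    have "(\<lambda>x. f x - ?p x) = (\<lambda>x. f' x + (- \<beta>) * b' x)" by (auto simp: f'_def)
    then have "s (\<lambda>x. f x - ?p x) q = s (\<lambda>x. f' x + (- \<beta>) * b' x) (\<lambda>x. ?g x + c * b' x)"
      using q' by simp
    also have "\<dots> = s (\<lambda>x. f' x + (- \<beta>) * b' x) ?g + c * s (\<lambda>x. f' x + (- \<beta>) * b' x) b'"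
      by (rule lin_right[OF g'X b'X lin_in[OF f'X b'X]])
    also have "\<dots> = s f' ?g - \<beta> * s b' ?g + c * (s f' b' - \<beta> * s b' b')"
      using lin[OF f'X b'X g'X, of "-\<beta>"] lin[OF f'X b'X b'X, of "-\<beta>"] by simp
    also have "\<dots> = 0" using orth f'0[OF g'] b'0[OF g'] by simp
    finally show ?thesis .
  qed
  then show ?case using p_in by (intro bexI[of _ ?p]) auto
qed

text \<open>Any two quadratic functionals on a finite-dimensional space compare as soon as their kernels do;
  the induction over a spanning set splits off one orthogonal direction at a time.\<close>

lemma quadratic_bound:
  assumes "finite B" "B \<subseteq> X"
    and N_lin: "\<And>f g c. f \<in> X \<Longrightarrow> g \<in> X \<Longrightarrow> N (\<lambda>x. f x + c * g x) \<le> 2 * N f + 2 * c\<^sup>2 * N g"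
    and N_nonneg: "\<And>f. f \<in> X \<Longrightarrow> 0 \<le> N f"
    and kernel: "\<And>f. f \<in> lin_comb B \<Longrightarrow> s f f = 0 \<Longrightarrow> N f = 0"
  shows "\<exists>C\<ge>0. \<forall>f\<in>lin_comb B. N f \<le> C * s f f"
  using assms(1,2) kernel
proof (induction B rule: finite_induct)
  case empty
  have "f = (\<lambda>x. 0)" if "f \<in> lin_comb {}" for f :: "'a \<Rightarrow> real"
    using that by (induction rule: lin_comb.induct) auto
  moreover have "N (\<lambda>x. 0) = 0"
    by (rule empty.prems(2)[OF lin_comb.zero zero_left[OF zero_in]])
  ultimately have "N f \<le> 0 * s f f" if "f \<in> lin_comb {}" for f using that by auto
  then show ?case by (intro exI[of _ 0]) auto
next
  case (insert b B)
  have B: "B \<subseteq> X" and b: "b \<in> X" using insert.prems by auto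
  have mono: "lin_comb B \<subseteq> lin_comb (insert b B)" using lin_comb_mono by blast
  obtain C where C: "0 \<le> C" "\<And>f. f \<in> lin_comb B \<Longrightarrow> N f \<le> C * s f f"
    using insert.IH[OF B] insert.prems(2) mono by blast
  obtain q0 where q0: "q0 \<in> lin_comb B" "\<And>q. q \<in> lin_comb B \<Longrightarrow> s (\<lambda>x. b x - q0 x) q = 0"
    using projection_exists[OF insert.hyps(1) B b] by blast
  define b' where "b' x = b x - q0 x" for x
  have q0X: "q0 \<in> X" using lin_comb_in[OF B] q0 by auto
  have b'X: "b' \<in> X" using lin_in[OF b q0X, of "-1"] by (simp add: b'_def[abs_def])
  have b'0: "s b' q = 0" if "q \<in> lin_comb B" for q using q0(2)[OF that] by (simp add: b'_def[abs_def])
  have b'_in: "b' \<in> lin_comb (insert b B)"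
    using lin_comb_lin[of q0 "insert b B" b "-1"] lin_comb_base[of b "insert b B"] q0(1) mono
    by (auto simp: b'_def[abs_def])
  \<comment> \<open>When \<open>s b' b'\<close> is 0 the quotient is 0, and the kernel condition
    forces \<open>N b'\<close> to be 0 as well, so the inequality holds in both cases.\<close>
  define D where "D = N b' / s b' b'"
  have D: "0 \<le> D" "N b' \<le> D * s b' b'"
    using N_nonneg[OF b'X] nonneg[OF b'X] insert.prems(2)[OF b'_in]
    by (auto simp: D_def)
  have "N f \<le> (2 * C + 2 * D) * s f f" if f: "f \<in> lin_comb (insert b B)" for f
  proof -
    obtain c g where g: "g \<in> lin_comb B" "f = (\<lambda>x. g x + c * b x)" using lin_comb_insertE[OF f] .
    let ?g = "\<lambda>x. g x + c * q0 x"
    have g': "?g \<in> lin_comb B" using g q0 by (intro lin_comb_lin)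
    then have g'X: "?g \<in> X" using lin_comb_in[OF B] by blast
    have f': "f = (\<lambda>x. ?g x + c * b' x)" using g by (auto simp: b'_def algebra_simps)
    have fX: "(\<lambda>x. ?g x + c * b' x) \<in> X" by (rule lin_in[OF g'X b'X])
    have "s f f = s (\<lambda>x. ?g x + c * b' x) ?g + c * s (\<lambda>x. ?g x + c * b' x) b'"
      unfolding f' by (rule lin_right[OF g'X b'X fX])
    also have "\<dots> = s ?g ?g + c * s b' ?g + c * (s ?g b' + c * s b' b')"
      using lin[OF g'X b'X g'X, of c] lin[OF g'X b'X b'X, of c] by simp
    also have "\<dots> = s ?g ?g + c\<^sup>2 * s b' b'"
      using b'0[OF g'] sym[OF g'X b'X] by (simp add: power2_eq_square)
    finally have sf: "s f f = s ?g ?g + c\<^sup>2 * s b' b'" .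
    have "N f \<le> 2 * N ?g + 2 * c\<^sup>2 * N b'" unfolding f' using g'X b'X by (rule N_lin)
    also have "\<dots> \<le> 2 * (C * s ?g ?g) + 2 * c\<^sup>2 * (D * s b' b')"
      using C(2)[OF g'] D by (intro add_mono mult_left_mono) auto
    also have "\<dots> \<le> (2 * C + 2 * D) * s ?g ?g + (2 * C + 2 * D) * (c\<^sup>2 * s b' b')"
    proof (rule add_mono)
      show "2 * (C * s ?g ?g) \<le> (2 * C + 2 * D) * s ?g ?g"
        using D(1) nonneg[OF g'X] by (simp add: distrib_right)
      have "0 \<le> C * (c\<^sup>2 * s b' b')" using C(1) nonneg[OF b'X] by simp
      then show "2 * c\<^sup>2 * (D * s b' b') \<le> (2 * C + 2 * D) * (c\<^sup>2 * s b' b')" by (simp add: algebra_simps)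
    qed
    also have "\<dots> = (2 * C + 2 * D) * s f f" by (simp add: sf distrib_left)
    finally show ?thesis .
  qed
  then show ?case using C(1) D(1) by (intro exI[of _ "2 * C + 2 * D"]) auto
qed

end

section \<open>Polynomials\<close>

text \<open>A coordinate-free degree bound: invariance under affine substitution and under
  differentiation become plain inductions, which multi-index sums would make laborious.\<close>

inductive pdeg :: "nat \<Rightarrow> ('a::euclidean_space \<Rightarrow> real) \<Rightarrow> bool" where
  const: "pdeg m (\<lambda>x. c)"
| linear: "bounded_linear f \<Longrightarrow> pdeg (Suc m) f"
| add: "pdeg m f \<Longrightarrow> pdeg m g \<Longrightarrow> pdeg m (\<lambda>x. f x + g x)"
| mult: "pdeg k f \<Longrightarrow> pdeg m g \<Longrightarrow> pdeg (k + m) (\<lambda>x. f x * g x)"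

lemma pdeg_mono: "pdeg m f \<Longrightarrow> m \<le> k \<Longrightarrow> pdeg k f"
proof (induction arbitrary: k rule: pdeg.induct)
  case (linear f m)
  then show ?case using pdeg.linear[of f "k - 1"] by simp
next
  case (mult a f b g)
  then have "pdeg (k - b) f" "pdeg b g" by auto
  then have "pdeg (k - b + b) (\<lambda>x. f x * g x)" by (rule pdeg.mult)
  then show ?case using mult.prems by simp
qed (auto intro: pdeg.intros)

lemma pdeg_cmult: "pdeg m f \<Longrightarrow> pdeg m (\<lambda>x. c * f x)"
  using pdeg.mult[OF pdeg.const[of 0 c], of m f] by simp

lemma pdeg_uminus: "pdeg m f \<Longrightarrow> pdeg m (\<lambda>x. - f x)"
  using pdeg_cmult[of m f "-1"] by simp

lemma pdeg_diff: "pdeg m f \<Longrightarrow> pdeg m g \<Longrightarrow> pdeg m (\<lambda>x. f x - g x)"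
  using pdeg.add[of m f "\<lambda>x. - g x"] pdeg_uminus[of m g] by simp

lemma pdeg_sum: "(\<And>i. i \<in> I \<Longrightarrow> pdeg m (f i)) \<Longrightarrow> pdeg m (\<lambda>x. \<Sum>i\<in>I. f i x)"
  by (induction I rule: infinite_finite_induct) (auto intro: pdeg.intros)

lemma pdeg_power: "pdeg m f \<Longrightarrow> pdeg (k * m) (\<lambda>x. f x ^ k)"
  by (induction k) (auto intro: pdeg.intros)

lemma pdeg_prod:
  "finite I \<Longrightarrow> (\<And>i. i \<in> I \<Longrightarrow> pdeg (d i) (f i)) \<Longrightarrow> pdeg (sum d I) (\<lambda>x. \<Prod>i\<in>I. f i x)"
  by (induction I rule: finite_induct) (auto intro: pdeg.intros)

lemma poly_deg_pdeg: "p \<in> poly_deg m \<Longrightarrow> pdeg m p"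
proof -
  assume "p \<in> poly_deg m"
  then obtain a where p: "p = (\<lambda>x. \<Sum>\<alpha>\<in>{\<alpha>. sum \<alpha> UNIV \<le> m}. a \<alpha> * (\<Prod>i\<in>UNIV. x $ i ^ \<alpha> i))"
    by (auto simp: poly_deg_def)
  have "pdeg m (\<lambda>x. a \<alpha> * (\<Prod>i\<in>UNIV. x $ i ^ \<alpha> i))" if "sum \<alpha> UNIV \<le> m" for \<alpha> :: "_ \<Rightarrow> nat"
  proof -
    have "pdeg (\<alpha> i * 1) (\<lambda>x::real^'a. x $ i ^ \<alpha> i)" for i
      by (intro pdeg_power) (simp add: pdeg.linear bounded_linear_vec_nth)
    then have "pdeg (sum \<alpha> UNIV) (\<lambda>x::real^'a. \<Prod>i\<in>UNIV. x $ i ^ \<alpha> i)"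
      by (intro pdeg_prod) auto
    with that show ?thesis by (intro pdeg_cmult) (rule pdeg_mono)
  qed
  then show ?thesis unfolding p by (intro pdeg_sum) auto
qed

lemma pdeg_polynomial: "pdeg m f \<Longrightarrow> real_polynomial_function f"
  by (induction rule: pdeg.induct) (auto intro: real_polynomial_function.intros)

lemma pdeg_affine: "pdeg m f \<Longrightarrow> bounded_linear A \<Longrightarrow> pdeg m (\<lambda>x. f (z + A x))"
proof (induction rule: pdeg.induct)
  case (linear f m)
  have "(\<lambda>x. f (z + A x)) = (\<lambda>x. f z + f (A x))"
    using bounded_linear.linear[OF linear.hyps] by (simp add: linear_add)
  moreover have "pdeg (Suc m) (\<lambda>x. f (A x))"
    by (rule pdeg.linear, rule bounded_linear_compose[OF linear.hyps linear.prems])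
  then have "pdeg (Suc m) (\<lambda>x. f z + f (A x))"
    by (intro pdeg.add pdeg.const)
  ultimately show ?case by simp
qed (auto intro: pdeg.intros)

lemma pdeg_smooth: "pdeg m f \<Longrightarrow> f \<in> smooth_fns"
  by (intro smooth_fns_polynomial pdeg_polynomial)

text \<open>The bound is not lowered by differentiation. Constants need only a uniform degree, and
  keeping \<open>m\<close> avoids truncated subtraction.\<close>

lemma pdeg_derivative:
  "pdeg m f \<Longrightarrow> (\<forall>x. f differentiable (at x)) \<and> (\<forall>v. pdeg m (\<lambda>x. frechet_derivative f (at x) v))"
proof (induction rule: pdeg.induct)
  case (const m c)
  have "frechet_derivative (\<lambda>x. c) (at x) = (\<lambda>h. 0)" for x :: 'a
    by (rule frechet_derivative_at[symmetric]) auto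
  then show ?case by (auto intro: pdeg.const)
next
  case (linear f m)
  then have "frechet_derivative f (at x) = f" for x
    by (intro frechet_derivative_at[symmetric] bounded_linear_imp_has_derivative)
  then show ?case using linear by (auto intro: pdeg.const bounded_linear_imp_differentiable)
next
  case (add m f g)
  have D: "((\<lambda>x. f x + g x) has_derivative (\<lambda>v. frechet_derivative f (at x) v + frechet_derivative g (at x) v)) (at x)" for x
    using add.IH by (intro has_derivative_add) (auto simp: frechet_derivative_works)
  have "frechet_derivative (\<lambda>x. f x + g x) (at x) = (\<lambda>v. frechet_derivative f (at x) v + frechet_derivative g (at x) v)"
    and "(\<lambda>x. f x + g x) differentiable (at x)" for x
    by (rule frechet_derivative_at[OF D, symmetric], rule differentiableI[OF D])
  then show ?case using add.IH by (auto intro: pdeg.intros)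
next
  case (mult a f b g)
  have D: "((\<lambda>x. f x * g x) has_derivative (\<lambda>v. f x * frechet_derivative g (at x) v + frechet_derivative f (at x) v * g x)) (at x)" for x
    using mult.IH by (intro has_derivative_mult) (auto simp: frechet_derivative_works)
  have "frechet_derivative (\<lambda>x. f x * g x) (at x) = (\<lambda>v. f x * frechet_derivative g (at x) v + frechet_derivative f (at x) v * g x)"
    and "(\<lambda>x. f x * g x) differentiable (at x)" for x
    by (rule frechet_derivative_at[OF D, symmetric], rule differentiableI[OF D])
  moreover have "pdeg (a + b) (\<lambda>x. f x * frechet_derivative g (at x) v + frechet_derivative f (at x) v * g x)" for v
    using mult.IH mult.hyps by (intro pdeg.add pdeg.mult) auto
  ultimately show ?case by auto
qed

text \<open>Restricted to the line from the centre through \<open>x\<close>, the polynomial has one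
  variable and infinitely many roots.\<close>

lemma polynomial_zero_on_ball:
  fixes p :: "'a::euclidean_space \<Rightarrow> real"
  assumes p: "real_polynomial_function p" and r: "0 < r" and z: "\<And>x. x \<in> ball z r \<Longrightarrow> p x = 0"
  shows "p x = 0"
proof (cases "x = z")
  case False
  let ?g = "\<lambda>t::real. z + t *\<^sub>R (x - z)"
  have "polynomial_function ?g"
    by (intro polynomial_function_add polynomial_function_const polynomial_function_mult) 
       (auto intro: polynomial_function_id)
  then have "real_polynomial_function (p \<circ> ?g)"
    using p polynomial_function_compose[of ?g p] by (simp add: real_polynomial_function_eq)
  then obtain a n where a: "(p \<circ> ?g) = (\<lambda>t. \<Sum>i\<le>n. a i * t ^ i)"
    using real_polynomial_function_imp_sum by metis
  have inf: "infinite {0<..<r / norm (x - z)}"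
    using r False by (simp add: infinite_Ioo)
  have "{0<..<r / norm (x - z)} \<subseteq> {t. (\<Sum>i\<le>n. a i * t ^ i) = 0}"
  proof
    fix t assume t: "t \<in> {0<..<r / norm (x - z)}"
    then have "t * norm (x - z) < r" using False by (simp add: field_simps)
    then have "?g t \<in> ball z r" using t by (simp add: dist_norm)
    then have "(p \<circ> ?g) t = 0" using z by simp
    then show "t \<in> {t. (\<Sum>i\<le>n. a i * t ^ i) = 0}" using a by (simp add: fun_eq_iff)
  qed
  with inf have "infinite {t. (\<Sum>i\<le>n. a i * t ^ i) = 0}" using finite_subset by blast
  then have "\<forall>k\<le>n. a k = 0" using polyfun_rootbound by blast
  then have "(p \<circ> ?g) 1 = 0" using a by simp
  then show ?thesis by simp
qed (use assms in simp)

text \<open>Lists of basis vectors encode products of coordinates with repetition: bounded length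
  makes the set finite, and concatenation of lists multiplies.\<close>

definition monomials :: "nat \<Rightarrow> ('a::euclidean_space \<Rightarrow> real) set" where
  "monomials m = (\<lambda>l x. \<Prod>b\<leftarrow>l. x \<bullet> b) ` {l. set l \<subseteq> Basis \<and> length l \<le> m}"

lemma finite_monomials: "finite (monomials m)"
  unfolding monomials_def by (intro finite_imageI finite_lists_length_le) simp

lemma monomials_mult: "f \<in> monomials k \<Longrightarrow> g \<in> monomials m \<Longrightarrow> (\<lambda>x. f x * g x) \<in> monomials (k + m)"
proof -
  assume "f \<in> monomials k" "g \<in> monomials m"
  then obtain l l' where "set l \<subseteq> Basis" "length l \<le> k" "f = (\<lambda>x. \<Prod>b\<leftarrow>l. x \<bullet> b)"
    "set l' \<subseteq> Basis" "length l' \<le> m" "g = (\<lambda>x. \<Prod>b\<leftarrow>l'. x \<bullet> b)"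
    by (auto simp: monomials_def)
  then show ?thesis unfolding monomials_def by (intro image_eqI[of _ _ "l @ l'"]) auto
qed

lemma lin_comb_monomials_mult:
  assumes "f \<in> lin_comb (monomials k)" "g \<in> lin_comb (monomials m)"
  shows "(\<lambda>x. f x * g x) \<in> lin_comb (monomials (k + m))"
  using assms(1)
proof (induction rule: lin_comb.induct)
  case zero
  then show ?case by (simp add: lin_comb.zero)
next
  case (step f b c)
  have "(\<lambda>x. b x * g x) \<in> lin_comb (monomials (k + m))"
    using assms(2)
  proof (induction rule: lin_comb.induct)
    case zero
    then show ?case by (simp add: lin_comb.zero)
  next
    case (step g b' d)
    have "(\<lambda>x. b x * g x + d * (b x * b' x)) \<in> lin_comb (monomials (k + m))"
      using step \<open>b \<in> monomials k\<close> by (intro lin_comb.step monomials_mult)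
    then show ?case by (simp add: algebra_simps)
  qed
  then have "(\<lambda>x. f x * g x + c * (b x * g x)) \<in> lin_comb (monomials (k + m))"
    using step.IH by (intro lin_comb_lin)
  then show ?case by (simp add: algebra_simps)
qed

lemma pdeg_lin_comb: "pdeg m f \<Longrightarrow> f \<in> lin_comb (monomials m)"
proof (induction rule: pdeg.induct)
  case (const m c)
  have "(\<lambda>x::'a. 1) \<in> monomials m" unfolding monomials_def by (intro image_eqI[of _ _ "[]"]) auto
  from lin_comb_cmult[OF lin_comb_base[OF this], of c] show ?case by simp
next
  case (linear f m)
  then interpret bounded_linear f by simp
  have "f = (\<lambda>x. \<Sum>b\<in>Basis. f b * (x \<bullet> b))"
  proof
    fix x
    show "f x = (\<Sum>b\<in>Basis. f b * (x \<bullet> b))"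
      by (subst euclidean_representation[of x, symmetric]) (simp add: sum scale mult.commute)
  qed
  also have "\<dots> \<in> lin_comb (monomials (Suc m))"
  proof (intro lin_comb_sum lin_comb_cmult lin_comb_base)
    fix b :: 'a assume "b \<in> Basis"
    then show "(\<lambda>x. x \<bullet> b) \<in> monomials (Suc m)" unfolding monomials_def by (intro image_eqI[of _ _ "[b]"]) auto
  qed simp
  finally show ?case .
qed (auto intro: lin_comb_add lin_comb_monomials_mult)

lemma monomials_polynomial: "f \<in> monomials m \<Longrightarrow> real_polynomial_function f"
proof -
  have "real_polynomial_function (\<lambda>x. \<Prod>b\<leftarrow>l. x \<bullet> b)" for l :: "'a list"
  proof (induction l)
    case (Cons a l)
    then have "real_polynomial_function (\<lambda>x. (x \<bullet> a) * (\<Prod>b\<leftarrow>l. x \<bullet> b))"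
      by (rule real_polynomial_function.intros(4)[rotated])
         (rule real_polynomial_function.intros(1), rule bounded_linear_inner_left)
    then show ?case by simp
  qed (simp add: real_polynomial_function.intros(2))
  then show "f \<in> monomials m \<Longrightarrow> real_polynomial_function f" by (auto simp: monomials_def)
qed

lemma monomials_smooth: "monomials m \<subseteq> smooth_fns"
  using monomials_polynomial smooth_fns_polynomial by blast

lemma lin_comb_monomials_polynomial: "f \<in> lin_comb (monomials m) \<Longrightarrow> real_polynomial_function f"
proof (induction rule: lin_comb.induct)
  case (step f b c)
  have "real_polynomial_function (\<lambda>x. c * b x)"
    by (rule real_polynomial_function.intros(4)[OF real_polynomial_function.intros(2) monomials_polynomial[OF step.hyps(2)]])
  with step.IH show ?case by (rule real_polynomial_function.intros(3))
qed (rule real_polynomial_function.intros(2))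

section \<open>Inverse estimates on balls\<close>

lemma integrable_continuous_support:
  fixes f :: "'a::euclidean_space \<Rightarrow> real"
  assumes "continuous_on UNIV f" "compact S" "\<And>x. x \<notin> S \<Longrightarrow> f x = 0"
  shows "integrable lborel f"
proof -
  have "integrable lborel (\<lambda>x. indicator S x *\<^sub>R f x)"
    using assms by (intro borel_integrable_compact) (auto intro: continuous_on_subset)
  moreover have "(\<lambda>x. indicator S x *\<^sub>R f x) = f"
  proof
    show "indicator S x *\<^sub>R f x = f x" for x using assms(3)[of x] by (cases "x \<in> S") auto
  qed
  ultimately show ?thesis by simp
qed

lemma integrable_indicator_ball:
  fixes f :: "'a::euclidean_space \<Rightarrow> real"
  assumes "continuous_on UNIV f"
  shows "integrable lborel (\<lambda>x. indicator (ball z r) x * f x)"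
proof -
  have "integrable lborel (\<lambda>x. indicator (cball z r) x *\<^sub>R f x)"
    using assms by (intro borel_integrable_compact) (auto intro: continuous_on_subset)
  then have "integrable lborel (\<lambda>x. indicator (ball z r) x *\<^sub>R (indicator (cball z r) x *\<^sub>R f x))"
    by (rule integrable_mult_indicator[rotated]) simp
  moreover have "(\<lambda>x. indicator (ball z r) x *\<^sub>R (indicator (cball z r) x *\<^sub>R f x)) = (\<lambda>x. indicator (ball z r) x * f x)"
    by (auto simp: indicator_def)
  ultimately show ?thesis by simp
qed

lemma integrable_bump_times:
  fixes f :: "real^'n \<Rightarrow> real"
  assumes "continuous_on UNIV f" "0 < r"
  shows "integrable lborel (\<lambda>x. bump z r x * f x)"
proof (rule integrable_continuous_support[where S="cball z r"])
  show "continuous_on UNIV (\<lambda>x. bump z r x * f x)"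
    using assms smooth_fns_continuous[OF bump_smooth] by (intro continuous_intros) auto
qed (use assms in \<open>auto simp: bump_zero dist_norm norm_minus_commute\<close>)

lemma lborel_integral_scale:
  fixes f :: "'a::euclidean_space \<Rightarrow> real"
  assumes "f \<in> borel_measurable borel" "0 < r"
  shows "(LINT x|lborel. f x) = r ^ DIM('a) * (LINT x|lborel. f (z + r *\<^sub>R x))"
proof -
  have "(LINT x|lborel. f x) = (LINT x|density (distr lborel borel (\<lambda>x. z + r *\<^sub>R x)) (\<lambda>_. r ^ DIM('a)). f x)"
    using lborel_affine[of r z] assms(2) by simp
  also have "\<dots> = (LINT x|distr lborel borel (\<lambda>x. z + r *\<^sub>R x). r ^ DIM('a) *\<^sub>R f x)"
    using assms by (intro integral_density) auto
  also have "\<dots> = (LINT x|lborel. r ^ DIM('a) *\<^sub>R f (z + r *\<^sub>R x))"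
    using assms by (intro integral_distr) auto
  finally show ?thesis by simp
qed

text \<open>Where a continuous function is nonzero there is a nonempty open set of such points, and
  that is never a null set.\<close>

lemma continuous_AE_zero:
  fixes f :: "'a::euclidean_space \<Rightarrow> real"
  assumes "continuous_on UNIV f" "open U" "AE x in lborel. x \<in> U \<longrightarrow> f x = 0" "x \<in> U"
  shows "f x = 0"
proof (rule ccontr)
  assume "f x \<noteq> 0"
  let ?V = "U \<inter> {x. f x \<noteq> 0}"
  have "open {x. f x \<noteq> 0}"
    using assms(1) by (intro open_Collect_neq continuous_on_const)
  then have "open ?V" using assms(2) by blast
  moreover have "?V \<noteq> {}" using \<open>f x \<noteq> 0\<close> assms(4) by blast
  ultimately have "\<not> negligible ?V" using open_not_negligible by blast
  moreover have "AE x in lebesgue. x \<notin> ?V"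
    using assms(3) by (subst AE_completion_iff) (auto elim: eventually_mono)
  then have "?V \<in> null_sets lebesgue"
    using \<open>open ?V\<close> by (subst (asm) AE_iff_null_sets[symmetric]) auto
  ultimately show False by (simp add: negligible_iff_null_sets)
qed

lemma cgrad_lin:
  assumes "f \<in> smooth_fns" "g \<in> smooth_fns"
  shows "cgrad (\<lambda>x. f x + c * g x) x = cgrad f x + c *\<^sub>R cgrad g x"
proof -
  have "((\<lambda>x. f x + c * g x) has_derivative (\<lambda>v. frechet_derivative f (at x) v + c * frechet_derivative g (at x) v)) (at x)"
    using smooth_fns_derivative[OF assms(1)] smooth_fns_derivative[OF assms(2)]
    by (intro has_derivative_add has_derivative_mult_right) (auto simp: frechet_derivative_works)
  then have "frechet_derivative (\<lambda>x. f x + c * g x) (at x) = (\<lambda>v. frechet_derivative f (at x) v + c * frechet_derivative g (at x) v)"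
    by (rule frechet_derivative_at[symmetric])
  then show ?thesis by (simp add: cgrad_def vec_eq_iff)
qed

lemma smooth_fns_continuous_cgrad: "f \<in> smooth_fns \<Longrightarrow> continuous_on S (cgrad f)"
  by (intro Ck_1_continuous_cgrad smooth_fns_Ck)

text \<open>The weight sees only the unit ball, so the form is degenerate on smooth functions; on
  polynomials it is definite by \<open>bump_inner_kernel\<close>.\<close>

interpretation bump_inner: semi_inner "smooth_fns :: (real^'n \<Rightarrow> real) set" "\<lambda>f g. LINT x|lborel. bump 0 1 x * (f x * g x)"
proof
  fix f g h :: "real^'n \<Rightarrow> real" and c
  assume fg: "f \<in> smooth_fns" "g \<in> smooth_fns"
  show "(\<lambda>x. f x + c * g x) \<in> smooth_fns" using fg by (intro smooth_fns.add smooth_fns.mult smooth_fns.const)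
  show "(LINT x|lborel. bump 0 1 x * (f x * g x)) = (LINT x|lborel. bump 0 1 x * (g x * f x))"
    by (simp add: mult.commute)
  assume h: "h \<in> smooth_fns"
  have "integrable lborel (\<lambda>x. bump 0 1 x * (f x * h x))" "integrable lborel (\<lambda>x. bump 0 1 x * (g x * h x))"
    using fg h by (auto intro!: integrable_bump_times smooth_fns_continuous smooth_fns.mult)
  then show "(LINT x|lborel. bump 0 1 x * ((f x + c * g x) * h x)) =
      (LINT x|lborel. bump 0 1 x * (f x * h x)) + c * (LINT x|lborel. bump 0 1 x * (g x * h x))"
    by (simp add: algebra_simps)
qed (auto intro!: smooth_fns.const Bochner_Integration.integral_nonneg mult_nonneg_nonneg[OF bump_nonneg zero_le_square])

text \<open>The weight is positive in the open unit ball, so a polynomial of zero mass vanishes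
  there and therefore everywhere.\<close>

lemma bump_inner_kernel:
  fixes f :: "real^'n \<Rightarrow> real"
  assumes f: "real_polynomial_function f" and zero: "(LINT x|lborel. bump 0 1 x * (f x * f x)) = 0"
  shows "f = (\<lambda>x. 0)"
proof -
  have fs: "f \<in> smooth_fns" using f by (rule smooth_fns_polynomial)
  have c: "continuous_on UNIV (\<lambda>x. bump 0 1 x * (f x * f x))"
    by (intro continuous_intros smooth_fns_continuous bump_smooth fs)
  have "integrable lborel (\<lambda>x. bump 0 1 x * (f x * f x))"
    using fs by (intro integrable_bump_times continuous_intros smooth_fns_continuous) auto
  moreover have "AE x in lborel. 0 \<le> bump 0 1 x * (f x * f x)"
    by (intro AE_I2 mult_nonneg_nonneg bump_nonneg zero_le_square)
  ultimately have "AE x in lborel. bump 0 1 x * (f x * f x) = 0"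
    using zero integral_nonneg_eq_0_iff_AE[of lborel "\<lambda>x. bump 0 1 x * (f x * f x)"] by blast
  then have "AE x in lborel. x \<in> ball 0 1 \<longrightarrow> bump 0 1 x * (f x * f x) = 0" by eventually_elim auto
  from continuous_AE_zero[OF c open_ball this] have "f x = 0" if "x \<in> ball 0 1" for x
    using that bump_pos[of x 0 1] by force
  from polynomial_zero_on_ball[OF f _ this, of 1 0] show ?thesis by auto
qed

text \<open>All inverse estimates originate here. The ball of radius \<open>\<Lambda>\<close> may be
  far larger than the support of the bump: a polynomial of zero mass is zero everywhere, so the
  kernels compare and \<open>quadratic_bound\<close> applies. The constant depends on
  \<open>M\<close>, \<open>\<Lambda>\<close> and the dimension only.\<close>

lemma unit_ball_bounds:
  "\<exists>C\<ge>0. \<forall>p::real^'n \<Rightarrow> real. pdeg M p \<longrightarrow>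
     (LINT x|lborel. indicator (ball 0 \<Lambda>) x * (p x)\<^sup>2) \<le> C * (LINT x|lborel. bump 0 1 x * (p x)\<^sup>2) \<and>
     (LINT x|lborel. indicator (ball 0 \<Lambda>) x * (norm (cgrad p x))\<^sup>2) \<le> C * (LINT x|lborel. bump 0 1 x * (p x)\<^sup>2)"
proof -
  let ?N1 = "\<lambda>p::real^'n \<Rightarrow> real. LINT x|lborel. indicator (ball 0 \<Lambda>) x * (p x)\<^sup>2"
  let ?N2 = "\<lambda>p::real^'n \<Rightarrow> real. LINT x|lborel. indicator (ball 0 \<Lambda>) x * (norm (cgrad p x))\<^sup>2"
  let ?s = "\<lambda>f g::real^'n \<Rightarrow> real. LINT x|lborel. bump 0 1 x * (f x * g x)"
  have N_lin: "(LINT x|lborel. indicator (ball 0 \<Lambda>) x * (norm (F x + c *\<^sub>R G x))\<^sup>2)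
      \<le> 2 * (LINT x|lborel. indicator (ball 0 \<Lambda>) x * (norm (F x))\<^sup>2) + 2 * c\<^sup>2 * (LINT x|lborel. indicator (ball 0 \<Lambda>) x * (norm (G x))\<^sup>2)"
    if "continuous_on UNIV F" "continuous_on UNIV G" for F G :: "real^'n \<Rightarrow> 'b::real_normed_vector" and c
  proof -
    have i: "integrable lborel (\<lambda>x. indicator (ball 0 \<Lambda>) x * (norm (F x))\<^sup>2)"
      "integrable lborel (\<lambda>x. indicator (ball 0 \<Lambda>) x * (norm (G x))\<^sup>2)"
      "integrable lborel (\<lambda>x. indicator (ball 0 \<Lambda>) x * (norm (F x + c *\<^sub>R G x))\<^sup>2)"
      using that by (auto intro!: integrable_indicator_ball continuous_intros)
    have "(LINT x|lborel. indicator (ball 0 \<Lambda>) x * (norm (F x + c *\<^sub>R G x))\<^sup>2)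
      \<le> (LINT x|lborel. 2 * (indicator (ball 0 \<Lambda>) x * (norm (F x))\<^sup>2) + 2 * c\<^sup>2 * (indicator (ball 0 \<Lambda>) x * (norm (G x))\<^sup>2))"
    proof (rule integral_mono)
      fix x
      show "indicator (ball 0 \<Lambda>) x * (norm (F x + c *\<^sub>R G x))\<^sup>2
          \<le> 2 * (indicator (ball 0 \<Lambda>) x * (norm (F x))\<^sup>2) + 2 * c\<^sup>2 * (indicator (ball 0 \<Lambda>) x * (norm (G x))\<^sup>2)"
        using norm_add_sq_le[of "F x" "c *\<^sub>R G x"] by (simp add: indicator_def power_mult_distrib)
    qed (use i in auto)
    also have "\<dots> = 2 * (LINT x|lborel. indicator (ball 0 \<Lambda>) x * (norm (F x))\<^sup>2) + 2 * c\<^sup>2 * (LINT x|lborel. indicator (ball 0 \<Lambda>) x * (norm (G x))\<^sup>2)"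
      using i by simp
    finally show ?thesis .
  qed
  have kernel: "f = (\<lambda>x. 0)" if "f \<in> lin_comb (monomials M)" "?s f f = 0" for f
    using bump_inner_kernel[OF lin_comb_monomials_polynomial[OF that(1)] that(2)] .
  have "\<exists>C\<ge>0. \<forall>f\<in>lin_comb (monomials M). ?N1 f \<le> C * ?s f f"
  proof (rule bump_inner.quadratic_bound[OF finite_monomials monomials_smooth])
    fix f g :: "real^'n \<Rightarrow> real" and c assume "f \<in> smooth_fns" "g \<in> smooth_fns"
    then show "?N1 (\<lambda>x. f x + c * g x) \<le> 2 * ?N1 f + 2 * c\<^sup>2 * ?N1 g"
      using N_lin[of f g c] smooth_fns_continuous by auto
  next
    fix f assume "f \<in> lin_comb (monomials M)" "?s f f = 0"
    then show "?N1 f = 0" using kernel[of f] by simp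
  qed auto
  then obtain C1 where C1: "0 \<le> C1" "\<And>f. f \<in> lin_comb (monomials M) \<Longrightarrow> ?N1 f \<le> C1 * ?s f f" by blast
  have "\<exists>C\<ge>0. \<forall>f\<in>lin_comb (monomials M). ?N2 f \<le> C * ?s f f"
  proof (rule bump_inner.quadratic_bound[OF finite_monomials monomials_smooth])
    fix f g :: "real^'n \<Rightarrow> real" and c assume "f \<in> smooth_fns" "g \<in> smooth_fns"
    then show "?N2 (\<lambda>x. f x + c * g x) \<le> 2 * ?N2 f + 2 * c\<^sup>2 * ?N2 g"
      using N_lin[OF smooth_fns_continuous_cgrad smooth_fns_continuous_cgrad, of f g c] by (simp add: cgrad_lin)
  next
    fix f assume "f \<in> lin_comb (monomials M)" "?s f f = 0"
    then have "f = (\<lambda>x. 0)" by (rule kernel)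
    moreover have "cgrad (\<lambda>x. 0) x = 0" for x :: "real^'n"
      by (simp add: cgrad_def vec_eq_iff)
    ultimately show "?N2 f = 0" by simp
  qed auto
  then obtain C2 where C2: "0 \<le> C2" "\<And>f. f \<in> lin_comb (monomials M) \<Longrightarrow> ?N2 f \<le> C2 * ?s f f" by blast
  show ?thesis
  proof (intro exI[of _ "C1 + C2"] conjI allI impI)
    fix p :: "real^'n \<Rightarrow> real" assume "pdeg M p"
    then have p: "p \<in> lin_comb (monomials M)" by (rule pdeg_lin_comb)
    have s0: "0 \<le> ?s p p" by (intro Bochner_Integration.integral_nonneg mult_nonneg_nonneg[OF bump_nonneg zero_le_square])
    have "?N1 p \<le> (C1 + C2) * ?s p p" "?N2 p \<le> (C1 + C2) * ?s p p"
      using C1(2)[OF p] C2(2)[OF p] mult_nonneg_nonneg[OF C1(1) s0] mult_nonneg_nonneg[OF C2(1) s0]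
      by (auto simp: distrib_right)
    then show "?N1 p \<le> (C1 + C2) * (LINT x|lborel. bump 0 1 x * (p x)\<^sup>2)"
      "?N2 p \<le> (C1 + C2) * (LINT x|lborel. bump 0 1 x * (p x)\<^sup>2)" by (simp_all add: power2_eq_square)
  qed (use C1 C2 in auto)
qed

lemma cgrad_scale:
  assumes "p \<in> smooth_fns"
  shows "cgrad (\<lambda>x. p (z + r *\<^sub>R x)) x = r *\<^sub>R cgrad p (z + r *\<^sub>R x)"
proof -
  have "(p has_derivative frechet_derivative p (at (z + r *\<^sub>R x))) (at (z + r *\<^sub>R x))"
    using smooth_fns_derivative[OF assms] by (simp add: frechet_derivative_works)
  moreover have "((\<lambda>x. z + r *\<^sub>R x) has_derivative (\<lambda>v. r *\<^sub>R v)) (at x)"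
    by (auto intro!: derivative_eq_intros)
  ultimately have "((\<lambda>x. p (z + r *\<^sub>R x)) has_derivative (\<lambda>v. frechet_derivative p (at (z + r *\<^sub>R x)) (r *\<^sub>R v))) (at x)"
    using has_derivative_compose by blast
  then have "frechet_derivative (\<lambda>x. p (z + r *\<^sub>R x)) (at x) = (\<lambda>v. frechet_derivative p (at (z + r *\<^sub>R x)) (r *\<^sub>R v))"
    by (rule frechet_derivative_at[symmetric])
  moreover have "linear (frechet_derivative p (at y))" for y
    using smooth_fns_derivative[OF assms] by (intro linear_frechet_derivative) blast
  ultimately show ?thesis
    by (simp add: vec_eq_iff cgrad_def linear_cmul)
qed

text \<open>Under the substitution z + r x all integrals change by the same power of r and the
  gradient gains one factor r, so the constant of the unit ball serves for every centre and
  radius.\<close>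

lemma ball_bounds:
  obtains C where "0 < C"
    "\<And>(p :: real^'n \<Rightarrow> real) z r. pdeg M p \<Longrightarrow> 0 < r \<Longrightarrow>
      (LINT x|lborel. indicator (ball z (\<Lambda> * r)) x * (p x)\<^sup>2) \<le> C * (LINT x|lborel. bump z r x * (p x)\<^sup>2)"
    "\<And>(p :: real^'n \<Rightarrow> real) z r. pdeg M p \<Longrightarrow> 0 < r \<Longrightarrow>
      r\<^sup>2 * (LINT x|lborel. indicator (ball z (\<Lambda> * r)) x * (norm (cgrad p x))\<^sup>2) \<le> C * (LINT x|lborel. bump z r x * (p x)\<^sup>2)"
proof -
  obtain C where C: "0 \<le> C" "\<And>p::real^'n \<Rightarrow> real. pdeg M p \<Longrightarrow>
     (LINT x|lborel. indicator (ball 0 \<Lambda>) x * (p x)\<^sup>2) \<le> C * (LINT x|lborel. bump 0 1 x * (p x)\<^sup>2)"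
    "\<And>p::real^'n \<Rightarrow> real. pdeg M p \<Longrightarrow>
     (LINT x|lborel. indicator (ball 0 \<Lambda>) x * (norm (cgrad p x))\<^sup>2) \<le> C * (LINT x|lborel. bump 0 1 x * (p x)\<^sup>2)"
    using unit_ball_bounds[of M \<Lambda>] by blast
  have main: "(LINT x|lborel. indicator (ball z (\<Lambda> * r)) x * (p x)\<^sup>2) \<le> C * (LINT x|lborel. bump z r x * (p x)\<^sup>2)"
    "r\<^sup>2 * (LINT x|lborel. indicator (ball z (\<Lambda> * r)) x * (norm (cgrad p x))\<^sup>2) \<le> C * (LINT x|lborel. bump z r x * (p x)\<^sup>2)"
    if p: "pdeg M p" and r: "0 < r" for p :: "real^'n \<Rightarrow> real" and z :: "real^'n" and r :: real
  proof -
    let ?q = "\<lambda>x. p (z + r *\<^sub>R x)" and ?n = "r ^ DIM(real^'n)"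
    have ps: "p \<in> smooth_fns" using p by (rule pdeg_smooth)
    have q: "pdeg M ?q" using pdeg_affine[OF p bounded_linear_scaleR_right[of r]] by simp
    have n: "0 \<le> ?n" using r by simp
    have ball: "indicator (ball z (\<Lambda> * r)) (z + r *\<^sub>R x) = (indicator (ball 0 \<Lambda>) x :: real)" for x :: "real^'n"
      using r by (simp add: indicator_def dist_norm mult.commute[of \<Lambda>])
    have [measurable]: "p \<in> borel_measurable borel" "cgrad p \<in> borel_measurable borel" "bump z r \<in> borel_measurable borel"
      using ps by (auto intro!: borel_measurable_continuous_onI smooth_fns_continuous smooth_fns_continuous_cgrad bump_smooth)
    have S: "(LINT x|lborel. bump z r x * (p x)\<^sup>2) = ?n * (LINT x|lborel. bump 0 1 x * (?q x)\<^sup>2)"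
      by (subst lborel_integral_scale[OF _ r, of _ z]) (measurable, simp add: bump_scale[OF r])
    have N1: "(LINT x|lborel. indicator (ball z (\<Lambda> * r)) x * (p x)\<^sup>2) = ?n * (LINT x|lborel. indicator (ball 0 \<Lambda>) x * (?q x)\<^sup>2)"
      by (subst lborel_integral_scale[OF _ r, of _ z])
         (auto simp: ball intro!: borel_measurable_times borel_measurable_indicator borel_measurable_power)
    have "r\<^sup>2 * (LINT x|lborel. indicator (ball z (\<Lambda> * r)) x * (norm (cgrad p x))\<^sup>2)
        = (LINT x|lborel. indicator (ball z (\<Lambda> * r)) x * (norm (r *\<^sub>R cgrad p x))\<^sup>2)"
      by (simp add: power_mult_distrib mult.left_commute)
    also have "\<dots> = ?n * (LINT x|lborel. indicator (ball 0 \<Lambda>) x * (norm (cgrad ?q x))\<^sup>2)"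
      by (subst lborel_integral_scale[OF _ r, of _ z])
         (auto simp: ball cgrad_scale[OF ps] intro!: borel_measurable_times borel_measurable_indicator borel_measurable_power)
    finally have N2: "r\<^sup>2 * (LINT x|lborel. indicator (ball z (\<Lambda> * r)) x * (norm (cgrad p x))\<^sup>2)
      = ?n * (LINT x|lborel. indicator (ball 0 \<Lambda>) x * (norm (cgrad ?q x))\<^sup>2)" .
    show "(LINT x|lborel. indicator (ball z (\<Lambda> * r)) x * (p x)\<^sup>2) \<le> C * (LINT x|lborel. bump z r x * (p x)\<^sup>2)"
      using mult_left_mono[OF C(2)[OF q] n] by (simp add: S N1 mult.left_commute)
    show "r\<^sup>2 * (LINT x|lborel. indicator (ball z (\<Lambda> * r)) x * (norm (cgrad p x))\<^sup>2) \<le> C * (LINT x|lborel. bump z r x * (p x)\<^sup>2)"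
      using mult_left_mono[OF C(3)[OF q] n] by (simp add: S N2 mult.left_commute)
  qed
  show ?thesis
  \<comment> \<open>Adding 1 makes the constant strictly positive.\<close>
  proof (rule that[of "C + 1"])
    fix p :: "real^'n \<Rightarrow> real" and z :: "real^'n" and r :: real assume p: "pdeg M p" "0 < r"
    have "0 \<le> (LINT x|lborel. bump z r x * (p x)\<^sup>2)" by (intro Bochner_Integration.integral_nonneg mult_nonneg_nonneg[OF bump_nonneg zero_le_power2])
    then show "(LINT x|lborel. indicator (ball z (\<Lambda> * r)) x * (p x)\<^sup>2) \<le> (C + 1) * (LINT x|lborel. bump z r x * (p x)\<^sup>2)"
      "r\<^sup>2 * (LINT x|lborel. indicator (ball z (\<Lambda> * r)) x * (norm (cgrad p x))\<^sup>2) \<le> (C + 1) * (LINT x|lborel. bump z r x * (p x)\<^sup>2)"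
      using main[OF p, of z] by (auto simp: distrib_right)
  qed (use C(1) in simp)
qed

section \<open>Local representatives and projections\<close>

lemma bounded_linear_frechet_component:
  fixes P :: "real^'n \<Rightarrow> real^'m"
  assumes "P differentiable (at x)"
  shows "(frechet_derivative P (at x) h) $ i = frechet_derivative (\<lambda>z. P z $ i) (at x) h"
proof -
  have "(P has_derivative frechet_derivative P (at x)) (at x)"
    using assms by (simp add: frechet_derivative_works)
  then have "((\<lambda>z. P z $ i) has_derivative (\<lambda>h. frechet_derivative P (at x) h $ i)) (at x)"
    by (rule bounded_linear.has_derivative[OF bounded_linear_vec_nth])
  from frechet_derivative_at[OF this] show ?thesis by (simp add: fun_eq_iff)
qed

lemma differentiable_componentwise_vec:
  fixes P :: "real^'n \<Rightarrow> real^'m"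
  assumes "\<And>i. (\<lambda>z. P z $ i) differentiable (at x)"
  shows "P differentiable (at x)"
proof -
  have "(\<lambda>z. P z \<bullet> b) differentiable (at x)" if b: "b \<in> Basis" for b
  proof -
    from b obtain i u where "b = axis i u" "u \<in> Basis" by (auto simp: Basis_vec_def)
    then have "(\<lambda>z. P z \<bullet> b) = (\<lambda>z. P z $ i)" by (auto simp: inner_axis)
    with assms show ?thesis by simp
  qed
  then show ?thesis by (subst differentiable_componentwise_within) auto
qed

definition vjac :: "(real^'n \<Rightarrow> real^'n) \<Rightarrow> real^'n \<Rightarrow> real^'n^'n" where
  "vjac v x = (\<chi> i. cgrad (\<lambda>z. v z $ i) x)"

definition vpdeg :: "nat \<Rightarrow> (real^'n \<Rightarrow> real^'n) \<Rightarrow> bool" where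
  "vpdeg m P \<longleftrightarrow> (\<forall>i. pdeg m (\<lambda>x. P x $ i))"

lemma vpdeg_differentiable: "vpdeg m P \<Longrightarrow> P differentiable (at x)"
  unfolding vpdeg_def using pdeg_derivative by (intro differentiable_componentwise_vec) blast

lemma vpdeg_frechet: "vpdeg m P \<Longrightarrow> frechet_derivative P (at x) h = vjac P x *v h"
proof -
  assume P: "vpdeg m P"
  have "(frechet_derivative P (at x) h) $ i = (vjac P x *v h) $ i" for i
  proof -
    have "(\<lambda>z. P z $ i) differentiable (at x)" using P pdeg_derivative by (auto simp: vpdeg_def)
    then show ?thesis
      by (simp add: bounded_linear_frechet_component[OF vpdeg_differentiable[OF P]]
          frechet_derivative_cgrad vjac_def matrix_vector_mult_def inner_vec_def)
  qed
  then show ?thesis by (simp add: vec_eq_iff)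
qed

lemma vec_space_poly_deg_vpdeg: "P \<in> vec_space (poly_deg m) \<Longrightarrow> vpdeg m P"
  by (auto simp: vec_space_def vpdeg_def poly_deg_pdeg)

lemma vpdeg_mono: "vpdeg m P \<Longrightarrow> m \<le> k \<Longrightarrow> vpdeg k P"
  by (auto simp: vpdeg_def intro: pdeg_mono)

lemma vpdeg_add: "vpdeg m P \<Longrightarrow> vpdeg m Q \<Longrightarrow> vpdeg m (\<lambda>x. P x + Q x)"
  and vpdeg_diff: "vpdeg m P \<Longrightarrow> vpdeg m Q \<Longrightarrow> vpdeg m (\<lambda>x. P x - Q x)"
  and vpdeg_scaleR: "vpdeg m P \<Longrightarrow> vpdeg m (\<lambda>x. r *\<^sub>R P x)"
  and vpdeg_scaleR_left: "pdeg m p \<Longrightarrow> vpdeg m (\<lambda>x. p x *\<^sub>R n)"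
  using pdeg_cmult[of m p "n $ _"]
  by (auto simp: vpdeg_def mult.commute[of "p _"] intro: pdeg.add pdeg_diff pdeg_cmult pdeg_uminus)

lemma vpdeg_cgrad: "pdeg m p \<Longrightarrow> vpdeg m (cgrad p)"
  using pdeg_derivative by (auto simp: vpdeg_def cgrad_def)

lemma pdeg_cgrad_nth: "pdeg m p \<Longrightarrow> pdeg m (\<lambda>x. cgrad p x $ j)"
  using vpdeg_cgrad by (auto simp: vpdeg_def)

lemma vpdeg_frechet_deg: "vpdeg m P \<Longrightarrow> vpdeg m (\<lambda>x. frechet_derivative P (at x) h)"
proof -
  assume P: "vpdeg m P"
  have "pdeg m (\<lambda>x. frechet_derivative P (at x) h $ i)" for i
    unfolding bounded_linear_frechet_component[OF vpdeg_differentiable[OF P]]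
    using P pdeg_derivative[of m "\<lambda>x. P x $ i"] by (auto simp: vpdeg_def)
  then show ?thesis by (simp add: vpdeg_def)
qed

lemma laplacian_component:
  assumes P: "vpdeg m P"
  shows "laplacian P x $ i = (\<Sum>j\<in>UNIV. cgrad (\<lambda>z. cgrad (\<lambda>y. P y $ i) z $ j) x $ j)"
    and "vpdeg m (laplacian P)"
proof -
  have fd: "frechet_derivative (\<lambda>z. frechet_derivative P (at z) e) (at x) e $ i =
      frechet_derivative (\<lambda>z. frechet_derivative (\<lambda>y. P y $ i) (at z) e) (at x) e" for e x i
    by (simp add: bounded_linear_frechet_component[OF vpdeg_differentiable[OF vpdeg_frechet_deg[OF P]]]
        bounded_linear_frechet_component[OF vpdeg_differentiable[OF P]])
  have Basis: "(Basis :: (real^'a) set) = (\<lambda>j. axis j 1) ` UNIV" by (auto simp: Basis_vec_def)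
  have inj: "inj (\<lambda>j. axis j 1 :: real^'a)" by (auto simp: inj_on_def axis_eq_axis)
  have L: "laplacian P x $ i = (\<Sum>j\<in>UNIV. frechet_derivative (\<lambda>z. frechet_derivative (\<lambda>y. P y $ i) (at z) (axis j 1)) (at x) (axis j 1))" for x i
    unfolding laplacian_def Basis by (simp add: sum.reindex[OF inj] fd)
  then show "laplacian P x $ i = (\<Sum>j\<in>UNIV. cgrad (\<lambda>z. cgrad (\<lambda>y. P y $ i) z $ j) x $ j)"
    by (simp add: cgrad_def)
  have "pdeg m (\<lambda>x. laplacian P x $ i)" for i
    unfolding L
  proof (rule pdeg_sum)
    fix j
    have "pdeg m (\<lambda>y. P y $ i)" using P by (simp add: vpdeg_def)
    then have "pdeg m (\<lambda>z. frechet_derivative (\<lambda>y. P y $ i) (at z) (axis j 1))" using pdeg_derivative by blast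
    then show "pdeg m (\<lambda>x. frechet_derivative (\<lambda>z. frechet_derivative (\<lambda>y. P y $ i) (at z) (axis j 1)) (at x) (axis j 1))"
      using pdeg_derivative by blast
  qed
  then show "vpdeg m (laplacian P)" by (simp add: vpdeg_def)
qed

lemma polynomial_function_vec:
  fixes P :: "real^'n \<Rightarrow> real^'m"
  assumes "\<And>i. real_polynomial_function (\<lambda>x. P x $ i)"
  shows "polynomial_function P"
proof -
  have "real_polynomial_function (\<lambda>x. P x \<bullet> b)" if b: "b \<in> Basis" for b
  proof -
    from b obtain i u where "b = axis i u" "u \<in> Basis" by (auto simp: Basis_vec_def)
    then have "(\<lambda>x. P x \<bullet> b) = (\<lambda>x. P x $ i)" by (auto simp: inner_axis)
    with assms show ?thesis by simp
  qed
  then show ?thesis by (simp add: polynomial_function_iff_Basis_inner)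
qed

lemma polynomial_AE_zero:
  fixes p :: "'a::euclidean_space \<Rightarrow> real"
  assumes p: "real_polynomial_function p" and K: "K \<in> sets lebesgue" "interior K \<noteq> {}"
    and z: "AE x in lebesgue_on K. p x = 0"
  shows "p = (\<lambda>x. 0)"
proof -
  obtain z r where r: "0 < r" "ball z r \<subseteq> K" using K(2) by (auto simp: mem_interior)
  have c: "continuous_on UNIV p"
    using p continuous_real_polymonial_function by (metis continuous_at_imp_continuous_on)
  have "AE x in lborel. x \<in> ball z r \<longrightarrow> p x = 0"
    using assms(4) unfolding AE_lebesgue_on_iff[OF K(1)] AE_completion_iff
    by eventually_elim (use r(2) in blast)
  from continuous_AE_zero[OF c open_ball this] polynomial_zero_on_ball[OF p r(1)] show ?thesis by blast
qed

text \<open>Two polynomials that agree almost everywhere on a set with interior points are equal, so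
  the definite description in \<open>loc\<close> is met by any polynomial that fits.\<close>

lemma loc_eqI:
  fixes v :: "'a::euclidean_space \<Rightarrow> 'b::euclidean_space"
  assumes K: "K \<in> sets lebesgue" "interior K \<noteq> {}"
    and P: "polynomial_function P" and eq: "AE x in lebesgue_on K. v x = P x"
  shows "loc K v = P"
  unfolding loc_def
proof (rule the_equality)
  show "polynomial_function P \<and> (AE x in lebesgue_on K. v x = P x)" using P eq by blast
  fix Q assume Q: "polynomial_function Q \<and> (AE x in lebesgue_on K. v x = Q x)"
  have "(\<lambda>x. (Q x - P x) \<bullet> b) = (\<lambda>x. 0)" for b
  proof (rule polynomial_AE_zero[OF _ K])
    have "polynomial_function (\<lambda>x. Q x - P x)" using P Q by (intro polynomial_function_diff) auto
    then show "real_polynomial_function (\<lambda>x. (Q x - P x) \<bullet> b)"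
      unfolding real_polynomial_function_eq by (intro polynomial_function_inner) auto
    have "AE x in lebesgue_on K. v x = Q x" using Q by blast
    with eq show "AE x in lebesgue_on K. (Q x - P x) \<bullet> b = 0" by eventually_elim auto
  qed
  then have "(Q x - P x) \<bullet> (Q x - P x) = 0" for x by metis
  then show "Q = P" by auto
qed

lemma loc_vec:
  fixes v :: "real^'n \<Rightarrow> real^'n"
  assumes "K \<in> sets lebesgue" "interior K \<noteq> {}" "K \<in> T" "v \<in> piecewise T (vec_space (poly_deg m))"
  shows "vpdeg m (loc K v)" "AE x in lebesgue_on K. v x = loc K v x"
proof -
  obtain P where P: "P \<in> vec_space (poly_deg m)" "AE x in lebesgue_on K. v x = P x"
    using assms(3,4) by (auto simp: piecewise_def)
  have "vpdeg m P" using P(1) by (rule vec_space_poly_deg_vpdeg)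
  then have "polynomial_function P"
    by (intro polynomial_function_vec) (auto simp: vpdeg_def intro: pdeg_polynomial)
  from loc_eqI[OF assms(1,2) this P(2)] P(2) \<open>vpdeg m P\<close>
  show "vpdeg m (loc K v)" "AE x in lebesgue_on K. v x = loc K v x" by simp_all
qed

lemma loc_scalar:
  fixes v :: "real^'n \<Rightarrow> real"
  assumes "K \<in> sets lebesgue" "interior K \<noteq> {}" "K \<in> T" "v \<in> piecewise T (poly_deg m)"
  shows "pdeg m (loc K v)" "AE x in lebesgue_on K. v x = loc K v x"
proof -
  obtain P where P: "P \<in> poly_deg m" "AE x in lebesgue_on K. v x = P x"
    using assms(3,4) by (auto simp: piecewise_def)
  have "pdeg m P" using P(1) by (rule poly_deg_pdeg)
  then have "polynomial_function P" using pdeg_polynomial real_polynomial_function_eq by blast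
  from loc_eqI[OF assms(1,2) this P(2)] P(2) \<open>pdeg m P\<close>
  show "pdeg m (loc K v)" "AE x in lebesgue_on K. v x = loc K v x" by simp_all
qed

section \<open>Polynomials in coordinates and the orthogonal projection onto them\<close>

lemma finite_multi_indices: "finite {\<alpha> :: 'n::finite \<Rightarrow> nat. sum \<alpha> UNIV \<le> m}"
proof (rule finite_subset)
  show "{\<alpha> :: 'n \<Rightarrow> nat. sum \<alpha> UNIV \<le> m} \<subseteq> PiE UNIV (\<lambda>_. {..m})"
  proof
    fix \<alpha> :: "'n \<Rightarrow> nat" assume "\<alpha> \<in> {\<alpha>. sum \<alpha> UNIV \<le> m}"
    moreover have "\<alpha> i \<le> sum \<alpha> UNIV" for i by (rule member_le_sum) auto
    ultimately have "\<alpha> i \<in> {..m}" for i using le_trans[of "\<alpha> i" "sum \<alpha> UNIV" m] by simp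
    then show "\<alpha> \<in> PiE UNIV (\<lambda>_. {..m})" by (simp add: PiE_UNIV_domain)
  qed
qed (simp add: finite_PiE)

text \<open>A finite generating set of exactly the space onto which \<open>proj\<close>
  projects.\<close>

definition power_products :: "nat \<Rightarrow> (real^'n \<Rightarrow> real) set" where
  "power_products m = (\<lambda>\<alpha> x. \<Prod>i\<in>UNIV. x $ i ^ \<alpha> i) ` {\<alpha>. sum \<alpha> UNIV \<le> m}"

lemma finite_power_products: "finite (power_products m)"
  unfolding power_products_def by (intro finite_imageI finite_multi_indices)

lemma poly_deg_eq_lin_comb: "(poly_deg m :: (real^'n \<Rightarrow> real) set) = lin_comb (power_products m)"
proof
  show "(poly_deg m :: (real^'n \<Rightarrow> real) set) \<subseteq> lin_comb (power_products m)"
  proof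
    fix p :: "real^'n \<Rightarrow> real" assume "p \<in> poly_deg m"
    then obtain a where p: "p = (\<lambda>x. \<Sum>\<alpha>\<in>{\<alpha>. sum \<alpha> UNIV \<le> m}. a \<alpha> * (\<Prod>i\<in>UNIV. x $ i ^ \<alpha> i))"
      by (auto simp: poly_deg_def)
    show "p \<in> lin_comb (power_products m)"
      unfolding p by (rule lin_comb_sum[OF finite_multi_indices], rule lin_comb_cmult, rule lin_comb_base)
        (auto simp: power_products_def)
  qed
  show "lin_comb (power_products m) \<subseteq> (poly_deg m :: (real^'n \<Rightarrow> real) set)"
  proof
    fix f :: "real^'n \<Rightarrow> real" assume "f \<in> lin_comb (power_products m)"
    then show "f \<in> poly_deg m"
    proof (induction rule: lin_comb.induct)
      case zero
      show ?case unfolding poly_deg_def by (intro CollectI exI[of _ "\<lambda>_. 0"]) simp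
    next
      case (step f b c)
      obtain a where a: "f = (\<lambda>x. \<Sum>\<alpha>\<in>{\<alpha>. sum \<alpha> UNIV \<le> m}. a \<alpha> * (\<Prod>i\<in>UNIV. x $ i ^ \<alpha> i))"
        using step.IH by (auto simp: poly_deg_def)
      obtain \<alpha>0 where \<alpha>0: "sum \<alpha>0 UNIV \<le> m" "b = (\<lambda>x. \<Prod>i\<in>UNIV. x $ i ^ \<alpha>0 i)"
        using step.hyps(2) by (auto simp: power_products_def)
      have eq: "c * b x = (\<Sum>\<alpha>\<in>{\<alpha>. sum \<alpha> UNIV \<le> m}. (if \<alpha> = \<alpha>0 then c else 0) * (\<Prod>i\<in>UNIV. x $ i ^ \<alpha> i))" for x
        using \<alpha>0 by (simp add: finite_multi_indices if_distrib[of "\<lambda>t. t * _"] sum.delta cong: if_cong)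
      have "(\<lambda>x. f x + c * b x) = (\<lambda>x. \<Sum>\<alpha>\<in>{\<alpha>. sum \<alpha> UNIV \<le> m}. (a \<alpha> + (if \<alpha> = \<alpha>0 then c else 0)) * (\<Prod>i\<in>UNIV. x $ i ^ \<alpha> i))"
        by (simp only: a eq sum.distrib distrib_right)
      then show ?case
        unfolding poly_deg_def by (intro CollectI exI[of _ "\<lambda>\<alpha>. a \<alpha> + (if \<alpha> = \<alpha>0 then c else 0)"])
    qed
  qed
qed

lemma poly_deg_smooth: "poly_deg m \<subseteq> smooth_fns"
  using poly_deg_pdeg pdeg_smooth by blast

lemma smooth_fns_L2:
  fixes f :: "real^'n \<Rightarrow> real"
  assumes "f \<in> smooth_fns" "compact K"
  shows "f \<in> L2 K"
proof -
  have c: "continuous_on K f" using assms(1) by (rule smooth_fns_continuous)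
  then have "bounded (f ` K)" using assms(2) by (intro compact_imp_bounded compact_continuous_image)
  then obtain B where "\<And>x. x \<in> K \<Longrightarrow> norm (f x) \<le> B" by (auto simp: bounded_iff)
  then show ?thesis
    using assms c by (intro L2_bounded[where B=B] continuous_imp_measurable_on_sets_lebesgue)
      (auto simp: lmeasurable_compact AE_lebesgue_on_iff fmeasurableD)
qed

lemma semi_inner_L2: "semi_inner (L2 K :: ('a::euclidean_space \<Rightarrow> real) set) (\<lambda>f g. LINT x|lebesgue_on K. f x * g x)"
proof
  fix f g h :: "'a \<Rightarrow> real" and c assume fg: "f \<in> L2 K" "g \<in> L2 K"
  show "(\<lambda>x. f x + c * g x) \<in> L2 K" using L2_add[OF fg(1) L2_scaleR[OF fg(2), of c]] by simp
  show "(LINT x|lebesgue_on K. f x * g x) = (LINT x|lebesgue_on K. g x * f x)" by (simp add: mult.commute)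
  assume h: "h \<in> L2 K"
  show "(LINT x|lebesgue_on K. (f x + c * g x) * h x) = (LINT x|lebesgue_on K. f x * h x) + c * (LINT x|lebesgue_on K. g x * h x)"
    using L2_mult_integrable[OF fg(1) h] L2_mult_integrable[OF fg(2) h] by (simp add: distrib_right mult.assoc)
qed (auto simp: L2_def intro!: Bochner_Integration.integral_nonneg)

lemma L2inner_components:
  fixes f g :: "'a::euclidean_space \<Rightarrow> real^'n"
  assumes "f \<in> L2 K" "g \<in> L2 K"
  shows "L2inner K f g = (\<Sum>i\<in>UNIV. LINT x|lebesgue_on K. f x $ i * g x $ i)"
  unfolding L2inner_def inner_vec_def
  using L2_mult_integrable[OF L2_component[OF assms(1)] L2_component[OF assms(2)]]
  by (subst Bochner_Integration.integral_sum) auto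

text \<open>Existence of the projection is componentwise by \<open>projection_exists\<close>;
  uniqueness holds because a polynomial of norm 0 on a set with interior points is 0. The conclusion
  makes projected data polynomials of bounded degree, so that residuals are polynomials.\<close>

lemma proj_poly:
  fixes f :: "real^'n \<Rightarrow> real^'n"
  assumes K: "compact K" "interior K \<noteq> {}" and f: "f \<in> L2 K"
  shows "vpdeg m (proj K m f)"
proof -
  interpret semi_inner "L2 K :: (real^'n \<Rightarrow> real) set" "\<lambda>f g. LINT x|lebesgue_on K. f x * g x"
    by (rule semi_inner_L2)
  have Ks: "K \<in> sets lebesgue" using K(1) by (simp add: fmeasurableD lmeasurable_compact)
  have L2p: "q \<in> L2 K" if "q \<in> poly_deg m" for q :: "real^'n \<Rightarrow> real"
    using that poly_deg_smooth smooth_fns_L2[OF _ K(1)] by blast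
  have L2v: "q \<in> L2 K" if "q \<in> vec_space (poly_deg m)" for q :: "real^'n \<Rightarrow> real^'n"
    using that L2p by (intro L2_componentwise) (auto simp: vec_space_def)
  have "\<exists>p\<in>poly_deg m. \<forall>q\<in>poly_deg m. (LINT x|lebesgue_on K. (f x $ i - p x) * q x) = 0" for i
    unfolding poly_deg_eq_lin_comb
  proof (rule projection_exists[OF finite_power_products])
    have "power_products m \<subseteq> poly_deg m" unfolding poly_deg_eq_lin_comb using lin_comb_base by blast
    then show "power_products m \<subseteq> L2 K" using L2p by blast
    show "(\<lambda>x. f x $ i) \<in> L2 K" using f by (rule L2_component)
  qed
  then have "\<forall>i. \<exists>p. p \<in> poly_deg m \<and> (\<forall>q\<in>poly_deg m. (LINT x|lebesgue_on K. (f x $ i - p x) * q x) = 0)"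
    by blast
  from choice[OF this] obtain P where P: "\<And>i. P i \<in> poly_deg m"
    "\<And>i q. q \<in> poly_deg m \<Longrightarrow> (LINT x|lebesgue_on K. (f x $ i - P i x) * q x) = 0"
    by blast
  let ?p = "\<lambda>x. \<chi> i. P i x"
  let ?good = "\<lambda>p. p \<in> vec_space (poly_deg m) \<and> (\<forall>q\<in>vec_space (poly_deg m). L2inner K (\<lambda>x. f x - p x) q = 0)"
  have p_in: "?p \<in> vec_space (poly_deg m)" using P by (simp add: vec_space_def)
  have "?good ?p"
  proof (intro conjI ballI p_in)
    fix q :: "real^'n \<Rightarrow> real^'n" assume q: "q \<in> vec_space (poly_deg m)"
    show "L2inner K (\<lambda>x. f x - ?p x) q = 0"
      using P(2) q by (subst L2inner_components[OF L2_diff[OF f L2v[OF p_in]] L2v[OF q]]) (auto simp: vec_space_def)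
  qed
  moreover have "p = ?p" if p: "?good p" for p :: "real^'n \<Rightarrow> real^'n"
  proof -
    let ?d = "\<lambda>x. p x - ?p x"
    have dc: "(\<lambda>x. ?d x $ i) \<in> poly_deg m" for i
    proof -
      have "(\<lambda>x. p x $ i) \<in> poly_deg m" using p by (simp add: vec_space_def)
      with P(1)[of i] show ?thesis
        unfolding poly_deg_eq_lin_comb using lin_comb_lin[of "P i" _ "\<lambda>x. p x $ i" "-1"] by simp
    qed
    then have d: "?d \<in> vec_space (poly_deg m)" by (simp add: vec_space_def)
    have fp: "(\<lambda>x. f x - p x) \<in> L2 K" and fP: "(\<lambda>x. f x - ?p x) \<in> L2 K"
      using f L2v p p_in by (auto intro: L2_diff)
    have i1: "integrable (lebesgue_on K) (\<lambda>x. (f x - p x) \<bullet> ?d x)" and i2: "integrable (lebesgue_on K) (\<lambda>x. (f x - ?p x) \<bullet> ?d x)"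
      using fp fP L2v[OF d] by (auto intro: L2_inner_integrable)
    \<comment> \<open>Both orthogonality relations are tested with the difference of the two
      candidates; subtracting them leaves its squared norm.\<close>
    have "(LINT x|lebesgue_on K. (f x - ?p x) \<bullet> ?d x - (f x - p x) \<bullet> ?d x) = 0"
      using p \<open>?good ?p\<close> d i1 i2 by (simp add: L2inner_def)
    moreover have "(f x - ?p x) \<bullet> ?d x - (f x - p x) \<bullet> ?d x = (norm (?d x))\<^sup>2" for x
      by (simp add: inner_diff_left[symmetric] power2_norm_eq_inner)
    ultimately have "(LINT x|lebesgue_on K. (norm (?d x))\<^sup>2) = 0" by simp
    then have "AE x in lebesgue_on K. (norm (?d x))\<^sup>2 = 0"
      using integral_nonneg_eq_0_iff_AE[OF L2_integrable[OF L2v[OF d]]] by simp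
    then have z: "AE x in lebesgue_on K. ?d x $ i = 0" for i by eventually_elim simp
    have "(\<lambda>x. ?d x $ i) = (\<lambda>x. 0)" for i
      by (rule polynomial_AE_zero[OF pdeg_polynomial[OF poly_deg_pdeg[OF dc]] Ks K(2) z])
    then show ?thesis by (simp add: fun_eq_iff vec_eq_iff)
  qed
  ultimately have "proj K m f = ?p" unfolding proj_def by (rule the_equality)
  then show ?thesis using p_in vec_space_poly_deg_vpdeg by metis
qed

section \<open>Weak residuals\<close>

lemma norm_matrix_vector_le:
  fixes A :: "real^'n^'m"
  shows "norm (A *v x) \<le> norm A * norm x"
proof -
  have "norm (A *v x) = L2_set (\<lambda>i. norm ((A *v x) $ i)) UNIV" by (simp add: norm_vec_def)
  also have "\<dots> \<le> L2_set (\<lambda>i. norm (A $ i) * norm x) UNIV"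
    by (intro L2_set_mono) (auto simp: matrix_vector_mul_component Cauchy_Schwarz_ineq2)
  also have "\<dots> = norm A * norm x"
    by (simp add: L2_set_left_distrib norm_vec_def)
  finally show ?thesis .
qed

lemma abs_trace_le: "\<bar>trace A\<bar> \<le> CARD('n) * norm A" for A :: "real^'n^'n"
proof -
  have "\<bar>trace A\<bar> \<le> (\<Sum>i\<in>UNIV. \<bar>A $ i $ i\<bar>)" unfolding trace_def by (rule sum_abs)
  also have "\<dots> \<le> (\<Sum>i\<in>(UNIV::'n set). norm A)"
  proof (rule sum_mono)
    fix i
    have "\<bar>A $ i $ i\<bar> \<le> norm (A $ i)" by (rule component_le_norm_cart)
    also have "\<dots> \<le> norm A" by (rule Finite_Cartesian_Product.norm_nth_le)
    finally show "\<bar>A $ i $ i\<bar> \<le> norm A" .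
  qed
  finally show ?thesis by simp
qed

lemma L2_matvec:
  fixes D :: "'a::euclidean_space \<Rightarrow> real^'n^'n"
  assumes D: "D \<in> L2 S" and c: "c \<in> borel_measurable (lebesgue_on S)" "AE x in lebesgue_on S. norm (c x) \<le> B"
  shows "(\<lambda>x. D x *v c x) \<in> L2 S"
proof (rule L2_bound)
  have "(\<lambda>x. D x $ i \<bullet> c x) \<in> borel_measurable (lebesgue_on S)" for i
    using borel_measurable_vec_nth_compose[OF L2_meas[OF D]] c(1) by (rule borel_measurable_inner)
  then show "(\<lambda>x. D x *v c x) \<in> borel_measurable (lebesgue_on S)"
    by (intro borel_measurable_componentwise) (simp add: matrix_vector_mul_component)
  show "(\<lambda>x. B *\<^sub>R norm (D x)) \<in> L2 S" using D by (intro L2_scaleR L2_norm)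
  show "AE x in lebesgue_on S. norm (D x *v c x) \<le> B *\<^sub>R norm (D x)"
    using c(2)
  proof eventually_elim
    case (elim x)
    have "norm (D x *v c x) \<le> norm (D x) * norm (c x)" by (rule norm_matrix_vector_le)
    also have "\<dots> \<le> norm (D x) * B" using elim by (intro mult_left_mono) auto
    finally show ?case by (simp add: mult.commute)
  qed
qed

lemma L2_trace: "D \<in> L2 S \<Longrightarrow> (\<lambda>x. trace (D x)) \<in> L2 S" for D :: "'a::euclidean_space \<Rightarrow> real^'n^'n"
  unfolding trace_def by (intro L2_sum L2_component) auto

text \<open>The integrand of right-hand side minus bilinear form. Gradient and pressure are separate
  arguments, so that it can be evaluated with weak gradients of errors as well as with classical
  Jacobians of local polynomials.\<close>

definition weak_res :: "real \<Rightarrow> real \<Rightarrow> 'n vfield \<Rightarrow> 'n vfield \<Rightarrow> (real^'n \<Rightarrow> real^'n^'n) \<Rightarrow>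
    'n sfield \<Rightarrow> 'n vfield \<Rightarrow> 'n vfield \<Rightarrow> real^'n \<Rightarrow> real" where
  "weak_res \<epsilon> \<kappa> c Y D P G \<xi> x = G x \<bullet> \<xi> x - \<epsilon> * (D x \<bullet> vjac \<xi> x)
     - (\<kappa> *\<^sub>R Y x + D x *v c x) \<bullet> \<xi> x + P x * trace (vjac \<xi> x)"

lemma weak_res_integrable:
  assumes "Y \<in> L2 S" "D \<in> L2 S" "P \<in> L2 S" "G \<in> L2 S" "\<xi> \<in> L2 S" "vjac \<xi> \<in> L2 S"
    "c \<in> borel_measurable (lebesgue_on S)" "AE x in lebesgue_on S. norm (c x) \<le> B"
  shows "integrable (lebesgue_on S) (weak_res \<epsilon> \<kappa> c Y D P G \<xi>)"
  unfolding weak_res_def[abs_def]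
  using assms
  by (intro Bochner_Integration.integrable_add Bochner_Integration.integrable_diff integrable_mult_right
      L2_inner_integrable L2_mult_integrable L2_add L2_scaleR L2_trace) (auto intro: L2_matvec)

lemma weak_res_diff:
  "weak_res \<epsilon> \<kappa> c (\<lambda>x. Y x - Y' x) (\<lambda>x. D x - D' x) (\<lambda>x. P x - P' x) (\<lambda>x. G x - G' x) \<xi> x =
    weak_res \<epsilon> \<kappa> c Y D P G \<xi> x - weak_res \<epsilon> \<kappa> c Y' D' P' G' \<xi> x"
  by (simp add: weak_res_def algebra_simps matrix_vector_mult_diff_rdistrib scaleR_diff_right
      inner_diff_left inner_add_left)

text \<open>Cauchy-Schwarz, with the terms sorted by what the test field contributes:
  \<open>D\<close> and \<open>P\<close> meet its gradient, whereas \<open>G\<close>,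
  \<open>Y\<close> and the convective term meet its values. The two groups later carry different
  powers of the radius.\<close>

lemma weak_res_bound:
  fixes c Y G \<xi> :: "real^'n \<Rightarrow> real^'n"
  assumes Y: "Y \<in> L2 S" and D: "D \<in> L2 S" and P: "P \<in> L2 S" and G: "G \<in> L2 S"
    and \<xi>: "\<xi> \<in> L2 S" and J: "vjac \<xi> \<in> L2 S"
    and c: "c \<in> borel_measurable (lebesgue_on S)" "AE x in lebesgue_on S. norm (c x) \<le> B"
    and nn: "0 \<le> \<epsilon>" "0 \<le> \<kappa>" "0 \<le> B"
  shows "(LINT x|lebesgue_on S. weak_res \<epsilon> \<kappa> c Y D P G \<xi> x)\<^sup>2
    \<le> (4 * \<epsilon>\<^sup>2 + 4 * (real CARD('n))\<^sup>2 + 4 + 8 * \<kappa> + 8 * B\<^sup>2) *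
      (((L2norm S D)\<^sup>2 + (L2norm S P)\<^sup>2) * (L2norm S (vjac \<xi>))\<^sup>2
       + ((L2norm S G)\<^sup>2 + \<kappa> * (L2norm S Y)\<^sup>2 + (L2norm S D)\<^sup>2) * (L2norm S \<xi>)\<^sup>2)"
proof -
  let ?n = "real CARD('n)"
  let ?K = "4 * \<epsilon>\<^sup>2 + 4 * ?n\<^sup>2 + 4 + 8 * \<kappa> + 8 * B\<^sup>2"
  let ?a = "\<lambda>x. \<epsilon> * norm (D x) + ?n * norm (P x)"
  let ?b = "\<lambda>x. norm (G x) + (\<kappa> * norm (Y x) + B * norm (D x))"
  have N: "(\<lambda>x. norm (Y x)) \<in> L2 S" "(\<lambda>x. norm (D x)) \<in> L2 S" "(\<lambda>x. norm (P x)) \<in> L2 S"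
    "(\<lambda>x. norm (G x)) \<in> L2 S" "(\<lambda>x. norm (\<xi> x)) \<in> L2 S" "(\<lambda>x. norm (vjac \<xi> x)) \<in> L2 S"
    by (intro L2_norm Y D P G \<xi> J)+
  have sc: "(\<lambda>x. r * f x) \<in> L2 S" if "f \<in> L2 S" for r and f :: "_ \<Rightarrow> real"
    using L2_scaleR[OF that, of r] by simp
  have nsc: "(L2norm S (\<lambda>x. r * norm (f x)))\<^sup>2 = r\<^sup>2 * (L2norm S f)\<^sup>2" for r and f :: "_ \<Rightarrow> 'b::euclidean_space"
    by (simp add: L2norm_squared power_mult_distrib)
  have nnorm: "L2norm S (\<lambda>x. norm (f x)) = L2norm S f" for f :: "_ \<Rightarrow> 'b::euclidean_space"
    by (simp add: L2norm_def)
  have aL: "?a \<in> L2 S" and bL: "?b \<in> L2 S" using N by (auto intro!: L2_add sc)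
  have a2: "(L2norm S ?a)\<^sup>2 \<le> 2 * \<epsilon>\<^sup>2 * (L2norm S D)\<^sup>2 + 2 * ?n\<^sup>2 * (L2norm S P)\<^sup>2"
    using L2norm_add_sq[OF sc[OF N(2), of \<epsilon>] sc[OF N(3), of ?n]] by (simp only: nsc)
  have b2: "(L2norm S ?b)\<^sup>2 \<le> 2 * (L2norm S G)\<^sup>2 + 4 * \<kappa>\<^sup>2 * (L2norm S Y)\<^sup>2 + 4 * B\<^sup>2 * (L2norm S D)\<^sup>2"
    using L2norm_add_sq[OF N(4) L2_add[OF sc[OF N(1), of \<kappa>] sc[OF N(2), of B]]]
      L2norm_add_sq[OF sc[OF N(1), of \<kappa>] sc[OF N(2), of B]] by (simp only: nsc nnorm)
  have iab: "integrable (lebesgue_on S) (\<lambda>x. ?a x * norm (vjac \<xi> x))" "integrable (lebesgue_on S) (\<lambda>x. ?b x * norm (\<xi> x))"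
    using aL bL N by (auto intro!: L2_mult_integrable)
  have "\<bar>LINT x|lebesgue_on S. weak_res \<epsilon> \<kappa> c Y D P G \<xi> x\<bar> \<le> (LINT x|lebesgue_on S. \<bar>weak_res \<epsilon> \<kappa> c Y D P G \<xi> x\<bar>)"
    by (rule integral_abs_bound)
  also have "\<dots> \<le> (LINT x|lebesgue_on S. ?a x * norm (vjac \<xi> x) + ?b x * norm (\<xi> x))"
  proof (rule integral_mono_AE)
    show "integrable (lebesgue_on S) (\<lambda>x. \<bar>weak_res \<epsilon> \<kappa> c Y D P G \<xi> x\<bar>)"
      by (intro integrable_abs weak_res_integrable[OF Y D P G \<xi> J c])
    show "integrable (lebesgue_on S) (\<lambda>x. ?a x * norm (vjac \<xi> x) + ?b x * norm (\<xi> x))"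
      using iab by simp
    show "AE x in lebesgue_on S. \<bar>weak_res \<epsilon> \<kappa> c Y D P G \<xi> x\<bar> \<le> ?a x * norm (vjac \<xi> x) + ?b x * norm (\<xi> x)"
      using c(2)
    proof eventually_elim
      case (elim x)
      have 1: "\<bar>G x \<bullet> \<xi> x\<bar> \<le> norm (G x) * norm (\<xi> x)" by (rule Cauchy_Schwarz_ineq2)
      have 2: "\<bar>\<epsilon> * (D x \<bullet> vjac \<xi> x)\<bar> \<le> \<epsilon> * (norm (D x) * norm (vjac \<xi> x))"
        using mult_left_mono[OF Cauchy_Schwarz_ineq2[of "D x" "vjac \<xi> x"] nn(1)] nn(1) by (simp add: abs_mult)
      have "\<bar>(\<kappa> *\<^sub>R Y x + D x *v c x) \<bullet> \<xi> x\<bar> \<le> norm (\<kappa> *\<^sub>R Y x + D x *v c x) * norm (\<xi> x)"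
        by (rule Cauchy_Schwarz_ineq2)
      also have "\<dots> \<le> (\<kappa> * norm (Y x) + B * norm (D x)) * norm (\<xi> x)"
      proof (rule mult_right_mono)
        have "norm (D x *v c x) \<le> norm (D x) * norm (c x)" by (rule norm_matrix_vector_le)
        also have "\<dots> \<le> norm (D x) * B" using elim by (intro mult_left_mono) auto
        finally show "norm (\<kappa> *\<^sub>R Y x + D x *v c x) \<le> \<kappa> * norm (Y x) + B * norm (D x)"
          using nn(2) norm_triangle_ineq[of "\<kappa> *\<^sub>R Y x" "D x *v c x"] by (simp add: mult.commute)
      qed simp
      finally have 3: "\<bar>(\<kappa> *\<^sub>R Y x + D x *v c x) \<bullet> \<xi> x\<bar> \<le> (\<kappa> * norm (Y x) + B * norm (D x)) * norm (\<xi> x)" .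
      have 4: "\<bar>P x * trace (vjac \<xi> x)\<bar> \<le> norm (P x) * (?n * norm (vjac \<xi> x))"
        by (simp add: abs_mult mult_left_mono abs_trace_le)
      have "\<bar>weak_res \<epsilon> \<kappa> c Y D P G \<xi> x\<bar> \<le> \<bar>G x \<bullet> \<xi> x\<bar> + \<bar>\<epsilon> * (D x \<bullet> vjac \<xi> x)\<bar>
          + \<bar>(\<kappa> *\<^sub>R Y x + D x *v c x) \<bullet> \<xi> x\<bar> + \<bar>P x * trace (vjac \<xi> x)\<bar>"
        unfolding weak_res_def by linarith
      also have "\<dots> \<le> ?a x * norm (vjac \<xi> x) + ?b x * norm (\<xi> x)"
        using 1 2 3 4 by (simp add: algebra_simps)
      finally show ?case .
    qed
  qed
  also have "\<dots> = (LINT x|lebesgue_on S. ?a x * norm (vjac \<xi> x)) + (LINT x|lebesgue_on S. ?b x * norm (\<xi> x))"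
    using iab by simp
  also have "\<dots> \<le> L2norm S ?a * L2norm S (vjac \<xi>) + L2norm S ?b * L2norm S \<xi>"
    using L2_Cauchy_Schwarz[OF aL N(6)] L2_Cauchy_Schwarz[OF bL N(5)] unfolding nnorm by linarith
  finally have "\<bar>LINT x|lebesgue_on S. weak_res \<epsilon> \<kappa> c Y D P G \<xi> x\<bar>
      \<le> L2norm S ?a * L2norm S (vjac \<xi>) + L2norm S ?b * L2norm S \<xi>" .
  then have "(LINT x|lebesgue_on S. weak_res \<epsilon> \<kappa> c Y D P G \<xi> x)\<^sup>2
      \<le> (L2norm S ?a * L2norm S (vjac \<xi>) + L2norm S ?b * L2norm S \<xi>)\<^sup>2"
    using power_mono[of "\<bar>LINT x|lebesgue_on S. weak_res \<epsilon> \<kappa> c Y D P G \<xi> x\<bar>" _ 2] by simp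
  also have "\<dots> \<le> 2 * ((L2norm S ?a)\<^sup>2 * (L2norm S (vjac \<xi>))\<^sup>2) + 2 * ((L2norm S ?b)\<^sup>2 * (L2norm S \<xi>)\<^sup>2)"
    using norm_add_sq_le[of "L2norm S ?a * L2norm S (vjac \<xi>)" "L2norm S ?b * L2norm S \<xi>"]
    by (simp add: power_mult_distrib)
  also have "\<dots> \<le> 2 * ((2 * \<epsilon>\<^sup>2 * (L2norm S D)\<^sup>2 + 2 * ?n\<^sup>2 * (L2norm S P)\<^sup>2) * (L2norm S (vjac \<xi>))\<^sup>2)
      + 2 * ((2 * (L2norm S G)\<^sup>2 + 4 * \<kappa>\<^sup>2 * (L2norm S Y)\<^sup>2 + 4 * B\<^sup>2 * (L2norm S D)\<^sup>2) * (L2norm S \<xi>)\<^sup>2)"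
    using a2 b2 by (intro add_mono mult_left_mono mult_right_mono) auto
  also have "\<dots> \<le> (?K * ((L2norm S D)\<^sup>2 + (L2norm S P)\<^sup>2)) * (L2norm S (vjac \<xi>))\<^sup>2
      + (?K * ((L2norm S G)\<^sup>2 + \<kappa> * (L2norm S Y)\<^sup>2 + (L2norm S D)\<^sup>2)) * (L2norm S \<xi>)\<^sup>2"
  proof -
    \<comment> \<open>The factor \<open>\<kappa>\<^sup>2\<close> is split: one
      \<open>\<kappa>\<close> goes into the constant and the other stays with the norm of
      \<open>Y\<close>. That weighted norm is part of the energy norm also when
      \<open>\<kappa>\<close> is 0, so no division by it occurs.\<close>
    have K: "4 * \<epsilon>\<^sup>2 \<le> ?K" "4 * ?n\<^sup>2 \<le> ?K" "4 \<le> ?K" "8 * \<kappa> \<le> ?K" "8 * B\<^sup>2 \<le> ?K"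
      using nn(2) zero_le_power2[of \<epsilon>] zero_le_power2[of ?n] zero_le_power2[of B] by linarith+
    have "2 * (2 * \<epsilon>\<^sup>2 * (L2norm S D)\<^sup>2 + 2 * ?n\<^sup>2 * (L2norm S P)\<^sup>2) \<le> ?K * ((L2norm S D)\<^sup>2 + (L2norm S P)\<^sup>2)"
      using mult_right_mono[OF K(1), of "(L2norm S D)\<^sup>2"] mult_right_mono[OF K(2), of "(L2norm S P)\<^sup>2"]
      by (simp add: distrib_left)
    then have 1: "2 * ((2 * \<epsilon>\<^sup>2 * (L2norm S D)\<^sup>2 + 2 * ?n\<^sup>2 * (L2norm S P)\<^sup>2) * (L2norm S (vjac \<xi>))\<^sup>2)
        \<le> (?K * ((L2norm S D)\<^sup>2 + (L2norm S P)\<^sup>2)) * (L2norm S (vjac \<xi>))\<^sup>2"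
      unfolding mult.assoc[of 2, symmetric] by (rule mult_right_mono) simp
    have "2 * (2 * (L2norm S G)\<^sup>2 + 4 * \<kappa>\<^sup>2 * (L2norm S Y)\<^sup>2 + 4 * B\<^sup>2 * (L2norm S D)\<^sup>2)
        \<le> ?K * ((L2norm S G)\<^sup>2 + \<kappa> * (L2norm S Y)\<^sup>2 + (L2norm S D)\<^sup>2)"
      using mult_right_mono[OF K(3), of "(L2norm S G)\<^sup>2"] mult_right_mono[OF K(4), of "\<kappa> * (L2norm S Y)\<^sup>2"]
        mult_right_mono[OF K(5), of "(L2norm S D)\<^sup>2"] nn(2)
      by (simp add: distrib_left power2_eq_square[of \<kappa>] mult.assoc)
    then have 2: "2 * ((2 * (L2norm S G)\<^sup>2 + 4 * \<kappa>\<^sup>2 * (L2norm S Y)\<^sup>2 + 4 * B\<^sup>2 * (L2norm S D)\<^sup>2) * (L2norm S \<xi>)\<^sup>2)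
        \<le> (?K * ((L2norm S G)\<^sup>2 + \<kappa> * (L2norm S Y)\<^sup>2 + (L2norm S D)\<^sup>2)) * (L2norm S \<xi>)\<^sup>2"
      unfolding mult.assoc[of 2, symmetric] by (rule mult_right_mono) simp
    from 1 2 show ?thesis by (rule add_mono)
  qed
  finally show ?thesis by (simp only: distrib_left[of ?K "_ * (L2norm S (vjac \<xi>))\<^sup>2"] mult.assoc)
qed

section \<open>Vector test functions and the representation of the error\<close>

lemma vtest_component: "\<xi> \<in> vec_space (test_functions \<Omega>) \<Longrightarrow> (\<lambda>x. \<xi> x $ i) \<in> test_functions \<Omega>"
  by (simp add: vec_space_def)

lemma vtest_support:
  fixes \<xi> :: "real^'n \<Rightarrow> real^'n"
  assumes "\<xi> \<in> vec_space (test_functions \<Omega>)"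
  obtains S where "compact S" "S \<subseteq> \<Omega>" "\<And>x. x \<notin> S \<Longrightarrow> \<xi> x = 0" "\<And>x. x \<notin> S \<Longrightarrow> vjac \<xi> x = 0"
proof -
  have "\<exists>S. compact S \<and> S \<subseteq> \<Omega> \<and> (\<forall>x. x \<notin> S \<longrightarrow> \<xi> x $ i = 0 \<and> cgrad (\<lambda>x. \<xi> x $ i) x = 0)" for i
    using test_functionsD[OF vtest_component[OF assms, of i]] by metis
  then have "\<forall>i. \<exists>S. compact S \<and> S \<subseteq> \<Omega> \<and> (\<forall>x. x \<notin> S \<longrightarrow> \<xi> x $ i = 0 \<and> cgrad (\<lambda>x. \<xi> x $ i) x = 0)" by blast
  from choice[OF this] obtain S where S: "\<And>i. compact (S i)" "\<And>i. S i \<subseteq> \<Omega>"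
    "\<And>i x. x \<notin> S i \<Longrightarrow> \<xi> x $ i = 0 \<and> cgrad (\<lambda>x. \<xi> x $ i) x = 0" by blast
  show ?thesis
    by (rule that[of "\<Union>i. S i"]) (use S in \<open>auto simp: vec_eq_iff vjac_def\<close>)
qed

lemma vtest_continuous:
  assumes "\<xi> \<in> vec_space (test_functions \<Omega>)"
  shows "continuous_on A \<xi>" "continuous_on A (vjac \<xi>)"
proof -
  have 1: "continuous_on A (\<lambda>x. \<xi> x $ i)" "continuous_on A (cgrad (\<lambda>x. \<xi> x $ i))" for i
    using test_functions_Ck[OF vtest_component[OF assms, of i], of 1]
    by (auto intro: Ck_1_continuous Ck_1_continuous_cgrad)
  have "continuous_on A (\<lambda>x. \<chi> i. \<xi> x $ i)" by (intro continuous_on_vec_lambda 1)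
  then show "continuous_on A \<xi>" by simp
  show "continuous_on A (vjac \<xi>)" unfolding vjac_def[abs_def] by (intro continuous_on_vec_lambda 1)
qed

lemma vtest_L2:
  fixes \<xi> :: "real^'n \<Rightarrow> real^'n"
  assumes "\<xi> \<in> vec_space (test_functions \<Omega>)" "A \<in> sets lebesgue"
  shows "\<xi> \<in> L2 A" "vjac \<xi> \<in> L2 A"
proof -
  obtain S where S: "compact S" "S \<subseteq> \<Omega>" "\<And>x. x \<notin> S \<Longrightarrow> \<xi> x = 0" "\<And>x. x \<notin> S \<Longrightarrow> vjac \<xi> x = 0"
    using vtest_support[OF assms(1)] by metis
  show "\<xi> \<in> L2 A" "vjac \<xi> \<in> L2 A"
    using S vtest_continuous[OF assms(1)] assms(2) by (auto intro: L2_continuous_compact_support)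
qed

lemma vtest_wGrad:
  fixes \<xi> :: "real^'n \<Rightarrow> real^'n"
  assumes "open \<Omega>" "\<xi> \<in> vec_space (test_functions \<Omega>)"
  shows "AE x in lebesgue_on \<Omega>. wGrad \<Omega> \<xi> x = vjac \<xi> x"
proof -
  have "AE x in lebesgue_on \<Omega>. wgrad \<Omega> (\<lambda>z. \<xi> z $ i) x = cgrad (\<lambda>z. \<xi> z $ i) x" for i
    using vtest_component[OF assms(2)] assms(1) test_functions_subset_H10 H10_subset_H1
    by (intro wgrad_eq_cgrad test_functions_Ck) blast+
  then have "AE x in lebesgue_on \<Omega>. \<forall>i\<in>UNIV. wgrad \<Omega> (\<lambda>z. \<xi> z $ i) x = cgrad (\<lambda>z. \<xi> z $ i) x"
    by (intro AE_finite_allI) auto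
  then show ?thesis by eventually_elim (simp add: wGrad_def vjac_def)
qed

lemma vtest_Vsp: "open \<Omega> \<Longrightarrow> \<xi> \<in> vec_space (test_functions \<Omega>) \<Longrightarrow> \<xi> \<in> Vsp \<Omega>"
  by (auto simp: vec_space_def intro: test_functions_subset_H10)

lemma wGrad_L2:
  assumes "open \<Omega>" "Y \<in> vec_space (H1 \<Omega>)"
  shows "wGrad \<Omega> Y \<in> L2 \<Omega>"
proof (rule L2_componentwise)
  fix i
  have "(\<lambda>z. Y z $ i) \<in> H1 \<Omega>" using assms(2) by (simp add: vec_space_def)
  from wgrad_weak(2)[OF assms(1) this] show "(\<lambda>x. wGrad \<Omega> Y x $ i) \<in> L2 \<Omega>" by (simp add: wGrad_def)
qed

lemma wGrad_diff:
  fixes Y Y' :: "real^'n \<Rightarrow> real^'n"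
  assumes "open \<Omega>" "Y \<in> vec_space (H1 \<Omega>)" "Y' \<in> vec_space (H1 \<Omega>)"
  shows "AE x in lebesgue_on \<Omega>. wGrad \<Omega> (\<lambda>x. Y x - Y' x) x = wGrad \<Omega> Y x - wGrad \<Omega> Y' x"
proof -
  have "AE x in lebesgue_on \<Omega>. wgrad \<Omega> (\<lambda>z. Y z $ i - Y' z $ i) x = wgrad \<Omega> (\<lambda>z. Y z $ i) x - wgrad \<Omega> (\<lambda>z. Y' z $ i) x" for i
    using assms by (intro wgrad_diff) (auto simp: vec_space_def)
  then have "AE x in lebesgue_on \<Omega>. \<forall>i\<in>UNIV. wgrad \<Omega> (\<lambda>z. Y z $ i - Y' z $ i) x = wgrad \<Omega> (\<lambda>z. Y z $ i) x - wgrad \<Omega> (\<lambda>z. Y' z $ i) x"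
    by (intro AE_finite_allI) auto
  then show ?thesis by eventually_elim (simp add: wGrad_def vec_eq_iff)
qed

lemma wGrad_eq_vjac:
  fixes Y P :: "real^'n \<Rightarrow> real^'n"
  assumes "open \<Omega>" "Y \<in> vec_space (H1 \<Omega>)" "open E" "E \<subseteq> \<Omega>" "vpdeg m P" "AE x in lebesgue_on E. Y x = P x"
  shows "AE x in lebesgue_on E. wGrad \<Omega> Y x = vjac P x"
proof -
  have "AE x in lebesgue_on E. wgrad \<Omega> (\<lambda>z. Y z $ i) x = cgrad (\<lambda>z. P z $ i) x" for i
  proof (rule wgrad_eq_cgrad[OF assms(1) _ assms(3,4)])
    show "(\<lambda>z. Y z $ i) \<in> H1 \<Omega>" using assms(2) by (simp add: vec_space_def)
    show "Ck 1 (\<lambda>z. P z $ i)" using assms(5) by (intro smooth_fns_Ck pdeg_smooth[of m]) (simp add: vpdeg_def)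
    show "AE x in lebesgue_on E. Y x $ i = P x $ i" using assms(6) by eventually_elim simp
  qed
  then have "AE x in lebesgue_on E. \<forall>i\<in>UNIV. wgrad \<Omega> (\<lambda>z. Y z $ i) x = cgrad (\<lambda>z. P z $ i) x"
    by (intro AE_finite_allI) auto
  then show ?thesis by eventually_elim (simp add: wGrad_def vjac_def)
qed

lemma vec_space_L2: "Y \<in> vec_space (H1 \<Omega>) \<Longrightarrow> Y \<in> L2 \<Omega>"
  using H1_subset_L2 by (intro L2_componentwise) (auto simp: vec_space_def)

lemma weak_res_eq_zero:
  fixes c Y G \<xi> :: "real^'n \<Rightarrow> real^'n"
  assumes \<Omega>: "open \<Omega>" and Y: "Y \<in> vec_space (H1 \<Omega>)" and P: "P \<in> L2 \<Omega>" and G: "G \<in> L2 \<Omega>"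
    and c: "c \<in> borel_measurable (lebesgue_on \<Omega>)" "AE x in lebesgue_on \<Omega>. norm (c x) \<le> B"
    and \<xi>: "\<xi> \<in> vec_space (test_functions \<Omega>)"
    and eq: "formA \<Omega> \<epsilon> \<kappa> c Y \<xi> - formB \<Omega> \<xi> P = L2inner \<Omega> G \<xi>"
  shows "(LINT x|lebesgue_on \<Omega>. weak_res \<epsilon> \<kappa> c Y (wGrad \<Omega> Y) P G \<xi> x) = 0"
proof -
  have s: "\<Omega> \<in> sets lebesgue" using \<Omega> by simp
  note J = vtest_wGrad[OF \<Omega> \<xi>]
  note L = vtest_L2[OF \<xi> s] vec_space_L2[OF Y] wGrad_L2[OF \<Omega> Y] P G
  have Dc: "(\<lambda>x. wGrad \<Omega> Y x *v c x) \<in> L2 \<Omega>" using L c by (intro L2_matvec)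
  have conv: "L2inner \<Omega> F (wGrad \<Omega> \<xi>) = (LINT x|lebesgue_on \<Omega>. F x \<bullet> vjac \<xi> x)" for F
  proof -
    have "AE x in lebesgue. (if x \<in> \<Omega> then F x \<bullet> wGrad \<Omega> \<xi> x else 0) = (if x \<in> \<Omega> then F x \<bullet> vjac \<xi> x else 0)"
      using J unfolding AE_lebesgue_on_iff[OF s] by eventually_elim auto
    from integrable_lebesgue_on_cong_AE(3)[OF s s this] show ?thesis by (simp add: L2inner_def)
  qed
  have conv_div: "formB \<Omega> \<xi> P = (LINT x|lebesgue_on \<Omega>. P x * trace (vjac \<xi> x))"
  proof -
    have "AE x in lebesgue. (if x \<in> \<Omega> then P x * wdiv \<Omega> \<xi> x else 0) = (if x \<in> \<Omega> then P x * trace (vjac \<xi> x) else 0)"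
      using J unfolding AE_lebesgue_on_iff[OF s] by eventually_elim (auto simp: wdiv_def)
    from integrable_lebesgue_on_cong_AE(3)[OF s s this] show ?thesis by (simp add: L2inner_def formB_def)
  qed
  have i: "integrable (lebesgue_on \<Omega>) (\<lambda>x. G x \<bullet> \<xi> x)" "integrable (lebesgue_on \<Omega>) (\<lambda>x. wGrad \<Omega> Y x \<bullet> vjac \<xi> x)"
    "integrable (lebesgue_on \<Omega>) (\<lambda>x. (\<kappa> *\<^sub>R Y x + wGrad \<Omega> Y x *v c x) \<bullet> \<xi> x)"
    "integrable (lebesgue_on \<Omega>) (\<lambda>x. P x * trace (vjac \<xi> x))"
    using L Dc by (auto intro!: L2_inner_integrable L2_mult_integrable L2_trace L2_add L2_scaleR)
  have "(LINT x|lebesgue_on \<Omega>. weak_res \<epsilon> \<kappa> c Y (wGrad \<Omega> Y) P G \<xi> x)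
      = (LINT x|lebesgue_on \<Omega>. G x \<bullet> \<xi> x) - \<epsilon> * (LINT x|lebesgue_on \<Omega>. wGrad \<Omega> Y x \<bullet> vjac \<xi> x)
      - (LINT x|lebesgue_on \<Omega>. (\<kappa> *\<^sub>R Y x + wGrad \<Omega> Y x *v c x) \<bullet> \<xi> x) + (LINT x|lebesgue_on \<Omega>. P x * trace (vjac \<xi> x))"
    unfolding weak_res_def using i by simp
  also have "\<dots> = L2inner \<Omega> G \<xi> - formA \<Omega> \<epsilon> \<kappa> c Y \<xi> + formB \<Omega> \<xi> P"
    unfolding conv_div formA_def conv by (simp add: L2inner_def)
  finally show ?thesis using eq by simp
qed

text \<open>The integrand is linear in its four field arguments and integrates to 0 at the exact
  solution, so the residual of any discrete quadruple is minus the weak form of the errors. Nothing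
  is required of the discrete scheme.\<close>

lemma weak_res_error:
  fixes c y yT G GT \<xi> :: "real^'n \<Rightarrow> real^'n"
  assumes \<Omega>: "open \<Omega>" and y: "y \<in> vec_space (H1 \<Omega>)" and p: "p \<in> L2 \<Omega>" and G: "G \<in> L2 \<Omega>"
    and yT: "yT \<in> vec_space (H1 \<Omega>)" and pT: "pT \<in> L2 \<Omega>" and GT: "GT \<in> L2 \<Omega>"
    and c: "c \<in> borel_measurable (lebesgue_on \<Omega>)" "AE x in lebesgue_on \<Omega>. norm (c x) \<le> B"
    and \<xi>: "\<xi> \<in> vec_space (test_functions \<Omega>)"
    and eq: "formA \<Omega> \<epsilon> \<kappa> c y \<xi> - formB \<Omega> \<xi> p = L2inner \<Omega> G \<xi>"
  shows "(LINT x|lebesgue_on \<Omega>. weak_res \<epsilon> \<kappa> c yT (wGrad \<Omega> yT) pT GT \<xi> x)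
    = - (LINT x|lebesgue_on \<Omega>. weak_res \<epsilon> \<kappa> c (\<lambda>x. y x - yT x) (wGrad \<Omega> (\<lambda>x. y x - yT x)) (\<lambda>x. p x - pT x) (\<lambda>x. G x - GT x) \<xi> x)"
proof -
  have s: "\<Omega> \<in> sets lebesgue" using \<Omega> by simp
  let ?w = "weak_res \<epsilon> \<kappa> c y (wGrad \<Omega> y) p G \<xi>" and ?wT = "weak_res \<epsilon> \<kappa> c yT (wGrad \<Omega> yT) pT GT \<xi>"
  let ?we = "weak_res \<epsilon> \<kappa> c (\<lambda>x. y x - yT x) (wGrad \<Omega> (\<lambda>x. y x - yT x)) (\<lambda>x. p x - pT x) (\<lambda>x. G x - GT x) \<xi>"
  have i: "integrable (lebesgue_on \<Omega>) ?w" "integrable (lebesgue_on \<Omega>) ?wT"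
    using vtest_L2[OF \<xi> s] vec_space_L2 wGrad_L2 assms by (auto intro!: weak_res_integrable)
  have "AE x in lebesgue. (if x \<in> \<Omega> then ?we x else 0) = (if x \<in> \<Omega> then ?w x - ?wT x else 0)"
    using wGrad_diff[OF \<Omega> y yT] unfolding AE_lebesgue_on_iff[OF s]
  proof eventually_elim
    case (elim x)
    show ?case
    proof (cases "x \<in> \<Omega>")
      case True
      with elim have "?we x = weak_res \<epsilon> \<kappa> c (\<lambda>x. y x - yT x) (\<lambda>x. wGrad \<Omega> y x - wGrad \<Omega> yT x) (\<lambda>x. p x - pT x) (\<lambda>x. G x - GT x) \<xi> x"
        by (simp add: weak_res_def)
      with True show ?thesis by (simp add: weak_res_diff)
    qed simp
  qed
  from integrable_lebesgue_on_cong_AE(3)[OF s s this]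
  have "integral\<^sup>L (lebesgue_on \<Omega>) ?we = integral\<^sup>L (lebesgue_on \<Omega>) ?w - integral\<^sup>L (lebesgue_on \<Omega>) ?wT"
    using i by simp
  then show ?thesis
    using weak_res_eq_zero[OF \<Omega> y p G c \<xi> eq] by simp
qed

section \<open>Elementwise integration by parts\<close>

text \<open>The divergence of \<open>flux\<close>, already expanded by the product rule.\<close>

definition strong_div :: "real \<Rightarrow> (real^'n \<Rightarrow> real^'n) \<Rightarrow> (real^'n \<Rightarrow> real) \<Rightarrow> (real^'n \<Rightarrow> real^'n) \<Rightarrow> real^'n \<Rightarrow> real" where
  "strong_div \<epsilon> P \<pi> \<xi> x = - \<epsilon> * (vjac P x \<bullet> vjac \<xi> x) - \<epsilon> * (laplacian P x \<bullet> \<xi> x)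
     + \<pi> x * trace (vjac \<xi> x) + cgrad \<pi> x \<bullet> \<xi> x"

text \<open>The j-th component of the field whose normal component is the face flux in the jump
  terms, paired with the test field.\<close>

definition flux :: "real \<Rightarrow> (real^'n \<Rightarrow> real^'n) \<Rightarrow> (real^'n \<Rightarrow> real) \<Rightarrow> (real^'n \<Rightarrow> real^'n) \<Rightarrow> 'n \<Rightarrow> real^'n \<Rightarrow> real" where
  "flux \<epsilon> P \<pi> \<xi> j x = (\<Sum>i\<in>UNIV. (- \<epsilon> * cgrad (\<lambda>z. P z $ i) x $ j) * \<xi> x $ i) + \<pi> x * \<xi> x $ j"

lemma C1_compact_add:
  assumes "C1_compact f" "C1_compact g"
  shows "C1_compact (\<lambda>x. f x + g x)"
    and "frechet_derivative (\<lambda>x. f x + g x) (at x) v = frechet_derivative f (at x) v + frechet_derivative g (at x) v"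
proof -
  note d = C1_compact_differentiable[OF assms(1)] C1_compact_differentiable[OF assms(2)]
  have D: "((\<lambda>x. f x + g x) has_derivative (\<lambda>v. frechet_derivative f (at x) v + frechet_derivative g (at x) v)) (at x)" for x
    using d by (intro has_derivative_add) (auto simp: frechet_derivative_works)
  then have fd: "frechet_derivative (\<lambda>x. f x + g x) (at x) = (\<lambda>v. frechet_derivative f (at x) v + frechet_derivative g (at x) v)" for x
    by (rule frechet_derivative_at[symmetric])
  then show "frechet_derivative (\<lambda>x. f x + g x) (at x) v = frechet_derivative f (at x) v + frechet_derivative g (at x) v"
    by simp
  obtain R R' where R: "\<And>x. x \<notin> cball 0 R \<Longrightarrow> f x = 0" "\<And>x. x \<notin> cball 0 R' \<Longrightarrow> g x = 0"
    using assms by (auto simp: C1_compact_def)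
  have "f x + g x = 0" if "x \<notin> cball 0 (max R R')" for x
    using that R by auto
  moreover have "Ck 1 (\<lambda>x. f x + g x)"
    using differentiableI[OF D] C1_compact_continuous_derivative[OF assms(1)] C1_compact_continuous_derivative[OF assms(2)]
    by (auto simp: fd intro!: continuous_intros)
  ultimately show "C1_compact (\<lambda>x. f x + g x)" unfolding C1_compact_def by blast
qed

lemma C1_compact_zero: "C1_compact (\<lambda>x::real^'m. 0)"
  and frechet_derivative_zero: "frechet_derivative (\<lambda>x. 0::real) (at (x::real^'n)) v = 0"
proof -
  have fd: "frechet_derivative (\<lambda>x. 0::real) (at x) = (\<lambda>h. 0)" for x :: "real^'n"
    by (rule frechet_derivative_at[symmetric]) auto
  then show "frechet_derivative (\<lambda>x. 0::real) (at (x::real^'n)) v = 0" by simp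
  have "frechet_derivative (\<lambda>x. 0::real) (at x) = (\<lambda>h. 0)" for x :: "real^'m"
    by (rule frechet_derivative_at[symmetric]) auto
  then show "C1_compact (\<lambda>x::real^'m. 0)" by (auto simp: C1_compact_def)
qed

lemma C1_compact_sum:
  assumes "finite I" "\<And>i. i \<in> I \<Longrightarrow> C1_compact (f i)"
  shows "C1_compact (\<lambda>x. \<Sum>i\<in>I. f i x) \<and>
    (\<forall>x v. frechet_derivative (\<lambda>x. \<Sum>i\<in>I. f i x) (at x) v = (\<Sum>i\<in>I. frechet_derivative (f i) (at x) v))"
  using assms
proof (induction I rule: finite_induct)
  case empty
  show ?case by (simp add: C1_compact_zero frechet_derivative_zero)
next
  case (insert j I)
  then have "C1_compact (f j)" "C1_compact (\<lambda>x. \<Sum>i\<in>I. f i x)" by auto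
  from C1_compact_add[OF this] insert show ?case by simp
qed

lemma flux_C1:
  assumes P: "vpdeg m P" and \<pi>: "pdeg m \<pi>" and \<xi>: "\<And>i. C1_compact (\<lambda>x. \<xi> x $ i)"
  shows "C1_compact (flux \<epsilon> P \<pi> \<xi> j)"
    and "(\<Sum>j\<in>UNIV. frechet_derivative (flux \<epsilon> P \<pi> \<xi> j) (at x) (axis j 1)) = strong_div \<epsilon> P \<pi> \<xi> x"
proof -
  have Pi: "pdeg m (\<lambda>x. P x $ i)" for i using P by (simp add: vpdeg_def)
  have dP: "Ck 1 (\<lambda>x. - \<epsilon> * cgrad (\<lambda>z. P z $ i) x $ j)" for i j
    by (intro smooth_fns_Ck pdeg_smooth[of m] pdeg_cmult pdeg_cgrad_nth Pi)
  have dP': "frechet_derivative (\<lambda>x. - \<epsilon> * cgrad (\<lambda>z. P z $ i) x $ j) (at x) v = - \<epsilon> * frechet_derivative (\<lambda>x. cgrad (\<lambda>z. P z $ i) x $ j) (at x) v" for i j x v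
  proof -
    have "(\<lambda>x. cgrad (\<lambda>z. P z $ i) x $ j) differentiable (at x)"
      using pdeg_derivative[OF pdeg_cgrad_nth[OF Pi]] by blast
    then have "((\<lambda>x. - \<epsilon> * cgrad (\<lambda>z. P z $ i) x $ j) has_derivative (\<lambda>v. - \<epsilon> * frechet_derivative (\<lambda>x. cgrad (\<lambda>z. P z $ i) x $ j) (at x) v)) (at x)"
      by (intro has_derivative_mult_right) (simp add: frechet_derivative_works)
    from frechet_derivative_at[OF this] show ?thesis by (simp add: fun_eq_iff)
  qed
  have \<pi>1: "Ck 1 \<pi>" using \<pi> by (intro smooth_fns_Ck pdeg_smooth)
  have Ck\<xi>: "Ck 1 (\<lambda>x. \<xi> x $ i)" for i using \<xi> by (simp add: C1_compact_def)
  have t1: "C1_compact (\<lambda>x. (- \<epsilon> * cgrad (\<lambda>z. P z $ i) x $ j) * \<xi> x $ i)" for i j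
    by (intro C1_compact_mult dP \<xi>)
  have t2: "C1_compact (\<lambda>x. \<pi> x * \<xi> x $ j)" for j by (intro C1_compact_mult \<pi>1 \<xi>)
  have sum: "C1_compact (\<lambda>x. \<Sum>i\<in>UNIV. (- \<epsilon> * cgrad (\<lambda>z. P z $ i) x $ j) * \<xi> x $ i) \<and>
    (\<forall>x v. frechet_derivative (\<lambda>x. \<Sum>i\<in>UNIV. (- \<epsilon> * cgrad (\<lambda>z. P z $ i) x $ j) * \<xi> x $ i) (at x) v =
      (\<Sum>i\<in>UNIV. frechet_derivative (\<lambda>x. (- \<epsilon> * cgrad (\<lambda>z. P z $ i) x $ j) * \<xi> x $ i) (at x) v))" for j
    by (rule C1_compact_sum) (use t1 in auto)
  show "C1_compact (flux \<epsilon> P \<pi> \<xi> j)"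
    unfolding flux_def[abs_def] by (rule C1_compact_add(1)[OF conjunct1[OF sum] t2])
  have fdflux: "frechet_derivative (flux \<epsilon> P \<pi> \<xi> j) (at x) v =
     (\<Sum>i\<in>UNIV. (- \<epsilon> * cgrad (\<lambda>z. P z $ i) x $ j) * frechet_derivative (\<lambda>x. \<xi> x $ i) (at x) v
        + (- \<epsilon> * frechet_derivative (\<lambda>x. cgrad (\<lambda>z. P z $ i) x $ j) (at x) v) * \<xi> x $ i)
     + (\<pi> x * frechet_derivative (\<lambda>x. \<xi> x $ j) (at x) v + frechet_derivative \<pi> (at x) v * \<xi> x $ j)" for j v
  proof -
    have "frechet_derivative (flux \<epsilon> P \<pi> \<xi> j) (at x) v =
      (\<Sum>i\<in>UNIV. frechet_derivative (\<lambda>x. (- \<epsilon> * cgrad (\<lambda>z. P z $ i) x $ j) * \<xi> x $ i) (at x) v)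
      + frechet_derivative (\<lambda>x. \<pi> x * \<xi> x $ j) (at x) v"
      unfolding flux_def[abs_def] C1_compact_add(2)[OF conjunct1[OF sum] t2] using sum[of j] by simp
    then show ?thesis
      by (simp only: Ck_1_mult(2)[OF dP Ck\<xi>] Ck_1_mult(2)[OF \<pi>1 Ck\<xi>] dP')
  qed
  have "(\<Sum>j\<in>UNIV. frechet_derivative (flux \<epsilon> P \<pi> \<xi> j) (at x) (axis j 1)) =
    - \<epsilon> * (\<Sum>j\<in>UNIV. \<Sum>i\<in>UNIV. cgrad (\<lambda>z. P z $ i) x $ j * cgrad (\<lambda>z. \<xi> z $ i) x $ j)
    - \<epsilon> * (\<Sum>j\<in>UNIV. \<Sum>i\<in>UNIV. cgrad (\<lambda>z. cgrad (\<lambda>y. P y $ i) z $ j) x $ j * \<xi> x $ i)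
    + \<pi> x * (\<Sum>j\<in>UNIV. cgrad (\<lambda>z. \<xi> z $ j) x $ j) + (\<Sum>j\<in>UNIV. cgrad \<pi> x $ j * \<xi> x $ j)"
    unfolding fdflux
    by (simp add: cgrad_def sum.distrib sum_distrib_left sum_subtractf sum_negf algebra_simps)
  also have "\<dots> = strong_div \<epsilon> P \<pi> \<xi> x"
    unfolding strong_div_def inner_vec_def[of "vjac P x"] inner_vec_def[of "vjac P x $ _"] inner_vec_def[of "laplacian P x"] inner_vec_def[of "cgrad \<pi> x"]
      laplacian_component(1)[OF P]
    by (subst (1 2) sum.swap) (simp add: vjac_def trace_def sum_distrib_right)
  finally show "(\<Sum>j\<in>UNIV. frechet_derivative (flux \<epsilon> P \<pi> \<xi> j) (at x) (axis j 1)) = strong_div \<epsilon> P \<pi> \<xi> x" .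
qed

lemma strong_div_integrable:
  assumes "vpdeg m P" "pdeg m \<pi>" "\<And>i. C1_compact (\<lambda>x. \<xi> x $ i)" "S \<in> sets borel"
  shows "integrable lborel (\<lambda>x. indicator S x * strong_div \<epsilon> P \<pi> \<xi> x)"
  unfolding flux_C1(2)[OF assms(1-3), symmetric] sum_distrib_left
  using flux_C1(1)[OF assms(1-3)] assms(4)
  by (intro Bochner_Integration.integrable_sum integrable_indicator_derivative)

lemma flux_normal:
  "(\<Sum>j\<in>UNIV. n $ j * flux \<epsilon> P \<pi> \<xi> j x) = (- \<epsilon> *\<^sub>R (vjac P x *v n) + \<pi> x *\<^sub>R n) \<bullet> \<xi> x"
proof -
  let ?A = "\<lambda>j i. - \<epsilon> * cgrad (\<lambda>z. P z $ i) x $ j * n $ j * \<xi> x $ i"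
  have "(\<Sum>j\<in>UNIV. n $ j * flux \<epsilon> P \<pi> \<xi> j x) = (\<Sum>j\<in>UNIV. \<Sum>i\<in>UNIV. ?A j i) + (\<Sum>j\<in>UNIV. \<pi> x * n $ j * \<xi> x $ j)"
    unfolding flux_def distrib_left sum.distrib sum_distrib_left
    by (intro arg_cong2[where f="(+)"] sum.cong refl) (simp_all only: ac_simps)
  also have "(\<Sum>j\<in>UNIV. \<Sum>i\<in>UNIV. ?A j i) = (\<Sum>i\<in>UNIV. \<Sum>j\<in>UNIV. ?A j i)" by (rule sum.swap)
  also have "\<dots> = (- \<epsilon> *\<^sub>R (vjac P x *v n)) \<bullet> \<xi> x"
    by (simp add: inner_vec_def vjac_def matrix_vector_mult_def sum_distrib_left sum_distrib_right mult.assoc sum_negf)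
  also have "(\<Sum>j\<in>UNIV. \<pi> x * n $ j * \<xi> x $ j) = (\<pi> x *\<^sub>R n) \<bullet> \<xi> x"
    by (simp add: inner_vec_def mult.assoc sum_distrib_left)
  finally show ?thesis by (simp only: inner_add_left)
qed

lemma hyper_int_sum:
  fixes \<phi> :: "'i \<Rightarrow> real^'n \<Rightarrow> real"
  assumes "finite I" "\<And>i. i \<in> I \<Longrightarrow> C1_compact (\<phi> i)" "norm n = 1" "0 < \<delta>"
  shows "hyper_int n t \<delta> (\<lambda>x. \<Sum>i\<in>I. k i * \<phi> i x) = (\<Sum>i\<in>I. k i * hyper_int n t \<delta> (\<phi> i))"
proof -
  let ?S = "{x. t \<le> n \<bullet> x \<and> n \<bullet> x \<le> t + \<delta>}"
  have "(LINT x|lborel. indicator ?S x * (\<Sum>i\<in>I. k i * \<phi> i (hyper_proj n t x)))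
     = (LINT x|lborel. (\<Sum>i\<in>I. k i * (indicator ?S x * \<phi> i (hyper_proj n t x))))"
    by (simp add: sum_distrib_left mult.left_commute)
  also have "\<dots> = (\<Sum>i\<in>I. k i * (LINT x|lborel. indicator ?S x * \<phi> i (hyper_proj n t x)))"
  proof -
    have "integrable lborel (\<lambda>x. k i * (indicator ?S x * \<phi> i (hyper_proj n t x)))" if "i \<in> I" for i
      by (rule integrable_mult_right, rule integral_halfspace_normal_derivative(2)[OF assms(2)[OF that] assms(3,4)])
    then show ?thesis by (subst Bochner_Integration.integral_sum) auto
  qed
  finally show ?thesis by (simp add: hyper_int_def sum_distrib_left mult.left_commute)
qed

lemma integral_strong_div_halfspace:
  assumes P: "vpdeg m P" and \<pi>: "pdeg m \<pi>" and \<xi>: "\<And>i. C1_compact (\<lambda>x. \<xi> x $ i)"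
    and n: "norm n = 1" and \<delta>: "0 < \<delta>"
  shows "(LINT x|lborel. indicator {x. n \<bullet> x < t} x * strong_div \<epsilon> P \<pi> \<xi> x) =
      hyper_int n t \<delta> (\<lambda>x. (- \<epsilon> *\<^sub>R (vjac P x *v n) + \<pi> x *\<^sub>R n) \<bullet> \<xi> x)"
    and "(LINT x|lborel. indicator {x. t < n \<bullet> x} x * strong_div \<epsilon> P \<pi> \<xi> x) =
      - hyper_int n t \<delta> (\<lambda>x. (- \<epsilon> *\<^sub>R (vjac P x *v n) + \<pi> x *\<^sub>R n) \<bullet> \<xi> x)"
proof -
  note fl = flux_C1[OF P \<pi> \<xi>]
  have "(LINT x|lborel. indicator {x. n \<bullet> x < t} x * strong_div \<epsilon> P \<pi> \<xi> x) =
    (\<Sum>j\<in>UNIV. (LINT x|lborel. indicator {x. n \<bullet> x < t} x * frechet_derivative (flux \<epsilon> P \<pi> \<xi> j) (at x) (axis j 1)))"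
    unfolding fl(2)[symmetric] sum_distrib_left
    using integrable_indicator_derivative[OF fl(1)] by (subst Bochner_Integration.integral_sum) auto
  also have "\<dots> = (\<Sum>j\<in>UNIV. n $ j * hyper_int n t \<delta> (flux \<epsilon> P \<pi> \<xi> j))"
    by (simp add: integral_halfspace_derivative[OF fl(1) n \<delta>] inner_axis)
  also have "\<dots> = hyper_int n t \<delta> (\<lambda>x. \<Sum>j\<in>UNIV. n $ j * flux \<epsilon> P \<pi> \<xi> j x)"
    using fl(1) n \<delta> by (intro hyper_int_sum[symmetric]) auto
  finally show lower: "(LINT x|lborel. indicator {x. n \<bullet> x < t} x * strong_div \<epsilon> P \<pi> \<xi> x) =
      hyper_int n t \<delta> (\<lambda>x. (- \<epsilon> *\<^sub>R (vjac P x *v n) + \<pi> x *\<^sub>R n) \<bullet> \<xi> x)"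
    by (simp only: flux_normal)
  have gt: "{x. t < n \<bullet> x} \<in> sets borel" by (intro borel_open open_halfspace_gt)
  have i1: "integrable lborel (\<lambda>x. indicator {x. n \<bullet> x < t} x * strong_div \<epsilon> P \<pi> \<xi> x)"
    and i2: "integrable lborel (\<lambda>x. indicator {x. t < n \<bullet> x} x * strong_div \<epsilon> P \<pi> \<xi> x)"
    and i3: "integrable lborel (strong_div \<epsilon> P \<pi> \<xi>)"
    using strong_div_integrable[OF P \<pi> \<xi>, of "{x. n \<bullet> x < t}"] strong_div_integrable[OF P \<pi> \<xi> gt] strong_div_integrable[OF P \<pi> \<xi>, of UNIV]
    by auto
  \<comment> \<open>Over the whole space the divergence of a compactly supported field integrates to
    0. The upper half-space thus contributes the negative of the lower one, with the same
    normal.\<close>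
  have "0 = (\<Sum>j\<in>UNIV. (LINT x|lborel. frechet_derivative (flux \<epsilon> P \<pi> \<xi> j) (at x) (axis j 1)))"
    by (simp add: integral_C1_compact_derivative(1)[OF fl(1)])
  also have "\<dots> = (LINT x|lborel. strong_div \<epsilon> P \<pi> \<xi> x)"
    unfolding fl(2)[symmetric]
    using integral_C1_compact_derivative(2)[OF fl(1)] by (subst Bochner_Integration.integral_sum) auto
  also have "\<dots> = (LINT x|lborel. indicator {x. n \<bullet> x < t} x * strong_div \<epsilon> P \<pi> \<xi> x + indicator {x. t < n \<bullet> x} x * strong_div \<epsilon> P \<pi> \<xi> x)"
  proof (rule integral_cong_AE)
    have "n \<noteq> 0" using n by auto
    from AE_lborel_hyperplane[OF this, of t]
    show "AE x in lborel. strong_div \<epsilon> P \<pi> \<xi> x = indicator {x. n \<bullet> x < t} x * strong_div \<epsilon> P \<pi> \<xi> x + indicator {x. t < n \<bullet> x} x * strong_div \<epsilon> P \<pi> \<xi> x"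
      by eventually_elim (auto simp: indicator_def)
    show "strong_div \<epsilon> P \<pi> \<xi> \<in> borel_measurable lborel" using i3 by (rule borel_measurable_integrable)
    show "(\<lambda>x. indicator {x. n \<bullet> x < t} x * strong_div \<epsilon> P \<pi> \<xi> x + indicator {x. t < n \<bullet> x} x * strong_div \<epsilon> P \<pi> \<xi> x) \<in> borel_measurable lborel"
      using i1 i2 by (intro borel_measurable_add) (rule borel_measurable_integrable, assumption)+
  qed
  also have "\<dots> = (LINT x|lborel. indicator {x. n \<bullet> x < t} x * strong_div \<epsilon> P \<pi> \<xi> x) + (LINT x|lborel. indicator {x. t < n \<bullet> x} x * strong_div \<epsilon> P \<pi> \<xi> x)"
    using i1 i2 by simp
  finally show "(LINT x|lborel. indicator {x. t < n \<bullet> x} x * strong_div \<epsilon> P \<pi> \<xi> x) =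
      - hyper_int n t \<delta> (\<lambda>x. (- \<epsilon> *\<^sub>R (vjac P x *v n) + \<pi> x *\<^sub>R n) \<bullet> \<xi> x)"
    using lower by linarith
qed

section \<open>Local estimates\<close>

lemma C1_compact_flux_normal:
  assumes P: "vpdeg m P" and \<pi>: "pdeg m \<pi>" and \<xi>: "\<And>i. C1_compact (\<lambda>x. \<xi> x $ i)"
  shows "C1_compact (\<lambda>x. (- \<epsilon> *\<^sub>R (vjac P x *v n) + \<pi> x *\<^sub>R n) \<bullet> \<xi> x)"
proof -
  have "C1_compact (\<lambda>x. n $ j * flux \<epsilon> P \<pi> \<xi> j x)" for j
    by (rule C1_compact_mult[OF smooth_fns_Ck[OF smooth_fns.const] flux_C1(1)[OF P \<pi> \<xi>]])
  then have "C1_compact (\<lambda>x. \<Sum>j\<in>UNIV. n $ j * flux \<epsilon> P \<pi> \<xi> j x)"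
    using C1_compact_sum[of UNIV "\<lambda>j x. n $ j * flux \<epsilon> P \<pi> \<xi> j x"] by simp
  then show ?thesis by (simp only: flux_normal)
qed

lemma hyper_int_diff:
  fixes \<phi> \<psi> :: "real^'n \<Rightarrow> real"
  assumes "C1_compact \<phi>" "C1_compact \<psi>" "norm n = 1" "0 < \<delta>"
  shows "hyper_int n t \<delta> (\<lambda>x. \<phi> x - \<psi> x) = hyper_int n t \<delta> \<phi> - hyper_int n t \<delta> \<psi>"
  using integral_halfspace_normal_derivative(2)[OF assms(1,3,4), of t]
    integral_halfspace_normal_derivative(2)[OF assms(2,3,4), of t]
  by (simp add: hyper_int_def right_diff_distrib)

text \<open>The residual with unprojected data and convection. Its difference from the polynomial
  residual is the oscillation.\<close>

definition strong_res :: "real \<Rightarrow> real \<Rightarrow> (real^'n \<Rightarrow> real^'n) \<Rightarrow> (real^'n \<Rightarrow> real^'n) \<Rightarrow> (real^'n \<Rightarrow> real) \<Rightarrow>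
    (real^'n \<Rightarrow> real^'n) \<Rightarrow> real^'n \<Rightarrow> real^'n" where
  "strong_res \<epsilon> \<kappa> c P \<pi> G x = G x + \<epsilon> *\<^sub>R laplacian P x - \<kappa> *\<^sub>R P x - vjac P x *v c x - cgrad \<pi> x"

lemma weak_res_strong:
  "weak_res \<epsilon> \<kappa> c P (vjac P) \<pi> G \<xi> x = strong_res \<epsilon> \<kappa> c P \<pi> G x \<bullet> \<xi> x + strong_div \<epsilon> P \<pi> \<xi> x"
  by (simp add: weak_res_def strong_res_def strong_div_def inner_add_left inner_diff_left)

lemma vjac_zero_outside:
  fixes \<xi> :: "real^'n \<Rightarrow> real^'n"
  assumes "\<And>x. x \<notin> cball z r \<Longrightarrow> \<xi> x = 0" "x \<notin> cball z r"
  shows "vjac \<xi> x = 0"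
proof -
  have "frechet_derivative (\<lambda>z. \<xi> z $ i) (at x) = (\<lambda>v. 0)" for i
    by (rule frechet_derivative_zero_outside[OF _ assms(2)]) (simp add: assms(1))
  then show ?thesis by (simp add: vjac_def cgrad_def vec_eq_iff)
qed

text \<open>Inside the ball the discrete functions are polynomials on either side of a single
  hyperplane and the test field vanishes outside, so the divergence theorem on two half-spaces
  suffices. Taking the same polynomials on both sides covers a ball inside one element.\<close>

lemma broken_integration_by_parts:
  fixes c Y GT F \<xi> P1 P2 :: "real^'n \<Rightarrow> real^'n"
  assumes \<Omega>: "open \<Omega>" and B: "cball z r \<subseteq> \<Omega>"
    and \<xi>: "\<xi> \<in> vec_space (test_functions \<Omega>)" and supp: "\<And>x. x \<notin> cball z r \<Longrightarrow> \<xi> x = 0"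
    and n: "norm n = 1" and \<delta>: "0 < \<delta>"
    and P1: "vpdeg m P1" "pdeg m \<pi>1" and P2: "vpdeg m P2" "pdeg m \<pi>2"
    and F: "F \<in> L2 (cball z r)"
    and low: "AE x in lebesgue_on (cball z r). n \<bullet> x < t \<longrightarrow> Y x = P1 x \<and> D x = vjac P1 x \<and> PT x = \<pi>1 x
      \<and> F x = strong_res \<epsilon> \<kappa> c P1 \<pi>1 GT x"
    and up: "AE x in lebesgue_on (cball z r). t < n \<bullet> x \<longrightarrow> Y x = P2 x \<and> D x = vjac P2 x \<and> PT x = \<pi>2 x
      \<and> F x = strong_res \<epsilon> \<kappa> c P2 \<pi>2 GT x"
  shows "(LINT x|lebesgue_on \<Omega>. weak_res \<epsilon> \<kappa> c Y D PT GT \<xi> x) = (LINT x|lebesgue_on (cball z r). F x \<bullet> \<xi> x)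
     + hyper_int n t \<delta> (\<lambda>x. ((- \<epsilon> *\<^sub>R (vjac P1 x *v n) + \<pi>1 x *\<^sub>R n) - (- \<epsilon> *\<^sub>R (vjac P2 x *v n) + \<pi>2 x *\<^sub>R n)) \<bullet> \<xi> x)"
proof -
  have s: "\<Omega> \<in> sets lebesgue" "cball z r \<in> sets lebesgue" using \<Omega> by auto
  have C1: "C1_compact (\<lambda>x. \<xi> x $ i)" for i
    using vtest_component[OF \<xi>] by (rule test_functions_C1_compact)
  let ?B = "cball z r" and ?d1 = "strong_div \<epsilon> P1 \<pi>1 \<xi>" and ?d2 = "strong_div \<epsilon> P2 \<pi>2 \<xi>"
  let ?l = "\<lambda>x. indicator {x. n \<bullet> x < t} x * ?d1 x" and ?u = "\<lambda>x. indicator {x. t < n \<bullet> x} x * ?d2 x"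
  have il: "integrable lborel ?l" by (rule strong_div_integrable[OF P1 C1]) simp
  have iu: "integrable lborel ?u"
    by (rule strong_div_integrable[OF P2 C1]) (intro borel_open open_halfspace_gt)
  have il': "integrable lebesgue ?l" and iu': "integrable lebesgue ?u"
    using il iu by (auto simp: integrable_completion borel_measurable_integrable)
  have iF: "integrable lebesgue (\<lambda>x. if x \<in> ?B then F x \<bullet> \<xi> x else 0)"
    by (rule Lebesgue_Measure.integrable_restrict_UNIV[OF s(2), THEN iffD2, OF L2_inner_integrable[OF F vtest_L2(1)[OF \<xi> s(2)]]])
  have n0: "n \<noteq> 0" using n by auto
  have ne: "AE x in lebesgue. n \<bullet> x \<noteq> t"
    using AE_lborel_hyperplane[OF n0] by (simp add: AE_completion_iff)
  \<comment> \<open>Outside the ball the test field and its Jacobian vanish; inside, each side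
    contributes its strong residual plus a divergence.\<close>
  have eq: "AE x in lebesgue. (if x \<in> \<Omega> then weak_res \<epsilon> \<kappa> c Y D PT GT \<xi> x else 0) =
      (if x \<in> ?B then F x \<bullet> \<xi> x else 0) + ?l x + ?u x"
    using low up ne unfolding AE_lebesgue_on_iff[OF s(2)]
  proof eventually_elim
    case (elim x)
    show ?case
    proof (cases "x \<in> ?B")
      case True
      then have x\<Omega>: "x \<in> \<Omega>" using B by blast
      consider "n \<bullet> x < t" | "t < n \<bullet> x" using elim by linarith
      then show ?thesis
      proof cases
        case 1
        have "weak_res \<epsilon> \<kappa> c Y D PT GT \<xi> x = weak_res \<epsilon> \<kappa> c P1 (vjac P1) \<pi>1 GT \<xi> x"
          using elim 1 True by (simp add: weak_res_def)
        then show ?thesis using elim 1 True x\<Omega> by (simp add: weak_res_strong)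
      next
        case 2
        have "weak_res \<epsilon> \<kappa> c Y D PT GT \<xi> x = weak_res \<epsilon> \<kappa> c P2 (vjac P2) \<pi>2 GT \<xi> x"
          using elim 2 True by (simp add: weak_res_def)
        then show ?thesis using elim 2 True x\<Omega> by (simp add: weak_res_strong)
      qed
    next
      case False
      then have "\<xi> x = 0" "vjac \<xi> x = 0" using supp vjac_zero_outside[of z r \<xi>] by auto
      then show ?thesis using False by (simp add: weak_res_def strong_div_def trace_def)
    qed
  qed
  have "(LINT x|lebesgue_on \<Omega>. weak_res \<epsilon> \<kappa> c Y D PT GT \<xi> x) =
      (LINT x|lebesgue. (if x \<in> ?B then F x \<bullet> \<xi> x else 0) + ?l x + ?u x)"
    using integrable_lebesgue_on_cong_AE(3)[OF s(1), of UNIV "weak_res \<epsilon> \<kappa> c Y D PT GT \<xi>"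
        "\<lambda>x. (if x \<in> ?B then F x \<bullet> \<xi> x else 0) + ?l x + ?u x"] eq
    by (simp add: lebesgue_on_UNIV_eq)
  also have "\<dots> = (LINT x|lebesgue. (if x \<in> ?B then F x \<bullet> \<xi> x else 0)) + (LINT x|lebesgue. ?l x) + (LINT x|lebesgue. ?u x)"
    using iF il' iu' by simp
  also have "(LINT x|lebesgue. (if x \<in> ?B then F x \<bullet> \<xi> x else 0)) = (LINT x|lebesgue_on ?B. F x \<bullet> \<xi> x)"
    by (rule Lebesgue_Measure.integral_restrict_UNIV[OF s(2)])
  also have "(LINT x|lebesgue. ?l x) = (LINT x|lborel. ?l x)"
    using il by (intro integral_completion borel_measurable_integrable)
  also have "(LINT x|lebesgue. ?u x) = (LINT x|lborel. ?u x)"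
    using iu by (intro integral_completion borel_measurable_integrable)
  also have "(LINT x|lborel. ?l x) = hyper_int n t \<delta> (\<lambda>x. (- \<epsilon> *\<^sub>R (vjac P1 x *v n) + \<pi>1 x *\<^sub>R n) \<bullet> \<xi> x)"
    by (rule integral_strong_div_halfspace(1)[OF P1 C1 n \<delta>])
  also have "(LINT x|lborel. ?u x) = - hyper_int n t \<delta> (\<lambda>x. (- \<epsilon> *\<^sub>R (vjac P2 x *v n) + \<pi>2 x *\<^sub>R n) \<bullet> \<xi> x)"
    by (rule integral_strong_div_halfspace(2)[OF P2 C1 n \<delta>])
  finally show ?thesis
    using hyper_int_diff[OF C1_compact_flux_normal[OF P1 C1, of \<epsilon> n] C1_compact_flux_normal[OF P2 C1, of \<epsilon> n] n \<delta>, of t]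
    by (simp add: inner_diff_left)
qed

section \<open>Polynomial fields weighted by a bump\<close>

lemma L2norm_sq_lborel:
  fixes f :: "'a::euclidean_space \<Rightarrow> 'b::euclidean_space"
  assumes "A \<in> sets borel" "f \<in> borel_measurable borel"
  shows "(L2norm A f)\<^sup>2 = (LINT x|lborel. indicator A x * (norm (f x))\<^sup>2)"
proof -
  have A: "A \<in> sets lebesgue" using assms(1) by auto
  have "(L2norm A f)\<^sup>2 = (LINT x|lebesgue. (if x \<in> A then (norm (f x))\<^sup>2 else 0))"
    unfolding L2norm_squared by (rule Lebesgue_Measure.integral_restrict_UNIV[OF A, symmetric])
  also have "\<dots> = (LINT x|lebesgue. indicator A x * (norm (f x))\<^sup>2)"
    by (intro Bochner_Integration.integral_cong) (auto simp: indicator_def)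
  also have "\<dots> = (LINT x|lborel. indicator A x * (norm (f x))\<^sup>2)"
    using assms by (intro integral_completion) auto
  finally show ?thesis .
qed

lemma vpdeg_continuous:
  assumes "vpdeg m R"
  shows "continuous_on S R" "continuous_on S (vjac R)"
proof -
  have R: "(\<lambda>x. R x $ i) \<in> smooth_fns" for i using assms by (auto simp: vpdeg_def intro: pdeg_smooth)
  have "continuous_on S (\<lambda>x. \<chi> i. R x $ i)"
    by (intro continuous_on_vec_lambda smooth_fns_continuous R)
  then show "continuous_on S R" by simp
  show "continuous_on S (vjac R)"
    unfolding vjac_def[abs_def] by (intro continuous_on_vec_lambda smooth_fns_continuous_cgrad R)
qed

lemma vpdeg_L2: "vpdeg m R \<Longrightarrow> compact S \<Longrightarrow> R \<in> L2 S"
  by (intro L2_componentwise smooth_fns_L2 pdeg_smooth[of m]) (auto simp: vpdeg_def)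

lemma norm_sq_vec: "(norm (v :: 'a::real_inner^'n))\<^sup>2 = (\<Sum>i\<in>UNIV. (norm (v $ i))\<^sup>2)"
  by (simp add: norm_vec_def L2_set_def sum_nonneg)

text \<open>The quantity that results from testing with the bump times \<open>R\<close>. Norms of
  \<open>R\<close>, of the test field and of its gradient are all measured against it.\<close>

definition bump_mass :: "real^'n \<Rightarrow> real \<Rightarrow> (real^'n \<Rightarrow> real^'n) \<Rightarrow> real" where
  "bump_mass z r R = (LINT x|lborel. bump z r x * (norm (R x))\<^sup>2)"

lemma bump_mass_nonneg: "0 \<le> bump_mass z r R"
  unfolding bump_mass_def by (intro Bochner_Integration.integral_nonneg mult_nonneg_nonneg bump_nonneg zero_le_power2)

lemma vector_ball_bounds:
  obtains C where "0 < C"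
    "\<And>(R :: real^'n \<Rightarrow> real^'n) z r. vpdeg M R \<Longrightarrow> 0 < r \<Longrightarrow>
      (L2norm (ball z (\<Lambda> * r)) R)\<^sup>2 \<le> C * bump_mass z r R"
    "\<And>(R :: real^'n \<Rightarrow> real^'n) z r. vpdeg M R \<Longrightarrow> 0 < r \<Longrightarrow>
      r\<^sup>2 * (L2norm (ball z (\<Lambda> * r)) (vjac R))\<^sup>2 \<le> C * bump_mass z r R"
proof -
  obtain C where C: "0 < C"
    "\<And>(p :: real^'n \<Rightarrow> real) z r. pdeg M p \<Longrightarrow> 0 < r \<Longrightarrow>
      (LINT x|lborel. indicator (ball z (\<Lambda> * r)) x * (p x)\<^sup>2) \<le> C * (LINT x|lborel. bump z r x * (p x)\<^sup>2)"
    "\<And>(p :: real^'n \<Rightarrow> real) z r. pdeg M p \<Longrightarrow> 0 < r \<Longrightarrow>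
      r\<^sup>2 * (LINT x|lborel. indicator (ball z (\<Lambda> * r)) x * (norm (cgrad p x))\<^sup>2) \<le> C * (LINT x|lborel. bump z r x * (p x)\<^sup>2)"
    by (rule ball_bounds[of M \<Lambda>]) (rule that)
  have "(L2norm (ball z (\<Lambda> * r)) R)\<^sup>2 \<le> C * bump_mass z r R \<and> r\<^sup>2 * (L2norm (ball z (\<Lambda> * r)) (vjac R))\<^sup>2 \<le> C * bump_mass z r R"
    if R: "vpdeg M R" and r: "0 < r" for R :: "real^'n \<Rightarrow> real^'n" and z r
  proof -
    let ?b = "ball z (\<Lambda> * r)"
    have Ri: "pdeg M (\<lambda>x. R x $ i)" for i using R by (simp add: vpdeg_def)
    have cR: "continuous_on UNIV (\<lambda>x. R x $ i)" and cg: "continuous_on UNIV (cgrad (\<lambda>x. R x $ i))" for i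
      using pdeg_smooth[OF Ri] by (auto intro: smooth_fns_continuous smooth_fns_continuous_cgrad)
    have mass: "bump_mass z r R = (\<Sum>i\<in>UNIV. LINT x|lborel. bump z r x * (R x $ i)\<^sup>2)"
      unfolding bump_mass_def norm_sq_vec sum_distrib_left real_norm_def power2_abs
      by (rule Bochner_Integration.integral_sum, rule integrable_bump_times[OF continuous_on_power[OF cR] r])
    have n1: "(L2norm ?b R)\<^sup>2 = (\<Sum>i\<in>UNIV. LINT x|lborel. indicator ?b x * (R x $ i)\<^sup>2)"
    proof -
      have "(L2norm ?b R)\<^sup>2 = (LINT x|lborel. indicator ?b x * (norm (R x))\<^sup>2)"
        using vpdeg_continuous(1)[OF R] by (intro L2norm_sq_lborel borel_measurable_continuous_onI) auto
      also have "\<dots> = (\<Sum>i\<in>UNIV. LINT x|lborel. indicator ?b x * (R x $ i)\<^sup>2)"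
        unfolding norm_sq_vec sum_distrib_left real_norm_def power2_abs
        by (rule Bochner_Integration.integral_sum, rule integrable_indicator_ball[OF continuous_on_power[OF cR]])
      finally show ?thesis .
    qed
    have vj2: "(norm (vjac R x))\<^sup>2 = (\<Sum>i\<in>UNIV. (norm (cgrad (\<lambda>x. R x $ i) x))\<^sup>2)" for x
      using norm_sq_vec[of "vjac R x"] by (simp add: vjac_def)
    have n2: "(L2norm ?b (vjac R))\<^sup>2 = (\<Sum>i\<in>UNIV. LINT x|lborel. indicator ?b x * (norm (cgrad (\<lambda>x. R x $ i) x))\<^sup>2)"
    proof -
      have "(L2norm ?b (vjac R))\<^sup>2 = (LINT x|lborel. indicator ?b x * (norm (vjac R x))\<^sup>2)"
        using vpdeg_continuous(2)[OF R] by (intro L2norm_sq_lborel borel_measurable_continuous_onI) auto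
      also have "\<dots> = (LINT x|lborel. (\<Sum>i\<in>UNIV. indicator ?b x * (norm (cgrad (\<lambda>x. R x $ i) x))\<^sup>2))"
        by (simp only: vj2 sum_distrib_left)
      also have "\<dots> = (\<Sum>i\<in>UNIV. LINT x|lborel. indicator ?b x * (norm (cgrad (\<lambda>x. R x $ i) x))\<^sup>2)"
        by (rule Bochner_Integration.integral_sum, rule integrable_indicator_ball[OF continuous_on_power[OF continuous_on_norm[OF cg]]])
      finally show ?thesis .
    qed
    show ?thesis
      unfolding mass n1 n2 sum_distrib_left
      using C(2,3)[OF Ri r] by (auto intro!: sum_mono)
  qed
  with C(1) that show ?thesis by blast
qed

text \<open>By dilation the bound for the unit bump, which is continuously differentiable with
  compact support, serves for all radii.\<close>

lemma bump_gradient_bound: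
  obtains L where "0 \<le> L" "\<And>(z :: real^'n) r x. 0 < r \<Longrightarrow> r * norm (cgrad (bump z r) x) \<le> L"
proof -
  have "Ck 1 (bump (0::real^'n) 1)" by (intro smooth_fns_Ck bump_smooth)
  moreover have "bump 0 1 x = 0" if "x \<notin> cball 0 1" for x :: "real^'n"
    using that by (intro bump_zero) auto
  ultimately have "C1_compact (bump (0::real^'n) 1)" unfolding C1_compact_def by blast
  from C1_compact_bounds[OF this] obtain L where L: "0 \<le> L" "\<And>x. norm (cgrad (bump (0::real^'n) 1) x) \<le> L" by metis
  have "r * norm (cgrad (bump z r) x) \<le> L" if r: "0 < r" for z x :: "real^'n" and r
  proof -
    let ?y = "(1 / r) *\<^sub>R (x - z)"
    have x: "z + r *\<^sub>R ?y = x" using r by simp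
    have "cgrad (bump 0 1) ?y = cgrad (\<lambda>y. bump z r (z + r *\<^sub>R y)) ?y"
      by (simp add: bump_scale[OF r])
    also have "\<dots> = r *\<^sub>R cgrad (bump z r) x"
      using cgrad_scale[OF bump_smooth, of z r z r ?y] x by simp
    finally show ?thesis using L(2)[of ?y] r by simp
  qed
  with L(1) that show ?thesis by blast
qed

lemma bump_field_test:
  fixes R :: "real^'n \<Rightarrow> real^'n"
  assumes "vpdeg m R" "0 < r" "cball z r \<subseteq> \<Omega>"
  shows "(\<lambda>x. bump z r x *\<^sub>R R x) \<in> vec_space (test_functions \<Omega>)"
    and "\<And>x. x \<notin> cball z r \<Longrightarrow> bump z r x *\<^sub>R R x = 0"
proof -
  have z: "bump z r x = 0" if "x \<notin> cball z r" for x
    using that assms(2) by (intro bump_zero) (auto simp: dist_norm norm_minus_commute)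
  then show "\<And>x. x \<notin> cball z r \<Longrightarrow> bump z r x *\<^sub>R R x = 0" by simp
  have "(\<lambda>x. bump z r x * R x $ i) \<in> test_functions \<Omega>" for i
  proof (rule test_functionsI[OF _ compact_cball assms(3)])
    have "(\<lambda>x. R x $ i) \<in> smooth_fns" using assms(1) by (auto simp: vpdeg_def intro: pdeg_smooth)
    then show "(\<lambda>x. bump z r x * R x $ i) \<in> smooth_fns" by (intro smooth_fns.mult bump_smooth)
  qed (simp add: z)
  then show "(\<lambda>x. bump z r x *\<^sub>R R x) \<in> vec_space (test_functions \<Omega>)" by (simp add: vec_space_def)
qed

lemma L2norm_sq_mono_pointwise:
  fixes f :: "'a::euclidean_space \<Rightarrow> 'b::euclidean_space" and g :: "'a \<Rightarrow> 'c::euclidean_space"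
  assumes "f \<in> L2 S" "g \<in> L2 S" "\<And>x. x \<in> S \<Longrightarrow> norm (f x) \<le> norm (g x)"
  shows "L2norm S f \<le> L2norm S g"
  unfolding L2norm_def
  by (intro real_sqrt_le_mono integral_mono) (use assms in \<open>auto simp: L2_def intro!: power_mono\<close>)

lemma bump_field_bounds:
  obtains C where "0 < C"
    "\<And>(R :: real^'n \<Rightarrow> real^'n) z r. vpdeg M R \<Longrightarrow> 0 < r \<Longrightarrow>
      (L2norm (cball z r) (\<lambda>x. bump z r x *\<^sub>R R x))\<^sup>2 \<le> C * bump_mass z r R"
    "\<And>(R :: real^'n \<Rightarrow> real^'n) z r. vpdeg M R \<Longrightarrow> 0 < r \<Longrightarrow>
      r\<^sup>2 * (L2norm (cball z r) (vjac (\<lambda>x. bump z r x *\<^sub>R R x)))\<^sup>2 \<le> C * bump_mass z r R"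
proof -
  \<comment> \<open>The ratio 2 is a convenient one for which the closed ball of radius
    \<open>r\<close> lies in the open ball where the bounds are available.\<close>
  obtain C where C: "0 < C"
    "\<And>(R :: real^'n \<Rightarrow> real^'n) z r. vpdeg M R \<Longrightarrow> 0 < r \<Longrightarrow>
      (L2norm (ball z (2 * r)) R)\<^sup>2 \<le> C * bump_mass z r R"
    "\<And>(R :: real^'n \<Rightarrow> real^'n) z r. vpdeg M R \<Longrightarrow> 0 < r \<Longrightarrow>
      r\<^sup>2 * (L2norm (ball z (2 * r)) (vjac R))\<^sup>2 \<le> C * bump_mass z r R"
    by (rule vector_ball_bounds[of M 2]) (rule that)
  obtain L where L: "0 \<le> L" "\<And>(z :: real^'n) r x. 0 < r \<Longrightarrow> r * norm (cgrad (bump z r) x) \<le> L"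
    using bump_gradient_bound by metis
  have main: "(L2norm (cball z r) (\<lambda>x. bump z r x *\<^sub>R R x))\<^sup>2 \<le> C * bump_mass z r R"
    "r\<^sup>2 * (L2norm (cball z r) (vjac (\<lambda>x. bump z r x *\<^sub>R R x)))\<^sup>2 \<le> (2 * L\<^sup>2 * C + 2 * C) * bump_mass z r R"
    if R: "vpdeg M R" and r: "0 < r" for R :: "real^'n \<Rightarrow> real^'n" and z r
  proof -
    let ?B = "cball z r" and ?\<xi> = "\<lambda>x. bump z r x *\<^sub>R R x"
    have \<xi>: "?\<xi> \<in> vec_space (test_functions UNIV)" by (rule bump_field_test(1)[OF R r]) simp
    have sub: "negligible (?B - ball z (2 * r))"
    proof -
      have "?B - ball z (2 * r) = {}" using r by auto
      then show ?thesis by (simp only: negligible_empty)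
    qed
    have meas: "?B \<in> sets lebesgue" "ball z (2 * r) \<in> sets lebesgue" by auto
    have RL2: "R \<in> L2 ?B" "vjac R \<in> L2 ?B" "R \<in> L2 (ball z (2 * r))" "vjac R \<in> L2 (ball z (2 * r))"
    proof -
      have vj: "vjac R \<in> L2 S" if "compact S" for S
      proof (intro L2_componentwise smooth_fns_L2[OF _ that] pdeg_smooth[of M])
        fix i j
        have "pdeg M (\<lambda>x. R x $ i)" using R by (simp add: vpdeg_def)
        then show "pdeg M (\<lambda>x. vjac R x $ i $ j)" by (simp add: vjac_def pdeg_cgrad_nth)
      qed
      show "R \<in> L2 ?B" "vjac R \<in> L2 ?B" using vpdeg_L2[OF R] vj by auto
      have neg: "negligible (ball z (2 * r) - cball z (2 * r))"
        using ball_subset_cball by (metis Diff_eq_empty_iff negligible_empty)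
      show "R \<in> L2 (ball z (2 * r))"
        by (rule L2_subset[OF vpdeg_L2[OF R compact_cball] _ _ neg]) auto
      show "vjac R \<in> L2 (ball z (2 * r))"
        by (rule L2_subset[OF vj[OF compact_cball] _ _ neg]) auto
    qed
    have n1: "(L2norm ?B R)\<^sup>2 \<le> C * bump_mass z r R"
      using power_mono[OF L2norm_subset[OF RL2(3) meas sub] L2norm_nonneg, of 2] C(2)[OF R r, of z] by linarith
    have n2: "r\<^sup>2 * (L2norm ?B (vjac R))\<^sup>2 \<le> C * bump_mass z r R"
      using mult_left_mono[OF power_mono[OF L2norm_subset[OF RL2(4) meas sub] L2norm_nonneg, of 2], of "r\<^sup>2"] C(3)[OF R r, of z] by simp
    have "L2norm ?B ?\<xi> \<le> L2norm ?B R"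
      using vtest_L2(1)[OF \<xi>] RL2(1)
      by (intro L2norm_sq_mono_pointwise) (auto simp: bump_nonneg bump_le_1 intro: mult_left_le_one_le)
    from power_mono[OF this L2norm_nonneg, of 2] n1
    show "(L2norm ?B ?\<xi>)\<^sup>2 \<le> C * bump_mass z r R" by linarith
    \<comment> \<open>Product rule: the Jacobian of the bump times \<open>R\<close> is the bump
      times the Jacobian of \<open>R\<close> plus the outer product of \<open>R\<close> with the
      gradient of the bump. The factor \<open>r\<close> turns the latter gradient into the bounded
      quantity \<open>L\<close>.\<close>
    have vj: "r * norm (vjac ?\<xi> x) \<le> norm (L * norm (R x) + r * norm (vjac R x))" for x
    proof -
      have Ri: "pdeg M (\<lambda>x. R x $ i)" for i using R by (simp add: vpdeg_def)
      have "cgrad (\<lambda>x. bump z r x * R x $ i) x = bump z r x *\<^sub>R cgrad (\<lambda>x. R x $ i) x + R x $ i *\<^sub>R cgrad (bump z r) x" for i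
      proof -
        have "Ck 1 (bump z r)" "Ck 1 (\<lambda>x. R x $ i)"
          using Ri by (auto intro!: smooth_fns_Ck bump_smooth pdeg_smooth simp del: Ck.simps One_nat_def)
        from Ck_1_mult(2)[OF this, of x] show ?thesis by (simp add: cgrad_def vec_eq_iff)
      qed
      then have 1: "vjac ?\<xi> x = bump z r x *\<^sub>R vjac R x + (\<chi> i. R x $ i *\<^sub>R cgrad (bump z r) x)"
        by (simp add: vjac_def vec_eq_iff)
      have 2: "norm (\<chi> i. R x $ i *\<^sub>R cgrad (bump z r) x) = norm (R x) * norm (cgrad (bump z r) x)"
        by (simp add: norm_vec_def[of "\<chi> i. _ i *\<^sub>R _"] norm_vec_def[of "R x"] L2_set_left_distrib)
      have "norm (vjac ?\<xi> x) \<le> norm (bump z r x *\<^sub>R vjac R x) + norm (R x) * norm (cgrad (bump z r) x)"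
        unfolding 1 2[symmetric] by (rule norm_triangle_ineq)
      also have "\<dots> \<le> norm (vjac R x) + norm (R x) * norm (cgrad (bump z r) x)"
        by (auto simp: bump_nonneg bump_le_1 intro: mult_left_le_one_le)
      finally have "r * norm (vjac ?\<xi> x) \<le> r * (norm (vjac R x) + norm (R x) * norm (cgrad (bump z r) x))"
        using r by (intro mult_left_mono) auto
      also have "\<dots> = norm (R x) * (r * norm (cgrad (bump z r) x)) + r * norm (vjac R x)"
        by (simp add: algebra_simps)
      also have "\<dots> \<le> norm (R x) * L + r * norm (vjac R x)"
        using L(2)[OF r] r by (intro add_mono mult_left_mono) auto
      finally show ?thesis using L(1) r by (simp add: mult.commute)
    qed
    have i1: "(\<lambda>x. L * norm (R x)) \<in> L2 ?B" "(\<lambda>x. r * norm (vjac R x)) \<in> L2 ?B"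
      using L2_scaleR[OF L2_norm[OF RL2(1)], of L] L2_scaleR[OF L2_norm[OF RL2(2)], of r] by auto
    have "r\<^sup>2 * (L2norm ?B (vjac ?\<xi>))\<^sup>2 = (L2norm ?B (\<lambda>x. r *\<^sub>R vjac ?\<xi> x))\<^sup>2"
      by (simp add: L2norm_squared power_mult_distrib)
    also have "\<dots> \<le> (L2norm ?B (\<lambda>x. L * norm (R x) + r * norm (vjac R x)))\<^sup>2"
    proof (intro power_mono L2norm_nonneg L2norm_sq_mono_pointwise)
      show "(\<lambda>x. r *\<^sub>R vjac ?\<xi> x) \<in> L2 ?B" by (intro L2_scaleR vtest_L2(2)[OF \<xi>]) auto
      show "(\<lambda>x. L * norm (R x) + r * norm (vjac R x)) \<in> L2 ?B" using i1 by (intro L2_add)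
      show "norm (r *\<^sub>R vjac ?\<xi> x) \<le> norm (L * norm (R x) + r * norm (vjac R x))" for x
        using vj[of x] r by simp
    qed
    also have "\<dots> \<le> 2 * (L2norm ?B (\<lambda>x. L * norm (R x)))\<^sup>2 + 2 * (L2norm ?B (\<lambda>x. r * norm (vjac R x)))\<^sup>2"
      using i1 by (rule L2norm_add_sq)
    also have "\<dots> = 2 * L\<^sup>2 * (L2norm ?B R)\<^sup>2 + 2 * (r\<^sup>2 * (L2norm ?B (vjac R))\<^sup>2)"
      by (simp add: L2norm_squared power_mult_distrib)
    also have "\<dots> \<le> 2 * L\<^sup>2 * (C * bump_mass z r R) + 2 * (C * bump_mass z r R)"
      using n1 n2 by (intro add_mono mult_left_mono) auto
    also have "\<dots> = (2 * L\<^sup>2 * C + 2 * C) * bump_mass z r R" by (simp add: algebra_simps)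
    finally show "r\<^sup>2 * (L2norm ?B (vjac ?\<xi>))\<^sup>2 \<le> (2 * L\<^sup>2 * C + 2 * C) * bump_mass z r R" .
  qed
  show ?thesis
  proof (rule that[of "2 * L\<^sup>2 * C + 2 * C"])
    show "0 < 2 * L\<^sup>2 * C + 2 * C" using C(1) by (intro add_nonneg_pos) auto
    fix R :: "real^'n \<Rightarrow> real^'n" and z r assume R: "vpdeg M R" "0 < (r::real)"
    have "C * bump_mass z r R \<le> (2 * L\<^sup>2 * C + 2 * C) * bump_mass z r R"
      using C(1) by (intro mult_right_mono bump_mass_nonneg) (simp add: add_increasing)
    then show "(L2norm (cball z r) (\<lambda>x. bump z r x *\<^sub>R R x))\<^sup>2 \<le> (2 * L\<^sup>2 * C + 2 * C) * bump_mass z r R"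
      using main(1)[OF R, of z] by linarith
    show "r\<^sup>2 * (L2norm (cball z r) (vjac (\<lambda>x. bump z r x *\<^sub>R R x)))\<^sup>2 \<le> (2 * L\<^sup>2 * C + 2 * C) * bump_mass z r R"
      by (rule main(2)[OF R])
  qed
qed

lemma L2_inner_Cauchy_Schwarz:
  assumes "f \<in> L2 S" "g \<in> L2 S"
  shows "(LINT x|lebesgue_on S. f x \<bullet> g x)\<^sup>2 \<le> (L2norm S f)\<^sup>2 * (L2norm S g)\<^sup>2"
proof -
  note n = L2_norm[OF assms(1)] L2_norm[OF assms(2)]
  have "\<bar>LINT x|lebesgue_on S. f x \<bullet> g x\<bar> \<le> (LINT x|lebesgue_on S. \<bar>f x \<bullet> g x\<bar>)" by (rule integral_abs_bound)
  also have "\<dots> \<le> (LINT x|lebesgue_on S. norm (f x) * norm (g x))"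
    using L2_inner_integrable[OF assms] L2_mult_integrable[OF n] Cauchy_Schwarz_ineq2
    by (intro integral_mono) auto
  also have "\<dots> \<le> L2norm S f * L2norm S g"
    using L2_Cauchy_Schwarz[OF n] by (simp add: L2norm_def)
  finally have "\<bar>LINT x|lebesgue_on S. f x \<bullet> g x\<bar>\<^sup>2 \<le> (L2norm S f * L2norm S g)\<^sup>2"
    by (intro power_mono) auto
  then show ?thesis by (simp add: power_mult_distrib)
qed

text \<open>Testing puts the squared mass on the left and one factor of it on the right. Cancelling
  that factor has to allow for mass 0.\<close>

lemma square_le_self_imp:
  fixes m a s :: real
  assumes "s * m\<^sup>2 \<le> a * m" "0 \<le> m" "0 \<le> a"
  shows "s * m \<le> a"
  using assms by (cases "m = 0") (auto simp: power2_eq_square mult.assoc[symmetric])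

lemma hyper_proj_idem: "norm n = 1 \<Longrightarrow> hyper_proj n t (hyper_proj n t x) = hyper_proj n t x"
  by (simp add: hyper_proj_def inner_diff_right norm_eq_1)

lemma hyper_proj_on: "norm n = 1 \<Longrightarrow> n \<bullet> hyper_proj n t x = t"
  by (simp add: hyper_proj_def inner_diff_right norm_eq_1)

lemma hyper_proj_dist:
  assumes n: "norm n = 1" and x0: "n \<bullet> x0 = t"
  shows "norm (hyper_proj n t x - x0) \<le> norm (x - x0)"
proof -
  let ?a = "n \<bullet> (x - x0)"
  have eq: "hyper_proj n t x - x0 = (x - x0) - ?a *\<^sub>R n"
    using x0 by (simp add: hyper_proj_def inner_diff_right)
  have nn: "n \<bullet> n = 1" using n by (simp add: norm_eq_1)
  have "(norm (w - (n \<bullet> w) *\<^sub>R n))\<^sup>2 = (norm w)\<^sup>2 - (n \<bullet> w)\<^sup>2" for w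
    unfolding power2_norm_eq_inner
    by (simp add: inner_diff_left inner_diff_right nn inner_commute) (simp add: power2_eq_square)
  from this[of "x - x0"] have "(norm (hyper_proj n t x - x0))\<^sup>2 = (norm (x - x0))\<^sup>2 - ?a\<^sup>2"
    unfolding eq .
  then have "(norm (hyper_proj n t x - x0))\<^sup>2 \<le> (norm (x - x0))\<^sup>2" by simp
  then show ?thesis by (rule power2_le_imp_le) simp
qed

text \<open>The projection is affine, so a jump extended constantly along the normal is again a
  polynomial field of the same degree, to which estimates on balls apply.\<close>

lemma vpdeg_hyper_proj:
  assumes "vpdeg m J"
  shows "vpdeg m (\<lambda>x. J (hyper_proj n t x))"
proof -
  have eq: "hyper_proj n t x = t *\<^sub>R n + (x - (n \<bullet> x) *\<^sub>R n)" for x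
    by (simp add: hyper_proj_def algebra_simps)
  have bl: "bounded_linear (\<lambda>x. x - (n \<bullet> x) *\<^sub>R n)"
    by (intro bounded_linear_sub bounded_linear_ident bounded_linear_scaleR_const bounded_linear_inner_right)
  show ?thesis
    using assms unfolding vpdeg_def eq by (auto intro: pdeg_affine[OF _ bl])
qed

lemma C1_compact_inner:
  fixes J \<xi> :: "real^'n \<Rightarrow> real^'n"
  assumes "vpdeg m J" "\<And>i. C1_compact (\<lambda>x. \<xi> x $ i)"
  shows "C1_compact (\<lambda>x. J x \<bullet> \<xi> x)"
proof -
  have "C1_compact (\<lambda>x. J x $ i * \<xi> x $ i)" for i
    using assms(1) by (intro C1_compact_mult assms(2) smooth_fns_Ck pdeg_smooth[of m]) (simp add: vpdeg_def)
  then have "C1_compact (\<lambda>x. \<Sum>i\<in>UNIV. J x $ i * \<xi> x $ i)"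
    using C1_compact_sum[of UNIV "\<lambda>i x. J x $ i * \<xi> x $ i"] by simp
  then show ?thesis by (simp add: inner_vec_def)
qed

lemma bump_mass_le_ball:
  fixes R :: "real^'n \<Rightarrow> real^'n"
  assumes "vpdeg m R" "0 < r" "ball z r \<subseteq> ball w s"
  shows "bump_mass z r R \<le> (L2norm (ball w s) R)\<^sup>2"
proof -
  note c = vpdeg_continuous(1)[OF assms(1)]
  have "bump_mass z r R \<le> (LINT x|lborel. indicator (ball w s) x * (norm (R x))\<^sup>2)"
    unfolding bump_mass_def
  proof (rule integral_mono)
    show "integrable lborel (\<lambda>x. bump z r x * (norm (R x))\<^sup>2)"
      using assms(2) c by (intro integrable_bump_times continuous_intros) auto
    show "integrable lborel (\<lambda>x. indicator (ball w s) x * (norm (R x))\<^sup>2)"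
      using c by (intro integrable_indicator_ball continuous_intros) auto
    fix x
    have "bump z r x \<le> indicator (ball w s) x"
    proof (cases "x \<in> ball z r")
      case True
      with assms(3) have "x \<in> ball w s" by blast
      then show ?thesis using bump_le_1 by simp
    next
      case False
      then have "bump z r x = 0" using assms(2) by (intro bump_zero) (auto simp: dist_norm norm_minus_commute)
      then show ?thesis by simp
    qed
    then show "bump z r x * (norm (R x))\<^sup>2 \<le> indicator (ball w s) x * (norm (R x))\<^sup>2"
      by (rule mult_right_mono) simp
  qed
  also have "\<dots> = (L2norm (ball w s) R)\<^sup>2"
    using c by (intro L2norm_sq_lborel[symmetric] borel_measurable_continuous_onI) auto
  finally show ?thesis .
qed

section \<open>Residual estimates on a single ball\<close>

definition energy_const :: "nat \<Rightarrow> real \<Rightarrow> real \<Rightarrow> real \<Rightarrow> real" where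
  "energy_const d \<epsilon> \<kappa> B = 4 * \<epsilon>\<^sup>2 + 4 * (real d)\<^sup>2 + 4 + 8 * \<kappa> + 8 * B\<^sup>2"

text \<open>One Oseen-type problem covers both equations of the optimality system: the adjoint problem is
  the state problem with \<open>c\<close> and the pressures negated. The constants \<open>C1\<close>, \<open>C2\<close> are parameters, so
  that the bounds below are visibly uniform in the mesh and in the discrete solution.\<close>

locale oseen_error =
  fixes \<Omega> :: "(real^'n) set" and \<epsilon> \<kappa> B :: real and c y yT G GT :: "real^'n \<Rightarrow> real^'n" and p pT :: "real^'n \<Rightarrow> real"
    and M :: nat and \<Lambda> C1 C2 :: real
  assumes open_domain: "open \<Omega>"
    and nonneg: "0 < \<epsilon>" "0 \<le> \<kappa>" "0 \<le> B"
    and c: "c \<in> borel_measurable (lebesgue_on \<Omega>)" "AE x in lebesgue_on \<Omega>. norm (c x) \<le> B"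
    and y: "y \<in> vec_space (H1 \<Omega>)" and yT: "yT \<in> vec_space (H1 \<Omega>)"
    and p: "p \<in> L2 \<Omega>" and pT: "pT \<in> L2 \<Omega>" and G: "G \<in> L2 \<Omega>" and GT: "GT \<in> L2 \<Omega>"
    and eq: "\<And>\<xi>. \<xi> \<in> vec_space (test_functions \<Omega>) \<Longrightarrow> formA \<Omega> \<epsilon> \<kappa> c y \<xi> - formB \<Omega> \<xi> p = L2inner \<Omega> G \<xi>"
    and C1: "0 < C1"
    "\<And>(R :: real^'n \<Rightarrow> real^'n) z r. vpdeg M R \<Longrightarrow> 0 < r \<Longrightarrow>
      (L2norm (cball z r) (\<lambda>x. bump z r x *\<^sub>R R x))\<^sup>2 \<le> C1 * bump_mass z r R"
    "\<And>(R :: real^'n \<Rightarrow> real^'n) z r. vpdeg M R \<Longrightarrow> 0 < r \<Longrightarrow>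
      r\<^sup>2 * (L2norm (cball z r) (vjac (\<lambda>x. bump z r x *\<^sub>R R x)))\<^sup>2 \<le> C1 * bump_mass z r R"
    and C2: "0 < C2"
    "\<And>(R :: real^'n \<Rightarrow> real^'n) z r. vpdeg M R \<Longrightarrow> 0 < r \<Longrightarrow>
      (L2norm (ball z (\<Lambda> * r)) R)\<^sup>2 \<le> C2 * bump_mass z r R"
begin

text \<open>Errors that pair with the gradient of the test field and hence carry no power of the
  radius. Those in \<open>reaction_error\<close> pair with its values and are weighted by the
  squared radius; the convective part of the gradient error occurs there too.\<close>

definition diffusion_error :: "(real^'n) set \<Rightarrow> real" where
  "diffusion_error S = (L2norm S (wGrad \<Omega> (\<lambda>x. y x - yT x)))\<^sup>2 + (L2norm S (\<lambda>x. p x - pT x))\<^sup>2"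

definition reaction_error :: "(real^'n) set \<Rightarrow> real" where
  "reaction_error S = (L2norm S (\<lambda>x. G x - GT x))\<^sup>2 + \<kappa> * (L2norm S (\<lambda>x. y x - yT x))\<^sup>2
     + (L2norm S (wGrad \<Omega> (\<lambda>x. y x - yT x)))\<^sup>2"

lemma energy_const_pos: "0 < (energy_const CARD('n) \<epsilon> \<kappa> B)"
proof -
  have "0 \<le> 4 * \<epsilon>\<^sup>2 + 4 * (real CARD('n))\<^sup>2" "0 \<le> 8 * \<kappa> + 8 * B\<^sup>2" using nonneg by auto
  then show ?thesis unfolding energy_const_def by linarith
qed

lemma errors_nonneg: "0 \<le> diffusion_error S" "0 \<le> reaction_error S"
  using nonneg by (auto simp: diffusion_error_def reaction_error_def)

text \<open>The test field is supported in the ball, so the error representation on the whole domain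
  involves only errors on that ball.\<close>

lemma weak_res_estimate:
  assumes B: "cball z r \<subseteq> \<Omega>" and \<xi>: "\<xi> \<in> vec_space (test_functions \<Omega>)"
    and supp: "\<And>x. x \<notin> cball z r \<Longrightarrow> \<xi> x = 0"
  shows "(LINT x|lebesgue_on \<Omega>. weak_res \<epsilon> \<kappa> c yT (wGrad \<Omega> yT) pT GT \<xi> x)\<^sup>2
    \<le> (energy_const CARD('n) \<epsilon> \<kappa> B) * (diffusion_error (cball z r) * (L2norm (cball z r) (vjac \<xi>))\<^sup>2
        + reaction_error (cball z r) * (L2norm (cball z r) \<xi>)\<^sup>2)"
proof -
  let ?S = "cball z r"
  let ?we = "weak_res \<epsilon> \<kappa> c (\<lambda>x. y x - yT x) (wGrad \<Omega> (\<lambda>x. y x - yT x)) (\<lambda>x. p x - pT x) (\<lambda>x. G x - GT x) \<xi>"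
  have s: "\<Omega> \<in> sets lebesgue" "?S \<in> sets lebesgue" using open_domain by auto
  have neg: "negligible (?S - \<Omega>)" using B by (metis Diff_eq_empty_iff negligible_empty)
  have "wGrad \<Omega> (\<lambda>x. y x - yT x) \<in> L2 \<Omega>"
  proof -
    have L: "(\<lambda>x. wGrad \<Omega> y x - wGrad \<Omega> yT x) \<in> L2 \<Omega>"
      by (intro L2_diff wGrad_L2 open_domain y yT)
    have "AE x in lebesgue_on \<Omega>. wGrad \<Omega> y x - wGrad \<Omega> yT x = wGrad \<Omega> (\<lambda>x. y x - yT x) x"
      using wGrad_diff[OF open_domain y yT] by eventually_elim simp
    from L2_cong_AE[OF s(1) this L] show ?thesis .
  qed
  then have L: "(\<lambda>x. y x - yT x) \<in> L2 ?S" "wGrad \<Omega> (\<lambda>x. y x - yT x) \<in> L2 ?S" "(\<lambda>x. p x - pT x) \<in> L2 ?S" "(\<lambda>x. G x - GT x) \<in> L2 ?S"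
    by (intro L2_subset[OF _ s(2,1) neg] L2_diff vec_space_L2 y yT p pT G GT; assumption)+
  have cS: "c \<in> borel_measurable (lebesgue_on ?S)" "AE x in lebesgue_on ?S. norm (c x) \<le> B"
    using borel_measurable_lebesgue_on_subset[OF c(1) s(2,1) neg] AE_lebesgue_on_subset[OF c(2) s(2,1) neg] by auto
  have "AE x in lebesgue. (if x \<in> \<Omega> then ?we x else 0) = (if x \<in> ?S then ?we x else 0)"
  proof (rule AE_I2)
    fix x
    show "(if x \<in> \<Omega> then ?we x else 0) = (if x \<in> ?S then ?we x else 0)"
    proof (cases "x \<in> ?S")
      case False
      then have "\<xi> x = 0" "vjac \<xi> x = 0" using supp vjac_zero_outside[of z r \<xi>] by auto
      then show ?thesis using False by (simp add: weak_res_def trace_def)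
    qed (use B in auto)
  qed
  from integrable_lebesgue_on_cong_AE(3)[OF s(1,2) this]
  have "(LINT x|lebesgue_on \<Omega>. weak_res \<epsilon> \<kappa> c yT (wGrad \<Omega> yT) pT GT \<xi> x) = - (LINT x|lebesgue_on ?S. ?we x)"
    using weak_res_error[OF open_domain y p G yT pT GT c \<xi> eq[OF \<xi>]] by simp
  then have "(LINT x|lebesgue_on \<Omega>. weak_res \<epsilon> \<kappa> c yT (wGrad \<Omega> yT) pT GT \<xi> x)\<^sup>2 = (LINT x|lebesgue_on ?S. ?we x)\<^sup>2"
    by simp
  also have "\<dots> \<le> (energy_const CARD('n) \<epsilon> \<kappa> B) * (diffusion_error ?S * (L2norm ?S (vjac \<xi>))\<^sup>2 + reaction_error ?S * (L2norm ?S \<xi>)\<^sup>2)"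
    unfolding energy_const_def diffusion_error_def reaction_error_def
    using weak_res_bound[OF L vtest_L2[OF \<xi> s(2)] cS, of \<epsilon> \<kappa>] nonneg by simp
  finally show ?thesis .
qed

text \<open>Common core of the element and face estimates. \<open>I\<close> stands for the bump mass
  or the face integral and \<open>F\<close> for what remains of the strong residual. The squared
  norms of the test field are linear in the mass \<open>m\<close>, while \<open>I\<close> is at
  least a multiple of \<open>m\<close> in both uses, so that one factor \<open>m\<close> can be
  cancelled afterwards.\<close>

lemma residual_bound:
  assumes B: "cball z r \<subseteq> \<Omega>" and \<xi>: "\<xi> \<in> vec_space (test_functions \<Omega>)"
    and supp: "\<And>x. x \<notin> cball z r \<Longrightarrow> \<xi> x = 0" and r: "0 < r"
    and O: "F \<in> L2 (cball z r)"
    and k: "0 \<le> k" "0 \<le> m"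
    and N: "(L2norm (cball z r) \<xi>)\<^sup>2 \<le> k * m" and D: "r\<^sup>2 * (L2norm (cball z r) (vjac \<xi>))\<^sup>2 \<le> k * m"
    and X: "(LINT x|lebesgue_on \<Omega>. weak_res \<epsilon> \<kappa> c yT (wGrad \<Omega> yT) pT GT \<xi> x) = I + (LINT x|lebesgue_on (cball z r). F x \<bullet> \<xi> x)"
  shows "r\<^sup>2 * I\<^sup>2 \<le> (2 * (energy_const CARD('n) \<epsilon> \<kappa> B) + 2) * k * (diffusion_error (cball z r)
      + r\<^sup>2 * (reaction_error (cball z r) + (L2norm (cball z r) F)\<^sup>2)) * m"
proof -
  let ?S = "cball z r"
  let ?X = "LINT x|lebesgue_on \<Omega>. weak_res \<epsilon> \<kappa> c yT (wGrad \<Omega> yT) pT GT \<xi> x"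
  let ?f = "LINT x|lebesgue_on ?S. F x \<bullet> \<xi> x"
  have s: "?S \<in> sets lebesgue" by auto
  have km: "0 \<le> k * m" using k by simp
  have "I\<^sup>2 \<le> 2 * ?X\<^sup>2 + 2 * ?f\<^sup>2"
    using norm_add_sq_le[of ?X "- ?f"] X by simp
  then have "r\<^sup>2 * I\<^sup>2 \<le> r\<^sup>2 * (2 * ?X\<^sup>2 + 2 * ?f\<^sup>2)" by (rule mult_left_mono) simp
  also have "\<dots> \<le> r\<^sup>2 * (2 * ((energy_const CARD('n) \<epsilon> \<kappa> B) * (diffusion_error ?S * (L2norm ?S (vjac \<xi>))\<^sup>2 + reaction_error ?S * (L2norm ?S \<xi>)\<^sup>2))
      + 2 * ((L2norm ?S F)\<^sup>2 * (L2norm ?S \<xi>)\<^sup>2))"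
    using weak_res_estimate[OF B \<xi> supp] L2_inner_Cauchy_Schwarz[OF O vtest_L2(1)[OF \<xi> s]]
    by (intro mult_left_mono add_mono) auto
  also have "\<dots> = 2 * (energy_const CARD('n) \<epsilon> \<kappa> B) * diffusion_error ?S * (r\<^sup>2 * (L2norm ?S (vjac \<xi>))\<^sup>2)
      + (2 * (energy_const CARD('n) \<epsilon> \<kappa> B) * (r\<^sup>2 * reaction_error ?S) + 2 * (r\<^sup>2 * (L2norm ?S F)\<^sup>2)) * (L2norm ?S \<xi>)\<^sup>2"
    by (simp add: algebra_simps)
  also have "\<dots> \<le> 2 * (energy_const CARD('n) \<epsilon> \<kappa> B) * diffusion_error ?S * (k * m)
      + (2 * (energy_const CARD('n) \<epsilon> \<kappa> B) * (r\<^sup>2 * reaction_error ?S) + 2 * (r\<^sup>2 * (L2norm ?S F)\<^sup>2)) * (k * m)"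
    using N D energy_const_pos errors_nonneg by (intro add_mono mult_left_mono) auto
  also have "\<dots> = (2 * (energy_const CARD('n) \<epsilon> \<kappa> B) * diffusion_error ?S
      + (2 * (energy_const CARD('n) \<epsilon> \<kappa> B) * (r\<^sup>2 * reaction_error ?S) + 2 * (r\<^sup>2 * (L2norm ?S F)\<^sup>2))) * (k * m)"
    by (simp add: algebra_simps)
  also have "\<dots> \<le> ((2 * (energy_const CARD('n) \<epsilon> \<kappa> B) + 2) * (diffusion_error ?S + r\<^sup>2 * (reaction_error ?S + (L2norm ?S F)\<^sup>2))) * (k * m)"
  proof (rule mult_right_mono[OF _ km])
    have "0 \<le> 2 * diffusion_error ?S" "0 \<le> 2 * (r\<^sup>2 * reaction_error ?S)" "0 \<le> 2 * (energy_const CARD('n) \<epsilon> \<kappa> B) * (r\<^sup>2 * (L2norm ?S F)\<^sup>2)"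
      using errors_nonneg energy_const_pos by auto
    then show "2 * (energy_const CARD('n) \<epsilon> \<kappa> B) * diffusion_error ?S + (2 * (energy_const CARD('n) \<epsilon> \<kappa> B) * (r\<^sup>2 * reaction_error ?S) + 2 * (r\<^sup>2 * (L2norm ?S F)\<^sup>2))
        \<le> (2 * (energy_const CARD('n) \<epsilon> \<kappa> B) + 2) * (diffusion_error ?S + r\<^sup>2 * (reaction_error ?S + (L2norm ?S F)\<^sup>2))"
      by (simp add: algebra_simps)
  qed
  finally show ?thesis by (simp add: mult_ac)
qed

text \<open>With the bump times \<open>R\<close> as test field, the weak form equals the mass of
  \<open>R\<close> plus the contribution of \<open>O'\<close>; the mass then controls
  \<open>R\<close> on the much larger ball, which is meant to contain the element.\<close>

lemma element_residual:
  assumes R: "vpdeg M R" and r: "0 < (r::real)" and B: "cball z r \<subseteq> \<Omega>" and P: "vpdeg m P" "pdeg m \<pi>"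
    and O: "O' \<in> L2 (cball z r)"
    and ae: "AE x in lebesgue_on (cball z r). yT x = P x \<and> wGrad \<Omega> yT x = vjac P x \<and> pT x = \<pi> x \<and> R x + O' x = strong_res \<epsilon> \<kappa> c P \<pi> GT x"
  shows "r\<^sup>2 * (L2norm (ball z (\<Lambda> * r)) R)\<^sup>2 \<le> C2 * ((2 * (energy_const CARD('n) \<epsilon> \<kappa> B) + 2) * C1) * (diffusion_error (cball z r)
       + r\<^sup>2 * (reaction_error (cball z r) + (L2norm (cball z r) O')\<^sup>2))"
proof -
  let ?S = "cball z r" and ?\<xi> = "\<lambda>x. bump z r x *\<^sub>R R x" and ?m = "bump_mass z r R"
  have s: "?S \<in> sets lebesgue" by auto
  note \<xi> = bump_field_test[OF R r B]
  have RL: "R \<in> L2 ?S" using vpdeg_L2[OF R] by simp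
  \<comment> \<open>Any hyperplane will do: with the same polynomials on both sides the jump term is
    0.\<close>
  obtain n :: "real^'n" where n: "norm n = 1" using vector_choose_size[of 1] by auto
  have F: "(\<lambda>x. R x + O' x) \<in> L2 ?S" using RL O by (rule L2_add)
  have low: "AE x in lebesgue_on ?S. n \<bullet> x < 0 \<longrightarrow> yT x = P x \<and> wGrad \<Omega> yT x = vjac P x \<and> pT x = \<pi> x \<and> R x + O' x = strong_res \<epsilon> \<kappa> c P \<pi> GT x"
    and up: "AE x in lebesgue_on ?S. 0 < n \<bullet> x \<longrightarrow> yT x = P x \<and> wGrad \<Omega> yT x = vjac P x \<and> pT x = \<pi> x \<and> R x + O' x = strong_res \<epsilon> \<kappa> c P \<pi> GT x"
    using ae by (auto elim: eventually_mono)
  have "(LINT x|lebesgue_on \<Omega>. weak_res \<epsilon> \<kappa> c yT (wGrad \<Omega> yT) pT GT ?\<xi> x) = (LINT x|lebesgue_on ?S. (R x + O' x) \<bullet> ?\<xi> x)"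
    using broken_integration_by_parts[OF open_domain B \<xi> n zero_less_one P P F low up]
    by (simp add: hyper_int_def)
  also have "\<dots> = (LINT x|lebesgue_on ?S. R x \<bullet> ?\<xi> x) + (LINT x|lebesgue_on ?S. O' x \<bullet> ?\<xi> x)"
    using L2_inner_integrable[OF RL vtest_L2(1)[OF \<xi>(1) s]] L2_inner_integrable[OF O vtest_L2(1)[OF \<xi>(1) s]]
    by (simp add: inner_add_left distrib_left)
  also have "(LINT x|lebesgue_on ?S. R x \<bullet> ?\<xi> x) = ?m"
  proof -
    have "(LINT x|lebesgue_on ?S. R x \<bullet> ?\<xi> x) = (LINT x|lborel. R x \<bullet> ?\<xi> x)"
    proof (rule integral_lebesgue_on_eq_lborel[OF s])
      show "(\<lambda>x. R x \<bullet> ?\<xi> x) \<in> borel_measurable borel"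
        by (intro borel_measurable_continuous_onI continuous_intros vpdeg_continuous(1)[OF R] smooth_fns_continuous bump_smooth)
    qed (simp add: \<xi>(2))
    then show ?thesis by (simp add: bump_mass_def power2_norm_eq_inner)
  qed
  finally have X: "(LINT x|lebesgue_on \<Omega>. weak_res \<epsilon> \<kappa> c yT (wGrad \<Omega> yT) pT GT ?\<xi> x) = ?m + (LINT x|lebesgue_on ?S. O' x \<bullet> ?\<xi> x)" .
  let ?E = "diffusion_error ?S + r\<^sup>2 * (reaction_error ?S + (L2norm ?S O')\<^sup>2)"
  have E0: "0 \<le> ?E" using errors_nonneg by (intro add_nonneg_nonneg mult_nonneg_nonneg) auto
  have "r\<^sup>2 * ?m\<^sup>2 \<le> (2 * (energy_const CARD('n) \<epsilon> \<kappa> B) + 2) * C1 * ?E * ?m"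
    using C1(1) bump_mass_nonneg[of z r R] C1(2,3)[OF R r, of z]
    by (intro residual_bound[OF B \<xi> r O _ _ _ _ X]) auto
  moreover have "0 \<le> (2 * (energy_const CARD('n) \<epsilon> \<kappa> B) + 2) * C1 * ?E"
    by (intro mult_nonneg_nonneg E0) (use energy_const_pos C1(1) in linarith)+
  ultimately have "r\<^sup>2 * ?m \<le> (2 * (energy_const CARD('n) \<epsilon> \<kappa> B) + 2) * C1 * ?E"
    by (rule square_le_self_imp[OF _ bump_mass_nonneg])
  note m_le = this
  have "r\<^sup>2 * (L2norm (ball z (\<Lambda> * r)) R)\<^sup>2 \<le> C2 * (r\<^sup>2 * ?m)"
    using mult_left_mono[OF C2(2)[OF R r, of z], of "r\<^sup>2"] by (simp add: mult_ac)
  also have "\<dots> \<le> C2 * ((2 * (energy_const CARD('n) \<epsilon> \<kappa> B) + 2) * C1 * ?E)"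
    using m_le C2(1) by (intro mult_left_mono) auto
  finally have "r\<^sup>2 * (L2norm (ball z (\<Lambda> * r)) R)\<^sup>2 \<le> C2 * ((2 * (energy_const CARD('n) \<epsilon> \<kappa> B) + 2) * C1 * ?E)" .
  then show "r\<^sup>2 * (L2norm (ball z (\<Lambda> * r)) R)\<^sup>2 \<le> C2 * ((2 * (energy_const CARD('n) \<epsilon> \<kappa> B) + 2) * C1) * ?E"
    by (simp only: mult.assoc)
qed

text \<open>The jump is extended constantly along the normal to a polynomial field \<open>R\<close>.
  The face integral of the jump against the bump times \<open>R\<close> dominates the mass of
  \<open>R\<close> on a ball beside the face. That mass in turn dominates the norm on the face,
  because a hyperplane integral may be computed from a slab of any thickness.\<close>

lemma face_residual:
  fixes J :: "real^'n \<Rightarrow> real^'n"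
  assumes n: "norm n = 1" and x0: "n \<bullet> x0 = t" and r: "0 < (r::real)" and H: "0 < H" "16 * H + 5 * r \<le> \<Lambda> * r"
    and B: "cball x0 r \<subseteq> \<Omega>" and P1: "vpdeg m P1" "pdeg m \<pi>1" and P2: "vpdeg m P2" "pdeg m \<pi>2"
    and F: "F \<in> L2 (cball x0 r)"
    and low: "AE x in lebesgue_on (cball x0 r). n \<bullet> x < t \<longrightarrow> yT x = P1 x \<and> wGrad \<Omega> yT x = vjac P1 x \<and> pT x = \<pi>1 x \<and> F x = strong_res \<epsilon> \<kappa> c P1 \<pi>1 GT x"
    and up: "AE x in lebesgue_on (cball x0 r). t < n \<bullet> x \<longrightarrow> yT x = P2 x \<and> wGrad \<Omega> yT x = vjac P2 x \<and> pT x = \<pi>2 x \<and> F x = strong_res \<epsilon> \<kappa> c P2 \<pi>2 GT x"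
    and J: "vpdeg M J" "\<And>x. J x = (- \<epsilon> *\<^sub>R (vjac P1 x *v n) + \<pi>1 x *\<^sub>R n) - (- \<epsilon> *\<^sub>R (vjac P2 x *v n) + \<pi>2 x *\<^sub>R n)"
    and \<gamma>: "compact \<gamma>" "\<gamma> \<subseteq> cball x0 H" "\<gamma> \<subseteq> {x. n \<bullet> x = t}"
    and e_def: "e = exp (- 4 / 3 :: real)"
  shows "H * (L2norm {x + s *\<^sub>R n |x s. x \<in> \<gamma> \<and> 0 \<le> s \<and> s \<le> 1} (\<lambda>z. J (hyper_proj n t z)))\<^sup>2
      \<le> C2 / e * ((2 * (energy_const CARD('n) \<epsilon> \<kappa> B) + 2) * (C1 * C2) / (4 * e\<^sup>2)) * (diffusion_error (cball x0 r) + r\<^sup>2 * (reaction_error (cball x0 r) + (L2norm (cball x0 r) F)\<^sup>2))"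
proof -
    have e: "0 < e" by (simp add: e_def)
    define A where "A = (2 * (energy_const CARD('n) \<epsilon> \<kappa> B) + 2) * (C1 * C2)"
    have A: "0 < A" using C1(1) C2(1) energy_const_pos by (simp add: A_def)
  let ?S = "cball x0 r"
  define R where "R x = J (hyper_proj n t x)" for x
  define \<xi> where "\<xi> x = bump x0 r x *\<^sub>R R x" for x
  \<comment> \<open>The ball of radius r/4 about this point touches the hyperplane from above. It
    lies in the slab of thickness r/2 and within r/2 of \<open>x0\<close>, where the bump is at
    least \<open>e\<close>.\<close>
  define z' where "z' = x0 + (r / 4) *\<^sub>R n"
  let ?m = "bump_mass z' (r / 4) R"
  let ?b = "ball z' (\<Lambda> * (r / 4))"
  have R: "vpdeg M R" unfolding R_def by (rule vpdeg_hyper_proj[OF J(1)])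
  have cR: "continuous_on UNIV R" by (rule vpdeg_continuous(1)[OF R])
  have R_proj: "R (hyper_proj n t x) = R x" for x by (simp add: R_def hyper_proj_idem[OF n])
  have \<xi>_test: "\<xi> \<in> vec_space (test_functions \<Omega>)" "\<And>x. x \<notin> ?S \<Longrightarrow> \<xi> x = 0"
    unfolding \<xi>_def using bump_field_test[OF R r B] by auto
  \<comment> \<open>A quarter of the hypothesis 16 H + 5 r <= \<open>\<Lambda>\<close> r. The
    inequalities let the ball of radius \<open>\<Lambda>\<close> r/4 about \<open>z'\<close> contain
    both the points within 3 H of \<open>x0\<close> and the ball of radius r about
    \<open>x0\<close>.\<close>
  have \<Lambda>r: "4 * H + r / 4 \<le> \<Lambda> * (r / 4)" "r + r / 4 \<le> \<Lambda> * (r / 4)"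
  proof -
    have "\<Lambda> * (r / 4) = (\<Lambda> * r) / 4" by simp
    then show "4 * H + r / 4 \<le> \<Lambda> * (r / 4)" "r + r / 4 \<le> \<Lambda> * (r / 4)" using H r by linarith+
  qed
  have dz: "norm (x - z') \<le> norm (x - x0) + r / 4" for x
    using norm_triangle_ineq4[of "x - x0" "(r / 4) *\<^sub>R n"] n r by (simp add: z'_def algebra_simps)
  \<comment> \<open>The norms of the test field are measured by the mass about \<open>x0\<close>,
    whereas the face integral controls the mass about \<open>z'\<close>; the inverse estimate trades
    one for the other at the price of \<open>C2\<close>.\<close>
  have mass0: "bump_mass x0 r R \<le> C2 * ?m"
  proof -
    have "ball x0 r \<subseteq> ?b"
    proof
      fix x assume "x \<in> ball x0 r"
      then have "norm (x - x0) < r" by (simp add: dist_norm norm_minus_commute)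
      then have "norm (x - z') < \<Lambda> * (r / 4)" using dz[of x] \<Lambda>r by linarith
      then show "x \<in> ?b" by (simp add: dist_norm norm_minus_commute)
    qed
    from bump_mass_le_ball[OF R r this] C2(2)[OF R, of "r / 4" z'] r show ?thesis by simp
  qed
  let ?I = "hyper_int n t (r / 2) (\<lambda>x. J x \<bullet> \<xi> x)"
  have C1\<xi>: "C1_compact (\<lambda>x. \<xi> x $ i)" for i
    using vtest_component[OF \<xi>_test(1)] by (rule test_functions_C1_compact)
  have C1J: "C1_compact (\<lambda>x. J x \<bullet> \<xi> x)" by (rule C1_compact_inner[OF J(1) C1\<xi>])
  have r2: "0 < r / 2" using r by simp
  have X: "(LINT x|lebesgue_on \<Omega>. weak_res \<epsilon> \<kappa> c yT (wGrad \<Omega> yT) pT GT \<xi> x) = ?I + (LINT x|lebesgue_on ?S. F x \<bullet> \<xi> x)"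
    using broken_integration_by_parts[OF open_domain B \<xi>_test n r2 P1 P2 F low up] by (simp add: J(2))
  \<comment> \<open>The slab of thickness r/2 brings the factor 2/r. Projection onto the hyperplane
    does not increase the distance from \<open>x0\<close>, so the bump at the projected point is
    still at least \<open>e\<close>.\<close>
  have I_lower: "(2 / r) * (e * ?m) \<le> ?I"
  proof -
    let ?sl = "{x. t \<le> n \<bullet> x \<and> n \<bullet> x \<le> t + r / 2}"
    have "e * ?m = (LINT x|lborel. e * (bump z' (r / 4) x * (norm (R x))\<^sup>2))"
      by (simp add: bump_mass_def)
    also have "\<dots> \<le> (LINT x|lborel. indicator ?sl x * (J (hyper_proj n t x) \<bullet> \<xi> (hyper_proj n t x)))"
    proof (rule integral_mono)
      show "integrable lborel (\<lambda>x. e * (bump z' (r / 4) x * (norm (R x))\<^sup>2))"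
        using r cR by (intro integrable_mult_right integrable_bump_times continuous_intros) auto
      show "integrable lborel (\<lambda>x. indicator ?sl x * (J (hyper_proj n t x) \<bullet> \<xi> (hyper_proj n t x)))"
        by (rule integral_halfspace_normal_derivative(2)[OF C1J n r2])
      fix x
      have Jx: "J (hyper_proj n t x) \<bullet> \<xi> (hyper_proj n t x) = bump x0 r (hyper_proj n t x) * (norm (R x))\<^sup>2"
        by (simp add: \<xi>_def R_proj power2_norm_eq_inner) (simp add: R_def)
      have "e * bump z' (r / 4) x \<le> indicator ?sl x * bump x0 r (hyper_proj n t x)"
      proof (cases "norm (x - z') < r / 4")
        case True
        have "\<bar>n \<bullet> (x - z')\<bar> \<le> norm (x - z')" using Cauchy_Schwarz_ineq2[of n "x - z'"] n by simp
        moreover have "n \<bullet> (x - z') = n \<bullet> x - t - r / 4"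
          using n x0 by (simp add: z'_def inner_diff_right inner_add_right norm_eq_1)
        ultimately have "\<bar>n \<bullet> x - t - r / 4\<bar> < r / 4" using True by linarith
        then have "t \<le> n \<bullet> x" "n \<bullet> x \<le> t + r / 2" unfolding abs_less_iff by linarith+
        then have sl: "x \<in> ?sl" by simp
        have "norm (x - x0) \<le> norm (x - z') + norm ((r / 4) *\<^sub>R n)"
          using norm_triangle_ineq[of "x - z'" "(r / 4) *\<^sub>R n"] by (simp add: z'_def)
        then have "norm (x - x0) \<le> r / 2" using True n r by simp
        then have "norm (hyper_proj n t x - x0) \<le> r / 2" using hyper_proj_dist[OF n x0, of x] by linarith
        then have "e \<le> bump x0 r (hyper_proj n t x)" unfolding e_def by (rule bump_lower[OF r])
        moreover have "e * bump z' (r / 4) x \<le> e" using e bump_le_1[of z' "r / 4" x] by (simp add: mult_left_le)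
        ultimately show ?thesis using sl by simp
      next
        case False
        then have "bump z' (r / 4) x = 0" using r by (intro bump_zero) auto
        then show ?thesis by (simp add: bump_nonneg)
      qed
      from mult_right_mono[OF this, of "(norm (R x))\<^sup>2"]
      show "e * (bump z' (r / 4) x * (norm (R x))\<^sup>2) \<le> indicator ?sl x * (J (hyper_proj n t x) \<bullet> \<xi> (hyper_proj n t x))"
        by (simp add: Jx mult.assoc)
    qed
    finally have "(2 / r) * (e * ?m) \<le> (2 / r) * (LINT x|lborel. indicator ?sl x * (J (hyper_proj n t x) \<bullet> \<xi> (hyper_proj n t x)))"
      using r by (intro mult_left_mono) auto
    then show ?thesis by (simp add: hyper_int_def)
  qed
  let ?E = "diffusion_error ?S + r\<^sup>2 * (reaction_error ?S + (L2norm ?S F)\<^sup>2)"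
  have E0: "0 \<le> ?E" using errors_nonneg by (intro add_nonneg_nonneg mult_nonneg_nonneg) auto
  have m0: "0 \<le> ?m" by (rule bump_mass_nonneg)
  have I2: "r\<^sup>2 * ?I\<^sup>2 \<le> (2 * (energy_const CARD('n) \<epsilon> \<kappa> B) + 2) * (C1 * C2) * ?E * ?m"
  proof (rule residual_bound[OF B \<xi>_test r F _ m0 _ _ X])
    show "0 \<le> C1 * C2" using C1(1) C2(1) by simp
    have "C1 * bump_mass x0 r R \<le> C1 * C2 * ?m" using mult_left_mono[OF mass0, of C1] C1(1) by (simp add: mult.assoc)
    then show "(L2norm ?S \<xi>)\<^sup>2 \<le> C1 * C2 * ?m" "r\<^sup>2 * (L2norm ?S (vjac \<xi>))\<^sup>2 \<le> C1 * C2 * ?m"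
      using C1(2,3)[OF R r, of x0] unfolding \<xi>_def[abs_def] by linarith+
  qed
  have "4 * e\<^sup>2 * ?m\<^sup>2 = r\<^sup>2 * ((2 / r) * (e * ?m))\<^sup>2" using r by (simp add: power2_eq_square)
  also have "\<dots> \<le> r\<^sup>2 * ?I\<^sup>2" using I_lower r e m0 by (intro mult_left_mono power_mono) auto
  also have "\<dots> \<le> A * ?E * ?m" using I2 by (simp add: A_def)
  finally have "4 * e\<^sup>2 * ?m\<^sup>2 \<le> A * ?E * ?m" .
  moreover have "0 \<le> A * ?E" using A by (intro mult_nonneg_nonneg E0) auto
  ultimately have "4 * e\<^sup>2 * ?m \<le> A * ?E"
    by (rule square_le_self_imp[OF _ m0])
  then have m_le: "?m \<le> A / (4 * e\<^sup>2) * ?E" using e by (simp add: field_simps)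
  let ?pr = "{x + s *\<^sub>R n |x s. x \<in> \<gamma> \<and> 0 \<le> s \<and> s \<le> 1}"
  \<comment> \<open>A smooth substitute for the indicator of the face: \<open>\<gamma>\<close> lies
    within H of \<open>x0\<close>, so the bump of radius 2 H is at least \<open>e\<close> on it.
    Differentiability is what makes \<open>hyper_int\<close> independent of the thickness.\<close>
  let ?\<phi> = "\<lambda>x. bump x0 (2 * H) x * (norm (R x))\<^sup>2"
  have H2: "0 < 2 * H" using H by simp
  have C1\<phi>: "C1_compact ?\<phi>"
  proof -
    have "(\<lambda>x. bump x0 (2 * H) x *\<^sub>R R x) \<in> vec_space (test_functions UNIV)"
      by (rule bump_field_test(1)[OF R H2]) simp
    from C1_compact_inner[OF R test_functions_C1_compact[OF vtest_component[OF this]]]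
    show ?thesis by (simp add: power2_norm_eq_inner)
  qed
  have pr_closed: "?pr \<in> sets borel"
  proof -
    have "compact ((\<lambda>(x, s). x + s *\<^sub>R n) ` (\<gamma> \<times> {0..1}))"
      by (intro compact_continuous_image compact_Times \<gamma>(1) compact_Icc) (auto intro!: continuous_intros simp: case_prod_beta)
    moreover have "(\<lambda>(x, s). x + s *\<^sub>R n) ` (\<gamma> \<times> {0..1}) = ?pr"
    proof (intro equalityI subsetI)
      fix v assume "v \<in> ?pr"
      then obtain x s where "v = x + s *\<^sub>R n" "x \<in> \<gamma>" "0 \<le> s" "s \<le> 1" by blast
      then show "v \<in> (\<lambda>(x, s). x + s *\<^sub>R n) ` (\<gamma> \<times> {0..1})"
        by (intro image_eqI[of _ _ "(x, s)"]) auto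
    qed (clarsimp, blast)
    ultimately show ?thesis by (simp add: borel_compact)
  qed
  have "e * (L2norm ?pr R)\<^sup>2 = (LINT x|lborel. e * (indicator ?pr x * (norm (R x))\<^sup>2))"
    using cR pr_closed by (subst L2norm_sq_lborel) (auto intro: borel_measurable_continuous_onI)
  also have "\<dots> \<le> (LINT x|lborel. indicator {x. t \<le> n \<bullet> x \<and> n \<bullet> x \<le> t + 1} x * ?\<phi> (hyper_proj n t x))"
  proof (rule integral_mono_AE')
    show "integrable lborel (\<lambda>x. indicator {x. t \<le> n \<bullet> x \<and> n \<bullet> x \<le> t + 1} x * ?\<phi> (hyper_proj n t x))"
      by (rule integral_halfspace_normal_derivative(2)[OF C1\<phi> n]) simp
    show "AE x in lborel. e * (indicator ?pr x * (norm (R x))\<^sup>2) \<le> indicator {x. t \<le> n \<bullet> x \<and> n \<bullet> x \<le> t + 1} x * ?\<phi> (hyper_proj n t x)"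
    proof (rule AE_I2)
      fix x
      show "e * (indicator ?pr x * (norm (R x))\<^sup>2) \<le> indicator {x. t \<le> n \<bullet> x \<and> n \<bullet> x \<le> t + 1} x * ?\<phi> (hyper_proj n t x)"
      proof (cases "x \<in> ?pr")
        case True
        then obtain g s where g: "x = g + s *\<^sub>R n" "g \<in> \<gamma>" "0 \<le> s" "s \<le> 1" by auto
        then have ng: "n \<bullet> g = t" using \<gamma>(3) by auto
        have nx: "n \<bullet> x = t + s" using g(1) ng n by (simp add: inner_add_right norm_eq_1)
        have pg: "hyper_proj n t x = g" using nx g(1) by (simp add: hyper_proj_def)
        have "norm (g - x0) \<le> 2 * H / 2" using g(2) \<gamma>(2) by (auto simp: dist_norm norm_minus_commute)
        then have "e \<le> bump x0 (2 * H) g" unfolding e_def by (rule bump_lower[OF H2])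
        then have "e * (norm (R x))\<^sup>2 \<le> bump x0 (2 * H) g * (norm (R x))\<^sup>2" by (rule mult_right_mono) simp
        moreover have "R g = R x" using R_proj[of x] pg by simp
        ultimately show ?thesis using True nx g(3,4) pg by simp
      next
        case False
        then show ?thesis by (auto simp: bump_nonneg)
      qed
    qed
    show "AE x in lborel. 0 \<le> indicator {x. t \<le> n \<bullet> x \<and> n \<bullet> x \<le> t + 1} x * ?\<phi> (hyper_proj n t x)"
      by (auto simp: bump_nonneg)
  qed
  also have "\<dots> = hyper_int n t 1 ?\<phi>" by (simp add: hyper_int_def)
  \<comment> \<open>The thickness 1 of the prism in \<open>face_L2norm\<close> is exchanged for H;
    the resulting factor 1/H accounts for the weight H in the claim.\<close>
  also have "\<dots> = hyper_int n t H ?\<phi>"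
    using integral_halfspace_normal_derivative(1)[OF C1\<phi> n, of 1 t]
      integral_halfspace_normal_derivative(1)[OF C1\<phi> n H(1), of t] by simp
  also have "\<dots> \<le> (1 / H) * (LINT x|lborel. indicator ?b x * (norm (R x))\<^sup>2)"
    unfolding hyper_int_def
  proof (intro mult_left_mono integral_mono)
    show "integrable lborel (\<lambda>x. indicator {x. t \<le> n \<bullet> x \<and> n \<bullet> x \<le> t + H} x * ?\<phi> (hyper_proj n t x))"
      by (rule integral_halfspace_normal_derivative(2)[OF C1\<phi> n H(1)])
    show "integrable lborel (\<lambda>x. indicator ?b x * (norm (R x))\<^sup>2)"
      using cR by (intro integrable_indicator_ball continuous_intros)
    fix x
    have "indicator {x. t \<le> n \<bullet> x \<and> n \<bullet> x \<le> t + H} x * bump x0 (2 * H) (hyper_proj n t x) \<le> indicator ?b x"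
    proof (cases "x \<in> {x. t \<le> n \<bullet> x \<and> n \<bullet> x \<le> t + H} \<and> norm (hyper_proj n t x - x0) < 2 * H")
      case True
      have "norm (x - x0) \<le> norm (hyper_proj n t x - x0) + norm ((n \<bullet> x - t) *\<^sub>R n)"
        using norm_triangle_ineq[of "hyper_proj n t x - x0" "(n \<bullet> x - t) *\<^sub>R n"] by (simp add: hyper_proj_def)
      also have "\<dots> < 2 * H + H" using True n by (intro add_less_le_mono) auto
      finally have "norm (x - z') < \<Lambda> * (r / 4)" using dz[of x] \<Lambda>r(1) H(1) by linarith
      then have "x \<in> ?b" by (simp add: dist_norm norm_minus_commute)
      then show ?thesis using bump_le_1[of x0 "2 * H" "hyper_proj n t x"] True by simp
    next
      case False
      then have zero: "indicator {x. t \<le> n \<bullet> x \<and> n \<bullet> x \<le> t + H} x * bump x0 (2 * H) (hyper_proj n t x) = 0"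
        using bump_zero[OF H2, of "hyper_proj n t x" x0] by (auto simp: indicator_def)
      show ?thesis unfolding zero by simp
    qed
    from mult_right_mono[OF this, of "(norm (R x))\<^sup>2"]
    show "indicator {x. t \<le> n \<bullet> x \<and> n \<bullet> x \<le> t + H} x * ?\<phi> (hyper_proj n t x) \<le> indicator ?b x * (norm (R x))\<^sup>2"
      by (simp add: R_proj mult.assoc)
  qed (use H in auto)
  also have "\<dots> = (1 / H) * (L2norm ?b R)\<^sup>2"
    using cR by (subst L2norm_sq_lborel) (auto intro: borel_measurable_continuous_onI)
  also have "\<dots> \<le> (1 / H) * (C2 * ?m)"
    using C2(2)[OF R, of "r / 4" z'] r H by (intro mult_left_mono) auto
  finally have "H * (L2norm ?pr R)\<^sup>2 \<le> C2 / e * ?m" using H(1) e by (simp add: field_simps)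
  also have "\<dots> \<le> C2 / e * (A / (4 * e\<^sup>2) * ?E)" using m_le C2(1) e by (intro mult_left_mono) auto
  finally show "H * (L2norm ?pr (\<lambda>z. J (hyper_proj n t z)))\<^sup>2 \<le> C2 / e * ((2 * (energy_const CARD('n) \<epsilon> \<kappa> B) + 2) * (C1 * C2) / (4 * e\<^sup>2)) * ?E"
    by (simp only: R_def[abs_def] A_def mult.assoc)
qed

end

section \<open>Geometry of simplicial meshes\<close>

lemma simplex_vertices:
  assumes "int CARD('n) simplex (K :: (real^'n) set)"
  obtains C where "finite C" "\<not> affine_dependent C" "card C = Suc CARD('n)" "K = convex hull C" "affine hull C = UNIV"
proof -
  obtain C where C: "finite C" "\<not> affine_dependent C" "int (card C) = int CARD('n) + 1" "K = convex hull C"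
    using assms by (auto simp: simplex)
  then have c: "card C = Suc CARD('n)" by linarith
  have "aff_dim C = int DIM(real^'n)"
    using aff_dim_affine_independent[OF C(2)] C(3) by simp
  then have "affine hull C = UNIV" by (simp only: aff_dim_eq_full)
  with C c that show ?thesis by blast
qed

lemma facet_hyperplane:
  fixes C :: "(real^'n) set"
  assumes C: "\<not> affine_dependent C" "card C = Suc CARD('n)" and v: "v \<in> C"
  obtains a b where "norm a = 1" "affine hull (C - {v}) = {x. a \<bullet> x = b}" "a \<bullet> v < b"
proof -
  have fin: "finite C" using C(1) by (rule aff_independent_finite)
  have ind: "\<not> affine_dependent (C - {v})"
    using C(1) affine_dependent_subset by blast
  have "aff_dim (C - {v}) = DIM(real^'n) - 1"
    using aff_dim_affine_independent[OF ind] C(2) v fin by simp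
  then obtain a b where ab: "a \<noteq> 0" "affine hull (C - {v}) = {x. a \<bullet> x = b}"
    using aff_dim_eq_hyperplane by blast
  have "v \<notin> affine hull (C - {v})" using C(1) v by (auto simp: affine_dependent_def)
  then have ne: "a \<bullet> v \<noteq> b" using ab(2) by blast
  \<comment> \<open>The sign places the opposite vertex on the negative side, so that the normal
    points out of the simplex.\<close>
  define \<sigma> :: real where "\<sigma> = (if a \<bullet> v < b then 1 else - 1)"
  have s: "\<bar>\<sigma>\<bar> = 1" "0 < \<sigma> * (b - a \<bullet> v)" using ne by (auto simp: \<sigma>_def)
  have na: "0 < norm a" using ab(1) by simp
  show ?thesis
  proof (rule that[of "(\<sigma> / norm a) *\<^sub>R a" "\<sigma> * b / norm a"])
    show "norm ((\<sigma> / norm a) *\<^sub>R a) = 1" using s na by simp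
    have "(((\<sigma> / norm a) *\<^sub>R a) \<bullet> x = \<sigma> * b / norm a) \<longleftrightarrow> (a \<bullet> x = b)" for x
      using s(1) na by (auto simp: divide_simps)
    then show "affine hull (C - {v}) = {x. ((\<sigma> / norm a) *\<^sub>R a) \<bullet> x = \<sigma> * b / norm a}"
      unfolding ab(2) by blast
    have "\<sigma> * (a \<bullet> v) / norm a < \<sigma> * b / norm a"
      using s(2) na by (intro divide_strict_right_mono) (auto simp: algebra_simps)
    then show "((\<sigma> / norm a) *\<^sub>R a) \<bullet> v < \<sigma> * b / norm a" by simp
  qed
qed

text \<open>The barycentric coordinate of x at v is (b v - a v . x) / (b v - a v . v), so its sign
  is decided by one half-space and its upper bound 1 by the parallel hyperplane through v.\<close>

lemma simplex_halfspaces: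
  fixes C :: "(real^'n) set"
  assumes fin: "finite C" and full: "affine hull C = UNIV"
    and face: "\<And>v w. v \<in> C \<Longrightarrow> w \<in> C - {v} \<Longrightarrow> a v \<bullet> w = b v" and vert: "\<And>v. v \<in> C \<Longrightarrow> a v \<bullet> v < b v"
  shows "(\<And>v. v \<in> C \<Longrightarrow> a v \<bullet> x \<le> b v) \<Longrightarrow> x \<in> convex hull C"
    and "x \<in> convex hull C \<Longrightarrow> v \<in> C \<Longrightarrow> a v \<bullet> v \<le> a v \<bullet> x \<and> a v \<bullet> x \<le> b v"
proof -
  assume le: "\<And>v. v \<in> C \<Longrightarrow> a v \<bullet> x \<le> b v"
  have "x \<in> affine hull C" using full by simp
  then obtain u where u: "sum u C = 1" "(\<Sum>w\<in>C. u w *\<^sub>R w) = x"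
    by (auto simp: affine_hull_finite[OF fin])
  have "0 \<le> u v" if v: "v \<in> C" for v
  proof -
    have "a v \<bullet> x = (\<Sum>w\<in>C. u w * (a v \<bullet> w))"
      by (simp add: u(2)[symmetric] inner_sum_right)
    then have "b v - a v \<bullet> x = (\<Sum>w\<in>C. u w * (b v - a v \<bullet> w))"
      by (simp add: right_diff_distrib sum_subtractf sum_distrib_right[symmetric] u(1))
    also have "\<dots> = u v * (b v - a v \<bullet> v) + (\<Sum>w\<in>C - {v}. u w * (b v - a v \<bullet> w))"
      by (rule sum.remove[OF fin v])
    also have "(\<Sum>w\<in>C - {v}. u w * (b v - a v \<bullet> w)) = 0"
      using face[OF v] by (intro sum.neutral) auto
    finally have "0 \<le> u v * (b v - a v \<bullet> v)" using le[OF v] by simp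
    then show ?thesis using vert[OF v] by (simp add: zero_le_mult_iff)
  qed
  then show "x \<in> convex hull C" using u by (auto simp: convex_hull_finite[OF fin])
next
  assume x: "x \<in> convex hull C" and v: "v \<in> C"
  have "C \<subseteq> {x. a v \<bullet> x \<le> b v} \<inter> {x. a v \<bullet> x \<ge> a v \<bullet> v}"
  proof
    fix w assume w: "w \<in> C"
    show "w \<in> {x. a v \<bullet> x \<le> b v} \<inter> {x. a v \<bullet> x \<ge> a v \<bullet> v}"
    proof (cases "w = v")
      case True
      then show ?thesis using vert[OF v] by simp
    next
      case False
      then show ?thesis using face[OF v, of w] vert[OF v] w by simp
    qed
  qed
  then have "convex hull C \<subseteq> {x. a v \<bullet> x \<le> b v} \<inter> {x. a v \<bullet> x \<ge> a v \<bullet> v}"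
    by (rule hull_minimal) (intro convex_Int convex_halfspace_le convex_halfspace_ge)
  then show "a v \<bullet> v \<le> a v \<bullet> x \<and> a v \<bullet> x \<le> b v" using x by auto
qed

text \<open>The barycentre when \<open>\<gamma>\<close> is a facet of a full-dimensional simplex,
  which has exactly \<open>CARD('n)\<close> vertices. It is expressed by extreme points so that it
  depends on the facet alone and is shared by both adjacent elements.\<close>

definition facet_center :: "(real^'n) set \<Rightarrow> real^'n" where
  "facet_center \<gamma> = (1 / CARD('n)) *\<^sub>R (\<Sum>w | w extreme_point_of \<gamma>. w)"

text \<open>Near its centre a facet of a simplex looks like a hyperplane, on the scale of the inscribed balls:
  each of the other vertices of the facet has barycentric coordinate \<open>1/n\<close> at the centre, and this
  coordinate has Lipschitz constant at most \<open>1 / (2 * \<rho>)\<close>.\<close>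

lemma facet_half_ball:
  fixes K :: "(real^'n) set"
  assumes K: "int CARD('n) simplex K" and \<gamma>: "\<gamma> facet_of K"
  obtains \<nu> \<beta> where "norm \<nu> = 1" "affine hull \<gamma> = {x. \<nu> \<bullet> x = \<beta>}" "\<And>x. x \<in> K \<Longrightarrow> \<nu> \<bullet> x \<le> \<beta>"
    "facet_center \<gamma> \<in> rel_interior \<gamma>"
    "\<And>z \<rho> x. cball z \<rho> \<subseteq> K \<Longrightarrow> 0 \<le> \<rho> \<Longrightarrow> norm (x - facet_center \<gamma>) \<le> 2 * \<rho> / CARD('n) \<Longrightarrow> \<nu> \<bullet> x \<le> \<beta> \<Longrightarrow> x \<in> K"
proof -
  obtain C where C: "finite C" "\<not> affine_dependent C" "card C = Suc CARD('n)" "K = convex hull C" "affine hull C = UNIV"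
    using simplex_vertices[OF K] .
  obtain v where v: "v \<in> C" "\<gamma> = convex hull (C - {v})"
    using \<gamma> facet_of_convex_hull_affine_independent[OF C(2)] C(4) by blast
  have "\<forall>v\<in>C. \<exists>ab. norm (fst ab) = 1 \<and> affine hull (C - {v}) = {x. fst ab \<bullet> x = snd ab} \<and> fst ab \<bullet> v < snd ab"
  proof
    fix v assume "v \<in> C"
    from facet_hyperplane[OF C(2,3) this] obtain a b where "norm a = 1" "affine hull (C - {v}) = {x. a \<bullet> x = b}" "a \<bullet> v < b" .
    then show "\<exists>ab. norm (fst ab) = 1 \<and> affine hull (C - {v}) = {x. fst ab \<bullet> x = snd ab} \<and> fst ab \<bullet> v < snd ab"
      by (intro exI[of _ "(a, b)"]) simp
  qed
  from bchoice[OF this] obtain ab where ab: "\<And>v. v \<in> C \<Longrightarrow> norm (fst (ab v)) = 1 \<and> affine hull (C - {v}) = {x. fst (ab v) \<bullet> x = snd (ab v)} \<and> fst (ab v) \<bullet> v < snd (ab v)"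
    by blast
  define a where "a v = fst (ab v)" for v
  define b where "b v = snd (ab v)" for v
  have n1: "norm (a v) = 1" and hull: "affine hull (C - {v}) = {x. a v \<bullet> x = b v}" and vert: "a v \<bullet> v < b v" if "v \<in> C" for v
    using ab[OF that] by (auto simp: a_def b_def)
  have face: "a v \<bullet> w = b v" if "v \<in> C" "w \<in> C - {v}" for v w
    using hull[OF that(1)] hull_subset[of "C - {v}" affine] that(2) by blast
  have in_hull: "x \<in> convex hull C" if "\<And>v. v \<in> C \<Longrightarrow> a v \<bullet> x \<le> b v" for x
    by (rule simplex_halfspaces(1)[OF C(1,5), of a b]) (use face vert that in auto)
  have bounds: "a v \<bullet> v \<le> a v \<bullet> x \<and> a v \<bullet> x \<le> b v" if "x \<in> convex hull C" "v \<in> C" for x v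
    by (rule simplex_halfspaces(2)[OF C(1,5), of a b]) (use face vert that in auto)
  have indv: "\<not> affine_dependent (C - {v})" using C(2) affine_dependent_subset by blast
  have cardv: "card (C - {v}) = CARD('n)" using C(1,3) v(1) by simp
  have "{w. w extreme_point_of \<gamma>} = C - {v}"
    unfolding v(2) using extreme_point_of_convex_hull_affine_independent[OF indv] by blast
  then have center: "facet_center \<gamma> = (\<Sum>w\<in>C - {v}. (1 / CARD('n)) *\<^sub>R w)"
    unfolding facet_center_def by (simp only: scaleR_sum_right)
  have sum1: "(\<Sum>w\<in>C - {v}. 1 / real CARD('n)) = 1" by (simp add: cardv)
  show ?thesis
  proof (rule that[of "a v" "b v"])
    show "norm (a v) = 1" by (rule n1[OF v(1)])
    show "affine hull \<gamma> = {x. a v \<bullet> x = b v}" using hull[OF v(1)] by (simp add: v(2) affine_hull_convex_hull)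
    show "a v \<bullet> x \<le> b v" if "x \<in> K" for x using bounds[of x v] that C(4) v(1) by blast
    show "facet_center \<gamma> \<in> rel_interior \<gamma>"
      unfolding v(2) rel_interior_convex_hull_explicit[OF indv]
      by (intro CollectI exI[of _ "\<lambda>w. 1 / CARD('n)"] conjI sum1 ballI) (simp_all add: center[unfolded v(2)])
    fix z \<rho> x
    assume ball: "cball z \<rho> \<subseteq> K" and \<rho>: "0 \<le> \<rho>" and x: "norm (x - facet_center \<gamma>) \<le> 2 * \<rho> / CARD('n)" and xv: "a v \<bullet> x \<le> b v"
    \<comment> \<open>The inscribed ball fits between the facet hyperplane opposite \<open>w\<close>
      and the parallel one through \<open>w\<close>, so the height is at least its diameter.\<close>
    have height: "2 * \<rho> \<le> b w - a w \<bullet> w" if w: "w \<in> C" for w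
    proof -
      have "z + \<rho> *\<^sub>R a w \<in> K" "z - \<rho> *\<^sub>R a w \<in> K"
        using ball n1[OF w] \<rho> by (auto simp: dist_norm intro!: subsetD[OF ball])
      then have "a w \<bullet> (z + \<rho> *\<^sub>R a w) \<le> b w" "a w \<bullet> w \<le> a w \<bullet> (z - \<rho> *\<^sub>R a w)"
        using bounds[OF _ w] C(4) by blast+
      moreover have "a w \<bullet> a w = 1" using n1[OF w] by (simp add: norm_eq_1)
      ultimately show ?thesis by (simp add: inner_add_right inner_diff_right)
    qed
    have "a w \<bullet> x \<le> b w" if w: "w \<in> C" for w
    proof (cases "w = v")
      case False
      \<comment> \<open>Of the vertices of the facet all but \<open>w\<close> lie on the hyperplane
        opposite \<open>w\<close>; averaging, the centre has 1/n of the height as distance from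
        it.\<close>
      have "(\<Sum>u\<in>C - {v}. (1 / CARD('n)) * b w) = b w"
        using sum1 by (simp only: sum_distrib_right[symmetric] mult_1_left)
      then have "b w - a w \<bullet> facet_center \<gamma> = (\<Sum>u\<in>C - {v}. (1 / CARD('n)) * (b w - a w \<bullet> u))"
        by (simp only: center inner_sum_right inner_scaleR_right right_diff_distrib sum_subtractf)
      also have "\<dots> = (1 / CARD('n)) * (b w - a w \<bullet> w) + (\<Sum>u\<in>C - {v} - {w}. (1 / CARD('n)) * (b w - a w \<bullet> u))"
        using C(1) w False by (intro sum.remove) auto
      also have "(\<Sum>u\<in>C - {v} - {w}. (1 / CARD('n)) * (b w - a w \<bullet> u)) = 0"
        using face[OF w] by (intro sum.neutral) auto
      finally have "2 * \<rho> / CARD('n) \<le> b w - a w \<bullet> facet_center \<gamma>"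
        using height[OF w] by (simp add: divide_right_mono)
      moreover have "a w \<bullet> (x - facet_center \<gamma>) \<le> norm (x - facet_center \<gamma>)"
        using norm_cauchy_schwarz[of "a w" "x - facet_center \<gamma>"] n1[OF w] by simp
      ultimately show ?thesis using x by (simp add: inner_diff_right)
    qed (use xv in simp)
    then show "x \<in> K" using in_hull C(4) by blast
  qed
qed

text \<open>A vector with constant inner product on \<open>\<gamma>\<close> is orthogonal to all
  directions of its affine hull. That hull is a hyperplane, so the vector is parallel to
  \<open>\<nu>\<close>.\<close>

lemma unit_normal_unique:
  fixes n \<nu> x0 :: "'a::euclidean_space"
  assumes n: "norm n = 1" and \<nu>: "norm \<nu> = 1" and A: "affine hull \<gamma> = {x. \<nu> \<bullet> x = \<beta>}" and x0: "x0 \<in> \<gamma>"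
    and t: "\<And>x. x \<in> \<gamma> \<Longrightarrow> n \<bullet> x = t"
  shows "(n = \<nu> \<and> t = \<beta>) \<or> (n = - \<nu> \<and> t = - \<beta>)"
proof -
  have "affine hull \<gamma> \<subseteq> {x. n \<bullet> x = t}"
    using t by (intro hull_minimal affine_hyperplane) auto
  then have sub: "n \<bullet> x = t" if "\<nu> \<bullet> x = \<beta>" for x using A that by blast
  have \<nu>0: "\<nu> \<bullet> x0 = \<beta>" using A x0 hull_subset[of \<gamma> affine] by blast
  have \<nu>\<nu>: "\<nu> \<bullet> \<nu> = 1" using \<nu> by (simp add: norm_eq_1)
  let ?d = "n - (n \<bullet> \<nu>) *\<^sub>R \<nu>"
  have d: "\<nu> \<bullet> ?d = 0" using \<nu>\<nu> by (simp add: inner_diff_right inner_commute)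
  then have "n \<bullet> (x0 + ?d) = t" using \<nu>0 by (intro sub) (simp only: inner_add_right)
  then have "n \<bullet> ?d = 0" using t[OF x0] by (simp add: inner_add_right)
  then have "?d \<bullet> ?d = 0" using d by (simp add: inner_diff_left)
  then have n\<nu>: "n = (n \<bullet> \<nu>) *\<^sub>R \<nu>" by simp
  then have "\<bar>n \<bullet> \<nu>\<bar> = 1" using n \<nu> by (metis mult.right_neutral norm_scaleR)
  then consider "n \<bullet> \<nu> = 1" | "n \<bullet> \<nu> = - 1" by linarith
  then show ?thesis
  proof cases
    case 1
    then have "n = \<nu>" using n\<nu> by simp
    then show ?thesis using \<nu>0 t[OF x0] by simp
  next
    case 2
    then have "n = - \<nu>" using n\<nu> by simp
    then show ?thesis using \<nu>0 t[OF x0] by simp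
  qed
qed

lemma simplex_interior:
  fixes K :: "(real^'n) set"
  assumes "int CARD('n) simplex K"
  shows "interior K \<noteq> {}" "compact K" "convex K" "aff_dim K = int CARD('n)" "negligible (K - interior K)"
proof -
  obtain C where C: "finite C" "\<not> affine_dependent C" "card C = Suc CARD('n)" "K = convex hull C" "affine hull C = UNIV"
    using simplex_vertices[OF assms] .
  show "interior K \<noteq> {}" using interior_convex_hull_eq_empty[of C] C by simp
  show "compact K" "convex K" using C by (auto intro: finite_imp_compact_convex_hull convex_convex_hull)
  then have "K - interior K \<subseteq> frontier K" by (auto simp: frontier_def dest: compact_imp_closed closure_closed)
  then show "negligible (K - interior K)"
    using negligible_convex_frontier[OF \<open>convex K\<close>] negligible_subset by blast
  show "aff_dim K = int CARD('n)" by (rule aff_dim_simplex[OF assms])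
qed

lemma outer_normal_eqI:
  fixes K :: "(real^'n) set"
  assumes K: "int CARD('n) simplex K" and \<nu>: "norm \<nu> = 1" and A: "affine hull \<gamma> = {x. \<nu> \<bullet> x = \<beta>}" and ne: "\<gamma> \<noteq> {}"
    and le: "\<And>x. x \<in> K \<Longrightarrow> \<nu> \<bullet> x \<le> \<beta>"
  shows "outer_normal K \<gamma> = \<nu>"
  unfolding outer_normal_def
proof (rule the_equality)
  have "\<gamma> \<subseteq> {x. \<nu> \<bullet> x = \<beta>}" using A hull_subset[of \<gamma> affine] by simp
  then show "norm \<nu> = 1 \<and> (\<exists>t. (\<forall>x\<in>\<gamma>. \<nu> \<bullet> x = t) \<and> (\<forall>x\<in>K. \<nu> \<bullet> x \<le> t))" using \<nu> le by blast
  fix n assume n: "norm n = 1 \<and> (\<exists>t. (\<forall>x\<in>\<gamma>. n \<bullet> x = t) \<and> (\<forall>x\<in>K. n \<bullet> x \<le> t))"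
  then obtain t where t: "\<And>x. x \<in> \<gamma> \<Longrightarrow> n \<bullet> x = t" "\<And>x. x \<in> K \<Longrightarrow> n \<bullet> x \<le> t" by blast
  obtain x0 where x0: "x0 \<in> \<gamma>" using ne by blast
  \<comment> \<open>The opposite sign would confine the simplex to the hyperplane, contradicting its
    nonempty interior.\<close>
  have "\<not> (n = - \<nu> \<and> t = - \<beta>)"
  proof
    assume *: "n = - \<nu> \<and> t = - \<beta>"
    have "K \<subseteq> {x. \<nu> \<bullet> x = \<beta>}"
    proof
      fix x assume x: "x \<in> K"
      show "x \<in> {x. \<nu> \<bullet> x = \<beta>}" using le[OF x] t(2)[OF x] * by simp
    qed
    then have "interior K \<subseteq> interior {x. \<nu> \<bullet> x = \<beta>}" by (rule interior_mono)
    moreover have "\<nu> \<noteq> 0" using \<nu> by auto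
    ultimately show False using simplex_interior(1)[OF K] by (simp add: interior_hyperplane)
  qed
  then show "n = \<nu>" using unit_normal_unique[OF _ \<nu> A x0 t(1)] n by blast
qed

lemma facets_of_simplex:
  fixes K :: "(real^'n) set"
  assumes "int CARD('n) simplex K"
  shows "finite {\<gamma>. \<gamma> facet_of K}" "card {\<gamma>. \<gamma> facet_of K} \<le> Suc CARD('n)"
proof -
  obtain C where C: "finite C" "\<not> affine_dependent C" "card C = Suc CARD('n)" "K = convex hull C" "affine hull C = UNIV"
    using simplex_vertices[OF assms] .
  have sub: "{\<gamma>. \<gamma> facet_of K} \<subseteq> (\<lambda>u. convex hull (C - {u})) ` C"
    using facet_of_convex_hull_affine_independent[OF C(2)] C(4) by blast
  show "finite {\<gamma>. \<gamma> facet_of K}" using finite_subset[OF sub] C(1) by simp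
  show "card {\<gamma>. \<gamma> facet_of K} \<le> Suc CARD('n)"
    using card_mono[OF _ sub] card_image_le[OF C(1), of "\<lambda>u. convex hull (C - {u})"] C(1,3) by simp
qed

lemma mesh_intersection_faces:
  assumes "triangulation T" "K \<in> T" "K' \<in> T"
  shows "(K \<inter> K') face_of K" "(K \<inter> K') face_of K'"
  using assms unfolding triangulation_def by (blast, metis Int_commute)

lemma simplex_proper_intersection:
  fixes K K' :: "(real^'n) set"
  assumes T: "triangulation T" "K \<in> T" "K' \<in> T" and s: "int CARD('n) simplex K" "int CARD('n) simplex K'" and ne: "K \<noteq> K'"
  shows "aff_dim (K \<inter> K') < int CARD('n)"
proof (cases "K \<inter> K' = K")
  case True
  then have "K face_of K'" using mesh_intersection_faces(2)[OF T] by simp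
  then have "aff_dim K < aff_dim K'" using face_of_aff_dim_lt[OF simplex_interior(3)[OF s(2)]] ne by blast
  then show ?thesis using simplex_interior(4)[OF s(1)] simplex_interior(4)[OF s(2)] by simp
next
  case False
  then show ?thesis
    using face_of_aff_dim_lt[OF simplex_interior(3)[OF s(1)] mesh_intersection_faces(1)[OF T]] simplex_interior(4)[OF s(1)] by simp
qed

text \<open>The intersection of the two elements is a face of K meeting the relative interior of
  \<open>\<gamma>\<close>, so it contains \<open>\<gamma>\<close>. A proper intersection has
  dimension at most n - 1, which leaves only \<open>\<gamma>\<close> itself.\<close>

lemma facet_of_neighbour:
  fixes K K' :: "(real^'n) set"
  assumes T: "triangulation T" "K \<in> T" "K' \<in> T" and s: "int CARD('n) simplex K" "int CARD('n) simplex K'" and ne: "K \<noteq> K'"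
    and \<gamma>: "\<gamma> facet_of K" and x: "x \<in> rel_interior \<gamma>" "x \<in> K'"
  shows "\<gamma> facet_of K'"
proof -
  have f: "\<gamma> face_of K" and dim: "aff_dim \<gamma> = int CARD('n) - 1" and g0: "\<gamma> \<noteq> {}"
    using \<gamma> simplex_interior(4)[OF s(1)] by (auto simp: facet_of_def)
  have sub: "\<gamma> \<subseteq> K" using f by (rule face_of_imp_subset)
  have "x \<in> K" using x(1) rel_interior_subset[of \<gamma>] sub by blast
  have in_I: "\<gamma> \<subseteq> K \<inter> K'"
    by (rule subset_of_face_of[OF mesh_intersection_faces(1)[OF T] sub]) (use x \<open>x \<in> K\<close> in blast)
  have "\<gamma> face_of (K \<inter> K')" by (rule face_of_subset[OF f in_I]) blast
  moreover have "convex (K \<inter> K')" using simplex_interior(3)[OF s(1)] simplex_interior(3)[OF s(2)] by (rule convex_Int)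
  moreover have "aff_dim (K \<inter> K') \<le> aff_dim \<gamma>" using simplex_proper_intersection[OF T s ne] dim by simp
  ultimately have "\<gamma> = K \<inter> K'" using face_of_aff_dim_lt by fastforce
  then show ?thesis
    using mesh_intersection_faces(2)[OF T] g0 dim simplex_interior(4)[OF s(2)] by (simp add: facet_of_def)
qed

lemma conforming_meshD:
  assumes "conforming_mesh \<Omega> (T :: (real^'n) set set)"
  shows "triangulation T" "finite T" "\<And>K. K \<in> T \<Longrightarrow> int CARD('n) simplex K" "\<Union>T = closure \<Omega>"
  using assms by (auto simp: conforming_mesh_def triangulation_def)

text \<open>With equal outer normals both simplices contain a half ball about the centre on the same
  side of the facet, so they overlap in an open set, which distinct elements of a triangulation
  cannot do.\<close>

lemma two_elements_same_side:
  fixes K K' :: "(real^'n) set"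
  assumes T: "triangulation T" "K \<in> T" "K' \<in> T" and s: "int CARD('n) simplex K" "int CARD('n) simplex K'"
    and \<gamma>: "\<gamma> facet_of K" "\<gamma> facet_of K'" and same: "outer_normal K \<gamma> = outer_normal K' \<gamma>"
  shows "K = K'"
proof (rule ccontr)
  assume ne: "K \<noteq> K'"
  let ?x0 = "facet_center \<gamma>"
  have g0: "\<gamma> \<noteq> {}" using \<gamma>(1) by (simp add: facet_of_def)
  obtain \<nu> \<beta> where K1: "norm \<nu> = 1" "affine hull \<gamma> = {x. \<nu> \<bullet> x = \<beta>}" "\<And>x. x \<in> K \<Longrightarrow> \<nu> \<bullet> x \<le> \<beta>" "?x0 \<in> rel_interior \<gamma>"
    "\<And>z \<rho> x. cball z \<rho> \<subseteq> K \<Longrightarrow> 0 \<le> \<rho> \<Longrightarrow> norm (x - ?x0) \<le> 2 * \<rho> / CARD('n) \<Longrightarrow> \<nu> \<bullet> x \<le> \<beta> \<Longrightarrow> x \<in> K"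
    by (rule facet_half_ball[OF s(1) \<gamma>(1)]) (rule that)
  obtain \<nu>' \<beta>' where K2: "norm \<nu>' = 1" "affine hull \<gamma> = {x. \<nu>' \<bullet> x = \<beta>'}" "\<And>x. x \<in> K' \<Longrightarrow> \<nu>' \<bullet> x \<le> \<beta>'"
    "\<And>z \<rho> x. cball z \<rho> \<subseteq> K' \<Longrightarrow> 0 \<le> \<rho> \<Longrightarrow> norm (x - ?x0) \<le> 2 * \<rho> / CARD('n) \<Longrightarrow> \<nu>' \<bullet> x \<le> \<beta>' \<Longrightarrow> x \<in> K'"
    by (rule facet_half_ball[OF s(2) \<gamma>(2)]) (rule that)
  have "\<nu>' = \<nu>"
    using same outer_normal_eqI[OF s(1) K1(1,2) g0 K1(3)] outer_normal_eqI[OF s(2) K2(1,2) g0 K2(3)] by simp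
  have x0: "?x0 \<in> \<gamma>" using K1(4) rel_interior_subset by blast
  then have x0h: "?x0 \<in> affine hull \<gamma>" by (rule hull_inc)
  have \<beta>: "\<nu> \<bullet> ?x0 = \<beta>" "\<beta>' = \<beta>" using x0h K1(2) K2(2) \<open>\<nu>' = \<nu>\<close> by auto
  obtain z1 r1 where r1: "0 < r1" "cball z1 r1 \<subseteq> K" using simplex_interior(1)[OF s(1)] by (auto simp: mem_interior_cball)
  obtain z2 r2 where r2: "0 < r2" "cball z2 r2 \<subseteq> K'" using simplex_interior(1)[OF s(2)] by (auto simp: mem_interior_cball)
  \<comment> \<open>A ball of radius d, centred at distance d inwards from the facet centre, stays
    on the inner side and within 2 d of that centre, as \<open>facet_half_ball\<close> requires for
    both inscribed balls.\<close>
  define d where "d = min r1 r2 / CARD('n)"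
  have n0: "0 < real CARD('n)" by simp
  have d: "0 < d" "2 * d \<le> 2 * r1 / CARD('n)" "2 * d \<le> 2 * r2 / CARD('n)"
    using r1(1) r2(1) n0 by (auto simp: d_def divide_right_mono)
  let ?y = "?x0 - d *\<^sub>R \<nu>"
  have "ball ?y d \<subseteq> K \<inter> K'"
  proof
    fix x assume "x \<in> ball ?y d"
    then have xy: "norm (x - ?y) < d" by (simp add: dist_norm norm_minus_commute)
    have "norm (x - ?x0) \<le> norm (x - ?y) + norm (d *\<^sub>R \<nu>)"
      using norm_triangle_ineq4[of "x - ?y" "d *\<^sub>R \<nu>"] by (simp add: algebra_simps)
    then have "norm (x - ?x0) \<le> 2 * d" using xy K1(1) d(1) by simp
    moreover have "\<nu> \<bullet> (x - ?y) \<le> d"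
      using norm_cauchy_schwarz[of \<nu> "x - ?y"] K1(1) xy by simp
    then have "\<nu> \<bullet> x \<le> \<beta>" using \<beta>(1) K1(1) by (simp add: inner_diff_right norm_eq_1)
    ultimately show "x \<in> K \<inter> K'"
      using K1(5)[OF r1(2), of x] K2(4)[OF r2(2), of x] r1(1) r2(1) d \<beta>(2) \<open>\<nu>' = \<nu>\<close> by auto
  qed
  then have "aff_dim (ball ?y d) \<le> aff_dim (K \<inter> K')" by (rule aff_dim_subset)
  moreover have "aff_dim (ball ?y d) = int CARD('n)"
    using d(1) by (subst aff_dim_open) auto
  ultimately show False using simplex_proper_intersection[OF T s ne] by simp
qed

text \<open>There are at most two elements since each is determined by its outer normal,
  \<open>n\<close> or \<open>- n\<close>. There are at least two since the centre of the face is
  interior to the domain and points on either side of it must be covered.\<close>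

lemma interior_face_elements:
  fixes \<Omega> :: "(real^'n) set"
  assumes \<Omega>: "open \<Omega>" and T: "conforming_mesh \<Omega> T" and \<gamma>: "\<gamma> \<in> int_faces \<Omega> T"
    and n: "norm n = 1" "\<And>x. x \<in> \<gamma> \<Longrightarrow> n \<bullet> x = t"
  obtains K1 K2 where "K1 \<noteq> K2" "face_patch T \<gamma> = {K1, K2}" "outer_normal K1 \<gamma> = n" "outer_normal K2 \<gamma> = - n"
    "affine hull \<gamma> = {x. n \<bullet> x = t}" "facet_center \<gamma> \<in> \<gamma>" "compact \<gamma>"
    "\<And>z \<rho> x. cball z \<rho> \<subseteq> K1 \<Longrightarrow> 0 \<le> \<rho> \<Longrightarrow> norm (x - facet_center \<gamma>) \<le> 2 * \<rho> / CARD('n) \<Longrightarrow> n \<bullet> x \<le> t \<Longrightarrow> x \<in> K1"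
    "\<And>z \<rho> x. cball z \<rho> \<subseteq> K2 \<Longrightarrow> 0 \<le> \<rho> \<Longrightarrow> norm (x - facet_center \<gamma>) \<le> 2 * \<rho> / CARD('n) \<Longrightarrow> t \<le> n \<bullet> x \<Longrightarrow> x \<in> K2"
proof -
  note T' = conforming_meshD[OF T]
  let ?x0 = "facet_center \<gamma>"
  have each: "(outer_normal K \<gamma> = n \<and> (\<forall>x\<in>K. n \<bullet> x \<le> t) \<and> (\<forall>z \<rho> x. cball z \<rho> \<subseteq> K \<longrightarrow> 0 \<le> \<rho> \<longrightarrow> norm (x - ?x0) \<le> 2 * \<rho> / CARD('n) \<longrightarrow> n \<bullet> x \<le> t \<longrightarrow> x \<in> K)
     \<or> outer_normal K \<gamma> = - n \<and> (\<forall>x\<in>K. t \<le> n \<bullet> x) \<and> (\<forall>z \<rho> x. cball z \<rho> \<subseteq> K \<longrightarrow> 0 \<le> \<rho> \<longrightarrow> norm (x - ?x0) \<le> 2 * \<rho> / CARD('n) \<longrightarrow> t \<le> n \<bullet> x \<longrightarrow> x \<in> K))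
     \<and> affine hull \<gamma> = {x. n \<bullet> x = t} \<and> ?x0 \<in> rel_interior \<gamma> \<and> compact \<gamma>"
    if K: "K \<in> T" "\<gamma> facet_of K" for K
  proof -
    have g0: "\<gamma> \<noteq> {}" using K(2) by (simp add: facet_of_def)
    then obtain g where g: "g \<in> \<gamma>" by blast
    obtain \<nu> \<beta> where K1: "norm \<nu> = 1" "affine hull \<gamma> = {x. \<nu> \<bullet> x = \<beta>}" "\<And>x. x \<in> K \<Longrightarrow> \<nu> \<bullet> x \<le> \<beta>" "?x0 \<in> rel_interior \<gamma>"
      "\<And>z \<rho> x. cball z \<rho> \<subseteq> K \<Longrightarrow> 0 \<le> \<rho> \<Longrightarrow> norm (x - ?x0) \<le> 2 * \<rho> / CARD('n) \<Longrightarrow> \<nu> \<bullet> x \<le> \<beta> \<Longrightarrow> x \<in> K"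
      by (rule facet_half_ball[OF T'(3)[OF K(1)] K(2)]) (rule that)
    have on: "outer_normal K \<gamma> = \<nu>" by (rule outer_normal_eqI[OF T'(3)[OF K(1)] K1(1,2) g0 K1(3)])
    have cpt: "compact \<gamma>"
      using K(2) simplex_interior(2,3)[OF T'(3)[OF K(1)]] face_of_imp_compact by (auto simp: facet_of_def)
    from unit_normal_unique[OF n(1) K1(1,2) g n(2)]
    consider "n = \<nu>" "t = \<beta>" | "n = - \<nu>" "t = - \<beta>" by blast
    then show ?thesis
    proof cases
      case 1
      then show ?thesis using K1 on cpt by blast
    next
      case 2
      then have "\<nu> = - n" "\<beta> = - t" by auto
      then show ?thesis using K1 on cpt by (intro conjI disjI2) auto
    qed
  qed
  obtain K where K: "K \<in> T" "\<gamma> facet_of K" and rel: "rel_interior \<gamma> \<subseteq> \<Omega>"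
    using \<gamma> by (auto simp: int_faces_def)
  have x0: "?x0 \<in> rel_interior \<gamma>" and hull: "affine hull \<gamma> = {x. n \<bullet> x = t}" and cpt: "compact \<gamma>" using each[OF K] by auto
  have x0g: "?x0 \<in> \<gamma>" using x0 rel_interior_subset by blast
  have nx0: "n \<bullet> ?x0 = t" by (rule n(2)[OF x0g])
  have nn: "n \<bullet> n = 1" using n(1) by (simp add: norm_eq_1)
  have side: "\<exists>K'\<in>T. \<gamma> facet_of K' \<and> (\<exists>x\<in>K'. \<sigma> * (n \<bullet> x - t) > 0)" if \<sigma>: "\<sigma> = 1 \<or> \<sigma> = - 1" for \<sigma> :: real
  proof -
    have "\<exists>K'\<in>T. ?x0 \<in> K' \<and> (\<exists>x\<in>K'. \<sigma> * (n \<bullet> x - t) > 0)"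
    proof (rule ccontr)
      assume no: "\<not> ?thesis"
      \<comment> \<open>The finitely many elements that miss the centre have closed union, so every
        point of the domain close enough to the centre lies in an element through the
        centre.\<close>
      let ?A = "\<Union>{K' \<in> T. ?x0 \<notin> K'}"
      have "closed ?A"
        using T'(2,3) simplex_interior(2) by (intro closed_Union) (auto intro: compact_imp_closed)
      then have "open (\<Omega> - ?A)" using \<Omega> by (rule open_Diff[rotated])
      moreover have "?x0 \<in> \<Omega> - ?A" using x0 rel by auto
      ultimately obtain e where e: "0 < e" "ball ?x0 e \<subseteq> \<Omega> - ?A" by (meson open_contains_ball)
      let ?z = "?x0 + (\<sigma> * (e / 2)) *\<^sub>R n"
      have "norm ((\<sigma> * (e / 2)) *\<^sub>R n) < e" using n(1) e(1) \<sigma> by auto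
      moreover have "dist ?x0 (?x0 + v) = norm v" for v by (simp add: dist_norm)
      ultimately have "?z \<in> ball ?x0 e" unfolding mem_ball by (simp only:)
      then have x: "?z \<in> \<Omega>" "?z \<notin> ?A" using e(2) by blast+
      then have "?z \<in> \<Union>T" using T'(4) closure_subset by blast
      then obtain K' where K': "K' \<in> T" "?z \<in> K'" by blast
      then have "?x0 \<in> K'" using x(2) by blast
      moreover have "\<sigma> * (n \<bullet> ?z - t) > 0"
        using e(1) \<sigma> nx0 nn by (auto simp: inner_add_right)
      ultimately show False using no K' by blast
    qed
    then obtain K' x where K': "K' \<in> T" "?x0 \<in> K'" "x \<in> K'" "\<sigma> * (n \<bullet> x - t) > 0" by blast
    have "\<gamma> facet_of K'"
    proof (cases "K' = K")
      case False
      then show ?thesis using facet_of_neighbour[OF T'(1) K(1) K'(1) T'(3)[OF K(1)] T'(3)[OF K'(1)] _ K(2) x0 K'(2)] by blast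
    qed (use K in simp)
    with K' show ?thesis by blast
  qed
  obtain K1 x1 where K1: "K1 \<in> T" "\<gamma> facet_of K1" "x1 \<in> K1" "n \<bullet> x1 < t" using side[of "-1"] by auto
  obtain K2 x2 where K2: "K2 \<in> T" "\<gamma> facet_of K2" "x2 \<in> K2" "t < n \<bullet> x2" using side[of 1] by auto
  have e1: "outer_normal K1 \<gamma> = n" "\<forall>z \<rho> x. cball z \<rho> \<subseteq> K1 \<longrightarrow> 0 \<le> \<rho> \<longrightarrow> norm (x - ?x0) \<le> 2 * \<rho> / CARD('n) \<longrightarrow> n \<bullet> x \<le> t \<longrightarrow> x \<in> K1"
  proof -
    have "\<not> (\<forall>x\<in>K1. t \<le> n \<bullet> x)" using K1(3,4) by force
    then show "outer_normal K1 \<gamma> = n" "\<forall>z \<rho> x. cball z \<rho> \<subseteq> K1 \<longrightarrow> 0 \<le> \<rho> \<longrightarrow> norm (x - ?x0) \<le> 2 * \<rho> / CARD('n) \<longrightarrow> n \<bullet> x \<le> t \<longrightarrow> x \<in> K1"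
      using each[OF K1(1,2)] by blast+
  qed
  have e2: "outer_normal K2 \<gamma> = - n" "\<forall>z \<rho> x. cball z \<rho> \<subseteq> K2 \<longrightarrow> 0 \<le> \<rho> \<longrightarrow> norm (x - ?x0) \<le> 2 * \<rho> / CARD('n) \<longrightarrow> t \<le> n \<bullet> x \<longrightarrow> x \<in> K2"
  proof -
    have "\<not> (\<forall>x\<in>K2. n \<bullet> x \<le> t)" using K2(3,4) by force
    then show "outer_normal K2 \<gamma> = - n" "\<forall>z \<rho> x. cball z \<rho> \<subseteq> K2 \<longrightarrow> 0 \<le> \<rho> \<longrightarrow> norm (x - ?x0) \<le> 2 * \<rho> / CARD('n) \<longrightarrow> t \<le> n \<bullet> x \<longrightarrow> x \<in> K2"
      using each[OF K2(1,2)] by blast+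
  qed
  have "n \<noteq> - n"
  proof
    assume "n = - n"
    from arg_cong[OF this, of "\<lambda>v. n \<bullet> v"] show False using nn by simp
  qed
  then have ne: "K1 \<noteq> K2" using e1(1) e2(1) by metis
  have patch: "face_patch T \<gamma> = {K1, K2}"
  proof
    show "{K1, K2} \<subseteq> face_patch T \<gamma>" using K1 K2 by (auto simp: face_patch_def)
    show "face_patch T \<gamma> \<subseteq> {K1, K2}"
    proof
      fix K3 assume "K3 \<in> face_patch T \<gamma>"
      then have K3: "K3 \<in> T" "\<gamma> facet_of K3" by (auto simp: face_patch_def)
      from each[OF K3] have "outer_normal K3 \<gamma> = outer_normal K1 \<gamma> \<or> outer_normal K3 \<gamma> = outer_normal K2 \<gamma>"
        using e1 e2 by auto
      then show "K3 \<in> {K1, K2}"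
        using two_elements_same_side[OF T'(1) K3(1) K1(1) T'(3)[OF K3(1)] T'(3)[OF K1(1)] K3(2) K1(2)]
          two_elements_same_side[OF T'(1) K3(1) K2(1) T'(3)[OF K3(1)] T'(3)[OF K2(1)] K3(2) K2(2)] by blast
    qed
  qed
  show ?thesis
    by (rule that[OF ne patch e1(1) e2(1) hull x0g cpt]) (use e1(2) e2(2) in blast)+
qed

section \<open>Consequences of shape regularity and of the Lipschitz boundary\<close>

lemma shape_regular_inball:
  assumes "shape_regular \<TT>"
  obtains \<sigma> where "0 < \<sigma>" "\<And>T K. T \<in> \<TT> \<Longrightarrow> K \<in> T \<Longrightarrow> 0 < diameter K \<Longrightarrow> \<exists>z r. 0 < r \<and> cball z r \<subseteq> K \<and> diameter K \<le> \<sigma> * r"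
proof -
  obtain \<sigma> where \<sigma>: "\<sigma> > 0" "\<And>T K. T \<in> \<TT> \<Longrightarrow> K \<in> T \<Longrightarrow> diameter K \<le> \<sigma> * inball_diameter K"
    using assms by (auto simp: shape_regular_def)
  have "\<exists>z r. 0 < r \<and> cball z r \<subseteq> K \<and> diameter K \<le> (4 * \<sigma>) * r" if "T \<in> \<TT>" "K \<in> T" "0 < diameter K" for T K
  proof -
    let ?X = "{2 * r | r. 0 \<le> r \<and> (\<exists>x. cball x r \<subseteq> K)}"
    have "K \<noteq> {}" using that(3) by auto
    then obtain k where "cball k 0 \<subseteq> K" by auto
    then have ne: "?X \<noteq> {}" by force
    \<comment> \<open>Aiming at half of the lower bound makes the inequality strict, so that some
      inscribed ball exceeds it without the supremum having to be attained. Passing from diameters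
      to radii doubles the constant once more, hence 4 \<open>\<sigma>\<close>.\<close>
    have "diameter K / (2 * \<sigma>) < Sup ?X"
    proof -
      have "diameter K / (2 * \<sigma>) < diameter K / \<sigma>" using that(3) \<sigma>(1) by (simp add: field_simps)
      also have "\<dots> \<le> inball_diameter K" using \<sigma>(2)[OF that(1,2)] \<sigma>(1) by (simp add: field_simps)
      finally show ?thesis by (simp add: inball_diameter_def)
    qed
    from less_cSupD[OF ne this] obtain r x where r: "diameter K / (2 * \<sigma>) < 2 * r" "cball x r \<subseteq> K"
      by blast
    have "0 < diameter K / (2 * \<sigma>)" using that(3) \<sigma>(1) by simp
    then have "0 < r" using r(1) by linarith
    moreover have "diameter K \<le> (4 * \<sigma>) * r" using r(1) \<sigma>(1) by (simp add: field_simps)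
    ultimately show ?thesis using r(2) by blast
  qed
  moreover have "0 < 4 * \<sigma>" using \<sigma>(1) by simp
  ultimately show ?thesis using that by blast
qed

text \<open>A Lipschitz domain lies on one side of its boundary, which excludes slits. The mesh
  determines only the closure of the domain, and this lemma turns open sets covered by elements into
  subsets of the domain.\<close>

lemma interior_closure_lipschitz:
  assumes "lipschitz_boundary \<Omega>" "open \<Omega>"
  shows "interior (closure \<Omega>) = \<Omega>"
proof
  show "\<Omega> \<subseteq> interior (closure \<Omega>)" using assms(2) closure_subset by (intro interior_maximal)
  show "interior (closure \<Omega>) \<subseteq> \<Omega>"
  proof (rule ccontr)
    assume "\<not> interior (closure \<Omega>) \<subseteq> \<Omega>"
    then obtain x where x: "x \<in> interior (closure \<Omega>)" "x \<notin> \<Omega>" by blast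
    then have "x \<in> frontier \<Omega>" using assms(2) interior_subset by (auto simp: frontier_def interior_open)
    from assms(1)[unfolded lipschitz_boundary_def, rule_format, OF this] obtain U e L \<phi> where U: "open U" "x \<in> U" "norm e = 1" "L-lipschitz_on UNIV \<phi>"
      "\<Omega> \<inter> U = {z \<in> U. \<phi> (z - (z \<bullet> e) *\<^sub>R e) < z \<bullet> e}"
      by (elim exE conjE) (rule that)
    have "open (interior (closure \<Omega>) \<inter> U)" using U(1) by auto
    then obtain r where r: "0 < r" "ball x r \<subseteq> interior (closure \<Omega>) \<inter> U"
      using x(1) U(2) by (meson IntI open_contains_ball)
    have cont: "continuous_on UNIV (\<lambda>z. \<phi> (z - (z \<bullet> e) *\<^sub>R e))"
      by (intro continuous_on_compose2[OF lipschitz_on_continuous_on[OF U(4)]] continuous_intros) auto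
    \<comment> \<open>A point just below the boundary graph: it belongs to the closure, yet a whole
      neighbourhood of it misses the domain.\<close>
    let ?y = "x - (r / 2) *\<^sub>R e"
    have ee: "e \<bullet> e = 1" using U(3) by (simp add: norm_eq_1)
    have y_in: "?y \<in> ball x r" using r(1) U(3) by (simp add: dist_norm)
    have proj: "?y - (?y \<bullet> e) *\<^sub>R e = x - (x \<bullet> e) *\<^sub>R e" using ee by (simp add: inner_diff_left algebra_simps)
    have "\<not> \<phi> (x - (x \<bullet> e) *\<^sub>R e) < x \<bullet> e" using x(2) U(2,5) by blast
    then have gt: "?y \<bullet> e < \<phi> (?y - (?y \<bullet> e) *\<^sub>R e)" unfolding proj using ee r(1) by (simp add: inner_diff_left)
    let ?V = "{z. z \<bullet> e < \<phi> (z - (z \<bullet> e) *\<^sub>R e)} \<inter> ball x r"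
    have V: "open ?V" by (intro open_Int open_ball open_Collect_less cont continuous_intros)
    have "?y \<in> ?V" using gt y_in by simp
    moreover have "?y \<in> closure \<Omega>" using y_in r(2) interior_subset by blast
    ultimately have "?y \<in> ?V \<inter> closure \<Omega>" by (rule IntI)
    then have "?V \<inter> closure \<Omega> \<noteq> {}" by (rule ex_in_conv[THEN iffD1, OF exI])
    then have "?V \<inter> \<Omega> \<noteq> {}" unfolding open_Int_closure_eq_empty[OF V] .
    then obtain w where w: "w \<in> \<Omega>" "w \<in> ?V" by (auto simp only: ex_in_conv[symmetric] Int_iff)
    then have "w \<in> \<Omega> \<inter> U" using r(2) by blast
    then have "\<phi> (w - (w \<bullet> e) *\<^sub>R e) < w \<bullet> e" unfolding U(5) mem_Collect_eq by (rule conjunct2)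
    moreover have "w \<bullet> e < \<phi> (w - (w \<bullet> e) *\<^sub>R e)" using w(2) unfolding Int_iff mem_Collect_eq by (rule conjunct1)
    ultimately show False by linarith
  qed
qed

text \<open>Glues the strong residuals of the two elements along a face into one function on a ball
  about the face centre. A bound by twice the sum is enough there.\<close>

lemma L2_piecewise:
  fixes f g :: "'a::euclidean_space \<Rightarrow> 'b::euclidean_space"
  assumes f: "f \<in> L2 K1" and g: "g \<in> L2 K2"
    and s: "K1 \<in> sets lebesgue" "K2 \<in> sets lebesgue" "S \<in> sets lebesgue" "A \<in> sets lebesgue"
    and sub: "S \<inter> A \<subseteq> K1" "S - A \<subseteq> K2"
  shows "(\<lambda>x. if x \<in> A then f x else g x) \<in> L2 S"
    and "(L2norm S (\<lambda>x. if x \<in> A then f x else g x))\<^sup>2 \<le> 2 * (L2norm K1 f)\<^sup>2 + 2 * (L2norm K2 g)\<^sup>2"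
proof -
  have part: "(\<lambda>x. indicator Z x *\<^sub>R k x) \<in> L2 S \<and> L2norm S (\<lambda>x. indicator Z x *\<^sub>R k x) \<le> L2norm K k"
    if k: "k \<in> L2 K" and K: "K \<in> sets lebesgue" and Z: "Z \<in> sets lebesgue" "S \<inter> Z \<subseteq> K" for k :: "'a \<Rightarrow> 'b" and K Z
  proof -
    have m: "S \<inter> Z \<in> sets lebesgue" using Z(1) s(3) by auto
    have neg: "negligible (S \<inter> Z - K)" using Z(2) by (metis Diff_eq_empty_iff negligible_empty)
    have kL: "k \<in> L2 (S \<inter> Z)" by (rule L2_subset[OF k m K neg])
    have eq: "AE x in lebesgue. (if x \<in> S \<inter> Z then k x else 0) = (if x \<in> S then indicator Z x *\<^sub>R k x else 0)"
      by (rule AE_I2) (auto simp: indicator_def)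
    have eq2: "AE x in lebesgue. (if x \<in> S \<inter> Z then (norm (k x))\<^sup>2 else 0) = (if x \<in> S then (norm (indicator Z x *\<^sub>R k x))\<^sup>2 else 0)"
      by (rule AE_I2) (auto simp: indicator_def)
    have "(\<lambda>x. indicator Z x *\<^sub>R k x) \<in> L2 S"
      using kL integrable_lebesgue_on_cong_AE(2)[OF m s(3) eq] integrable_lebesgue_on_cong_AE(1)[OF m s(3) eq2]
      by (simp add: L2_def)
    moreover have "L2norm S (\<lambda>x. indicator Z x *\<^sub>R k x) = L2norm (S \<inter> Z) k"
      by (rule L2norm_sq_cong_AE[OF m s(3) eq, symmetric])
    moreover have "L2norm (S \<inter> Z) k \<le> L2norm K k" by (rule L2norm_subset[OF k m K neg])
    ultimately show ?thesis by simp
  qed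
  have cA: "- A \<in> sets lebesgue" using s(4) by (simp add: Compl_in_sets_lebesgue)
  have sub2: "S \<inter> - A \<subseteq> K2" using sub(2) by auto
  note 1 = part[OF f s(1,4) sub(1)] and 2 = part[OF g s(2) cA sub2]
  have eq: "(\<lambda>x. if x \<in> A then f x else g x) = (\<lambda>x. indicator A x *\<^sub>R f x + indicator (- A) x *\<^sub>R g x)"
    by (auto simp: indicator_def)
  show "(\<lambda>x. if x \<in> A then f x else g x) \<in> L2 S" unfolding eq using 1 2 by (intro L2_add) auto
  have "(L2norm S (\<lambda>x. indicator A x *\<^sub>R f x))\<^sup>2 \<le> (L2norm K1 f)\<^sup>2"
    "(L2norm S (\<lambda>x. indicator (- A) x *\<^sub>R g x))\<^sup>2 \<le> (L2norm K2 g)\<^sup>2"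
    using 1 2 by (auto intro!: power_mono)
  then show "(L2norm S (\<lambda>x. if x \<in> A then f x else g x))\<^sup>2 \<le> 2 * (L2norm K1 f)\<^sup>2 + 2 * (L2norm K2 g)\<^sup>2"
    unfolding eq using L2norm_add_sq[OF conjunct1[OF 1] conjunct1[OF 2]] by linarith
qed

lemma L2norm_sq_mono:
  fixes f :: "'a::euclidean_space \<Rightarrow> 'b::euclidean_space"
  assumes "f \<in> L2 T" "S \<in> sets lebesgue" "T \<in> sets lebesgue" "S \<subseteq> T"
  shows "(L2norm S f)\<^sup>2 \<le> (L2norm T f)\<^sup>2"
proof -
  have "S - T = {}" using assms(4) by blast
  then have "negligible (S - T)" by simp
  from L2norm_subset[OF assms(1-3) this] show ?thesis by (intro power_mono) auto
qed

lemma radius_le_diameter: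
  fixes K :: "(real^'n) set"
  assumes "cball z r \<subseteq> K" "bounded K" "0 \<le> r"
  shows "r \<le> diameter K"
proof -
  obtain e :: "real^'n" where e: "norm e = 1" using vector_choose_size[of 1] by auto
  have "z \<in> K" "z + r *\<^sub>R e \<in> K" using assms(1,3) e by (auto intro!: subsetD[OF assms(1)] simp: dist_norm)
  from diameter_bounded_bound[OF assms(2) this] show ?thesis using assms(3) e by (simp add: dist_norm)
qed

text \<open>An element lies in the closure of the domain, so its interior lies in the domain itself
  and the rest is a null set. Through this, data and errors on the domain restrict to
  elements.\<close>

lemma mesh_element:
  fixes \<Omega> :: "(real^'n) set"
  assumes \<Omega>: "open \<Omega>" "lipschitz_boundary \<Omega>" and T: "conforming_mesh \<Omega> T" and K: "K \<in> T"
  shows "compact K" "interior K \<noteq> {}" "interior K \<subseteq> \<Omega>" "negligible (K - \<Omega>)" "negligible (K - interior K)"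
    "0 < diameter K" "K \<in> sets lebesgue" "K \<in> lmeasurable" "K \<subseteq> closure \<Omega>"
proof -
  note s = simplex_interior[OF conforming_meshD(3)[OF T K]]
  show "compact K" "interior K \<noteq> {}" "negligible (K - interior K)" using s by auto
  show sub: "K \<subseteq> closure \<Omega>" using conforming_meshD(4)[OF T] K by blast
  then have "interior K \<subseteq> interior (closure \<Omega>)" by (rule interior_mono)
  then show i: "interior K \<subseteq> \<Omega>" using interior_closure_lipschitz[OF \<Omega>(2,1)] by simp
  then have "K - \<Omega> \<subseteq> K - interior K" by blast
  with s(5) show "negligible (K - \<Omega>)" by (rule negligible_subset)
  obtain z r where r: "0 < r" "cball z r \<subseteq> K" using s(1) by (auto simp: mem_interior_cball)
  then show "0 < diameter K" using radius_le_diameter[OF r(2) compact_imp_bounded[OF s(2)]] by simp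
  show "K \<in> lmeasurable" using s(2) by (rule lmeasurable_compact)
  then show "K \<in> sets lebesgue" by (rule fmeasurableD)
qed

lemma closest_point_hyperplane:
  fixes n :: "'a::euclidean_space"
  assumes "norm n = 1"
  shows "closest_point {x. n \<bullet> x = t} z = hyper_proj n t z"
proof -
  have "dist z (hyper_proj n t z) \<le> dist z w" if "n \<bullet> w = t" for w
  proof -
    have "dist z (hyper_proj n t z) = \<bar>n \<bullet> (z - w)\<bar>"
      using that assms by (simp add: hyper_proj_def dist_norm inner_diff_right)
    also have "\<dots> \<le> dist z w"
      using Cauchy_Schwarz_ineq2[of n "z - w"] assms by (simp add: dist_norm)
    finally show ?thesis .
  qed
  then show ?thesis
    using hyper_proj_on[OF assms] closest_point_unique[of "{x. n \<bullet> x = t}" "hyper_proj n t z" z]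
    by (simp add: convex_hyperplane closed_hyperplane)
qed

text \<open>The face norm rests on a chosen unit normal of unknown orientation. Exactly this normal
  is handed out, and the two adjacent elements are labelled to suit it afterwards.\<close>

lemma face_L2norm_hyper_proj:
  fixes \<gamma> :: "(real^'n) set"
  assumes T: "conforming_mesh \<Omega> T" and \<gamma>: "\<gamma> \<in> int_faces \<Omega> T"
  obtains n t where "norm n = 1" "\<And>x. x \<in> \<gamma> \<Longrightarrow> n \<bullet> x = t"
    "\<And>g :: real^'n \<Rightarrow> real^'n. affine hull \<gamma> = {x. n \<bullet> x = t} \<Longrightarrow>
      face_L2norm \<gamma> g = L2norm {x + s *\<^sub>R n |x s. x \<in> \<gamma> \<and> 0 \<le> s \<and> s \<le> 1} (\<lambda>z. g (hyper_proj n t z))"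
proof -
  obtain K where K: "K \<in> T" "\<gamma> facet_of K" using \<gamma> by (auto simp: int_faces_def)
  obtain \<nu> \<beta> where \<nu>: "norm \<nu> = 1" "affine hull \<gamma> = {x. \<nu> \<bullet> x = \<beta>}"
    using facet_half_ball[OF conforming_meshD(3)[OF T K(1)] K(2)] by metis
  have "\<gamma> \<subseteq> {x. \<nu> \<bullet> x = \<beta>}" using \<nu>(2) hull_subset[of \<gamma> affine] by simp
  then have "\<exists>n. norm n = 1 \<and> (\<exists>t. \<forall>x\<in>\<gamma>. n \<bullet> x = t)" using \<nu>(1) by blast
  from someI_ex[OF this] obtain t where "norm (SOME n. norm n = 1 \<and> (\<exists>t. \<forall>x\<in>\<gamma>. n \<bullet> x = t)) = 1"
    "\<forall>x\<in>\<gamma>. (SOME n. norm n = 1 \<and> (\<exists>t. \<forall>x\<in>\<gamma>. n \<bullet> x = t)) \<bullet> x = t" by blast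
  then show ?thesis
    by (intro that[of "SOME n. norm n = 1 \<and> (\<exists>t. \<forall>x\<in>\<gamma>. n \<bullet> x = t)" t])
      (auto simp: face_L2norm_def Let_def closest_point_hyperplane)
qed

section \<open>Residual bounds on the elements and faces of one mesh\<close>

locale mesh_error = oseen_error \<Omega> \<epsilon> \<kappa> B c y yT G GT p pT M \<Lambda> C1 C2
  for \<Omega> :: "(real^'n) set" and \<epsilon> \<kappa> B c y yT G GT p pT M \<Lambda> C1 C2 +
  fixes T :: "(real^'n) set set" and \<sigma> :: real and P R F :: "(real^'n) set \<Rightarrow> real^'n \<Rightarrow> real^'n"
    and \<pi> :: "(real^'n) set \<Rightarrow> real^'n \<Rightarrow> real"
  assumes lip: "lipschitz_boundary \<Omega>" and mesh: "conforming_mesh \<Omega> T"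
    and \<sigma>: "0 < \<sigma>" "16 * (\<sigma> * CARD('n)) + 5 \<le> \<Lambda>"
    and inball: "\<And>K. K \<in> T \<Longrightarrow> 0 < diameter K \<Longrightarrow> \<exists>z r. 0 < r \<and> cball z r \<subseteq> K \<and> diameter K \<le> \<sigma> * r"
    and local: "\<And>K. K \<in> T \<Longrightarrow> vpdeg M (P K)" "\<And>K. K \<in> T \<Longrightarrow> pdeg M (\<pi> K)" "\<And>K. K \<in> T \<Longrightarrow> vpdeg M (R K)"
      "\<And>K. K \<in> T \<Longrightarrow> F K \<in> L2 K"
    and ae: "\<And>K. K \<in> T \<Longrightarrow> AE x in lebesgue_on K. yT x = P K x \<and> wGrad \<Omega> yT x = vjac (P K) x \<and> pT x = \<pi> K x
      \<and> R K x + F K x = strong_res \<epsilon> \<kappa> c (P K) (\<pi> K) GT x"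
begin

lemmas elt = mesh_element[OF open_domain lip mesh]

text \<open>Here \<open>F K\<close> is the non-polynomial part of the strong residual, that is, the
  oscillation; the polynomial part \<open>R K\<close> is what the following bounds control.\<close>

definition element_error :: "(real^'n) set \<Rightarrow> real" where
  "element_error K = diffusion_error K + (diameter K)\<^sup>2 * (reaction_error K + (L2norm K (F K))\<^sup>2)"

definition element_const :: real where
  "element_const = 4 * \<sigma>\<^sup>2 * (C2 * ((2 * energy_const CARD('n) \<epsilon> \<kappa> B + 2) * C1))"

lemma consts_nonneg: "0 < energy_const CARD('n) \<epsilon> \<kappa> B" "0 \<le> element_const" "0 \<le> element_error K"
proof -
  show 1: "0 < energy_const CARD('n) \<epsilon> \<kappa> B" by (rule energy_const_pos)
  show "0 \<le> element_const" unfolding element_const_def using 1 C1(1) C2(1) by simp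
  show "0 \<le> element_error K" unfolding element_error_def
    by (intro add_nonneg_nonneg mult_nonneg_nonneg errors_nonneg) auto
qed

lemma errors_L2:
  assumes "S \<in> sets lebesgue" "negligible (S - \<Omega>)"
  shows "wGrad \<Omega> (\<lambda>x. y x - yT x) \<in> L2 S" "(\<lambda>x. p x - pT x) \<in> L2 S" "(\<lambda>x. y x - yT x) \<in> L2 S" "(\<lambda>x. G x - GT x) \<in> L2 S"
proof -
  have s: "\<Omega> \<in> sets lebesgue" using open_domain by auto
  have L: "(\<lambda>x. wGrad \<Omega> y x - wGrad \<Omega> yT x) \<in> L2 \<Omega>"
    by (intro L2_diff wGrad_L2 open_domain y yT)
  have "AE x in lebesgue_on \<Omega>. wGrad \<Omega> y x - wGrad \<Omega> yT x = wGrad \<Omega> (\<lambda>x. y x - yT x) x"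
    using wGrad_diff[OF open_domain y yT] by eventually_elim simp
  from L2_cong_AE[OF s this L] have "wGrad \<Omega> (\<lambda>x. y x - yT x) \<in> L2 \<Omega>" .
  then show "wGrad \<Omega> (\<lambda>x. y x - yT x) \<in> L2 S" "(\<lambda>x. p x - pT x) \<in> L2 S" "(\<lambda>x. y x - yT x) \<in> L2 S" "(\<lambda>x. G x - GT x) \<in> L2 S"
    by (intro L2_subset[OF _ assms(1) s assms(2)] L2_diff vec_space_L2 y yT p pT G GT; assumption)+
qed

lemma errors_mono:
  assumes S: "S \<in> sets lebesgue" and K: "K \<in> T" "S \<subseteq> K"
  shows "diffusion_error S \<le> diffusion_error K" "reaction_error S \<le> reaction_error K"
proof -
  note L = L2norm_sq_mono[OF _ S elt(7)[OF K(1)] K(2)]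
  note E = errors_L2[OF elt(7,4)[OF K(1)]]
  note 1 = L[OF E(1)] L[OF E(2)] L[OF E(4)] mult_left_mono[OF L[OF E(3)] nonneg(2)]
  show "diffusion_error S \<le> diffusion_error K" "reaction_error S \<le> reaction_error K"
    unfolding diffusion_error_def reaction_error_def using 1 by linarith+
qed

lemma errors_Un:
  assumes S: "S \<in> sets lebesgue" and K: "K1 \<in> T" "K2 \<in> T" "S \<subseteq> K1 \<union> K2"
  shows "diffusion_error S \<le> 2 * (diffusion_error K1 + diffusion_error K2)"
    "reaction_error S \<le> 2 * (reaction_error K1 + reaction_error K2)"
proof -
  note s = elt(7)[OF K(1)] elt(7)[OF K(2)]
  have L: "(L2norm S f)\<^sup>2 \<le> 2 * (L2norm K1 f)\<^sup>2 + 2 * (L2norm K2 f)\<^sup>2" if "f \<in> L2 K1" "f \<in> L2 K2" for f :: "real^'n \<Rightarrow> 'b::euclidean_space"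
    using L2_piecewise(2)[OF that s S s(1)] K(3) by auto
  note E1 = errors_L2[OF elt(7,4)[OF K(1)]] and E2 = errors_L2[OF elt(7,4)[OF K(2)]]
  have "\<kappa> * (L2norm S (\<lambda>x. y x - yT x))\<^sup>2 \<le> \<kappa> * (2 * (L2norm K1 (\<lambda>x. y x - yT x))\<^sup>2 + 2 * (L2norm K2 (\<lambda>x. y x - yT x))\<^sup>2)"
    by (rule mult_left_mono[OF L[OF E1(3) E2(3)] nonneg(2)])
  then have 4: "\<kappa> * (L2norm S (\<lambda>x. y x - yT x))\<^sup>2 \<le> 2 * (\<kappa> * (L2norm K1 (\<lambda>x. y x - yT x))\<^sup>2) + 2 * (\<kappa> * (L2norm K2 (\<lambda>x. y x - yT x))\<^sup>2)"
    by (simp add: algebra_simps)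
  note 1 = L[OF E1(1) E2(1)] L[OF E1(2) E2(2)] L[OF E1(4) E2(4)]
  show "diffusion_error S \<le> 2 * (diffusion_error K1 + diffusion_error K2)"
    unfolding diffusion_error_def using add_mono[OF 1(1,2)] by (simp add: algebra_simps)
  show "reaction_error S \<le> 2 * (reaction_error K1 + reaction_error K2)"
    unfolding reaction_error_def using add_mono[OF add_mono[OF 1(3) 4] 1(1)] by (simp add: algebra_simps)
qed

lemma element_bound:
  assumes K: "K \<in> T"
  shows "(diameter K)\<^sup>2 * (L2norm K (R K))\<^sup>2 \<le> element_const * element_error K"
proof -
  let ?h = "diameter K"
  note e = elt[OF K]
  obtain z r where r: "0 < r" "cball z r \<subseteq> K" "?h \<le> \<sigma> * r" using inball[OF K e(6)] by blast
  \<comment> \<open>Halving the radius moves the closed ball into the interior of K and hence into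
    the domain. It is the origin of the factor \<open>4 * \<sigma>\<^sup>2\<close> in
    \<open>element_const\<close>.\<close>
  let ?r = "r / 2"
  let ?S = "cball z ?r"
  have r2: "0 < ?r" using r(1) by simp
  have S: "?S \<in> sets lebesgue" by simp
  have "ball z r \<subseteq> interior K" using r(2) ball_subset_cball by (intro interior_maximal) auto
  then have SK: "?S \<subseteq> interior K" using r(1) by (force simp: subset_iff)
  then have S\<Omega>: "?S \<subseteq> \<Omega>" and SK': "?S \<subseteq> K" using e(3) interior_subset[of K] by blast+
  have rh: "?r \<le> ?h" using radius_le_diameter[OF r(2) compact_imp_bounded[OF e(1)]] r(1) by simp
  have neg: "negligible (?S - K)" using SK' by (metis Diff_eq_empty_iff negligible_empty)
  have FS: "F K \<in> L2 ?S" by (rule L2_subset[OF local(4)[OF K] S e(7) neg])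
  note res = element_residual[OF local(3)[OF K] r2 S\<Omega> local(1,2)[OF K] FS AE_lebesgue_on_subset[OF ae[OF K] S e(7) neg]]
  have n1: "1 \<le> real CARD('n)" by (simp add: Suc_leI)
  \<comment> \<open>Lets the ball of radius \<open>\<Lambda>\<close> r/2 contain K, whose diameter
    is at most \<open>\<sigma>\<close> r.\<close>
  have \<Lambda>: "2 * \<sigma> < \<Lambda>"
    using \<sigma> mult_left_mono[OF n1, of \<sigma>] by linarith
  have sub: "K \<subseteq> ball z (\<Lambda> * ?r)"
  proof
    fix x assume "x \<in> K"
    moreover have "z \<in> K" using r(1,2) by auto
    ultimately have "dist z x \<le> ?h" by (intro diameter_bounded_bound compact_imp_bounded[OF e(1)])
    also have "\<dots> \<le> \<sigma> * r" by (rule r(3))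
    also have "\<dots> < \<Lambda> * ?r" using mult_strict_right_mono[OF \<Lambda> r2] by simp
    finally show "x \<in> ball z (\<Lambda> * ?r)" by simp
  qed
  have RL: "R K \<in> L2 (ball z (\<Lambda> * ?r))"
  proof (rule L2_subset[OF vpdeg_L2[OF local(3)[OF K] compact_cball]])
    have "ball z (\<Lambda> * ?r) - cball z (\<Lambda> * ?r) = {}" using ball_subset_cball by blast
    then show "negligible (ball z (\<Lambda> * ?r) - cball z (\<Lambda> * ?r))" by simp
  qed auto
  have "?h\<^sup>2 * (L2norm K (R K))\<^sup>2 \<le> (\<sigma> * r)\<^sup>2 * (L2norm (ball z (\<Lambda> * ?r)) (R K))\<^sup>2"
    using r(3) e(6) L2norm_sq_mono[OF RL e(7) _ sub] by (intro mult_mono power_mono) auto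
  also have "\<dots> = 4 * \<sigma>\<^sup>2 * (?r\<^sup>2 * (L2norm (ball z (\<Lambda> * ?r)) (R K))\<^sup>2)"
    by (simp add: power2_eq_square)
  also have "\<dots> \<le> 4 * \<sigma>\<^sup>2 * (C2 * ((2 * energy_const CARD('n) \<epsilon> \<kappa> B + 2) * C1) * (diffusion_error ?S
       + ?r\<^sup>2 * (reaction_error ?S + (L2norm ?S (F K))\<^sup>2)))"
    by (rule mult_left_mono[OF res]) simp
  also have "\<dots> = element_const * (diffusion_error ?S + ?r\<^sup>2 * (reaction_error ?S + (L2norm ?S (F K))\<^sup>2))"
    by (simp only: element_const_def mult.assoc)
  also have "\<dots> \<le> element_const * element_error K"
  proof (rule mult_left_mono[OF _ consts_nonneg(2)])
    have "reaction_error ?S + (L2norm ?S (F K))\<^sup>2 \<le> reaction_error K + (L2norm K (F K))\<^sup>2"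
      using errors_mono(2)[OF S K SK'] L2norm_sq_mono[OF local(4)[OF K] S e(7) SK'] by linarith
    moreover have "?r\<^sup>2 \<le> ?h\<^sup>2" using rh r2 by (intro power_mono) auto
    moreover have "0 \<le> reaction_error ?S + (L2norm ?S (F K))\<^sup>2" using errors_nonneg by (intro add_nonneg_nonneg) auto
    ultimately have "?r\<^sup>2 * (reaction_error ?S + (L2norm ?S (F K))\<^sup>2) \<le> ?h\<^sup>2 * (reaction_error K + (L2norm K (F K))\<^sup>2)"
      by (intro mult_mono) auto
    then show "diffusion_error ?S + ?r\<^sup>2 * (reaction_error ?S + (L2norm ?S (F K))\<^sup>2) \<le> element_error K"
      unfolding element_error_def using errors_mono(1)[OF S K SK'] by linarith
  qed
  finally show ?thesis .
qed

definition face_const :: real where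
  "face_const = C2 / exp (- 4 / 3) * ((2 * energy_const CARD('n) \<epsilon> \<kappa> B + 2) * (C1 * C2) / (4 * (exp (- 4 / 3))\<^sup>2)) * (4 + 4 * element_const)"

lemma face_bound:
  assumes \<gamma>: "\<gamma> \<in> int_faces \<Omega> T" and H: "0 < H" "\<And>K. K \<in> face_patch T \<gamma> \<Longrightarrow> H \<le> diameter K"
    and g: "\<And>x. g x = (\<Sum>K\<in>face_patch T \<gamma>. - \<epsilon> *\<^sub>R (vjac (P K) x *v outer_normal K \<gamma>) + \<pi> K x *\<^sub>R outer_normal K \<gamma>)"
  shows "H * (face_L2norm \<gamma> g)\<^sup>2 \<le> face_const * (\<Sum>K\<in>face_patch T \<gamma>. element_error K)"
proof -
  obtain n t where n: "norm n = 1" "\<And>x. x \<in> \<gamma> \<Longrightarrow> n \<bullet> x = t"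
    "\<And>g :: real^'n \<Rightarrow> real^'n. affine hull \<gamma> = {x. n \<bullet> x = t} \<Longrightarrow>
      face_L2norm \<gamma> g = L2norm {x + s *\<^sub>R n |x s. x \<in> \<gamma> \<and> 0 \<le> s \<and> s \<le> 1} (\<lambda>z. g (hyper_proj n t z))"
    by (rule face_L2norm_hyper_proj[OF mesh \<gamma>]) (rule that)
  obtain K1 K2 where K: "K1 \<noteq> K2" "face_patch T \<gamma> = {K1, K2}" "outer_normal K1 \<gamma> = n" "outer_normal K2 \<gamma> = - n"
    "affine hull \<gamma> = {x. n \<bullet> x = t}" "facet_center \<gamma> \<in> \<gamma>" "compact \<gamma>"
    and h1: "\<And>z \<rho> x. cball z \<rho> \<subseteq> K1 \<Longrightarrow> 0 \<le> \<rho> \<Longrightarrow> norm (x - facet_center \<gamma>) \<le> 2 * \<rho> / CARD('n) \<Longrightarrow> n \<bullet> x \<le> t \<Longrightarrow> x \<in> K1"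
    and h2: "\<And>z \<rho> x. cball z \<rho> \<subseteq> K2 \<Longrightarrow> 0 \<le> \<rho> \<Longrightarrow> norm (x - facet_center \<gamma>) \<le> 2 * \<rho> / CARD('n) \<Longrightarrow> t \<le> n \<bullet> x \<Longrightarrow> x \<in> K2"
    by (rule interior_face_elements[OF open_domain mesh \<gamma> n(1)], rule n(2), assumption) (rule that)
  let ?x0 = "facet_center \<gamma>"
  have T1: "K1 \<in> T" and T2: "K2 \<in> T" and f1: "\<gamma> facet_of K1" and f2: "\<gamma> facet_of K2" using K(2) by (auto simp: face_patch_def)
  have H1: "H \<le> diameter K1" and H2: "H \<le> diameter K2" using H(2) K(2) by auto
  obtain z1 r1 where r1: "0 < r1" "cball z1 r1 \<subseteq> K1" "diameter K1 \<le> \<sigma> * r1" using inball[OF T1 elt(6)[OF T1]] by blast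
  obtain z2 r2 where r2: "0 < r2" "cball z2 r2 \<subseteq> K2" "diameter K2 \<le> \<sigma> * r2" using inball[OF T2 elt(6)[OF T2]] by blast
  \<comment> \<open>With the smaller inscribed radius divided by n, distances up to 2 r from the
    face centre are within the reach of \<open>facet_half_ball\<close> for both elements.\<close>
  define r where "r = min r1 r2 / CARD('n)"
  have n1: "1 \<le> real CARD('n)" by (simp add: Suc_leI)
  have r: "0 < r" "2 * r \<le> 2 * r1 / CARD('n)" "2 * r \<le> 2 * r2 / CARD('n)"
    using r1(1) r2(1) n1 by (auto simp: r_def divide_right_mono)
  have rn: "r * CARD('n) = min r1 r2" by (simp add: r_def)
  have "r \<le> min r1 r2" using rn mult_left_mono[OF n1, of r] r(1) by simp
  then have rh: "r \<le> diameter K1" "r \<le> diameter K2"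
    using radius_le_diameter[OF r1(2) compact_imp_bounded[OF elt(1)[OF T1]]] r1(1)
      radius_le_diameter[OF r2(2) compact_imp_bounded[OF elt(1)[OF T2]]] r2(1) by linarith+
  have "H \<le> \<sigma> * min r1 r2"
    using H1 H2 r1(3) r2(3) by (cases "r1 \<le> r2") (auto simp: min_def)
  then have "H \<le> \<sigma> * CARD('n) * r" using rn by (simp add: mult_ac)
  moreover have "(16 * (\<sigma> * CARD('n)) + 5) * r \<le> \<Lambda> * r" using \<sigma>(2) r(1) by (intro mult_right_mono) auto
  ultimately have Hr: "16 * H + 5 * r \<le> \<Lambda> * r" by (simp add: algebra_simps)
  have in1: "x \<in> K1" if "norm (x - ?x0) \<le> 2 * r" "n \<bullet> x \<le> t" for x
    by (rule h1[OF r1(2) _ _ that(2)]) (use r1(1) r(2) that(1) in linarith)+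
  have in2: "x \<in> K2" if "norm (x - ?x0) \<le> 2 * r" "t \<le> n \<bullet> x" for x
    by (rule h2[OF r2(2) _ _ that(2)]) (use r2(1) r(3) that(1) in linarith)+
  let ?S = "cball ?x0 r"
  let ?A = "{x. n \<bullet> x \<le> t}"
  \<comment> \<open>The doubled radius leaves room: an open set inside the closure of the domain
    lies in the domain, and this one contains the closed ball of radius r.\<close>
  have "ball ?x0 (2 * r) \<subseteq> closure \<Omega>"
  proof
    fix x assume "x \<in> ball ?x0 (2 * r)"
    then have "norm (x - ?x0) \<le> 2 * r" by (simp add: dist_norm norm_minus_commute)
    then have "x \<in> K1 \<union> K2" using in1 in2 by (cases "n \<bullet> x \<le> t") auto
    then show "x \<in> closure \<Omega>" using elt(9)[OF T1] elt(9)[OF T2] by blast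
  qed
  then have "ball ?x0 (2 * r) \<subseteq> interior (closure \<Omega>)" by (intro interior_maximal) auto
  moreover have "?S \<subseteq> ball ?x0 (2 * r)" using r(1) by (auto simp: subset_iff)
  ultimately have S\<Omega>: "?S \<subseteq> \<Omega>" using interior_closure_lipschitz[OF lip open_domain] by blast
  have nS: "norm (x - ?x0) \<le> 2 * r" if "x \<in> ?S" for x using that r(1) by (simp add: dist_norm norm_minus_commute)
  have SA1: "?S \<inter> ?A \<subseteq> K1" using in1[OF nS] by auto
  have SA2: "?S - ?A \<subseteq> K2" by (rule subsetI, rule in2[OF nS]) auto
  have S: "?S \<in> sets lebesgue" "?A \<in> sets lebesgue" by (auto simp: closed_halfspace_le borel_closed)
  \<comment> \<open>The test field of a face also pairs with the residuals inside the two elements,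
    so the remainder consists of the full strong residual, polynomial part included.\<close>
  define RF where "RF K x = R K x + F K x" for K x
  have RF: "RF K \<in> L2 K" "(L2norm K (RF K))\<^sup>2 \<le> 2 * (L2norm K (R K))\<^sup>2 + 2 * (L2norm K (F K))\<^sup>2" if "K \<in> T" for K
    unfolding RF_def using L2_add[OF vpdeg_L2[OF local(3) elt(1)] local(4)] L2norm_add_sq[OF vpdeg_L2[OF local(3) elt(1)] local(4)] that by auto
  let ?F = "\<lambda>x. if x \<in> ?A then RF K1 x else RF K2 x"
  note FL = L2_piecewise[OF RF(1)[OF T1] RF(1)[OF T2] elt(7)[OF T1] elt(7)[OF T2] S SA1 SA2]
  have low: "AE x in lebesgue_on ?S. n \<bullet> x < t \<longrightarrow> yT x = P K1 x \<and> wGrad \<Omega> yT x = vjac (P K1) x \<and> pT x = \<pi> K1 x \<and> ?F x = strong_res \<epsilon> \<kappa> c (P K1) (\<pi> K1) GT x"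
    unfolding AE_lebesgue_on_iff[OF S(1)]
    using ae[OF T1, unfolded AE_lebesgue_on_iff[OF elt(7)[OF T1]]]
  proof eventually_elim
    case (elim x)
    then show ?case using SA1 by (auto simp: RF_def)
  qed
  have up: "AE x in lebesgue_on ?S. t < n \<bullet> x \<longrightarrow> yT x = P K2 x \<and> wGrad \<Omega> yT x = vjac (P K2) x \<and> pT x = \<pi> K2 x \<and> ?F x = strong_res \<epsilon> \<kappa> c (P K2) (\<pi> K2) GT x"
    unfolding AE_lebesgue_on_iff[OF S(1)]
    using ae[OF T2, unfolded AE_lebesgue_on_iff[OF elt(7)[OF T2]]]
  proof eventually_elim
    case (elim x)
    then show ?case using SA2 by (auto simp: RF_def)
  qed
  have g_eq: "g x = (- \<epsilon> *\<^sub>R (vjac (P K1) x *v n) + \<pi> K1 x *\<^sub>R n) - (- \<epsilon> *\<^sub>R (vjac (P K2) x *v n) + \<pi> K2 x *\<^sub>R n)" for x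
    unfolding g K(2) using K(1,3,4) by (simp add: linear_neg[OF matrix_vector_mul_linear])
  have gd: "vpdeg M g"
  proof -
    have vj: "vpdeg M (\<lambda>x. vjac (P K) x *v n)" if "K \<in> T" for K
      using vpdeg_frechet_deg[OF local(1)[OF that], of n] by (simp add: vpdeg_frechet[OF local(1)[OF that]])
    show ?thesis unfolding g_eq[abs_def]
      by (intro vpdeg_diff vpdeg_add vpdeg_scaleR vpdeg_scaleR_left vj local(2) T1 T2)
  qed
  have \<gamma>K: "\<gamma> \<subseteq> K1" "\<gamma> \<subseteq> K2" using f1 f2 by (auto dest: facet_of_imp_subset)
  have \<gamma>H: "\<gamma> \<subseteq> cball ?x0 (min (diameter K1) (diameter K2))"
  proof
    fix x assume x: "x \<in> \<gamma>"
    show "x \<in> cball ?x0 (min (diameter K1) (diameter K2))"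
      using diameter_bounded_bound[OF compact_imp_bounded[OF elt(1)[OF T1]], of ?x0 x]
        diameter_bounded_bound[OF compact_imp_bounded[OF elt(1)[OF T2]], of ?x0 x] x K(6) \<gamma>K by auto
  qed
  \<comment> \<open>The face must lie within the chosen distance of its centre. The diameters
    guarantee this; the given \<open>H\<close> is only a lower bound for them.\<close>
  define H' where "H' = min (diameter K1) (diameter K2)"
  have H': "0 < H'" "H \<le> H'" using H1 H2 elt(6)[OF T1] elt(6)[OF T2] by (auto simp: H'_def)
  have "H' \<le> \<sigma> * min r1 r2"
    using r1(3) r2(3) by (cases "r1 \<le> r2") (auto simp: min_def H'_def)
  then have "H' \<le> \<sigma> * CARD('n) * r" using rn by (simp add: mult_ac)
  moreover have "(16 * (\<sigma> * CARD('n)) + 5) * r \<le> \<Lambda> * r" using \<sigma>(2) r(1) by (intro mult_right_mono) auto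
  ultimately have Hr': "16 * H' + 5 * r \<le> \<Lambda> * r" by (simp add: algebra_simps)
  define CF where "CF = C2 / exp (- 4 / 3) * ((2 * energy_const CARD('n) \<epsilon> \<kappa> B + 2) * (C1 * C2) / (4 * (exp (- 4 / 3))\<^sup>2))"
  have CF: "0 \<le> CF" using consts_nonneg(1) C1(1) C2(1) by (simp add: CF_def)
  have "H * (face_L2norm \<gamma> g)\<^sup>2 \<le> H' * (face_L2norm \<gamma> g)\<^sup>2" using H'(2) by (rule mult_right_mono) simp
  also have "\<dots> \<le> CF * (diffusion_error ?S + r\<^sup>2 * (reaction_error ?S + (L2norm ?S ?F)\<^sup>2))"
    unfolding n(3)[OF K(5)] CF_def
    using n(2) \<gamma>H K(6,7) unfolding H'_def[symmetric]
    by (intro face_residual[OF n(1) n(2)[OF K(6)] r(1) H'(1) Hr' S\<Omega> local(1,2)[OF T1] local(1,2)[OF T2] FL(1) low up gd g_eq _ _ _ refl]) auto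
  also have "\<dots> \<le> CF * ((4 + 4 * element_const) * (element_error K1 + element_error K2))"
  proof (rule mult_left_mono[OF _ CF])
    let ?E = "\<lambda>K. reaction_error K + (L2norm K (F K))\<^sup>2"
    \<comment> \<open>The polynomial residuals are eliminated by \<open>element_bound\<close>, which
      produces \<open>4 * element_const\<close>; the other 4 covers the error terms and the
      oscillation.\<close>
    have part: "r\<^sup>2 * (2 * reaction_error K + 4 * (L2norm K (R K))\<^sup>2 + 4 * (L2norm K (F K))\<^sup>2) + 2 * diffusion_error K \<le> (4 + 4 * element_const) * element_error K"
      if "K \<in> T" "r \<le> diameter K" for K
    proof -
      have rr: "r\<^sup>2 \<le> (diameter K)\<^sup>2" using that(2) r(1) by (intro power_mono) auto
      have nn: "0 \<le> reaction_error K" "0 \<le> diffusion_error K" by (rule errors_nonneg)+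
      have "r\<^sup>2 * (2 * reaction_error K + 4 * (L2norm K (R K))\<^sup>2 + 4 * (L2norm K (F K))\<^sup>2)
          \<le> (diameter K)\<^sup>2 * (2 * reaction_error K + 4 * (L2norm K (R K))\<^sup>2 + 4 * (L2norm K (F K))\<^sup>2)"
        using nn by (intro mult_right_mono[OF rr]) auto
      also have "\<dots> \<le> (diameter K)\<^sup>2 * (4 * ?E K) + 4 * ((diameter K)\<^sup>2 * (L2norm K (R K))\<^sup>2)"
        using nn by (simp add: algebra_simps)
      also have "\<dots> \<le> (diameter K)\<^sup>2 * (4 * ?E K) + 4 * (element_const * element_error K)"
        using element_bound[OF that(1)] by simp
      finally show ?thesis unfolding element_error_def using nn by (simp add: algebra_simps)
    qed
    have "(L2norm ?S ?F)\<^sup>2 \<le> 4 * (L2norm K1 (R K1))\<^sup>2 + 4 * (L2norm K1 (F K1))\<^sup>2 + 4 * (L2norm K2 (R K2))\<^sup>2 + 4 * (L2norm K2 (F K2))\<^sup>2"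
      using FL(2) RF(2)[OF T1] RF(2)[OF T2] by linarith
    moreover have "?S \<subseteq> K1 \<union> K2" using SA1 SA2 by blast
    note U = errors_Un[OF S(1) T1 T2 this]
    ultimately have "r\<^sup>2 * (reaction_error ?S + (L2norm ?S ?F)\<^sup>2)
        \<le> r\<^sup>2 * ((2 * reaction_error K1 + 4 * (L2norm K1 (R K1))\<^sup>2 + 4 * (L2norm K1 (F K1))\<^sup>2) + (2 * reaction_error K2 + 4 * (L2norm K2 (R K2))\<^sup>2 + 4 * (L2norm K2 (F K2))\<^sup>2))"
      using U(2) by (intro mult_left_mono) auto
    then show "diffusion_error ?S + r\<^sup>2 * (reaction_error ?S + (L2norm ?S ?F)\<^sup>2) \<le> (4 + 4 * element_const) * (element_error K1 + element_error K2)"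
      using U(1) part[OF T1 rh(1)] part[OF T2 rh(2)] unfolding distrib_left by linarith
  qed
  also have "\<dots> = face_const * (\<Sum>K\<in>face_patch T \<gamma>. element_error K)"
    using K(1) by (simp add: K(2) face_const_def CF_def)
  finally show ?thesis .
qed

end

section \<open>The control indicator and the divergence terms\<close>

lemma norm_box_proj_diff_le: "norm (box_proj a b z - box_proj a b z') \<le> norm (z - z')"
  by (rule norm_le_componentwise_cart) (auto simp: box_proj_def min_def max_def)

lemma borel_measurable_box_proj:
  fixes g :: "'a \<Rightarrow> real^'n"
  assumes "g \<in> borel_measurable M"
  shows "(\<lambda>x. box_proj a b (g x)) \<in> borel_measurable M"
proof (rule borel_measurable_componentwise)
  fix i
  have "(\<lambda>x. min (b $ i) (max (a $ i) (g x $ i))) \<in> borel_measurable M"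
    by (intro borel_measurable_min borel_measurable_max borel_measurable_const borel_measurable_vec_nth_compose assms)
  then show "(\<lambda>x. box_proj a b (g x) $ i) \<in> borel_measurable M" by (simp add: box_proj_def)
qed

text \<open>In each component this is the obtuse-angle property (v - z)(v - u) <= 0 of the
  projection v of z, rearranged with z - u = (z - v) + (v - u).\<close>

lemma box_proj_inequality:
  fixes a b z u :: "real^'n"
  assumes "\<And>i. a $ i \<le> u $ i \<and> u $ i \<le> b $ i"
  shows "(u - z) \<bullet> (box_proj a b z - u) \<le> - (norm (box_proj a b z - u))\<^sup>2"
proof -
  have key: "(u0 - z0) * (v - u0) \<le> - (v - u0)\<^sup>2"
    if "a0 \<le> u0" "u0 \<le> b0" "v = min b0 (max a0 z0)" for u0 z0 v a0 b0 :: real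
  proof -
    have "(v - z0) * (v - u0) \<le> 0" using that by (auto simp: min_def max_def mult_le_0_iff)
    then show ?thesis by (simp add: power2_eq_square algebra_simps)
  qed
  have "(u - z) \<bullet> (box_proj a b z - u) = (\<Sum>i\<in>UNIV. (u $ i - z $ i) * (box_proj a b z $ i - u $ i))"
    by (simp add: inner_vec_def)
  also have "\<dots> \<le> (\<Sum>i\<in>UNIV. - (box_proj a b z $ i - u $ i)\<^sup>2)"
    using assms by (intro sum_mono key[of "a $ i" _ "b $ i" for i]) (auto simp: box_proj_def)
  also have "\<dots> = - (norm (box_proj a b z - u))\<^sup>2"
    by (simp add: power2_norm_eq_inner inner_vec_def sum_negf) (simp add: power2_eq_square)
  finally show ?thesis .
qed

text \<open>The pointwise projection is itself an admissible control. Used as competitor in the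
  variational inequality, it bounds the squared norm of its distance from the optimal control by
  0.\<close>

lemma optimal_control_projection:
  fixes \<Omega> :: "(real^'n) set"
  assumes \<Omega>: "open \<Omega>" "bounded \<Omega>" and \<theta>: "0 < \<theta>" and ab: "\<forall>i. a $ i < b $ i" and w: "w \<in> L2 \<Omega>"
    and opt: "variational_ineq \<Omega> \<theta> (Uad \<Omega> a b) w u"
  shows "AE x in lebesgue_on \<Omega>. u x = box_proj a b (- (1 / \<theta>) *\<^sub>R w x)"
proof -
  define v where "v x = box_proj a b (- (1 / \<theta>) *\<^sub>R w x)" for x
  have \<Omega>m: "\<Omega> \<in> lmeasurable" using \<Omega> by (simp add: lmeasurable_open)
  have u: "u \<in> L2 \<Omega>" "AE x in lebesgue_on \<Omega>. \<forall>i. a $ i \<le> u x $ i \<and> u x $ i \<le> b $ i"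
    using opt by (auto simp: variational_ineq_def Uad_def)
  have v_meas: "v \<in> borel_measurable (lebesgue_on \<Omega>)"
    unfolding v_def[abs_def] using L2_scaleR[OF w, of "- (1 / \<theta>)"] by (intro borel_measurable_box_proj L2_meas)
  have vb: "a $ i \<le> v x $ i \<and> v x $ i \<le> b $ i" for x i
    using ab less_imp_le[of "a $ i" "b $ i"] by (auto simp: v_def box_proj_def)
  have "norm (v x) \<le> (\<Sum>i\<in>UNIV. \<bar>a $ i\<bar> + \<bar>b $ i\<bar>)" for x
  proof -
    have "norm (v x) \<le> (\<Sum>i\<in>UNIV. \<bar>v x $ i\<bar>)" by (rule norm_le_l1_cart)
    also have "\<dots> \<le> (\<Sum>i\<in>UNIV. \<bar>a $ i\<bar> + \<bar>b $ i\<bar>)" 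
    proof (rule sum_mono)
      fix i show "\<bar>v x $ i\<bar> \<le> \<bar>a $ i\<bar> + \<bar>b $ i\<bar>" using vb[of i x] by linarith
    qed
    finally show ?thesis .
  qed
  then have v: "v \<in> L2 \<Omega>" by (intro L2_bounded[OF \<Omega>m v_meas]) auto
  then have "v \<in> Uad \<Omega> a b" using vb by (simp add: Uad_def)
  then have "0 \<le> (LINT x|lebesgue_on \<Omega>. (w x + \<theta> *\<^sub>R u x) \<bullet> (v x - u x))"
    using opt by (auto simp: variational_ineq_def L2inner_def)
  also have "\<dots> \<le> (LINT x|lebesgue_on \<Omega>. - \<theta> * (norm (v x - u x))\<^sup>2)"
  proof (rule integral_mono_AE)
    show "integrable (lebesgue_on \<Omega>) (\<lambda>x. (w x + \<theta> *\<^sub>R u x) \<bullet> (v x - u x))"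
      by (intro L2_inner_integrable L2_add L2_diff L2_scaleR w u v)
    show "integrable (lebesgue_on \<Omega>) (\<lambda>x. - \<theta> * (norm (v x - u x))\<^sup>2)"
      by (intro integrable_mult_right L2_integrable L2_diff v u)
    show "AE x in lebesgue_on \<Omega>. (w x + \<theta> *\<^sub>R u x) \<bullet> (v x - u x) \<le> - \<theta> * (norm (v x - u x))\<^sup>2"
      using u(2)
    proof eventually_elim
      case (elim x)
      have "w x + \<theta> *\<^sub>R u x = \<theta> *\<^sub>R (u x - (- (1 / \<theta>) *\<^sub>R w x))" using \<theta> by (simp add: algebra_simps)
      then have "(w x + \<theta> *\<^sub>R u x) \<bullet> (v x - u x) = \<theta> * ((u x - (- (1 / \<theta>) *\<^sub>R w x)) \<bullet> (v x - u x))" by (simp only: inner_scaleR_left)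
      also have "\<dots> \<le> \<theta> * (- (norm (v x - u x))\<^sup>2)"
        unfolding v_def using elim \<theta> by (intro mult_left_mono box_proj_inequality) auto
      finally show ?case by simp
    qed
  qed
  also have "\<dots> = - \<theta> * (LINT x|lebesgue_on \<Omega>. (norm (v x - u x))\<^sup>2)" by simp
  finally have "(LINT x|lebesgue_on \<Omega>. (norm (v x - u x))\<^sup>2) \<le> 0" using \<theta> by (simp add: mult_le_0_iff)
  then have "(LINT x|lebesgue_on \<Omega>. (norm (v x - u x))\<^sup>2) = 0" by (intro antisym) (auto intro: Bochner_Integration.integral_nonneg)
  then have "AE x in lebesgue_on \<Omega>. (norm (v x - u x))\<^sup>2 = 0"
    using integral_nonneg_eq_0_iff_AE[OF L2_integrable[OF L2_diff[OF v u(1)]]] by simp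
  then show ?thesis unfolding v_def by eventually_elim simp
qed

text \<open>The exact control is inserted between the two terms. Since the projection is
  nonexpansive, the first difference is at most 1/\<open>\<theta>\<close> times the adjoint error;
  this is the source of the separate adjoint term in the final estimate.\<close>

lemma eta_u_bound:
  fixes \<Omega> K :: "(real^'n) set"
  assumes K: "K \<in> sets lebesgue" and \<theta>: "0 < \<theta>"
    and opt: "AE x in lebesgue_on K. u x = box_proj a b (- (1 / \<theta>) *\<^sub>R w x)"
    and L: "w \<in> L2 K" "wT \<in> L2 K" "u \<in> L2 K" "uT \<in> L2 K"
  shows "(eta_u a b \<theta> wT uT K)\<^sup>2 \<le> 2 / \<theta>\<^sup>2 * (L2norm K (\<lambda>x. w x - wT x))\<^sup>2 + 2 * (L2norm K (\<lambda>x. u x - uT x))\<^sup>2"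
proof -
  let ?g = "\<lambda>x. norm ((1 / \<theta>) *\<^sub>R (w x - wT x))" and ?k = "\<lambda>x. norm (u x - uT x)"
  have g: "?g \<in> L2 K" and k: "?k \<in> L2 K" by (intro L2_norm L2_scaleR L2_diff L)+
  have "AE x in lebesgue_on K. norm (box_proj a b (- (1 / \<theta>) *\<^sub>R wT x) - uT x) \<le> ?g x + ?k x"
    using opt
  proof eventually_elim
    case (elim x)
    let ?p = "\<lambda>w. box_proj a b (- (1 / \<theta>) *\<^sub>R w)"
    have "norm (?p (wT x) - uT x) \<le> norm (?p (wT x) - ?p (w x)) + norm (?p (w x) - uT x)"
      using norm_triangle_ineq[of "?p (wT x) - ?p (w x)" "?p (w x) - uT x"] by simp
    also have "norm (?p (wT x) - ?p (w x)) \<le> norm (- (1 / \<theta>) *\<^sub>R wT x - (- (1 / \<theta>) *\<^sub>R w x))" by (rule norm_box_proj_diff_le)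
    also have "- (1 / \<theta>) *\<^sub>R wT x - (- (1 / \<theta>) *\<^sub>R w x) = (1 / \<theta>) *\<^sub>R (w x - wT x)" by (simp add: scaleR_diff_right)
    finally show ?case using elim by simp
  qed
  moreover have "(\<lambda>x. box_proj a b (- (1 / \<theta>) *\<^sub>R wT x) - uT x) \<in> borel_measurable (lebesgue_on K)"
    using L2_scaleR[OF L(2), of "- (1 / \<theta>)"] L(4) by (intro borel_measurable_diff borel_measurable_box_proj L2_meas)
  ultimately have "eta_u a b \<theta> wT uT K \<le> L2norm K (\<lambda>x. ?g x + ?k x)"
    unfolding eta_u_def by (intro L2norm_mono L2_add g k)
  then have "(eta_u a b \<theta> wT uT K)\<^sup>2 \<le> (L2norm K (\<lambda>x. ?g x + ?k x))\<^sup>2"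
    by (rule power_mono) (simp add: eta_u_def)
  also have "\<dots> \<le> 2 * (L2norm K ?g)\<^sup>2 + 2 * (L2norm K ?k)\<^sup>2" by (rule L2norm_add_sq[OF g k])
  also have "(L2norm K ?g)\<^sup>2 = (1 / \<theta>)\<^sup>2 * (L2norm K (\<lambda>x. w x - wT x))\<^sup>2"
    by (simp add: L2norm_squared power_mult_distrib power_divide)
  also have "L2norm K ?k = L2norm K (\<lambda>x. u x - uT x)" by (simp add: L2norm_def)
  finally show ?thesis by (simp add: power_divide)
qed

text \<open>The divergence of a field with zero boundary values has mean zero, so it may be tested
  against itself.\<close>

lemma divergence_free:
  fixes \<Omega> :: "(real^'n) set"
  assumes \<Omega>: "open \<Omega>" "bounded \<Omega>" and y: "y \<in> Vsp \<Omega>" and eq: "\<forall>\<phi>\<in>Qsp \<Omega>. formB \<Omega> y \<phi> = 0"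
  shows "AE x in lebesgue_on \<Omega>. wdiv \<Omega> y x = 0"
proof -
  have yH: "y \<in> vec_space (H1 \<Omega>)" using y H10_subset_H1 by (auto simp: vec_space_def)
  have \<Omega>m: "\<Omega> \<in> lmeasurable" using \<Omega> by (simp add: lmeasurable_open)
  note g = wGrad_L2[OF \<Omega>(1) yH]
  have L: "wdiv \<Omega> y \<in> L2 \<Omega>" using L2_trace[OF g] by (simp add: wdiv_def[abs_def])
  have gi: "integrable (lebesgue_on \<Omega>) (\<lambda>x. wgrad \<Omega> (\<lambda>z. y z $ i) x $ i)" for i
    using L2_integrable_self[OF \<Omega>m L2_component[OF L2_component[OF g]], of i i] by (simp add: wGrad_def)
  have "(LINT x|lebesgue_on \<Omega>. wdiv \<Omega> y x) = (LINT x|lebesgue_on \<Omega>. (\<Sum>i\<in>UNIV. wgrad \<Omega> (\<lambda>z. y z $ i) x $ i))"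
    by (simp add: wdiv_def trace_def wGrad_def)
  also have "\<dots> = (\<Sum>i\<in>UNIV. (LINT x|lebesgue_on \<Omega>. wgrad \<Omega> (\<lambda>z. y z $ i) x $ i))"
    using gi by (intro Bochner_Integration.integral_sum) auto
  also have "\<dots> = 0" using y H10_integral_wgrad[OF \<Omega>] by (intro sum.neutral) (auto simp: vec_space_def)
  finally have "wdiv \<Omega> y \<in> Qsp \<Omega>" using L by (simp add: Qsp_def)
  then have "(LINT x|lebesgue_on \<Omega>. (norm (wdiv \<Omega> y x))\<^sup>2) = 0"
    using eq by (auto simp: formB_def L2inner_def power2_eq_square)
  then have "AE x in lebesgue_on \<Omega>. (norm (wdiv \<Omega> y x))\<^sup>2 = 0"
    using integral_nonneg_eq_0_iff_AE[OF L2_integrable[OF L]] by simp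
  then show ?thesis by eventually_elim simp
qed

lemma divergence_bound:
  fixes \<Omega> K :: "(real^'n) set"
  assumes \<Omega>: "open \<Omega>" and y: "y \<in> vec_space (H1 \<Omega>)" and yT: "yT \<in> vec_space (H1 \<Omega>)"
    and free: "AE x in lebesgue_on \<Omega>. wdiv \<Omega> y x = 0"
    and K: "K \<in> sets lebesgue" "negligible (K - \<Omega>)"
  shows "(L2norm K (wdiv \<Omega> yT))\<^sup>2 \<le> (real CARD('n))\<^sup>2 * (L2norm K (wGrad \<Omega> (\<lambda>x. y x - yT x)))\<^sup>2"
proof -
  have s: "\<Omega> \<in> sets lebesgue" using \<Omega> by auto
  let ?D = "\<lambda>x. wGrad \<Omega> y x - wGrad \<Omega> yT x"
  have D: "?D \<in> L2 \<Omega>" by (intro L2_diff wGrad_L2 \<Omega> y yT)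
  have eq: "AE x in lebesgue_on K. ?D x = wGrad \<Omega> (\<lambda>x. y x - yT x) x"
    using AE_lebesgue_on_subset[OF wGrad_diff[OF \<Omega> y yT] K(1) s K(2)] by eventually_elim simp
  have DK: "?D \<in> L2 K" by (rule L2_subset[OF D K(1) s K(2)])
  have "AE x in lebesgue_on K. norm (wdiv \<Omega> yT x) \<le> norm (real CARD('n) *\<^sub>R ?D x)"
    using AE_lebesgue_on_subset[OF free K(1) s K(2)]
  proof eventually_elim
    case (elim x)
    have "wdiv \<Omega> yT x = wdiv \<Omega> y x - trace (?D x)" by (simp add: wdiv_def trace_sub)
    then show ?case using elim abs_trace_le[of "?D x"] by simp
  qed
  moreover have "wdiv \<Omega> yT \<in> L2 \<Omega>" using L2_trace[OF wGrad_L2[OF \<Omega> yT]] by (simp add: wdiv_def[abs_def])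
  ultimately have "L2norm K (wdiv \<Omega> yT) \<le> L2norm K (\<lambda>x. norm (real CARD('n) *\<^sub>R ?D x))"
    using L2_subset[OF _ K(1) s K(2)] L2_meas by (intro L2norm_mono L2_norm L2_scaleR DK) blast+
  then have "(L2norm K (wdiv \<Omega> yT))\<^sup>2 \<le> (L2norm K (\<lambda>x. norm (real CARD('n) *\<^sub>R ?D x)))\<^sup>2"
    by (intro power_mono) auto
  also have "\<dots> = (real CARD('n))\<^sup>2 * (L2norm K ?D)\<^sup>2"
    by (simp add: L2norm_squared power_mult_distrib)
  finally show ?thesis using L2norm_cong_AE[OF K(1) eq] by simp
qed

text \<open>The summation detached from analysis. The jump hypothesis is stated for every H below
  the diameters at the face because on a patch these are only comparable to \<open>h K\<close>; it
  is applied with \<open>h K / \<Lambda>\<close>.\<close>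

lemma patch_bound:
  fixes E h res jmp osc :: "'k \<Rightarrow> real" and ew eta dv \<Lambda> :: real and R :: "'k \<Rightarrow> 'k \<Rightarrow> bool"
  assumes fin: "finite T" "finite F" and sub: "That \<subseteq> T" "Fhat \<subseteq> F"
    and Omt: "Omt = That \<union> (\<Union>\<gamma>\<in>Fhat. {K \<in> T. R \<gamma> K})" "K \<in> Omt"
    and facets: "\<And>K'. K' \<in> T \<Longrightarrow> card {\<gamma> \<in> F. R \<gamma> K'} \<le> N"
    and h: "0 < h K" "0 < \<Lambda>" "\<And>K'. K' \<in> Omt \<Longrightarrow> h K \<le> \<Lambda> * h K'"
    and E: "\<And>K'. 0 \<le> E K'" and res0: "\<And>K'. 0 \<le> res K'" "\<And>K'. 0 \<le> osc K'" "0 \<le> ew"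
    and a0: "0 \<le> a1" "0 \<le> a2" "0 \<le> a3" "0 \<le> a4"
    and dv: "dv \<le> a1 * E K"
    and res: "\<And>K'. K' \<in> T \<Longrightarrow> (h K')\<^sup>2 * res K' \<le> a2 * E K'"
    and osc: "\<And>K'. K' \<in> T \<Longrightarrow> (h K')\<^sup>2 * osc K' \<le> E K'"
    and jmp: "\<And>\<gamma> H. \<gamma> \<in> F \<Longrightarrow> 0 < H \<Longrightarrow> (\<And>K'. K' \<in> T \<Longrightarrow> R \<gamma> K' \<Longrightarrow> H \<le> h K') \<Longrightarrow> H * jmp \<gamma> \<le> a3 * (\<Sum>K'\<in>{K \<in> T. R \<gamma> K}. E K')"
    and eta: "eta \<le> a4 * ew + 2 * E K"
  shows "dv + (\<Sum>K'\<in>That. (h K)\<^sup>2 * res K') + (\<Sum>\<gamma>\<in>Fhat. h K * jmp \<gamma>) + (\<Sum>K'\<in>That. (h K)\<^sup>2 * osc K') + eta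
    \<le> (a1 + \<Lambda>\<^sup>2 * a2 + \<Lambda> * a3 * N + \<Lambda>\<^sup>2 + a4 + 2) * (ew + (\<Sum>K'\<in>Omt. E K'))"
proof -
  let ?E = "\<Sum>K'\<in>Omt. E K'"
  have OT: "Omt \<subseteq> T" using Omt(1) sub(1) by blast
  have finO: "finite Omt" using OT fin(1) by (rule finite_subset)
  have E0: "0 \<le> ?E" by (intro sum_nonneg E)
  have EK: "E K \<le> ?E" using Omt(2) finO E by (intro member_le_sum) auto
  have that_le: "(\<Sum>K'\<in>That. E K') \<le> ?E" using Omt(1) finO E by (intro sum_mono2) auto
  have hK: "(h K)\<^sup>2 \<le> \<Lambda>\<^sup>2 * (h K')\<^sup>2" if "K' \<in> Omt" for K'
    using power_mono[OF h(3)[OF that], of 2] h(1) by (simp add: power_mult_distrib)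
  have vol: "(\<Sum>K'\<in>That. (h K)\<^sup>2 * r K') \<le> \<Lambda>\<^sup>2 * (k * ?E)"
    if r: "\<And>K'. 0 \<le> r K'" "\<And>K'. K' \<in> T \<Longrightarrow> (h K')\<^sup>2 * r K' \<le> k * E K'" and k: "0 \<le> k" for r k
  proof -
    have "(\<Sum>K'\<in>That. (h K)\<^sup>2 * r K') \<le> (\<Sum>K'\<in>That. \<Lambda>\<^sup>2 * (k * E K'))"
    proof (rule sum_mono)
      fix K' assume K': "K' \<in> That"
      have "(h K)\<^sup>2 * r K' \<le> \<Lambda>\<^sup>2 * (h K')\<^sup>2 * r K'" using K' Omt(1) by (intro mult_right_mono hK r) auto
      also have "\<dots> = \<Lambda>\<^sup>2 * ((h K')\<^sup>2 * r K')" by (rule mult.assoc)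
      also have "\<dots> \<le> \<Lambda>\<^sup>2 * (k * E K')" using K' sub(1) by (intro mult_left_mono r(2)) auto
      finally show "(h K)\<^sup>2 * r K' \<le> \<Lambda>\<^sup>2 * (k * E K')" .
    qed
    also have "\<dots> = \<Lambda>\<^sup>2 * (k * (\<Sum>K'\<in>That. E K'))" by (simp add: sum_distrib_left)
    also have "\<dots> \<le> \<Lambda>\<^sup>2 * (k * ?E)" using that_le k by (intro mult_left_mono) auto
    finally show ?thesis .
  qed
  have face: "(\<Sum>\<gamma>\<in>Fhat. h K * jmp \<gamma>) \<le> \<Lambda> * a3 * (N * ?E)"
  proof -
    have "(\<Sum>\<gamma>\<in>Fhat. h K * jmp \<gamma>) \<le> (\<Sum>\<gamma>\<in>Fhat. \<Lambda> * (a3 * (\<Sum>K'\<in>{K \<in> Omt. R \<gamma> K}. E K')))"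
    proof (rule sum_mono)
      fix \<gamma> assume \<gamma>: "\<gamma> \<in> Fhat"
      have eq: "{K \<in> T. R \<gamma> K} = {K \<in> Omt. R \<gamma> K}" using Omt(1) OT \<gamma> by blast
      have "h K / \<Lambda> * jmp \<gamma> \<le> a3 * (\<Sum>K'\<in>{K \<in> T. R \<gamma> K}. E K')"
      proof (rule jmp)
        show "\<gamma> \<in> F" using \<gamma> sub(2) by blast
        show "0 < h K / \<Lambda>" using h by simp
        fix K' assume "K' \<in> T" "R \<gamma> K'"
        then have "K' \<in> Omt" using \<gamma> Omt(1) by blast
        from h(3)[OF this] h(2) show "h K / \<Lambda> \<le> h K'" by (simp add: divide_le_eq mult.commute)
      qed
      from mult_left_mono[OF this, of \<Lambda>] h(2) show "h K * jmp \<gamma> \<le> \<Lambda> * (a3 * (\<Sum>K'\<in>{K \<in> Omt. R \<gamma> K}. E K'))"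
        unfolding eq by simp
    qed
    also have "\<dots> = \<Lambda> * a3 * (\<Sum>\<gamma>\<in>Fhat. \<Sum>K'\<in>{K \<in> Omt. R \<gamma> K}. E K')" by (simp add: sum_distrib_left mult.assoc)
    \<comment> \<open>After interchanging the sums each element is counted once for every one of its
      faces in \<open>Fhat\<close>, at most N times.\<close>
    also have "(\<Sum>\<gamma>\<in>Fhat. \<Sum>K'\<in>{K \<in> Omt. R \<gamma> K}. E K') = (\<Sum>K'\<in>Omt. \<Sum>\<gamma>\<in>{\<gamma> \<in> Fhat. R \<gamma> K'}. E K')"
      by (rule sum.swap_restrict) (use finO finite_subset[OF sub(2) fin(2)] in auto)
    also have "\<dots> \<le> (\<Sum>K'\<in>Omt. N * E K')"
    proof (rule sum_mono)
      fix K' assume K': "K' \<in> Omt"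
      have "card {\<gamma> \<in> Fhat. R \<gamma> K'} \<le> card {\<gamma> \<in> F. R \<gamma> K'}" using sub(2) fin(2) by (intro card_mono) auto
      also have "\<dots> \<le> N" using K' OT by (intro facets) auto
      finally show "(\<Sum>\<gamma>\<in>{\<gamma> \<in> Fhat. R \<gamma> K'}. E K') \<le> N * E K'" using E by (simp add: mult_right_mono)
    qed
    also have "\<dots> = N * ?E" by (simp add: sum_distrib_left)
    finally show ?thesis using h(2) a0(3) by (simp add: mult_left_mono)
  qed
  have "a1 * E K \<le> a1 * ?E" using EK a0 by (intro mult_left_mono)
  moreover have "(\<Sum>K'\<in>That. (h K)\<^sup>2 * res K') \<le> \<Lambda>\<^sup>2 * (a2 * ?E)" by (rule vol[OF res0(1) res a0(2)])
  moreover have "(\<Sum>K'\<in>That. (h K)\<^sup>2 * osc K') \<le> \<Lambda>\<^sup>2 * (1 * ?E)" by (rule vol[OF res0(2)]) (use osc in auto)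
  moreover have "0 \<le> a4 * ?E" using E0 a0 by simp
  moreover have "0 \<le> (a1 + \<Lambda>\<^sup>2 * a2 + \<Lambda> * a3 * N + \<Lambda>\<^sup>2 + 2) * ew"
    using a0 h(2) res0(3) by (intro mult_nonneg_nonneg add_nonneg_nonneg) auto
  ultimately show ?thesis using dv eta face EK by (simp add: algebra_simps)
qed

section \<open>Polynomial representatives of the discrete residuals\<close>

lemma cgrad_uminus:
  assumes "f \<in> smooth_fns"
  shows "cgrad (\<lambda>x. - f x) x = - cgrad f x"
proof -
  have "(\<lambda>x. 0) \<in> smooth_fns" by (rule pdeg_smooth[of 0]) (rule pdeg.const)
  from cgrad_lin[OF this assms, of "- 1" x] show ?thesis by (simp add: cgrad_def vec_eq_iff)
qed

lemma vpdeg_vjac_L2: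
  assumes "vpdeg m P" "compact K"
  shows "vjac P \<in> L2 K"
proof (rule L2_componentwise)
  fix i
  have "cgrad (\<lambda>z. P z $ i) \<in> L2 K"
    using assms by (intro vpdeg_L2[of m] vpdeg_cgrad) (auto simp: vpdeg_def)
  then show "(\<lambda>x. vjac P x $ i) \<in> L2 K" by (simp add: vjac_def)
qed

lemma conv_eq_vjac: "vpdeg m (loc K v) \<Longrightarrow> conv c K v x = vjac (loc K v) x *v c x"
  by (simp add: conv_def vpdeg_frechet)

lemma conv_L2:
  assumes "vpdeg m (loc K v)" "compact K" "c \<in> borel_measurable (lebesgue_on K)" "AE x in lebesgue_on K. norm (c x) \<le> B"
  shows "conv c K v \<in> L2 K"
proof -
  have "conv c K v = (\<lambda>x. vjac (loc K v) x *v c x)" by (rule ext) (rule conv_eq_vjac[OF assms(1)])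
  then show ?thesis using L2_matvec[OF vpdeg_vjac_L2[OF assms(1,2)] assms(3,4)] by simp
qed

text \<open>The residual mixes polynomials with pointwise representatives of \<open>yT\<close> and
  \<open>uT\<close>, which are polynomials only almost everywhere. Replacing them by
  \<open>loc\<close> yields a genuine polynomial field without changing norms.\<close>

lemma state_residual:
  fixes K :: "(real^'n) set"
  assumes K: "compact K" "interior K \<noteq> {}" "K \<in> T"
    and yT: "yT \<in> piecewise T (vec_space (poly_deg lV))" and pT: "pT \<in> piecewise T (poly_deg lQ)"
    and uT: "uT \<in> piecewise T (vec_space (poly_deg lU))"
    and f: "f \<in> L2 K" and c: "c \<in> borel_measurable (lebesgue_on K)" "AE x in lebesgue_on K. norm (c x) \<le> B"
    and M: "lV \<le> M" "lQ \<le> M" "lU \<le> M" "m \<le> M"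
  shows "\<exists>R. vpdeg M R \<and> osc_st c f m yT K \<in> L2 K \<and> (AE x in lebesgue_on K. R_st \<epsilon> \<kappa> c f m yT pT uT K x = R x) \<and>
    (AE x in lebesgue_on K. R x + osc_st c f m yT K x = strong_res \<epsilon> \<kappa> c (loc K yT) (loc K pT) (\<lambda>x. f x + uT x) x)"
proof -
  have s: "K \<in> sets lebesgue" using K(1) by (simp add: lmeasurable_compact fmeasurableD)
  note y = loc_vec[OF s K(2,3) yT] and p = loc_scalar[OF s K(2,3) pT] and u = loc_vec[OF s K(2,3) uT]
  note cv = conv_L2[OF y(1) K(1) c]
  note pr = proj_poly[OF K(1,2) f, of m] proj_poly[OF K(1,2) cv, of m]
  define R where "R x = proj K m f x + loc K uT x + \<epsilon> *\<^sub>R laplacian (loc K yT) x - proj K m (conv c K yT) x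
     - \<kappa> *\<^sub>R loc K yT x - cgrad (loc K pT) x" for x
  have "vpdeg M R" unfolding R_def[abs_def]
    by (intro vpdeg_diff vpdeg_add vpdeg_scaleR vpdeg_mono[OF pr(1) M(4)] vpdeg_mono[OF pr(2) M(4)] vpdeg_mono[OF u(1) M(3)]
        vpdeg_mono[OF laplacian_component(2)[OF y(1)] M(1)] vpdeg_mono[OF y(1) M(1)] vpdeg_mono[OF vpdeg_cgrad[OF p(1)] M(2)])
  moreover have "osc_st c f m yT K \<in> L2 K" unfolding osc_st_def[abs_def]
    by (intro L2_diff f cv vpdeg_L2[OF pr(1) K(1)] vpdeg_L2[OF pr(2) K(1)])
  moreover have "AE x in lebesgue_on K. R_st \<epsilon> \<kappa> c f m yT pT uT K x = R x"
    using y(2) u(2) by eventually_elim (simp add: R_def R_st_def)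
  moreover have "AE x in lebesgue_on K. R x + osc_st c f m yT K x = strong_res \<epsilon> \<kappa> c (loc K yT) (loc K pT) (\<lambda>x. f x + uT x) x"
    using u(2) by eventually_elim (simp add: R_def osc_st_def strong_res_def conv_eq_vjac[OF y(1)])
  ultimately show ?thesis by blast
qed

text \<open>The strong residual is written with convection \<open>- c\<close> and pressure
  \<open>- loc K qT\<close>, the form in which the adjoint equation is a state equation.\<close>

lemma adjoint_residual:
  fixes K :: "(real^'n) set"
  assumes K: "compact K" "interior K \<noteq> {}" "K \<in> T"
    and yT: "yT \<in> piecewise T (vec_space (poly_deg lV))" and wT: "wT \<in> piecewise T (vec_space (poly_deg lV))"
    and qT: "qT \<in> piecewise T (poly_deg lQ)"
    and y\<Omega>: "y\<Omega> \<in> L2 K" and c: "c \<in> borel_measurable (lebesgue_on K)" "AE x in lebesgue_on K. norm (c x) \<le> B"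
    and M: "lV \<le> M" "lQ \<le> M" "m \<le> M"
  shows "\<exists>R. vpdeg M R \<and> osc_ad c y\<Omega> m wT K \<in> L2 K \<and> (AE x in lebesgue_on K. R_ad \<epsilon> \<kappa> c y\<Omega> m yT wT qT K x = R x) \<and>
    (AE x in lebesgue_on K. R x + osc_ad c y\<Omega> m wT K x
       = strong_res \<epsilon> \<kappa> (\<lambda>x. - c x) (loc K wT) (\<lambda>x. - loc K qT x) (\<lambda>x. yT x - y\<Omega> x) x)"
proof -
  have s: "K \<in> sets lebesgue" using K(1) by (simp add: lmeasurable_compact fmeasurableD)
  note y = loc_vec[OF s K(2,3) yT] and q = loc_scalar[OF s K(2,3) qT] and w = loc_vec[OF s K(2,3) wT]
  note cv = conv_L2[OF w(1) K(1) c]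
  note pr = proj_poly[OF K(1,2) y\<Omega>, of m] proj_poly[OF K(1,2) cv, of m]
  define R where "R x = loc K yT x - proj K m y\<Omega> x + \<epsilon> *\<^sub>R laplacian (loc K wT) x + proj K m (conv c K wT) x
     - \<kappa> *\<^sub>R loc K wT x + cgrad (loc K qT) x" for x
  have "vpdeg M R" unfolding R_def[abs_def]
    by (intro vpdeg_diff vpdeg_add vpdeg_scaleR vpdeg_mono[OF pr(1) M(3)] vpdeg_mono[OF pr(2) M(3)] vpdeg_mono[OF y(1) M(1)]
        vpdeg_mono[OF laplacian_component(2)[OF w(1)] M(1)] vpdeg_mono[OF w(1) M(1)] vpdeg_mono[OF vpdeg_cgrad[OF q(1)] M(2)])
  moreover have "osc_ad c y\<Omega> m wT K \<in> L2 K" unfolding osc_ad_def[abs_def]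
    by (intro L2_diff L2_add L2_uminus y\<Omega> cv vpdeg_L2[OF pr(1) K(1)] vpdeg_L2[OF pr(2) K(1)])
  moreover have "AE x in lebesgue_on K. R_ad \<epsilon> \<kappa> c y\<Omega> m yT wT qT K x = R x"
    using y(2) w(2) by eventually_elim (simp add: R_def R_ad_def)
  moreover have neg: "vjac (loc K wT) x *v - c x = - (vjac (loc K wT) x *v c x)" for x
    by (rule linear_neg[OF matrix_vector_mul_linear])
  have "AE x in lebesgue_on K. R x + osc_ad c y\<Omega> m wT K x
       = strong_res \<epsilon> \<kappa> (\<lambda>x. - c x) (loc K wT) (\<lambda>x. - loc K qT x) (\<lambda>x. yT x - y\<Omega> x) x"
    using y(2) by eventually_elim
      (simp add: R_def osc_ad_def strong_res_def conv_eq_vjac[OF w(1)] neg cgrad_uminus[OF pdeg_smooth[OF q(1)]])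
  ultimately show ?thesis by blast
qed

text \<open>The \<open>element_error\<close> of one equation, written without reference to the
  locale: \<open>g\<close> is the error of the source term and \<open>r\<close> the
  oscillation.\<close>

definition eq_error :: "(real^'n) set \<Rightarrow> real \<Rightarrow> (real^'n) set \<Rightarrow> (real^'n \<Rightarrow> real^'n) \<Rightarrow> (real^'n \<Rightarrow> real) \<Rightarrow>
    (real^'n \<Rightarrow> real^'n) \<Rightarrow> (real^'n \<Rightarrow> real^'n) \<Rightarrow> real" where
  "eq_error \<Omega> \<kappa> K e \<pi> g r = (L2norm K (wGrad \<Omega> e))\<^sup>2 + (L2norm K \<pi>)\<^sup>2
     + (diameter K)\<^sup>2 * ((L2norm K g)\<^sup>2 + \<kappa> * (L2norm K e)\<^sup>2 + (L2norm K (wGrad \<Omega> e))\<^sup>2 + (L2norm K r)\<^sup>2)"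

text \<open>The bound D for all diameters makes terms such as h^2 times the squared gradient part of
  the energy norm, with a factor depending on \<open>\<epsilon>\<close>. Division by
  \<open>\<rho>\<close> supplies the missing weight of the pressure error.\<close>

lemma eq_error_bound:
  assumes c: "0 < \<epsilon>" "0 \<le> \<kappa>" "0 < \<rho>" and h: "0 \<le> diameter K" "diameter K \<le> D"
  shows "eq_error \<Omega> \<kappa> K e \<pi> g r \<le> ((1 + D\<^sup>2) / \<epsilon> + 1 / \<rho> + 1 + D\<^sup>2) *
    ((normV \<Omega> \<epsilon> \<kappa> K e)\<^sup>2 + \<rho> * (L2norm K \<pi>)\<^sup>2 + (diameter K)\<^sup>2 * ((L2norm K g)\<^sup>2 + (L2norm K r)\<^sup>2))"
proof -
  let ?a = "(L2norm K (wGrad \<Omega> e))\<^sup>2" and ?b = "(L2norm K e)\<^sup>2" and ?h = "(diameter K)\<^sup>2"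
  let ?N = "\<epsilon> * ?a + \<kappa> * ?b" and ?p = "\<rho> * (L2norm K \<pi>)\<^sup>2" and ?q = "?h * ((L2norm K g)\<^sup>2 + (L2norm K r)\<^sup>2)"
  let ?A = "(1 + D\<^sup>2) / \<epsilon> + 1 / \<rho> + 1 + D\<^sup>2"
  have nn: "0 \<le> \<epsilon> * ?a" "0 \<le> \<kappa> * ?b" "0 \<le> ?p" "0 \<le> ?q" using c by auto
  have N: "(normV \<Omega> \<epsilon> \<kappa> K e)\<^sup>2 = ?N" unfolding normV_def using nn by (intro real_sqrt_pow2) linarith
  have hD: "?h \<le> D\<^sup>2" using h by (intro power_mono)
  have a: "?a \<le> ?N / \<epsilon>" using nn(2) c(1) by (simp add: field_simps)
  then have ha: "?h * ?a \<le> D\<^sup>2 * (?N / \<epsilon>)" using hD by (intro mult_mono) auto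
  have hb: "?h * (\<kappa> * ?b) \<le> D\<^sup>2 * ?N" using hD nn by (intro mult_mono) auto
  have p: "(L2norm K \<pi>)\<^sup>2 = (1 / \<rho>) * ?p" using c(3) by simp
  have A: "1 / \<epsilon> + D\<^sup>2 / \<epsilon> + D\<^sup>2 \<le> ?A" "1 / \<rho> \<le> ?A" "1 \<le> ?A"
    using c by (auto simp: add_divide_distrib)
  have "eq_error \<Omega> \<kappa> K e \<pi> g r = ?a + (1 / \<rho>) * ?p + ?h * ?a + ?h * (\<kappa> * ?b) + ?q"
    unfolding eq_error_def p[symmetric] by (simp add: algebra_simps)
  also have "\<dots> \<le> ?N / \<epsilon> + (1 / \<rho>) * ?p + D\<^sup>2 * (?N / \<epsilon>) + D\<^sup>2 * ?N + ?q"
    using a ha hb by linarith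
  also have "\<dots> = (1 / \<epsilon> + D\<^sup>2 / \<epsilon> + D\<^sup>2) * ?N + (1 / \<rho>) * ?p + 1 * ?q"
    by (simp add: distrib_right)
  also have "\<dots> \<le> ?A * ?N + ?A * ?p + ?A * ?q"
    using nn by (intro add_mono[OF add_mono[OF mult_right_mono[OF A(1)] mult_right_mono[OF A(2) nn(3)]] mult_right_mono[OF A(3) nn(4)]]) linarith
  finally show ?thesis unfolding N by (simp only: distrib_left)
qed

section \<open>The residual bounds with constants independent of the mesh\<close>

locale residual_setup =
  fixes \<Omega> :: "(real^'n) set" and \<epsilon> \<kappa> B :: real and c :: "real^'n \<Rightarrow> real^'n" and M :: nat and \<Lambda> C1 C2 \<sigma> :: real
  assumes domain: "polytopal_domain \<Omega>"
    and nonneg: "0 < \<epsilon>" "0 \<le> \<kappa>" "0 \<le> B"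
    and c: "c \<in> borel_measurable (lebesgue_on \<Omega>)" "AE x in lebesgue_on \<Omega>. norm (c x) \<le> B"
    and C1: "0 < C1"
    "\<And>(R :: real^'n \<Rightarrow> real^'n) z r. vpdeg M R \<Longrightarrow> 0 < r \<Longrightarrow>
      (L2norm (cball z r) (\<lambda>x. bump z r x *\<^sub>R R x))\<^sup>2 \<le> C1 * bump_mass z r R"
    "\<And>(R :: real^'n \<Rightarrow> real^'n) z r. vpdeg M R \<Longrightarrow> 0 < r \<Longrightarrow>
      r\<^sup>2 * (L2norm (cball z r) (vjac (\<lambda>x. bump z r x *\<^sub>R R x)))\<^sup>2 \<le> C1 * bump_mass z r R"
    and C2: "0 < C2"
    "\<And>(R :: real^'n \<Rightarrow> real^'n) z r. vpdeg M R \<Longrightarrow> 0 < r \<Longrightarrow>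
      (L2norm (ball z (\<Lambda> * r)) R)\<^sup>2 \<le> C2 * bump_mass z r R"
    and \<sigma>: "0 < \<sigma>" "16 * (\<sigma> * CARD('n)) + 5 \<le> \<Lambda>"
begin

lemma open_domain: "open \<Omega>" and bounded_domain: "bounded \<Omega>" and lip: "lipschitz_boundary \<Omega>"
  using domain by (auto simp: polytopal_domain_def)

lemma Vsp_H1: "v \<in> Vsp \<Omega> \<Longrightarrow> v \<in> vec_space (H1 \<Omega>)"
  using H10_subset_H1 by (auto simp: vec_space_def)

text \<open>The value of \<open>element_const\<close>, restated where no mesh or discrete function
  is in scope, which makes its uniformity evident. The same holds for \<open>jump_const\<close> and
  \<open>face_const\<close>.\<close>

definition elem_const :: real where
  "elem_const = 4 * \<sigma>\<^sup>2 * (C2 * ((2 * energy_const CARD('n) \<epsilon> \<kappa> B + 2) * C1))"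

definition jump_const :: real where
  "jump_const = C2 / exp (- 4 / 3) * ((2 * energy_const CARD('n) \<epsilon> \<kappa> B + 2) * (C1 * C2) / (4 * (exp (- 4 / 3))\<^sup>2)) * (4 + 4 * elem_const)"

lemma consts_nonneg: "0 \<le> elem_const" "0 \<le> jump_const"
proof -
  have "0 \<le> 4 * \<epsilon>\<^sup>2 + 4 * (real CARD('n))\<^sup>2 + 4 + 8 * \<kappa> + 8 * B\<^sup>2"
    using nonneg by (intro add_nonneg_nonneg mult_nonneg_nonneg) auto
  then have 1: "0 \<le> energy_const CARD('n) \<epsilon> \<kappa> B" by (simp add: energy_const_def)
  show 2: "0 \<le> elem_const" unfolding elem_const_def using 1 C1(1) C2(1) by simp
  show "0 \<le> jump_const" unfolding jump_const_def using 1 2 C1(1) C2(1) by (intro mult_nonneg_nonneg divide_nonneg_nonneg add_nonneg_nonneg) auto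
qed

text \<open>Weak gradients are local on open sets, so the identification with the polynomial's
  Jacobian takes place in the interior of the element and extends over its null boundary.\<close>

lemma local_gradient:
  assumes T: "conforming_mesh \<Omega> T" and K: "K \<in> T" and v: "v \<in> vec_space (H1 \<Omega>)" "v \<in> piecewise T (vec_space (poly_deg lV))"
  shows "vpdeg lV (loc K v)" "AE x in lebesgue_on K. v x = loc K v x \<and> wGrad \<Omega> v x = vjac (loc K v) x"
proof -
  note e = mesh_element[OF open_domain lip T K]
  note lv = loc_vec[OF e(7,2) K v(2)]
  show "vpdeg lV (loc K v)" by (rule lv(1))
  have i: "interior K \<in> sets lebesgue" by simp
  have "negligible (interior K - K)" using interior_subset[of K] by (metis Diff_eq_empty_iff negligible_empty)
  then have "AE x in lebesgue_on (interior K). v x = loc K v x" by (rule AE_lebesgue_on_subset[OF lv(2) i e(7)])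
  from wGrad_eq_vjac[OF open_domain v(1) open_interior e(3) lv(1) this]
  have "AE x in lebesgue_on K. wGrad \<Omega> v x = vjac (loc K v) x"
    by (rule AE_lebesgue_on_subset[OF _ e(7) i e(5)])
  with lv(2) show "AE x in lebesgue_on K. v x = loc K v x \<and> wGrad \<Omega> v x = vjac (loc K v) x"
    by eventually_elim simp
qed

lemma data_on_element:
  assumes T: "conforming_mesh \<Omega> T" and K: "K \<in> T"
  shows "f \<in> L2 \<Omega> \<Longrightarrow> f \<in> L2 K" "c \<in> borel_measurable (lebesgue_on K)" "AE x in lebesgue_on K. norm (c x) \<le> B"
proof -
  note e = mesh_element[OF open_domain lip T K]
  have s: "\<Omega> \<in> sets lebesgue" using open_domain by auto
  show "f \<in> L2 \<Omega> \<Longrightarrow> f \<in> L2 K" by (rule L2_subset[OF _ e(7) s e(4)])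
  show "c \<in> borel_measurable (lebesgue_on K)" by (rule borel_measurable_lebesgue_on_subset[OF c(1) e(7) s e(4)])
  show "AE x in lebesgue_on K. norm (c x) \<le> B" by (rule AE_lebesgue_on_subset[OF c(2) e(7) s e(4)])
qed

lemma state_bounds:
  assumes T: "conforming_mesh \<Omega> T"
    and inball: "\<And>K. K \<in> T \<Longrightarrow> 0 < diameter K \<Longrightarrow> \<exists>z r. 0 < r \<and> cball z r \<subseteq> K \<and> diameter K \<le> \<sigma> * r"
    and M: "lV \<le> M" "lQ \<le> M" "lU \<le> M" "m \<le> M"
    and f: "f \<in> L2 \<Omega>" and u: "u \<in> L2 \<Omega>" and state: "state_eqs \<Omega> \<epsilon> \<kappa> c (\<lambda>x. f x + u x) y p"
    and yT: "yT \<in> V_fe \<Omega> T lV" and pT: "pT \<in> L2 \<Omega>" "pT \<in> piecewise T (poly_deg lQ)"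
    and uT: "uT \<in> L2 \<Omega>" "uT \<in> piecewise T (vec_space (poly_deg lU))"
  defines "E \<equiv> \<lambda>K. eq_error \<Omega> \<kappa> K (\<lambda>x. y x - yT x) (\<lambda>x. p x - pT x) (\<lambda>x. u x - uT x) (osc_st c f m yT K)"
  shows "K \<in> T \<Longrightarrow> (diameter K)\<^sup>2 * (L2norm K (R_st \<epsilon> \<kappa> c f m yT pT uT K))\<^sup>2 \<le> elem_const * E K"
    and "\<gamma> \<in> int_faces \<Omega> T \<Longrightarrow> 0 < H \<Longrightarrow> (\<And>K. K \<in> face_patch T \<gamma> \<Longrightarrow> H \<le> diameter K) \<Longrightarrow>
      H * (face_L2norm \<gamma> (jump_st \<epsilon> T yT pT \<gamma>))\<^sup>2 \<le> jump_const * (\<Sum>K\<in>face_patch T \<gamma>. E K)"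
proof -
  note elt = mesh_element[OF open_domain lip T]
  have yT': "yT \<in> vec_space (H1 \<Omega>)" "yT \<in> piecewise T (vec_space (poly_deg lV))" using yT Vsp_H1 by (auto simp: V_fe_def)
  have y: "y \<in> vec_space (H1 \<Omega>)" "p \<in> L2 \<Omega>" using state Vsp_H1 by (auto simp: state_eqs_def Qsp_def)
  have "\<forall>K\<in>T. \<exists>R. vpdeg M R \<and> osc_st c f m yT K \<in> L2 K \<and> (AE x in lebesgue_on K. R_st \<epsilon> \<kappa> c f m yT pT uT K x = R x) \<and>
    (AE x in lebesgue_on K. R x + osc_st c f m yT K x = strong_res \<epsilon> \<kappa> c (loc K yT) (loc K pT) (\<lambda>x. f x + uT x) x)"
    (is "\<forall>K\<in>T. ?residual K")
  proof
    fix K assume K: "K \<in> T"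
    show "?residual K"
      by (rule state_residual[OF elt(1,2)[OF K] K yT'(2) pT(2) uT(2) data_on_element(1)[OF T K f] data_on_element(2,3)[OF T K] M])
  qed
  from bchoice[OF this] obtain R where R: "\<And>K. K \<in> T \<Longrightarrow> vpdeg M (R K)" "\<And>K. K \<in> T \<Longrightarrow> osc_st c f m yT K \<in> L2 K"
    "\<And>K. K \<in> T \<Longrightarrow> AE x in lebesgue_on K. R_st \<epsilon> \<kappa> c f m yT pT uT K x = R K x"
    "\<And>K. K \<in> T \<Longrightarrow> AE x in lebesgue_on K. R K x + osc_st c f m yT K x = strong_res \<epsilon> \<kappa> c (loc K yT) (loc K pT) (\<lambda>x. f x + uT x) x"
    by blast
  have eq: "formA \<Omega> \<epsilon> \<kappa> c y \<xi> - formB \<Omega> \<xi> p = L2inner \<Omega> (\<lambda>x. f x + u x) \<xi>"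
    if "\<xi> \<in> vec_space (test_functions \<Omega>)" for \<xi>
    using state vtest_Vsp[OF open_domain that] by (auto simp: state_eqs_def)
  have yM: "vpdeg M (loc K yT)" and pM: "pdeg M (loc K pT)" if "K \<in> T" for K
    using vpdeg_mono[OF local_gradient(1)[OF T that yT'] M(1)] pdeg_mono[OF loc_scalar(1)[OF elt(7,2)[OF that] that pT(2)] M(2)] by blast+
  have ae: "AE x in lebesgue_on K. yT x = loc K yT x \<and> wGrad \<Omega> yT x = vjac (loc K yT) x \<and> pT x = loc K pT x
    \<and> R K x + osc_st c f m yT K x = strong_res \<epsilon> \<kappa> c (loc K yT) (loc K pT) (\<lambda>x. f x + uT x) x" if "K \<in> T" for K
    using local_gradient(2)[OF T that yT'] loc_scalar(2)[OF elt(7,2)[OF that] that pT(2)] R(4)[OF that]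
    by eventually_elim simp
  interpret me: mesh_error \<Omega> \<epsilon> \<kappa> B c y yT "\<lambda>x. f x + u x" "\<lambda>x. f x + uT x" p pT M \<Lambda> C1 C2 T \<sigma>
    "\<lambda>K. loc K yT" R "\<lambda>K. osc_st c f m yT K" "\<lambda>K. loc K pT"
    by unfold_locales (fact open_domain nonneg c yT'(1) y pT(1) C1 C2 lip T \<sigma> L2_add[OF f u] L2_add[OF f uT(1)]
      eq inball yM pM R(1,2) ae)+
  have E: "me.element_error K = E K" for K
    by (simp add: me.element_error_def me.diffusion_error_def me.reaction_error_def E_def eq_error_def)
  have const_eqs: "me.element_const = elem_const" "me.face_const = jump_const"
    by (simp_all add: me.element_const_def me.face_const_def elem_const_def jump_const_def)
  show "(diameter K)\<^sup>2 * (L2norm K (R_st \<epsilon> \<kappa> c f m yT pT uT K))\<^sup>2 \<le> elem_const * E K" if "K \<in> T"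
    using me.element_bound[OF that] unfolding E const_eqs L2norm_cong_AE[OF elt(7)[OF that] R(3)[OF that]] .
  show "H * (face_L2norm \<gamma> (jump_st \<epsilon> T yT pT \<gamma>))\<^sup>2 \<le> jump_const * (\<Sum>K\<in>face_patch T \<gamma>. E K)"
    if "\<gamma> \<in> int_faces \<Omega> T" "0 < H" "\<And>K. K \<in> face_patch T \<gamma> \<Longrightarrow> H \<le> diameter K"
  proof -
    have "jump_st \<epsilon> T yT pT \<gamma> x = (\<Sum>K\<in>face_patch T \<gamma>. - \<epsilon> *\<^sub>R (vjac (loc K yT) x *v outer_normal K \<gamma>) + loc K pT x *\<^sub>R outer_normal K \<gamma>)" for x
      unfolding jump_st_def
      using vpdeg_frechet[OF local_gradient(1)[OF T _ yT']] by (intro sum.cong) (auto simp: face_patch_def)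
    from me.face_bound[OF that this] show ?thesis unfolding E const_eqs .
  qed
qed

lemma adjoint_bounds:
  assumes T: "conforming_mesh \<Omega> T"
    and inball: "\<And>K. K \<in> T \<Longrightarrow> 0 < diameter K \<Longrightarrow> \<exists>z r. 0 < r \<and> cball z r \<subseteq> K \<and> diameter K \<le> \<sigma> * r"
    and M: "lV \<le> M" "lQ \<le> M" "m \<le> M"
    and y\<Omega>: "y\<Omega> \<in> L2 \<Omega>" and y: "y \<in> L2 \<Omega>" and adjoint: "adjoint_eqs \<Omega> \<epsilon> \<kappa> c (\<lambda>x. y x - y\<Omega> x) w q"
    and yT: "yT \<in> V_fe \<Omega> T lV" and wT: "wT \<in> V_fe \<Omega> T lV" and qT: "qT \<in> L2 \<Omega>" "qT \<in> piecewise T (poly_deg lQ)"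
  defines "E \<equiv> \<lambda>K. eq_error \<Omega> \<kappa> K (\<lambda>x. w x - wT x) (\<lambda>x. q x - qT x) (\<lambda>x. y x - yT x) (osc_ad c y\<Omega> m wT K)"
  shows "K \<in> T \<Longrightarrow> (diameter K)\<^sup>2 * (L2norm K (R_ad \<epsilon> \<kappa> c y\<Omega> m yT wT qT K))\<^sup>2 \<le> elem_const * E K"
    and "\<gamma> \<in> int_faces \<Omega> T \<Longrightarrow> 0 < H \<Longrightarrow> (\<And>K. K \<in> face_patch T \<gamma> \<Longrightarrow> H \<le> diameter K) \<Longrightarrow>
      H * (face_L2norm \<gamma> (jump_ad \<epsilon> T wT qT \<gamma>))\<^sup>2 \<le> jump_const * (\<Sum>K\<in>face_patch T \<gamma>. E K)"
proof -
  note elt = mesh_element[OF open_domain lip T]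
  have yT': "yT \<in> vec_space (H1 \<Omega>)" "yT \<in> piecewise T (vec_space (poly_deg lV))" using yT Vsp_H1 by (auto simp: V_fe_def)
  have wT': "wT \<in> vec_space (H1 \<Omega>)" "wT \<in> piecewise T (vec_space (poly_deg lV))" using wT Vsp_H1 by (auto simp: V_fe_def)
  have w: "w \<in> vec_space (H1 \<Omega>)" "q \<in> L2 \<Omega>" using adjoint Vsp_H1 by (auto simp: adjoint_eqs_def Qsp_def)
  have "\<forall>K\<in>T. \<exists>R. vpdeg M R \<and> osc_ad c y\<Omega> m wT K \<in> L2 K \<and> (AE x in lebesgue_on K. R_ad \<epsilon> \<kappa> c y\<Omega> m yT wT qT K x = R x) \<and>
    (AE x in lebesgue_on K. R x + osc_ad c y\<Omega> m wT K x
       = strong_res \<epsilon> \<kappa> (\<lambda>x. - c x) (loc K wT) (\<lambda>x. - loc K qT x) (\<lambda>x. yT x - y\<Omega> x) x)"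
    (is "\<forall>K\<in>T. ?residual K")
  proof
    fix K assume K: "K \<in> T"
    show "?residual K"
      by (rule adjoint_residual[OF elt(1,2)[OF K] K yT'(2) wT'(2) qT(2) data_on_element(1)[OF T K y\<Omega>] data_on_element(2,3)[OF T K] M])
  qed
  from bchoice[OF this] obtain R where R: "\<And>K. K \<in> T \<Longrightarrow> vpdeg M (R K)" "\<And>K. K \<in> T \<Longrightarrow> osc_ad c y\<Omega> m wT K \<in> L2 K"
    "\<And>K. K \<in> T \<Longrightarrow> AE x in lebesgue_on K. R_ad \<epsilon> \<kappa> c y\<Omega> m yT wT qT K x = R K x"
    "\<And>K. K \<in> T \<Longrightarrow> AE x in lebesgue_on K. R K x + osc_ad c y\<Omega> m wT K x
       = strong_res \<epsilon> \<kappa> (\<lambda>x. - c x) (loc K wT) (\<lambda>x. - loc K qT x) (\<lambda>x. yT x - y\<Omega> x) x"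
    by blast
  have eq: "formA \<Omega> \<epsilon> \<kappa> (\<lambda>x. - c x) w \<xi> - formB \<Omega> \<xi> (\<lambda>x. - q x) = L2inner \<Omega> (\<lambda>x. y x - y\<Omega> x) \<xi>"
    if "\<xi> \<in> vec_space (test_functions \<Omega>)" for \<xi>
  proof -
    have "wGrad \<Omega> w x *v - c x = - (wGrad \<Omega> w x *v c x)" for x
      by (rule linear_neg[OF matrix_vector_mul_linear])
    then have "formA \<Omega> \<epsilon> \<kappa> (\<lambda>x. - c x) w \<xi> = formC \<Omega> \<epsilon> \<kappa> c w \<xi>" by (simp add: formA_def formC_def)
    moreover have "formB \<Omega> \<xi> (\<lambda>x. - q x) = - formB \<Omega> \<xi> q" by (simp add: formB_def L2inner_def)
    ultimately show ?thesis using adjoint vtest_Vsp[OF open_domain that] by (auto simp: adjoint_eqs_def)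
  qed
  have q': "(\<lambda>x. - q x) \<in> L2 \<Omega>" "(\<lambda>x. - qT x) \<in> L2 \<Omega>" by (intro L2_uminus w qT)+
  have c': "(\<lambda>x. - c x) \<in> borel_measurable (lebesgue_on \<Omega>)" "AE x in lebesgue_on \<Omega>. norm (- c x) \<le> B"
    using c by auto
  have wM: "vpdeg M (loc K wT)" and qM: "pdeg M (\<lambda>x. - loc K qT x)" if "K \<in> T" for K
    using vpdeg_mono[OF local_gradient(1)[OF T that wT'] M(1)] pdeg_uminus[OF pdeg_mono[OF loc_scalar(1)[OF elt(7,2)[OF that] that qT(2)] M(2)]] by blast+
  have ae: "AE x in lebesgue_on K. wT x = loc K wT x \<and> wGrad \<Omega> wT x = vjac (loc K wT) x \<and> - qT x = - loc K qT x
    \<and> R K x + osc_ad c y\<Omega> m wT K x = strong_res \<epsilon> \<kappa> (\<lambda>x. - c x) (loc K wT) (\<lambda>x. - loc K qT x) (\<lambda>x. yT x - y\<Omega> x) x" if "K \<in> T" for K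
    using local_gradient(2)[OF T that wT'] loc_scalar(2)[OF elt(7,2)[OF that] that qT(2)] R(4)[OF that]
    by eventually_elim simp
  interpret me: mesh_error \<Omega> \<epsilon> \<kappa> B "\<lambda>x. - c x" w wT "\<lambda>x. y x - y\<Omega> x" "\<lambda>x. yT x - y\<Omega> x" "\<lambda>x. - q x" "\<lambda>x. - qT x" M \<Lambda> C1 C2 T \<sigma>
    "\<lambda>K. loc K wT" R "\<lambda>K. osc_ad c y\<Omega> m wT K" "\<lambda>K x. - loc K qT x"
    by unfold_locales (fact open_domain nonneg c' wT'(1) w(1) q' C1 C2 lip T \<sigma> L2_diff[OF y y\<Omega>] L2_diff[OF vec_space_L2[OF yT'(1)] y\<Omega>]
      eq inball wM qM R(1,2) ae)+
  have "L2norm K (\<lambda>x. - q x - - qT x) = L2norm K (\<lambda>x. q x - qT x)" for K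
    by (simp add: L2norm_def power2_commute)
  then have E: "me.element_error K = E K" for K
    by (simp add: me.element_error_def me.diffusion_error_def me.reaction_error_def E_def eq_error_def)
  have const_eqs: "me.element_const = elem_const" "me.face_const = jump_const"
    by (simp_all add: me.element_const_def me.face_const_def elem_const_def jump_const_def)
  show "(diameter K)\<^sup>2 * (L2norm K (R_ad \<epsilon> \<kappa> c y\<Omega> m yT wT qT K))\<^sup>2 \<le> elem_const * E K" if "K \<in> T"
    using me.element_bound[OF that] unfolding E const_eqs L2norm_cong_AE[OF elt(7)[OF that] R(3)[OF that]] .
  show "H * (face_L2norm \<gamma> (jump_ad \<epsilon> T wT qT \<gamma>))\<^sup>2 \<le> jump_const * (\<Sum>K\<in>face_patch T \<gamma>. E K)"
    if "\<gamma> \<in> int_faces \<Omega> T" "0 < H" "\<And>K. K \<in> face_patch T \<gamma> \<Longrightarrow> H \<le> diameter K"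
  proof -
    have "jump_ad \<epsilon> T wT qT \<gamma> x = (\<Sum>K\<in>face_patch T \<gamma>. - \<epsilon> *\<^sub>R (vjac (loc K wT) x *v outer_normal K \<gamma>) + (- loc K qT x) *\<^sub>R outer_normal K \<gamma>)" for x
      unfolding jump_ad_def
      using vpdeg_frechet[OF local_gradient(1)[OF T _ wT']] by (intro sum.cong) (auto simp: face_patch_def)
    from me.face_bound[OF that this] show ?thesis unfolding E const_eqs .
  qed
qed

end

section \<open>Assembly of the two relations\<close>

lemma W1inf_bounded:
  fixes c :: "real^'n \<Rightarrow> real^'n"
  assumes "c \<in> vec_space (W1inf \<Omega>)"
  obtains B where "0 \<le> B" "c \<in> borel_measurable (lebesgue_on \<Omega>)" "AE x in lebesgue_on \<Omega>. norm (c x) \<le> B"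
proof -
  have L: "(\<lambda>x. c x $ i) \<in> Linf \<Omega>" for i using assms by (simp add: vec_space_def W1inf_def)
  then have "\<exists>B. AE x in lebesgue_on \<Omega>. norm (c x $ i) \<le> B" for i by (simp add: Linf_def)
  then obtain b where b: "\<And>i. AE x in lebesgue_on \<Omega>. norm (c x $ i) \<le> b i" by metis
  then have "AE x in lebesgue_on \<Omega>. \<forall>i. norm (c x $ i) \<le> b i" by (simp add: eventually_all_finite)
  then have "AE x in lebesgue_on \<Omega>. norm (c x) \<le> (\<Sum>i\<in>UNIV. \<bar>b i\<bar>)"
  proof eventually_elim
    case (elim x)
    have "norm (c x) \<le> (\<Sum>i\<in>UNIV. \<bar>c x $ i\<bar>)" by (rule norm_le_l1_cart)
    also have "\<dots> \<le> (\<Sum>i\<in>UNIV. \<bar>b i\<bar>)" using elim by (intro sum_mono) (auto intro: order_trans[OF _ abs_ge_self])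
    finally show ?case .
  qed
  moreover have "c \<in> borel_measurable (lebesgue_on \<Omega>)"
    using L by (intro borel_measurable_componentwise) (simp add: Linf_def)
  moreover have "0 \<le> (\<Sum>i\<in>UNIV. \<bar>b i\<bar>)" by (intro sum_nonneg) simp
  ultimately show ?thesis using that by blast
qed

text \<open>The absolute value spares a discussion of the sign of the weight.\<close>

lemma weighted_square_bound:
  fixes c :: real
  assumes "0 \<le> \<eta>" "\<eta> \<le> C * \<eta>'"
  shows "c * \<eta>\<^sup>2 \<le> \<bar>c\<bar> * C\<^sup>2 * \<eta>'\<^sup>2"
proof -
  have "c * \<eta>\<^sup>2 \<le> \<bar>c\<bar> * \<eta>\<^sup>2" by (intro mult_right_mono) auto
  also have "\<dots> \<le> \<bar>c\<bar> * (C * \<eta>')\<^sup>2" using assms by (intro mult_left_mono power_mono) auto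
  finally show ?thesis by (simp add: power_mult_distrib)
qed

text \<open>The weights are fixed numbers for the whole family and only enlarge the constant;
  nonnegativity of the indicators permits squaring the given relations.\<close>

lemma lesssim_weighted_squares:
  assumes nonneg: "\<And>i K. K \<in> \<T> i \<Longrightarrow> 0 \<le> \<eta>1 i K \<and> 0 \<le> \<eta>2 i K \<and> 0 \<le> \<eta>3 i K \<and> 0 \<le> \<eta>4 i K"
    and le: "lesssim \<T> \<eta>1 \<eta>1'" "lesssim \<T> \<eta>2 \<eta>2'" "lesssim \<T> \<eta>3 \<eta>3'" "lesssim \<T> \<eta>4 \<eta>4'"
  shows "lesssim \<T> (\<lambda>i K. c1 * (\<eta>1 i K)\<^sup>2 + c2 * (\<eta>2 i K)\<^sup>2 + c3 * (\<eta>3 i K)\<^sup>2 + c4 * (\<eta>4 i K)\<^sup>2 + c5 * (\<eta>5 i K)\<^sup>2)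
    (\<lambda>i K. (\<eta>1' i K)\<^sup>2 + (\<eta>2' i K)\<^sup>2 + (\<eta>3' i K)\<^sup>2 + (\<eta>4' i K)\<^sup>2 + (\<eta>5 i K)\<^sup>2)"
proof -
  obtain C1 C2 C3 C4 where C: "\<And>i K. K \<in> \<T> i \<Longrightarrow> \<eta>1 i K \<le> C1 * \<eta>1' i K" "\<And>i K. K \<in> \<T> i \<Longrightarrow> \<eta>2 i K \<le> C2 * \<eta>2' i K"
    "\<And>i K. K \<in> \<T> i \<Longrightarrow> \<eta>3 i K \<le> C3 * \<eta>3' i K" "\<And>i K. K \<in> \<T> i \<Longrightarrow> \<eta>4 i K \<le> C4 * \<eta>4' i K"
    using le unfolding lesssim_def by metis
  define C where "C = \<bar>c1\<bar> * C1\<^sup>2 + \<bar>c2\<bar> * C2\<^sup>2 + \<bar>c3\<bar> * C3\<^sup>2 + \<bar>c4\<bar> * C4\<^sup>2 + \<bar>c5\<bar> + 1"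
  have nn: "0 \<le> \<bar>c1\<bar> * C1\<^sup>2" "0 \<le> \<bar>c2\<bar> * C2\<^sup>2" "0 \<le> \<bar>c3\<bar> * C3\<^sup>2" "0 \<le> \<bar>c4\<bar> * C4\<^sup>2" "0 \<le> \<bar>c5\<bar>" by auto
  then have k: "0 < C" "\<bar>c1\<bar> * C1\<^sup>2 \<le> C" "\<bar>c2\<bar> * C2\<^sup>2 \<le> C" "\<bar>c3\<bar> * C3\<^sup>2 \<le> C" "\<bar>c4\<bar> * C4\<^sup>2 \<le> C" "c5 \<le> C"
    unfolding C_def using abs_ge_self[of c5] by linarith+
  show ?thesis unfolding lesssim_def
  proof (intro exI[of _ C] conjI allI ballI k(1))
    fix i K assume K: "K \<in> \<T> i"
    have step: "c * \<eta>\<^sup>2 \<le> C * \<eta>'\<^sup>2" if "0 \<le> \<eta>" "\<eta> \<le> D * \<eta>'" "\<bar>c\<bar> * D\<^sup>2 \<le> C" for c \<eta> D \<eta>'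
      using weighted_square_bound[OF that(1,2), of c] mult_right_mono[OF that(3), of "\<eta>'\<^sup>2"] by simp
    have "c5 * (\<eta>5 i K)\<^sup>2 \<le> C * (\<eta>5 i K)\<^sup>2" using k(6) by (intro mult_right_mono) auto
    then show "c1 * (\<eta>1 i K)\<^sup>2 + c2 * (\<eta>2 i K)\<^sup>2 + c3 * (\<eta>3 i K)\<^sup>2 + c4 * (\<eta>4 i K)\<^sup>2 + c5 * (\<eta>5 i K)\<^sup>2
        \<le> C * ((\<eta>1' i K)\<^sup>2 + (\<eta>2' i K)\<^sup>2 + (\<eta>3' i K)\<^sup>2 + (\<eta>4' i K)\<^sup>2 + (\<eta>5 i K)\<^sup>2)"
      using step[OF _ C(1)[OF K] k(2)] step[OF _ C(2)[OF K] k(3)] step[OF _ C(3)[OF K] k(4)] step[OF _ C(4)[OF K] k(5)] nonneg[OF K]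
      by (simp add: distrib_left add_mono)
  qed
qed

lemma lesssim_trans:
  assumes "lesssim \<T> X Y" "lesssim \<T> Y Z"
  shows "lesssim \<T> X Z"
proof -
  obtain C where C: "0 < C" "\<And>i K. K \<in> \<T> i \<Longrightarrow> X i K \<le> C * Y i K" using assms(1) unfolding lesssim_def by blast
  obtain D where D: "0 < D" "\<And>i K. K \<in> \<T> i \<Longrightarrow> Y i K \<le> D * Z i K" using assms(2) unfolding lesssim_def by blast
  have "X i K \<le> C * D * Z i K" if "K \<in> \<T> i" for i K
    using order_trans[OF C(2)[OF that] mult_left_mono[OF D(2)[OF that]]] C(1) by (simp add: mult.assoc)
  then show ?thesis unfolding lesssim_def using mult_pos_pos[OF C(1) D(1)] by blast
qed

lemma finite_int_faces:
  fixes \<Omega> :: "(real^'n) set"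
  assumes "conforming_mesh \<Omega> T"
  shows "finite (int_faces \<Omega> T)"
proof (rule finite_subset)
  show "int_faces \<Omega> T \<subseteq> (\<Union>K\<in>T. {\<gamma>. \<gamma> facet_of K})" by (auto simp: int_faces_def)
  show "finite (\<Union>K\<in>T. {\<gamma>. \<gamma> facet_of K})"
    using conforming_meshD(2,3)[OF assms] facets_of_simplex(1) by blast
qed

theorem theorem5p4:
  fixes \<Omega> :: "(real^'n::{finite,wellorder}) set"
    and f y\<Omega> c :: "'n vfield" and a b l :: "real^'n::_"
    and \<epsilon> \<kappa> \<theta> \<beta> \<rho> :: real
    and y w u :: "'n vfield" and p q :: "'n sfield"
    and \<T> :: "'i \<Rightarrow> (real^'n::_) set set"
    and VT UT :: "'i \<Rightarrow> 'n vfield set" and QT :: "'i \<Rightarrow> 'n sfield set"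
    and lV lQ lU m :: nat
    and S Qs :: "'i \<Rightarrow> 'n vfield \<Rightarrow> 'n sfield \<Rightarrow> 'n vfield \<Rightarrow> 'n vfield \<Rightarrow> real"
    and H Ks :: "'i \<Rightarrow> 'n vfield \<Rightarrow> 'n sfield \<Rightarrow> 'n vfield \<Rightarrow> 'n sfield \<Rightarrow> real"
    and yT wT uT yh wh :: "'i \<Rightarrow> 'n vfield" and pT qT ph qh :: "'i \<Rightarrow> 'n sfield"
    and \<eta>y \<eta>p \<eta>w \<eta>q \<eta>y' \<eta>p' \<eta>w' \<eta>q' \<eta>u UpsSq UpsSq' :: "'i \<Rightarrow> (real^'n::_) set \<Rightarrow> real"
    and That Fhat Omt :: "'i \<Rightarrow> (real^'n::_) set \<Rightarrow> (real^'n::_) set set"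
    and ey ew eu :: "'i \<Rightarrow> 'n vfield" and ep eq :: "'i \<Rightarrow> 'n sfield"
    and h :: "(real^'n::_) set \<Rightarrow> real"
    and Rst Rad ost oad :: "'i \<Rightarrow> (real^'n::_) set \<Rightarrow> 'n vfield"
  defines "h \<equiv> diameter"
    and "m \<equiv> max lV (max (lQ - 1) lU)"
    and "\<eta>u \<equiv> \<lambda>i. eta_u a b \<theta> (wT i) (uT i)"
    and "Rst \<equiv> \<lambda>i. R_st \<epsilon> \<kappa> c f m (yT i) (pT i) (uT i)"
    and "Rad \<equiv> \<lambda>i. R_ad \<epsilon> \<kappa> c y\<Omega> m (yT i) (wT i) (qT i)"
    and "ost \<equiv> \<lambda>i. osc_st c f m (yT i)"
    and "oad \<equiv> \<lambda>i. osc_ad c y\<Omega> m (wT i)"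
    and "ey \<equiv> \<lambda>i x. y x - yT i x"
    and "ep \<equiv> \<lambda>i x. p x - pT i x"
    and "ew \<equiv> \<lambda>i x. w x - wT i x"
    and "eq \<equiv> \<lambda>i x. q x - qT i x"
    and "eu \<equiv> \<lambda>i x. u x - uT i x"
    and "Omt \<equiv> \<lambda>i K. That i K \<union> (\<Union>\<gamma>\<in>Fhat i K. face_patch (\<T> i) \<gamma>)"
    and "UpsSq' \<equiv> \<lambda>i K. ((\<eta>y' i K)\<^sup>2 + (\<eta>p' i K)\<^sup>2 + (\<eta>w' i K)\<^sup>2 + (\<eta>q' i K)\<^sup>2 + (\<eta>u i K)\<^sup>2)"
    and "UpsSq \<equiv> \<lambda>i K.
          let r = \<rho> * omega \<Omega> \<epsilon> \<kappa> c l \<beta>; C = C_Om \<epsilon> \<kappa> l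
          in (const_y (mu \<theta>) r C * (\<eta>y i K)\<^sup>2 + 2 * \<rho> * (\<eta>p i K)\<^sup>2
             + const_w (mu \<theta>) r C * (\<eta>w i K)\<^sup>2 + 2 * \<rho> * (\<eta>q i K)\<^sup>2
             + const_u (mu \<theta>) r C * (\<eta>u i K)\<^sup>2)"
  assumes dimension: "CARD('n) = 2 \<or> CARD('n) = 3"
    and domain: "polytopal_domain \<Omega>"
    and data: "f \<in> L2 \<Omega>" "y\<Omega> \<in> L2 \<Omega>" "0 < \<epsilon>" "0 \<le> \<kappa>" "0 < \<theta>" "\<forall>i. a $ i < b $ i"
    and convection: "c \<in> vec_space (W1inf \<Omega>)" "AE x in lebesgue_on \<Omega>. wdiv \<Omega> c x = 0"
    and box: "in_box \<Omega> l"
    and inf_sup: "inf_sup_const \<Omega> \<beta>"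
    and rho: "0 \<le> \<rho>" "\<rho> \<noteq> 0"
    and optimality: "state_eqs \<Omega> \<epsilon> \<kappa> c (\<lambda>x. f x + u x) y p"
      "adjoint_eqs \<Omega> \<epsilon> \<kappa> c (\<lambda>x. y x - y\<Omega> x) w q"
      "variational_ineq \<Omega> \<theta> (Uad \<Omega> a b) w u"
    and meshes: "\<And>i. conforming_mesh \<Omega> (\<T> i)" "shape_regular (range \<T>)"
    and discrete_optimality:
      "\<And>i. discrete_state_eqs \<Omega> \<epsilon> \<kappa> c (VT i) (QT i) (S i) (H i) (\<lambda>x. f x + uT i x) (yT i) (pT i)"
      "\<And>i. discrete_adjoint_eqs \<Omega> \<epsilon> \<kappa> c (VT i) (QT i) (Qs i) (Ks i) (\<lambda>x. yT i x - y\<Omega> x) (wT i) (qT i)"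
      "\<And>i. variational_ineq \<Omega> \<theta> (UT i) (wT i) (uT i)"
    and auxiliary: "\<And>i. state_eqs \<Omega> \<epsilon> \<kappa> c (\<lambda>x. f x + uT i x) (yh i) (ph i)"
      "\<And>i. adjoint_eqs \<Omega> \<epsilon> \<kappa> c (\<lambda>x. yT i x - y\<Omega> x) (wh i) (qh i)"
    and nonneg: "\<And>i K. K \<in> \<T> i \<Longrightarrow> 0 \<le> \<eta>y i K \<and> 0 \<le> \<eta>p i K \<and> 0 \<le> \<eta>w i K \<and> 0 \<le> \<eta>q i K"
    and i: "\<And>i. (normV_mesh \<Omega> \<epsilon> \<kappa> (\<T> i) (\<lambda>x. yh i x - yT i x))\<^sup>2 \<le> (\<Sum>K\<in>\<T> i. (\<eta>y i K)\<^sup>2)"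
      "\<And>i. (normQ_mesh (\<T> i) (\<lambda>x. ph i x - pT i x))\<^sup>2 \<le> (\<Sum>K\<in>\<T> i. (\<eta>p i K)\<^sup>2)"
      "\<And>i. (normV_mesh \<Omega> \<epsilon> \<kappa> (\<T> i) (\<lambda>x. wh i x - wT i x))\<^sup>2 \<le> (\<Sum>K\<in>\<T> i. (\<eta>w i K)\<^sup>2)"
      "\<And>i. (normQ_mesh (\<T> i) (\<lambda>x. qh i x - qT i x))\<^sup>2 \<le> (\<Sum>K\<in>\<T> i. (\<eta>q i K)\<^sup>2)"
    and ii: "lesssim \<T> \<eta>y \<eta>y'" "lesssim \<T> \<eta>p \<eta>p'" "lesssim \<T> \<eta>w \<eta>w'" "lesssim \<T> \<eta>q \<eta>q'"
    and iii: "0 < lV" "\<And>i. VT i = V_fe \<Omega> (\<T> i) lV"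
      "(\<forall>i. QT i = Q_fe_disc \<Omega> (\<T> i) lQ) \<or> (0 < lQ \<and> (\<forall>i. QT i = Q_fe_cont \<Omega> (\<T> i) lQ))"
      "(\<forall>i. UT i = U_fe_disc \<Omega> a b (\<T> i) lU) \<or> (0 < lU \<and> (\<forall>i. UT i = U_fe_cont \<Omega> a b (\<T> i) lU))"
    and iv_sets: "\<And>i K. K \<in> \<T> i \<Longrightarrow> That i K \<subseteq> \<T> i \<and> Fhat i K \<subseteq> int_faces \<Omega> (\<T> i)"
    and iv_patch: "\<And>i K. K \<in> \<T> i \<Longrightarrow> K \<in> Omt i K"
      "\<exists>\<Lambda>>0. \<forall>i. \<forall>K\<in>\<T> i. \<forall>K'\<in>Omt i K. h K \<le> \<Lambda> * h K'"
    and iv: "lesssim \<T> UpsSq' (\<lambda>i K.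
        (L2norm K (wdiv \<Omega> (yT i)))\<^sup>2 + (L2norm K (wdiv \<Omega> (wT i)))\<^sup>2
        + (\<Sum>K'\<in>That i K. (h K)\<^sup>2 * ((L2norm K' (Rst i K'))\<^sup>2 + (L2norm K' (Rad i K'))\<^sup>2))
        + (\<Sum>\<gamma>\<in>Fhat i K. h K * ((face_L2norm \<gamma> (jump_st \<epsilon> (\<T> i) (yT i) (pT i) \<gamma>))\<^sup>2
                              + (face_L2norm \<gamma> (jump_ad \<epsilon> (\<T> i) (wT i) (qT i) \<gamma>))\<^sup>2))
        + (\<Sum>K'\<in>That i K. (h K)\<^sup>2 * ((L2norm K' (ost i K'))\<^sup>2 + (L2norm K' (oad i K'))\<^sup>2))
        + (\<eta>u i K)\<^sup>2)"
  shows "lesssim \<T> UpsSq UpsSq' \<and>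
    lesssim \<T> UpsSq' (\<lambda>i K.
      (L2norm K (ew i))\<^sup>2
      + (\<Sum>K'\<in>Omt i K.
          local_error_sq \<Omega> \<epsilon> \<kappa> \<rho> (ey i) (ep i) (ew i) (eq i) (eu i) K'
          + (h K')\<^sup>2 * ((L2norm K' (eu i))\<^sup>2 + (L2norm K' (ey i))\<^sup>2
                      + (L2norm K' (ost i K'))\<^sup>2 + (L2norm K' (oad i K'))\<^sup>2)))"
proof (rule conjI)
  show "lesssim \<T> UpsSq UpsSq'"
    unfolding UpsSq_def UpsSq'_def Let_def by (rule lesssim_weighted_squares[OF nonneg ii])
  let ?Err = "\<lambda>i K'. local_error_sq \<Omega> \<epsilon> \<kappa> \<rho> (ey i) (ep i) (ew i) (eq i) (eu i) K'
          + (h K')\<^sup>2 * ((L2norm K' (eu i))\<^sup>2 + (L2norm K' (ey i))\<^sup>2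
                      + (L2norm K' (ost i K'))\<^sup>2 + (L2norm K' (oad i K'))\<^sup>2)"
  have \<rho>: "0 < \<rho>" using rho by simp
  obtain B where B: "0 \<le> B" "c \<in> borel_measurable (lebesgue_on \<Omega>)" "AE x in lebesgue_on \<Omega>. norm (c x) \<le> B"
    by (rule W1inf_bounded[OF convection(1)]) (rule that)
  obtain \<sigma> where regular: "0 < \<sigma>" "\<And>T K. T \<in> range \<T> \<Longrightarrow> K \<in> T \<Longrightarrow> 0 < diameter K \<Longrightarrow> \<exists>z r. 0 < r \<and> cball z r \<subseteq> K \<and> diameter K \<le> \<sigma> * r"
    by (rule shape_regular_inball[OF meshes(2)]) (rule that)
  \<comment> \<open>The sum is a convenient common bound for the degrees of local functions,
    projected data and jumps. The ratio \<open>\<Lambda>\<^sub>0\<close> defined next stems from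
    \<open>face_residual\<close>: there H is at most \<open>\<sigma>\<close> n r, so that 16 H + 5 r
    stays below \<open>\<Lambda>\<^sub>0\<close> times r.\<close>
  define M where "M = m + lV + lQ + lU"
  define \<Lambda>\<^sub>0 where "\<Lambda>\<^sub>0 = 16 * (\<sigma> * CARD('n)) + 5"
  \<comment> \<open>Both constants are obtained before any mesh index is fixed, as the quantifiers
    in \<open>lesssim\<close> demand.\<close>
  obtain C1 where C1: "0 < C1"
    "\<And>(R :: 'n vfield) z r. vpdeg M R \<Longrightarrow> 0 < r \<Longrightarrow>
      (L2norm (cball z r) (\<lambda>x. bump z r x *\<^sub>R R x))\<^sup>2 \<le> C1 * bump_mass z r R"
    "\<And>(R :: 'n vfield) z r. vpdeg M R \<Longrightarrow> 0 < r \<Longrightarrow>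
      r\<^sup>2 * (L2norm (cball z r) (vjac (\<lambda>x. bump z r x *\<^sub>R R x)))\<^sup>2 \<le> C1 * bump_mass z r R"
    by (rule bump_field_bounds[of M]) (rule that)
  obtain C2 where C2: "0 < C2"
    "\<And>(R :: 'n vfield) z r. vpdeg M R \<Longrightarrow> 0 < r \<Longrightarrow>
      (L2norm (ball z (\<Lambda>\<^sub>0 * r)) R)\<^sup>2 \<le> C2 * bump_mass z r R"
    by (rule vector_ball_bounds[of M \<Lambda>\<^sub>0]) (rule that)
  interpret residual_setup \<Omega> \<epsilon> \<kappa> B c M \<Lambda>\<^sub>0 C1 C2 \<sigma>
    by unfold_locales (fact domain data B C1 C2 regular(1) eq_refl[OF \<Lambda>\<^sub>0_def[symmetric]])+
  have M: "lV \<le> M" "lQ \<le> M" "lU \<le> M" "m \<le> M" by (auto simp: M_def)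
  obtain \<Lambda> where \<Lambda>: "0 < \<Lambda>" "\<And>i K K'. K \<in> \<T> i \<Longrightarrow> K' \<in> Omt i K \<Longrightarrow> h K \<le> \<Lambda> * h K'" using iv_patch(2) by blast
  have V: "yT i \<in> V_fe \<Omega> (\<T> i) lV" "wT i \<in> V_fe \<Omega> (\<T> i) lV" for i
    using discrete_optimality(1,2)[of i] iii(2)[of i] by (auto simp: discrete_state_eqs_def discrete_adjoint_eqs_def)
  have VH: "yT i \<in> vec_space (H1 \<Omega>)" "wT i \<in> vec_space (H1 \<Omega>)" for i
    using V[of i] Vsp_H1 by (auto simp: V_fe_def)
  have "QT i \<subseteq> L2 \<Omega> \<inter> piecewise (\<T> i) (poly_deg lQ)" for i
    using iii(3) by (auto simp: Q_fe_disc_def Q_fe_cont_def Qsp_def)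
  then have Q: "pT i \<in> L2 \<Omega>" "pT i \<in> piecewise (\<T> i) (poly_deg lQ)" "qT i \<in> L2 \<Omega>" "qT i \<in> piecewise (\<T> i) (poly_deg lQ)" for i
    using discrete_optimality(1,2)[of i] by (auto simp: discrete_state_eqs_def discrete_adjoint_eqs_def)
  have "UT i \<subseteq> L2 \<Omega> \<inter> piecewise (\<T> i) (vec_space (poly_deg lU))" for i
    using iii(4) by (auto simp: U_fe_disc_def U_fe_cont_def Uad_def)
  then have U: "uT i \<in> L2 \<Omega>" "uT i \<in> piecewise (\<T> i) (vec_space (poly_deg lU))" for i
    using discrete_optimality(3)[of i] by (auto simp: variational_ineq_def)
  have u: "u \<in> L2 \<Omega>" using optimality(3) by (auto simp: variational_ineq_def Uad_def)
  have yw: "y \<in> Vsp \<Omega>" "w \<in> Vsp \<Omega>" "\<forall>\<phi>\<in>Qsp \<Omega>. formB \<Omega> y \<phi> = 0" "\<forall>\<phi>\<in>Qsp \<Omega>. formB \<Omega> w \<phi> = 0"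
    using optimality(1,2) by (auto simp: state_eqs_def adjoint_eqs_def)
  note ywH = Vsp_H1[OF yw(1)] Vsp_H1[OF yw(2)]
  note yL = vec_space_L2[OF ywH(1)] and wL = vec_space_L2[OF ywH(2)]
  note free = divergence_free[OF open_domain bounded_domain yw(1,3)] divergence_free[OF open_domain bounded_domain yw(2,4)]
  note ctrl = optimal_control_projection[OF open_domain bounded_domain data(5,6) wL optimality(3)]
  have inball: "\<exists>z r. 0 < r \<and> cball z r \<subseteq> K \<and> diameter K \<le> \<sigma> * r" if "K \<in> \<T> i" "0 < diameter K" for i K
    using regular(2)[OF rangeI that] .
  \<comment> \<open>Every element lies in the closure of the domain, so its diameter is at most D,
    and the factor \<open>A\<close> of \<open>eq_error_bound\<close> serves all meshes.\<close>
  define D where "D = diameter (closure \<Omega>)"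
  define A where "A = (1 + D\<^sup>2) / \<epsilon> + 1 / \<rho> + 1 + D\<^sup>2"
  have A0: "0 \<le> A" using data(3) \<rho> by (simp add: A_def)
  define n where "n = real CARD('n)"
  note elt = mesh_element[OF open_domain lip meshes(1)]
  have hD: "0 \<le> diameter K" "diameter K \<le> D" if "K \<in> \<T> i" for i K
    using elt(6,9)[OF that] bounded_domain by (auto simp: D_def intro!: diameter_subset bounded_closure)
  have normV: "0 \<le> (normV \<Omega> \<epsilon> \<kappa> K e)\<^sup>2" "(L2norm K (wGrad \<Omega> e))\<^sup>2 \<le> 1 / \<epsilon> * (normV \<Omega> \<epsilon> \<kappa> K e)\<^sup>2" for K e
  proof -
    have "(normV \<Omega> \<epsilon> \<kappa> K e)\<^sup>2 = \<epsilon> * (L2norm K (wGrad \<Omega> e))\<^sup>2 + \<kappa> * (L2norm K e)\<^sup>2"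
      unfolding normV_def using data(3,4) by (intro real_sqrt_pow2 add_nonneg_nonneg mult_nonneg_nonneg) auto
    then show "0 \<le> (normV \<Omega> \<epsilon> \<kappa> K e)\<^sup>2" "(L2norm K (wGrad \<Omega> e))\<^sup>2 \<le> 1 / \<epsilon> * (normV \<Omega> \<epsilon> \<kappa> K e)\<^sup>2"
      using data(3,4) by (auto simp: field_simps)
  qed
  have Err_ge: "0 \<le> ?Err i K"
    "(normV \<Omega> \<epsilon> \<kappa> K (ey i))\<^sup>2 + (normV \<Omega> \<epsilon> \<kappa> K (ew i))\<^sup>2 \<le> ?Err i K"
    "(L2norm K (eu i))\<^sup>2 \<le> ?Err i K"
    "(h K)\<^sup>2 * ((L2norm K (ost i K))\<^sup>2 + (L2norm K (oad i K))\<^sup>2) \<le> ?Err i K"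
    "(normV \<Omega> \<epsilon> \<kappa> K (ey i))\<^sup>2 + \<rho> * (L2norm K (ep i))\<^sup>2 + (h K)\<^sup>2 * ((L2norm K (eu i))\<^sup>2 + (L2norm K (ost i K))\<^sup>2) \<le> ?Err i K"
    "(normV \<Omega> \<epsilon> \<kappa> K (ew i))\<^sup>2 + \<rho> * (L2norm K (eq i))\<^sup>2 + (h K)\<^sup>2 * ((L2norm K (ey i))\<^sup>2 + (L2norm K (oad i K))\<^sup>2) \<le> ?Err i K" for i K
  proof -
    have nn: "0 \<le> (normV \<Omega> \<epsilon> \<kappa> K (ey i))\<^sup>2" "0 \<le> (normV \<Omega> \<epsilon> \<kappa> K (ew i))\<^sup>2" "0 \<le> \<rho> * (L2norm K (ep i))\<^sup>2" "0 \<le> \<rho> * (L2norm K (eq i))\<^sup>2"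
      "0 \<le> (L2norm K (eu i))\<^sup>2" "0 \<le> (h K)\<^sup>2 * (L2norm K (eu i))\<^sup>2" "0 \<le> (h K)\<^sup>2 * (L2norm K (ey i))\<^sup>2"
      "0 \<le> (h K)\<^sup>2 * (L2norm K (ost i K))\<^sup>2" "0 \<le> (h K)\<^sup>2 * (L2norm K (oad i K))\<^sup>2"
      using \<rho> by auto
    show "0 \<le> ?Err i K"
      "(normV \<Omega> \<epsilon> \<kappa> K (ey i))\<^sup>2 + (normV \<Omega> \<epsilon> \<kappa> K (ew i))\<^sup>2 \<le> ?Err i K"
      "(L2norm K (eu i))\<^sup>2 \<le> ?Err i K"
      "(h K)\<^sup>2 * ((L2norm K (ost i K))\<^sup>2 + (L2norm K (oad i K))\<^sup>2) \<le> ?Err i K"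
      "(normV \<Omega> \<epsilon> \<kappa> K (ey i))\<^sup>2 + \<rho> * (L2norm K (ep i))\<^sup>2 + (h K)\<^sup>2 * ((L2norm K (eu i))\<^sup>2 + (L2norm K (ost i K))\<^sup>2) \<le> ?Err i K"
      "(normV \<Omega> \<epsilon> \<kappa> K (ew i))\<^sup>2 + \<rho> * (L2norm K (eq i))\<^sup>2 + (h K)\<^sup>2 * ((L2norm K (ey i))\<^sup>2 + (L2norm K (oad i K))\<^sup>2) \<le> ?Err i K"
      unfolding local_error_sq_def distrib_left using nn by linarith+
  qed
  \<comment> \<open>The equations are coupled through their sources: the source error of the state
    equation is the control error, and that of the adjoint equation \<open>Ea\<close> is the state
    error.\<close>
  define Es where "Es i K = eq_error \<Omega> \<kappa> K (ey i) (ep i) (eu i) (ost i K)" for i K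
  define Ea where "Ea i K = eq_error \<Omega> \<kappa> K (ew i) (eq i) (ey i) (oad i K)" for i K
  have Es: "Es i K \<le> A * ?Err i K" and Ea: "Ea i K \<le> A * ?Err i K" if "K \<in> \<T> i" for i K
    using order_trans[OF eq_error_bound[OF data(3,4) \<rho> hD[OF that]] mult_left_mono[OF Err_ge(5)[unfolded h_def] A0[unfolded A_def]]]
      order_trans[OF eq_error_bound[OF data(3,4) \<rho> hD[OF that]] mult_left_mono[OF Err_ge(6)[unfolded h_def] A0[unfolded A_def]]]
    unfolding Es_def Ea_def A_def h_def by blast+
  have state: "K \<in> \<T> i \<Longrightarrow> (diameter K)\<^sup>2 * (L2norm K (R_st \<epsilon> \<kappa> c f m (yT i) (pT i) (uT i) K))\<^sup>2 \<le> elem_const * Es i K"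
    "\<gamma> \<in> int_faces \<Omega> (\<T> i) \<Longrightarrow> 0 < H \<Longrightarrow> (\<And>K. K \<in> face_patch (\<T> i) \<gamma> \<Longrightarrow> H \<le> diameter K) \<Longrightarrow>
      H * (face_L2norm \<gamma> (jump_st \<epsilon> (\<T> i) (yT i) (pT i) \<gamma>))\<^sup>2 \<le> jump_const * (\<Sum>K\<in>face_patch (\<T> i) \<gamma>. Es i K)" for i K \<gamma> H
    unfolding Es_def ey_def ep_def eu_def ost_def
    by (rule state_bounds[OF meshes(1) _ M data(1) u optimality(1) V(1) Q(1,2) U]; (erule (1) inball | assumption | blast))+
  have adjoint: "K \<in> \<T> i \<Longrightarrow> (diameter K)\<^sup>2 * (L2norm K (R_ad \<epsilon> \<kappa> c y\<Omega> m (yT i) (wT i) (qT i) K))\<^sup>2 \<le> elem_const * Ea i K"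
    "\<gamma> \<in> int_faces \<Omega> (\<T> i) \<Longrightarrow> 0 < H \<Longrightarrow> (\<And>K. K \<in> face_patch (\<T> i) \<gamma> \<Longrightarrow> H \<le> diameter K) \<Longrightarrow>
      H * (face_L2norm \<gamma> (jump_ad \<epsilon> (\<T> i) (wT i) (qT i) \<gamma>))\<^sup>2 \<le> jump_const * (\<Sum>K\<in>face_patch (\<T> i) \<gamma>. Ea i K)" for i K \<gamma> H
    unfolding Ea_def ey_def ew_def eq_def oad_def
    by (rule adjoint_bounds[OF meshes(1) _ M(1,2,4) data(2) yL optimality(2) V Q(3,4)]; (erule (1) inball | assumption | blast))+
  have res: "(h K)\<^sup>2 * ((L2norm K (Rst i K))\<^sup>2 + (L2norm K (Rad i K))\<^sup>2) \<le> 2 * elem_const * A * ?Err i K" if K: "K \<in> \<T> i" for i K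
  proof -
    have "(h K)\<^sup>2 * ((L2norm K (Rst i K))\<^sup>2 + (L2norm K (Rad i K))\<^sup>2) \<le> elem_const * Es i K + elem_const * Ea i K"
      unfolding distrib_left h_def Rst_def Rad_def
      by (rule add_mono[OF state(1)[OF K] adjoint(1)[OF K]])
    also have "\<dots> \<le> elem_const * (A * ?Err i K) + elem_const * (A * ?Err i K)"
      by (intro add_mono mult_left_mono Es[OF K] Ea[OF K] consts_nonneg(1))
    finally show ?thesis by (simp only: mult_2[symmetric] mult.assoc)
  qed
  have jmp: "H * ((face_L2norm \<gamma> (jump_st \<epsilon> (\<T> i) (yT i) (pT i) \<gamma>))\<^sup>2 + (face_L2norm \<gamma> (jump_ad \<epsilon> (\<T> i) (wT i) (qT i) \<gamma>))\<^sup>2)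
      \<le> 2 * jump_const * A * (\<Sum>K\<in>face_patch (\<T> i) \<gamma>. ?Err i K)"
    if \<gamma>: "\<gamma> \<in> int_faces \<Omega> (\<T> i)" and H: "0 < H" "\<And>K. K \<in> face_patch (\<T> i) \<gamma> \<Longrightarrow> H \<le> diameter K" for i \<gamma> H
  proof -
    have T: "K \<in> \<T> i" if "K \<in> face_patch (\<T> i) \<gamma>" for K using that by (simp add: face_patch_def)
    have "H * ((face_L2norm \<gamma> (jump_st \<epsilon> (\<T> i) (yT i) (pT i) \<gamma>))\<^sup>2 + (face_L2norm \<gamma> (jump_ad \<epsilon> (\<T> i) (wT i) (qT i) \<gamma>))\<^sup>2)
        \<le> jump_const * (\<Sum>K\<in>face_patch (\<T> i) \<gamma>. Es i K) + jump_const * (\<Sum>K\<in>face_patch (\<T> i) \<gamma>. Ea i K)"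
      unfolding distrib_left
      by (rule add_mono[OF state(2)[OF \<gamma> H] adjoint(2)[OF \<gamma> H]])
    also have "\<dots> \<le> jump_const * (\<Sum>K\<in>face_patch (\<T> i) \<gamma>. A * ?Err i K) + jump_const * (\<Sum>K\<in>face_patch (\<T> i) \<gamma>. A * ?Err i K)"
      by (intro add_mono mult_left_mono sum_mono consts_nonneg(2) Es Ea T)
    finally show ?thesis by (simp only: sum_distrib_left[symmetric] mult_2[symmetric] mult.assoc)
  qed
  have dv: "(L2norm K (wdiv \<Omega> (yT i)))\<^sup>2 + (L2norm K (wdiv \<Omega> (wT i)))\<^sup>2 \<le> n\<^sup>2 / \<epsilon> * ?Err i K" if K: "K \<in> \<T> i" for i K
  proof -
    have "(L2norm K (wdiv \<Omega> (yT i)))\<^sup>2 + (L2norm K (wdiv \<Omega> (wT i)))\<^sup>2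
        \<le> n\<^sup>2 * (L2norm K (wGrad \<Omega> (ey i)))\<^sup>2 + n\<^sup>2 * (L2norm K (wGrad \<Omega> (ew i)))\<^sup>2"
      unfolding n_def ey_def ew_def
      by (intro add_mono divergence_bound[OF open_domain ywH(1) VH(1) free(1) elt(7,4)[OF K]]
          divergence_bound[OF open_domain ywH(2) VH(2) free(2) elt(7,4)[OF K]])
    also have "\<dots> \<le> n\<^sup>2 * (1 / \<epsilon> * (normV \<Omega> \<epsilon> \<kappa> K (ey i))\<^sup>2) + n\<^sup>2 * (1 / \<epsilon> * (normV \<Omega> \<epsilon> \<kappa> K (ew i))\<^sup>2)"
      by (intro add_mono mult_left_mono normV(2)) auto
    also have "\<dots> = n\<^sup>2 / \<epsilon> * ((normV \<Omega> \<epsilon> \<kappa> K (ey i))\<^sup>2 + (normV \<Omega> \<epsilon> \<kappa> K (ew i))\<^sup>2)" by (simp add: distrib_left)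
    also have "\<dots> \<le> n\<^sup>2 / \<epsilon> * ?Err i K" using data(3) by (intro mult_left_mono Err_ge(2)) auto
    finally show ?thesis .
  qed
  have eta: "(\<eta>u i K)\<^sup>2 \<le> 2 / \<theta>\<^sup>2 * (L2norm K (ew i))\<^sup>2 + 2 * ?Err i K" if K: "K \<in> \<T> i" for i K
  proof -
    have s: "\<Omega> \<in> sets lebesgue" using open_domain by auto
    note L = data_on_element(1)[OF meshes(1) K]
    have "(\<eta>u i K)\<^sup>2 \<le> 2 / \<theta>\<^sup>2 * (L2norm K (ew i))\<^sup>2 + 2 * (L2norm K (eu i))\<^sup>2"
      unfolding \<eta>u_def ew_def eu_def
      by (rule eta_u_bound[OF elt(7)[OF K] data(5) AE_lebesgue_on_subset[OF ctrl elt(7)[OF K] s elt(4)[OF K]]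
            L[OF wL] L[OF vec_space_L2[OF VH(2)]] L[OF u] L[OF U(1)]])
    also have "\<dots> \<le> 2 / \<theta>\<^sup>2 * (L2norm K (ew i))\<^sup>2 + 2 * ?Err i K"
      by (intro add_left_mono mult_left_mono Err_ge(3)) auto
    finally show ?thesis .
  qed
  \<comment> \<open>The summands follow the factors in \<open>patch_bound\<close>: divergence,
    element residuals, jumps with at most n + 1 faces per element, oscillations, and the two parts
    of the control indicator.\<close>
  define C where "C = n\<^sup>2 / \<epsilon> + \<Lambda>\<^sup>2 * (2 * elem_const * A) + \<Lambda> * (2 * jump_const * A) * real (Suc CARD('n)) + \<Lambda>\<^sup>2 + 2 / \<theta>\<^sup>2 + 2"
  have cs: "0 \<le> n\<^sup>2 / \<epsilon>" "0 \<le> 2 * elem_const * A" "0 \<le> 2 * jump_const * A" "0 \<le> 2 / \<theta>\<^sup>2"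
    using data(3) consts_nonneg A0 by auto
  have "0 \<le> \<Lambda>\<^sup>2 * (2 * elem_const * A)" "0 \<le> \<Lambda> * (2 * jump_const * A) * real (Suc CARD('n))" "0 \<le> \<Lambda>\<^sup>2"
    using cs \<Lambda>(1) by (auto intro!: mult_nonneg_nonneg)
  then have C: "0 < C" unfolding C_def using cs by linarith
  show "lesssim \<T> UpsSq' (\<lambda>i K. (L2norm K (ew i))\<^sup>2 + (\<Sum>K'\<in>Omt i K. ?Err i K'))"
  proof (rule lesssim_trans[OF iv], unfold lesssim_def, intro exI[of _ C] conjI allI ballI C)
    fix i K assume K: "K \<in> \<T> i"
    have patch: "face_patch (\<T> i) \<gamma> = {K' \<in> \<T> i. \<gamma> facet_of K'}" for \<gamma> by (simp add: face_patch_def)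
    show "(L2norm K (wdiv \<Omega> (yT i)))\<^sup>2 + (L2norm K (wdiv \<Omega> (wT i)))\<^sup>2
        + (\<Sum>K'\<in>That i K. (h K)\<^sup>2 * ((L2norm K' (Rst i K'))\<^sup>2 + (L2norm K' (Rad i K'))\<^sup>2))
        + (\<Sum>\<gamma>\<in>Fhat i K. h K * ((face_L2norm \<gamma> (jump_st \<epsilon> (\<T> i) (yT i) (pT i) \<gamma>))\<^sup>2
                              + (face_L2norm \<gamma> (jump_ad \<epsilon> (\<T> i) (wT i) (qT i) \<gamma>))\<^sup>2))
        + (\<Sum>K'\<in>That i K. (h K)\<^sup>2 * ((L2norm K' (ost i K'))\<^sup>2 + (L2norm K' (oad i K'))\<^sup>2))
        + (\<eta>u i K)\<^sup>2 \<le> C * ((L2norm K (ew i))\<^sup>2 + (\<Sum>K'\<in>Omt i K. ?Err i K'))"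
      unfolding C_def
    proof (rule patch_bound[where T = "\<T> i" and F = "int_faces \<Omega> (\<T> i)" and R = "\<lambda>\<gamma> K'. \<gamma> facet_of K'" and K = K and h = h])
      show "finite (\<T> i)" "finite (int_faces \<Omega> (\<T> i))"
        using conforming_meshD(2)[OF meshes(1)] finite_int_faces[OF meshes(1)] by auto
      show "That i K \<subseteq> \<T> i" "Fhat i K \<subseteq> int_faces \<Omega> (\<T> i)" using iv_sets[OF K] by auto
      show "Omt i K = That i K \<union> (\<Union>\<gamma>\<in>Fhat i K. {K' \<in> \<T> i. \<gamma> facet_of K'})" by (simp add: Omt_def patch)
      show "K \<in> Omt i K" by (rule iv_patch(1)[OF K])
      show "card {\<gamma> \<in> int_faces \<Omega> (\<T> i). \<gamma> facet_of K'} \<le> Suc CARD('n)" if "K' \<in> \<T> i" for K'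
      proof -
        note f = facets_of_simplex[OF conforming_meshD(3)[OF meshes(1) that]]
        have "card {\<gamma> \<in> int_faces \<Omega> (\<T> i). \<gamma> facet_of K'} \<le> card {\<gamma>. \<gamma> facet_of K'}" using f(1) by (intro card_mono) auto
        with f(2) show ?thesis by linarith
      qed
      show "0 < h K" unfolding h_def by (rule elt(6)[OF K])
      show "h K \<le> \<Lambda> * h K'" if "K' \<in> Omt i K" for K' by (rule \<Lambda>(2)[OF K that])
      show "(h K')\<^sup>2 * ((L2norm K' (Rst i K'))\<^sup>2 + (L2norm K' (Rad i K'))\<^sup>2) \<le> 2 * elem_const * A * ?Err i K'" if "K' \<in> \<T> i" for K'
        by (rule res[OF that])
      show "H * ((face_L2norm \<gamma> (jump_st \<epsilon> (\<T> i) (yT i) (pT i) \<gamma>))\<^sup>2 + (face_L2norm \<gamma> (jump_ad \<epsilon> (\<T> i) (wT i) (qT i) \<gamma>))\<^sup>2)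
          \<le> 2 * jump_const * A * (\<Sum>K'\<in>{K' \<in> \<T> i. \<gamma> facet_of K'}. ?Err i K')"
        if "\<gamma> \<in> int_faces \<Omega> (\<T> i)" "0 < H" "\<And>K'. K' \<in> \<T> i \<Longrightarrow> \<gamma> facet_of K' \<Longrightarrow> H \<le> h K'" for \<gamma> H
        unfolding patch[symmetric]
        by (rule jmp[OF that(1,2)]) (use that(3) in \<open>auto simp: face_patch_def h_def\<close>)
      show "(h K')\<^sup>2 * ((L2norm K' (ost i K'))\<^sup>2 + (L2norm K' (oad i K'))\<^sup>2) \<le> ?Err i K'" for K' by (rule Err_ge(4))
      show "0 \<le> ?Err i K'" for K' by (rule Err_ge(1))
    qed (use \<Lambda>(1) cs dv[OF K] eta[OF K] in auto)
  qed
qed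

end
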